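(* Let $f$ and $\tilde f$ be the weak solutions of $$\partial_tf+v\cdot\nabla f=0\ \text{ in }(0,T]\times\Omega,\quad f(0,\cdot)=f^0,\qquad\text{and}\qquad \partial_t\tilde f+\tilde v\cdot\nabla\tilde f=0\ \text{ in }(0,T]\times\mathbb{R}^3,\quad \tilde f(0,\cdot)=\tilde f^0,$$ respectively, and let $g_\delta$, $\delta=(h,\tau)$, be the step functions generated by the truncated explicit scheme (defined in the context). Then, as $\delta=(h,\tau)\to0$ under the scaling condition $\tau=h^{2-\alpha}$, $h^{1-(\alpha+\beta)}\le\frac27$ (with fixed $\alpha>0$, $\beta>\frac12$, $\alpha+\beta<1$): (1) $\{g_\delta\}$ converges (in the whole sequence) to $\tilde f$ strongly in $L^2([0,T];L^2(\mathbb{R}^3))$; (2) $\{g_\delta|_{x\in\Omega}\}$ converges (in the whole sequence) to $f$ strongly in $L^p([0,T];L^p(\Omega))$ for any $1\le p<\infty$.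
   Context: Setting. $T>0$; $\Omega\subset\mathbb{R}^3$ is a bounded connected open set; $v\in L^2([0,T];H^1_0(\Omega)^3)\cap L^\infty([0,T];L^2(\Omega)^3)$ with $\nabla\cdot v=0$ and $\mathrm{supp}(v)\subset[0,T]\times\Omega$ (so $v$ vanishes for $x$ near $\partial\Omega$); $f^0\in L^\infty(\Omega)$ with $f^0\equiv0$ in a neighborhood of $\partial\Omega$. $\tilde v,\tilde f^0$ are the extensions of $v,f^0$ by $0$ to $x\in\mathbb{R}^3\setminus\Omega$. Weak solutions. $f\in L^\infty([0,T];L^\infty(\Omega))$ is a weak solution of the problem on $\Omega$ if $$\int_0^T\!\!\int_\Omega\big(f\,\partial_t\varphi+f\,v\cdot\nabla\varphi\big)\,dx\,dt+\int_\Omega f^0(x)\varphi(0,x)\,dx=0$$ for all $\varphi\in C^\infty([0,T]\times\mathbb{R}^3;\mathbb{R})$ with $\mathrm{supp}(\varphi)\subset[0,T)\times\mathbb{R}^3$ compact. A weak solution $\tilde f\in L^\infty([0,T];L^\infty(\mathbb{R}^3))$ of the whole-space problem is defined in the same way with $\Omega,v,f^0$ replaced by $\mathbb{R}^3,\tilde v,\tilde f^0$. By DiPerna-Lions theory these weak solutions exist, are unique, satisfy $\tilde f|_{x\in\Omega}=f$, and $\|\tilde f(t,\cdot)\|_{L^2(\mathbb{R}^3)}=\|f(t,\cdot)\|_{L^2(\Omega)}=\|f^0\|_{L^2(\Omega)}$ for a.e. $t\in[0,T]$. Grid. $h,\tau>0$ are the space and time mesh sizes, $t_n=n\tau$, and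 $T_\tau\in\mathbb{N}$ is such that $T\in[\tau T_\tau,\tau T_\tau+\tau)$. $e^1,e^2,e^3$ is the standard basis of $\mathbb{R}^3$; $B=\{\pm e^1,\pm e^2,\pm e^3,0\}$; $C_h(x)=\prod_{i=1}^3[x_i-\frac h2,x_i+\frac h2)$; $D_j\phi(x)=\frac{\phi(x+he^j)-\phi(x-he^j)}{2h}$ for $\phi:h\mathbb{Z}^3\to\mathbb{R}$. Discrete data. $g^0(x)=\frac1{h^3}\int_{C_h(x)}\tilde f^0(y)\,dy$, $u^n_i(x)=\frac{1}{\tau h^3}\int_{\tau n}^{\tau(n+1)}\int_{C_h(x)}\tilde v_i(s,y)\,dy\,ds$ for $x\in h\mathbb{Z}^3$, $0\le n\le T_\tau-1$. Truncation: $\tilde u^n_j(x)=u^n_j(x)$ if $|u^n_j(x)|\le h^{-\beta}$, and $\tilde u^n_j(x)=\mathrm{sign}(u^n_j(x))h^{-\beta}$ otherwise. Only sufficiently small $h$ are considered (so that $g^0,u^n$ vanish at and outside the boundary of $\{x\in\Omega\cap h\mathbb{Z}^3:C_{2h}(x)\subset\Omega\}$). Truncated explicit scheme. For $n=0,\dots,T_\tau-1$ and $x\in h\mathbb{Z}^3$, $$\Big(g^{n+1}(x)-\frac17\sum_{\omega\in B}g^n(x+h\omega)\Big)\frac1\tau+\sum_{j=1}^3\tilde u^n_j(x)D_jg^n(x)=0 .$$ Step function: $g_\delta:[0,\tau T_\tau+\tau)\times\mathbb{R}^3\to\mathbb{R}$, $g_\delta(s,y)=g^n(x)$ if $s\in[t_n,t_{n+1})$,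 $y\in C_h(x)$, $x\in h\mathbb{Z}^3$. *)

theory Defs
  imports "HOL-Analysis.Analysis"
begin

text \<open>
  Elements of Lebesgue and Bochner spaces are represented by functions. A space
  \<open>L\<^sup>q([0,T]; X)\<close>, \<open>X\<close> a space of functions on \<open>\<Omega>\<close>, consists of the jointly Lebesgue
  measurable \<open>f t x\<close> on \<open>[0,T] \<times> \<Omega>\<close> for which \<open>t \<mapsto> \<parallel>f t\<parallel>\<close> (norm of \<open>X\<close>) is in \<open>L\<^sup>q\<close>.
  Only values at \<open>t \<in> [0,T]\<close> and \<open>x \<in> \<Omega>\<close> are ever relevant, and only up to null sets.
\<close>

type_synonym R3 = "real^3"

section \<open>Smooth functions\<close>

text \<open>
  Derivatives are taken within \<open>S\<close>. For \<open>S\<close> convex with nonempty interior (below: the whole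
  space, or \<open>[0,T] \<times> \<real>\<^sup>3\<close>) they are unique, also at boundary points.
\<close>

primrec Ck_on :: "nat \<Rightarrow> 'a::euclidean_space set \<Rightarrow> ('a \<Rightarrow> real) \<Rightarrow> bool" where
  "Ck_on 0 S f \<longleftrightarrow> continuous_on S f"
| "Ck_on (Suc k) S f \<longleftrightarrow>
     (\<exists>f'. (\<forall>x\<in>S. (f has_derivative f' x) (at x within S)) \<and> (\<forall>b\<in>Basis. Ck_on k S (\<lambda>x. f' x b)))"

definition smooth_on :: "'a::euclidean_space set \<Rightarrow> ('a \<Rightarrow> real) \<Rightarrow> bool" where
  "smooth_on S f \<longleftrightarrow> (\<forall>k. Ck_on k S f)"

definition supp_on :: "'a::euclidean_space set \<Rightarrow> ('a \<Rightarrow> real) \<Rightarrow> 'a set" where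
  "supp_on S f = closure {x\<in>S. f x \<noteq> 0}"

definition Cc_infty :: "R3 set \<Rightarrow> (R3 \<Rightarrow> real) set" where
  "Cc_infty \<Omega> = {\<phi>. smooth_on UNIV \<phi> \<and> compact (supp_on UNIV \<phi>) \<and> supp_on UNIV \<phi> \<subseteq> \<Omega>}"

definition pderiv_at :: "3 \<Rightarrow> (R3 \<Rightarrow> real) \<Rightarrow> R3 \<Rightarrow> real" where
  "pderiv_at j \<phi> x = frechet_derivative \<phi> (at x) (axis j 1)"


section \<open>Lebesgue and Sobolev spaces on \<open>\<Omega>\<close>\<close>

definition L2 :: "R3 set \<Rightarrow> (R3 \<Rightarrow> real) \<Rightarrow> bool" where
  "L2 \<Omega> u \<longleftrightarrow> u \<in> borel_measurable (lebesgue_on \<Omega>) \<and> integrable (lebesgue_on \<Omega>) (\<lambda>x. (u x)\<^sup>2)"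

definition Linf :: "R3 set \<Rightarrow> (R3 \<Rightarrow> real) \<Rightarrow> bool" where
  "Linf \<Omega> u \<longleftrightarrow> u \<in> borel_measurable (lebesgue_on \<Omega>) \<and> (\<exists>M. AE x in lebesgue_on \<Omega>. \<bar>u x\<bar> \<le> M)"

text \<open>\<open>w\<close> is the weak partial derivative \<open>\<partial>\<^sub>j u\<close> in \<open>\<Omega>\<close>; \<open>u\<close> and \<open>w\<close> are required to be in \<open>L\<^sup>2\<close>.\<close>

definition weak_pderiv :: "R3 set \<Rightarrow> 3 \<Rightarrow> (R3 \<Rightarrow> real) \<Rightarrow> (R3 \<Rightarrow> real) \<Rightarrow> bool" where
  "weak_pderiv \<Omega> j u w \<longleftrightarrow> L2 \<Omega> u \<and> L2 \<Omega> w \<and>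
     (\<forall>\<phi>\<in>Cc_infty \<Omega>. (LINT x|lebesgue_on \<Omega>. u x * pderiv_at j \<phi> x)
                       = - (LINT x|lebesgue_on \<Omega>. w x * \<phi> x))"

text \<open>\<open>H\<^sup>1\<^sub>0(\<Omega>)\<close>: the closure of \<open>C\<^sub>c\<^sup>\<infinity>(\<Omega>)\<close> in \<open>H\<^sup>1(\<Omega>)\<close>.\<close>

definition H10 :: "R3 set \<Rightarrow> (R3 \<Rightarrow> real) \<Rightarrow> bool" where
  "H10 \<Omega> u \<longleftrightarrow> (\<exists>w. (\<forall>j. weak_pderiv \<Omega> j u (w j)) \<and>
     (\<forall>\<epsilon>>0. \<exists>\<phi>\<in>Cc_infty \<Omega>.
        (LINT x|lebesgue_on \<Omega>. (u x - \<phi> x)\<^sup>2)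
        + (\<Sum>j\<in>UNIV. LINT x|lebesgue_on \<Omega>. (w j x - pderiv_at j \<phi> x)\<^sup>2) < \<epsilon>))"

definition ext0 :: "R3 set \<Rightarrow> (R3 \<Rightarrow> 'b::zero) \<Rightarrow> R3 \<Rightarrow> 'b" where
  "ext0 \<Omega> u x = (if x \<in> \<Omega> then u x else 0)"


section \<open>Spaces of time-dependent functions\<close>

definition joint_measurable :: "real \<Rightarrow> R3 set \<Rightarrow> (real \<Rightarrow> R3 \<Rightarrow> 'b::euclidean_space) \<Rightarrow> bool" where
  "joint_measurable T \<Omega> f \<longleftrightarrow> (\<lambda>(t, x). f t x) \<in> borel_measurable (lebesgue_on ({0..T} \<times> \<Omega>))"

text \<open>
  \<open>L\<^sup>2([0,T]; H\<^sup>1\<^sub>0(\<Omega>)\<^sup>3)\<close>. Here \<open>G t x $ i $ j\<close> is the weak derivative \<open>\<partial>\<^sub>j v\<^sub>i\<close>, and the norm of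
  a matrix in \<open>real^3^3\<close> is the Frobenius norm, so the integrand is that of the squared
  \<open>H\<^sup>1\<close>-norm. Joint measurability of \<open>G\<close> is that of \<open>t \<mapsto> v t\<close> as a map into \<open>H\<^sup>1\<close>.
\<close>

definition L2_H10 :: "real \<Rightarrow> R3 set \<Rightarrow> (real \<Rightarrow> R3 \<Rightarrow> R3) \<Rightarrow> bool" where
  "L2_H10 T \<Omega> v \<longleftrightarrow> joint_measurable T \<Omega> v \<and>
     (AE t in lebesgue_on {0..T}. \<forall>i. H10 \<Omega> (\<lambda>x. v t x $ i)) \<and>
     (\<exists>G :: real \<Rightarrow> R3 \<Rightarrow> real^3^3. joint_measurable T \<Omega> G \<and>
        (AE t in lebesgue_on {0..T}. \<forall>i j. weak_pderiv \<Omega> j (\<lambda>x. v t x $ i) (\<lambda>x. G t x $ i $ j)) \<and>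
        (\<integral>\<^sup>+t. (\<integral>\<^sup>+x. ennreal ((norm (v t x))\<^sup>2 + (norm (G t x))\<^sup>2) \<partial>lebesgue_on \<Omega>)
           \<partial>lebesgue_on {0..T}) < \<infinity>)"

definition Linf_L2 :: "real \<Rightarrow> R3 set \<Rightarrow> (real \<Rightarrow> R3 \<Rightarrow> R3) \<Rightarrow> bool" where
  "Linf_L2 T \<Omega> v \<longleftrightarrow> joint_measurable T \<Omega> v \<and>
     (\<exists>M::real. AE t in lebesgue_on {0..T}.
        (\<integral>\<^sup>+x. ennreal ((norm (v t x))\<^sup>2) \<partial>lebesgue_on \<Omega>) \<le> ennreal M)"

definition Linf_Linf :: "real \<Rightarrow> R3 set \<Rightarrow> (real \<Rightarrow> R3 \<Rightarrow> real) \<Rightarrow> bool" where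
  "Linf_Linf T \<Omega> f \<longleftrightarrow> joint_measurable T \<Omega> f \<and>
     (\<exists>M. AE t in lebesgue_on {0..T}. AE x in lebesgue_on \<Omega>. \<bar>f t x\<bar> \<le> M)"

definition Lp_Lp :: "real \<Rightarrow> real \<Rightarrow> R3 set \<Rightarrow> (real \<Rightarrow> R3 \<Rightarrow> real) \<Rightarrow> bool" where
  "Lp_Lp p T \<Omega> f \<longleftrightarrow> joint_measurable T \<Omega> f \<and>
     (\<integral>\<^sup>+t. (\<integral>\<^sup>+x. ennreal (\<bar>f t x\<bar> powr p) \<partial>lebesgue_on \<Omega>) \<partial>lebesgue_on {0..T}) < \<infinity>"

definition Lp_Lp_norm :: "real \<Rightarrow> real \<Rightarrow> R3 set \<Rightarrow> (real \<Rightarrow> R3 \<Rightarrow> real) \<Rightarrow> real" where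
  "Lp_Lp_norm p T \<Omega> f =
     enn2real (\<integral>\<^sup>+t. (\<integral>\<^sup>+x. ennreal (\<bar>f t x\<bar> powr p) \<partial>lebesgue_on \<Omega>) \<partial>lebesgue_on {0..T}) powr (1 / p)"

definition converges_Lp_Lp ::
    "real \<Rightarrow> real \<Rightarrow> R3 set \<Rightarrow> ('d \<Rightarrow> real \<Rightarrow> R3 \<Rightarrow> real) \<Rightarrow> (real \<Rightarrow> R3 \<Rightarrow> real) \<Rightarrow> 'd filter \<Rightarrow> bool" where
  "converges_Lp_Lp p T \<Omega> F f \<F> \<longleftrightarrow> Lp_Lp p T \<Omega> f \<and> (\<forall>\<^sub>F d in \<F>. Lp_Lp p T \<Omega> (F d)) \<and>
     ((\<lambda>d. Lp_Lp_norm p T \<Omega> (\<lambda>t x. F d t x - f t x)) \<longlongrightarrow> 0) \<F>"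

definition divergence_free :: "real \<Rightarrow> R3 set \<Rightarrow> (real \<Rightarrow> R3 \<Rightarrow> R3) \<Rightarrow> bool" where
  "divergence_free T \<Omega> v \<longleftrightarrow> (AE t in lebesgue_on {0..T}.
     \<exists>w. (\<forall>j. weak_pderiv \<Omega> j (\<lambda>x. v t x $ j) (w j)) \<and>
         (AE x in lebesgue_on \<Omega>. (\<Sum>j\<in>UNIV. w j x) = 0))"

text \<open>
  Essential support of \<open>v\<close> (an equivalence class), relative to \<open>[0,T] \<times> \<real>\<^sup>3\<close>. For a field on
  \<open>\<Omega>\<close> extended by \<open>0\<close>, it may meet the boundary of \<open>\<Omega>\<close>.
\<close>

definition ess_supp :: "real \<Rightarrow> (real \<Rightarrow> R3 \<Rightarrow> R3) \<Rightarrow> (real \<times> R3) set" where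
  "ess_supp T v = {z \<in> {0..T} \<times> UNIV. \<forall>U. open U \<and> z \<in> U \<longrightarrow>
     \<not> (AE (t, x) in lebesgue_on ({0..T} \<times> UNIV). (t, x) \<in> U \<longrightarrow> v t x = 0)}"

definition vanishes_near_frontier :: "R3 set \<Rightarrow> (R3 \<Rightarrow> real) \<Rightarrow> bool" where
  "vanishes_near_frontier \<Omega> u \<longleftrightarrow>
     (\<exists>U. open U \<and> frontier \<Omega> \<subseteq> U \<and> (AE x in lebesgue_on \<Omega>. x \<in> U \<longrightarrow> u x = 0))"


section \<open>Weak solutions of the transport equation\<close>

definition test_functions :: "real \<Rightarrow> (real \<times> R3 \<Rightarrow> real) set" where
  "test_functions T = {\<phi>. smooth_on ({0..T} \<times> UNIV) \<phi> \<and>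
     compact (supp_on ({0..T} \<times> UNIV) \<phi>) \<and> supp_on ({0..T} \<times> UNIV) \<phi> \<subseteq> {0..<T} \<times> UNIV}"

definition time_deriv :: "real \<Rightarrow> (real \<times> R3 \<Rightarrow> real) \<Rightarrow> real \<Rightarrow> R3 \<Rightarrow> real" where
  "time_deriv T \<phi> t x = frechet_derivative \<phi> (at (t, x) within {0..T} \<times> UNIV) (1, 0)"

definition space_grad :: "real \<Rightarrow> (real \<times> R3 \<Rightarrow> real) \<Rightarrow> real \<Rightarrow> R3 \<Rightarrow> R3" where
  "space_grad T \<phi> t x = (\<chi> j. frechet_derivative \<phi> (at (t, x) within {0..T} \<times> UNIV) (0, axis j 1))"

definition weak_solution ::
    "real \<Rightarrow> R3 set \<Rightarrow> (real \<Rightarrow> R3 \<Rightarrow> R3) \<Rightarrow> (R3 \<Rightarrow> real) \<Rightarrow> (real \<Rightarrow> R3 \<Rightarrow> real) \<Rightarrow> bool" where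
  "weak_solution T \<Omega> v f0 f \<longleftrightarrow> Linf_Linf T \<Omega> f \<and>
     (\<forall>\<phi>\<in>test_functions T.
        (LINT t|lebesgue_on {0..T}. LINT x|lebesgue_on \<Omega>.
            f t x * time_deriv T \<phi> t x + f t x * (v t x \<bullet> space_grad T \<phi> t x))
        + (LINT x|lebesgue_on \<Omega>. f0 x * \<phi> (0, x)) = 0)"


section \<open>The truncated explicit scheme\<close>

definition grid :: "real \<Rightarrow> R3 set" where
  "grid h = {x. \<forall>i. \<exists>k::int. x $ i = h * of_int k}"

definition cell :: "real \<Rightarrow> R3 \<Rightarrow> R3 set" where
  "cell h x = {y. \<forall>i. x $ i - h / 2 \<le> y $ i \<and> y $ i < x $ i + h / 2}"

definition stencil :: "R3 set" where
  "stencil = range (\<lambda>j. axis j 1) \<union> range (\<lambda>j. - axis j 1) \<union> {0}"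

definition central_diff :: "real \<Rightarrow> 3 \<Rightarrow> (R3 \<Rightarrow> real) \<Rightarrow> R3 \<Rightarrow> real" where
  "central_diff h j \<phi> x = (\<phi> (x + h *\<^sub>R axis j 1) - \<phi> (x - h *\<^sub>R axis j 1)) / (2 * h)"

text \<open>For \<open>T, \<tau> > 0\<close>, the unique \<open>N\<close> with \<open>\<tau> N \<le> T < \<tau> N + \<tau>\<close>.\<close>

definition num_steps :: "real \<Rightarrow> real \<Rightarrow> nat" where
  "num_steps T \<tau> = nat \<lfloor>T / \<tau>\<rfloor>"

definition cell_average :: "real \<Rightarrow> (R3 \<Rightarrow> real) \<Rightarrow> R3 \<Rightarrow> real" where
  "cell_average h u x = 1 / h ^ 3 * (LINT y|lebesgue_on (cell h x). u y)"

definition discrete_velocity ::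
    "real \<Rightarrow> real \<Rightarrow> (real \<Rightarrow> R3 \<Rightarrow> R3) \<Rightarrow> nat \<Rightarrow> 3 \<Rightarrow> R3 \<Rightarrow> real" where
  "discrete_velocity h \<tau> v n j x = 1 / (\<tau> * h ^ 3) *
     (LINT s|lebesgue_on {\<tau> * real n..\<tau> * real (n + 1)}. LINT y|lebesgue_on (cell h x). v s y $ j)"

definition truncate :: "real \<Rightarrow> real \<Rightarrow> real \<Rightarrow> real" where
  "truncate h \<beta> r = (if \<bar>r\<bar> \<le> h powr (- \<beta>) then r else sgn r * h powr (- \<beta>))"

text \<open>\<open>v\<close> and \<open>f0\<close> are fields on the whole space here, and \<open>g n x\<close> is only constrained for
  \<open>n \<le> num_steps T \<tau>\<close> and \<open>x \<in> grid h\<close>.\<close>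

definition truncated_explicit_scheme ::
    "real \<Rightarrow> real \<Rightarrow> (real \<Rightarrow> R3 \<Rightarrow> R3) \<Rightarrow> (R3 \<Rightarrow> real) \<Rightarrow> real \<Rightarrow> real \<Rightarrow> (nat \<Rightarrow> R3 \<Rightarrow> real) \<Rightarrow> bool" where
  "truncated_explicit_scheme T \<beta> v f0 h \<tau> g \<longleftrightarrow>
     (\<forall>x\<in>grid h. g 0 x = cell_average h f0 x) \<and>
     (\<forall>n<num_steps T \<tau>. \<forall>x\<in>grid h.
        (g (Suc n) x - 1 / 7 * (\<Sum>\<omega>\<in>stencil. g n (x + h *\<^sub>R \<omega>))) * (1 / \<tau>)
        + (\<Sum>j\<in>UNIV. truncate h \<beta> (discrete_velocity h \<tau> v n j x) * central_diff h j (g n) x) = 0)"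

text \<open>For \<open>h, \<tau> > 0\<close> and \<open>s \<ge> 0\<close> there is exactly one \<open>n\<close> and one \<open>x\<close> as below.\<close>

definition step_function :: "real \<Rightarrow> real \<Rightarrow> (nat \<Rightarrow> R3 \<Rightarrow> real) \<Rightarrow> real \<Rightarrow> R3 \<Rightarrow> real" where
  "step_function h \<tau> g s y =
     (THE r. \<exists>n. \<exists>x\<in>grid h. s \<in> {\<tau> * real n..<\<tau> * real (n + 1)} \<and> y \<in> cell h x \<and> r = g n x)"

definition admissible :: "real \<Rightarrow> real \<Rightarrow> (real \<times> real) set" where
  "admissible \<alpha> \<beta> = {(h, \<tau>). 0 < h \<and> 0 < \<tau> \<and> \<tau> = h powr (2 - \<alpha>) \<and> h powr (1 - (\<alpha> + \<beta>)) \<le> 2 / 7}"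

end

theory Submission
  imports Defs "HOL-Computational_Algebra.Polynomial"
begin

text \<open>
  Both parts are instances of one estimate. Extend everything by \<open>0\<close>, let \<open>F\<close> be a bounded weak
  solution and \<open>e\<close> the difference between the discrete solution, as a step function, and a
  mollification \<open>F * \<rho>\<^sub>\<epsilon>\<close> in space. Under the scaling condition each step of the scheme forms convex
  combinations of neighbouring values, so it is stable in \<open>L\<^sup>\<infinity>\<close>, and in \<open>L\<^sup>1\<close> up to the
  discrete divergence of the truncated velocity. This divergence tends to \<open>0\<close> in \<open>L\<^sup>1\<close>: the
  difference quotients of a divergence-free field in \<open>L\<^sup>2(H\<^sup>1\<^sub>0)\<close> do, and the truncation changes
  them by at most \<open>h\<^sup>\<beta>\<close> times the energy. The consistency error of \<open>F * \<rho>\<^sub>\<epsilon>\<close> contains the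
  DiPerna--Lions commutator, which is small because \<open>v\<close> has a gradient in \<open>L\<^sup>2\<close>. Hence the scheme
  converges in \<open>L\<^sup>1\<close>, and by the uniform bound in every \<open>L\<^sup>p\<close> with \<open>p < \<infinity>\<close>.
\<close>

text \<open>The mollification radius \<epsilon> is fixed before the mesh. The derivative bounds of
  the mollified solution deteriorate as \<epsilon> tends to 0, but for fixed \<epsilon> they are
  mere constants while h tends to 0; only the commutator and the mollification errors have to be
  small through \<epsilon>. The scaling enters through two identities: h^2/\<tau> = h^\<alpha> is
  the size of the artificial viscosity, and \<tau> h^(-\<beta>)/(2h) = h^(1-\<alpha>-\<beta>)/2 <=
  1/7 keeps every weight of a step nonnegative. The main obstacle is time. A weak solution is
  determined for almost every t only, while a step compares the times \<tau> n and \<tau> (n+1). The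
  mollified solution is therefore defined by the time-integrated equation, which makes sense at
  every t, is Lipschitz in t and equals the convolution almost everywhere. A second obstacle is the
  many null sets; they are removed once, by passing to Borel representatives whose bounds hold at
  every time and which vanish outside a fixed ball. In L1 the discrete divergence acts as an
  additive error, because the error is bounded pointwise, so the steps add up without an exponential
  factor.\<close>

abbreviation nn_lborel :: "('a::euclidean_space \<Rightarrow> ennreal) \<Rightarrow> ennreal" (binder "NNINT " 10)
  where "nn_lborel u \<equiv> integral\<^sup>N lborel u"

abbreviation int_lborel :: "('a::euclidean_space \<Rightarrow> real) \<Rightarrow> real" (binder "RINT " 10)
  where "int_lborel u \<equiv> integral\<^sup>L lborel u"

abbreviation borel_fn :: "('a::topological_space \<Rightarrow> 'b::topological_space) set"
  where "borel_fn \<equiv> borel_measurable borel"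

section \<open>Smooth functions and mollifiers\<close>

lemma Ck_on_Suc_D: "Ck_on (Suc k) S f ==> Ck_on k S f"
proof (induction k arbitrary: f)
 case 0
 then show ?case by (auto intro: has_derivative_continuous_on)
next
 case (Suc k)
 then obtain f' where "\<forall>x\<in>S. (f has_derivative f' x) (at x within S)"
   "\<forall>b\<in>Basis. Ck_on (Suc k) S (%x. f' x b)"
  by (auto simp del: Ck_on.simps(2) simp: Ck_on.simps(2)[of "Suc k"])
 with Suc.IH show ?case by (auto simp del: Ck_on.simps(2) simp: Ck_on.simps(2)[of k])
qed

lemma Ck_on_const: "Ck_on k S (%x. c)"
proof (induction k arbitrary: c)
 case (Suc k)
 show ?case by (auto intro!: exI[of _ "%_ _. 0"] Suc)
qed auto

lemma Ck_on_bounded_linear: "bounded_linear f ==> Ck_on k S f"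
 by (cases k) (auto simp: linear_continuous_on intro!: exI[of _ "%_. f"] Ck_on_const
   bounded_linear.has_derivative[of f, OF _ has_derivative_ident])

lemma Ck_on_add: "Ck_on k S f ==> Ck_on k S g ==> Ck_on k S (%x. f x + g x)"
proof (induction k arbitrary: f g)
 case (Suc k)
 then obtain f' g' where
  "\<forall>x\<in>S. (f has_derivative f' x) (at x within S)" "\<forall>b\<in>Basis. Ck_on k S (%x. f' x b)"
  "\<forall>x\<in>S. (g has_derivative g' x) (at x within S)" "\<forall>b\<in>Basis. Ck_on k S (%x. g' x b)"
  by auto
 then show ?case
  by (auto intro!: exI[of _ "%x b. f' x b + g' x b"] Suc.IH has_derivative_add)
qed (auto intro: continuous_on_add)

lemma Ck_on_mult: "Ck_on k S f ==> Ck_on k S g ==> Ck_on k S (%x. f x * g x)"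
proof (induction k arbitrary: f g)
 case (Suc k)
 then obtain f' g' where
  "\<forall>x\<in>S. (f has_derivative f' x) (at x within S)" "\<forall>b\<in>Basis. Ck_on k S (%x. f' x b)"
  "\<forall>x\<in>S. (g has_derivative g' x) (at x within S)" "\<forall>b\<in>Basis. Ck_on k S (%x. g' x b)"
  by auto
 moreover have "Ck_on k S f" "Ck_on k S g" using Suc.prems by (blast intro: Ck_on_Suc_D)+
 ultimately show ?case
  by (auto intro!: exI[of _ "%x b. f x * g' x b + f' x b * g x"] Suc.IH Ck_on_add has_derivative_mult)
qed (auto intro: continuous_on_mult)

lemma Ck_on_sum: "(\<And>i. i \<in> I ==> Ck_on k S (f i)) ==> Ck_on k S (%x. \<Sum>i\<in>I. f i x)"
 by (induction I rule: infinite_finite_induct) (auto intro: Ck_on_const Ck_on_add)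

lemma Ck_on_compose_real:
 assumes "Ck_on k UNIV (g :: real => real)" "Ck_on k S f"
 shows "Ck_on k S (%x. g (f x))"
 using assms
proof (induction k arbitrary: g f)
 case 0
 then show ?case by (auto intro: continuous_on_compose2)
next
 case (Suc k)
 then obtain f' g' where *:
  "\<forall>x\<in>S. (f has_derivative f' x) (at x within S)" "\<forall>b\<in>Basis. Ck_on k S (%x. f' x b)"
  "\<forall>x. (g has_derivative g' x) (at x)" "Ck_on k UNIV (%x. g' x 1)"
  by auto
 have lin: "g' x y = y * g' x 1" for x y
 proof -
  have "linear (g' x)" using *(3) has_derivative_linear by blast
  from linear_scale[OF this, of y 1] show ?thesis by simp
 qed
 have "Ck_on k S f" using Suc.prems by (blast intro: Ck_on_Suc_D)+
 then have "Ck_on k S (%x. f' x b * g' (f x) 1)" if "b \<in> Basis" for b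
  using that *(2) Suc.IH[OF *(4)] by (intro Ck_on_mult) auto
 moreover have "((%x. g (f x)) has_derivative (%b. g' (f x) (f' x b))) (at x within S)" if "x \<in> S" for x
  using that * by (auto intro!: has_derivative_compose[of f "f' x" x S g "g' (f x)"])
 moreover have "g' (f x) (f' x b) = f' x b * g' (f x) 1" for x b by (rule lin)
 ultimately show ?case by (auto intro!: exI[of _ "%x b. f' x b * g' (f x) 1"])
qed

text \<open>The derivative \<open>L\<close> of the inner map is the same at every point. Hence the
  derivative of the composition is a fixed linear combination of the partial derivatives of
  \<open>g\<close> along that map, and the induction involves \<open>g\<close> alone. This covers
  translations and the two projections of space-time.\<close>

lemma Ck_on_compose_affine:
 fixes A :: "'a::euclidean_space => 'b::euclidean_space"
 assumes "Ck_on k UNIV g" "\<And>z. z \<in> S ==> (A has_derivative L) (at z within S)"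
 shows "Ck_on k S (%z. g (A z))"
 using assms(1)
proof (induction k arbitrary: g)
 case 0
 have "continuous_on S A" using assms(2) by (rule has_derivative_continuous_on)
 with 0 show ?case by (auto intro: continuous_on_compose2)
next
 case (Suc k)
 then obtain g' where *: "\<forall>x. (g has_derivative g' x) (at x)" "\<forall>b\<in>Basis. Ck_on k UNIV (%x. g' x b)"
  by auto
 have lin: "g' x y = (\<Sum>c\<in>Basis. (y \<bullet> c) * g' x c)" for x y
 proof -
  have "linear (g' x)" using * has_derivative_linear by blast
  then have "g' x (\<Sum>c\<in>Basis. (y \<bullet> c) *\<^sub>R c) = (\<Sum>c\<in>Basis. (y \<bullet> c) * g' x c)"
   by (simp add: linear_sum linear_scale)
  then show ?thesis by (simp add: euclidean_representation)
 qed
 have "((%x. g (A x)) has_derivative (%b. g' (A x) (L b))) (at x within S)" if "x \<in> S" for x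
  using that * assms by (auto intro!: has_derivative_compose[of A L x S g "g' (A x)"])
 moreover have "Ck_on k S (%x. \<Sum>c\<in>Basis. (L b \<bullet> c) * g' (A x) c)" for b
  using * Suc.IH by (intro Ck_on_sum Ck_on_mult Ck_on_const) auto
 ultimately show ?case
  by (auto simp: lin[of _ "L _"] intro!: exI[of _ "%x b. g' (A x) (L b)"])
qed

text \<open>The classical exp(-1/x), extended by 0, with a polynomial factor in 1/x. The factor
  makes the family closed under differentiation: differentiating replaces p by X^2 (p - p').
  Smoothness is then a single induction over all p at once.\<close>

definition flat_exp :: "real poly => real => real" where
 "flat_exp p x = (if 0 < x then poly p (1 / x) * exp (- (1 / x)) else 0)"

lemma poly_mult_exp_minus_tendsto_0: "((%u. poly p u * exp (- u)) \<longlongrightarrow> (0::real)) at_top"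
proof -
 have "((%u. \<Sum>i\<le>degree p. coeff p i * (u ^ i / exp u)) \<longlongrightarrow> (\<Sum>i\<le>degree p. coeff p i * 0)) at_top"
  by (intro tendsto_intros tendsto_power_div_exp_0)
 then show ?thesis by (simp add: poly_altdef exp_minus sum_distrib_right divide_inverse mult.assoc)
qed

lemma flat_exp_has_field_derivative:
 "(flat_exp p has_field_derivative flat_exp ([:0, 0, 1:] * (p - pderiv p)) x) (at x)"
proof -
 consider "x > 0" | "x < 0" | "x = 0" by linarith
 then show ?thesis
 proof cases
  case 1
  have "((%x. poly p (1 / x) * exp (- (1 / x))) has_field_derivative
    flat_exp ([:0, 0, 1:] * (p - pderiv p)) x) (at x)"
   using 1 by (auto simp: flat_exp_def field_simps power2_eq_square intro!: derivative_eq_intros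
     poly_DERIV[THEN DERIV_chain2])
  moreover have "\<forall>\<^sub>F y in nhds x. flat_exp p y = poly p (1 / y) * exp (- (1 / y))"
   using eventually_nhds_in_open[of "{0<..}" x] 1 by (auto simp: flat_exp_def elim!: eventually_mono)
  ultimately show ?thesis by (simp add: DERIV_cong_ev)
 next
  case 2
  have "\<forall>\<^sub>F y in nhds x. flat_exp p y = 0"
   using eventually_nhds_in_open[of "{..<0}" x] 2 by (auto simp: flat_exp_def elim!: eventually_mono)
  then have "(flat_exp p has_field_derivative 0) (at x)" by (simp add: DERIV_cong_ev)
  then show ?thesis using 2 by (simp add: flat_exp_def)
 next
  case 3
  \<comment> \<open>With u = 1/h the difference quotient at 0 is u p(u) exp(-u), whence the factor
    \<open>[:0,1:]\<close>.\<close>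
  have "((%h. poly ([:0,1:] * p) (inverse h) * exp (- inverse h)) \<longlongrightarrow> 0) (at_right 0)"
   using filterlim_compose[OF poly_mult_exp_minus_tendsto_0 filterlim_inverse_at_top_right] .
  then have "((%h. flat_exp p h / h) \<longlongrightarrow> 0) (at_right 0)"
   by (rule Lim_transform_eventually)
     (auto simp: flat_exp_def eventually_at_filter field_simps)
  moreover have "((%h. flat_exp p h / h) \<longlongrightarrow> 0) (at_left 0)"
   by (rule tendsto_eventually) (auto simp: flat_exp_def eventually_at_filter)
  ultimately have "((%h. flat_exp p h / h) \<longlongrightarrow> 0) (at 0)" by (rule filterlim_split_at[rotated])
  then show ?thesis using 3 by (simp add: DERIV_def flat_exp_def)
 qed
qed

lemma Ck_on_flat_exp: "Ck_on k UNIV (flat_exp p)"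
proof (induction k arbitrary: p)
 case 0
 show ?case unfolding Ck_on.simps
  by (rule DERIV_continuous_on) (rule has_field_derivative_at_within[OF flat_exp_has_field_derivative])
next
 case (Suc k)
 let ?q = "[:0, 0, 1:] * (p - pderiv p)"
 have "(flat_exp p has_derivative (*) (flat_exp ?q x)) (at x)" for x
  using flat_exp_has_field_derivative[of p x] unfolding has_field_derivative_def .
 moreover have "Ck_on k UNIV (%x. flat_exp ?q x * b)" if "b \<in> Basis" for b :: real
  using that Suc[of ?q] by (simp del: mult_pCons_left)
 ultimately show ?case unfolding Ck_on.simps
  by (intro exI[of _ "%x. (*) (flat_exp ?q x)"] conjI ballI)
qed

lemma flat_exp_eq_0: "x <= 0 ==> flat_exp p x = 0"
 by (simp add: flat_exp_def)

section \<open>Calculus of test functions\<close>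

lemma Cc_infty_UNIV:
 assumes "\<phi> \<in> Cc_infty \<Omega>"
 shows "\<phi> \<in> Cc_infty UNIV"
 using assms by (auto simp: Cc_infty_def)

lemma Cc_infty_has_derivative:
 assumes "\<phi> \<in> Cc_infty \<Omega>"
 shows "(\<phi> has_derivative (%h. \<Sum>j\<in>UNIV. h $ j * pderiv_at j \<phi> x)) (at x)"
  and "continuous_on UNIV \<phi>"
  and "pderiv_at j \<phi> \<in> Cc_infty \<Omega>"
proof -
 have sm: "Ck_on k UNIV \<phi>" for k using assms by (auto simp: Cc_infty_def smooth_on_def)
 from sm[of 0] show "continuous_on UNIV \<phi>" by simp
 have d: "(\<phi> has_derivative frechet_derivative \<phi> (at x)) (at x)" for x
  using sm[of 1] unfolding frechet_derivative_works[symmetric] by (auto simp: differentiable_def)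
 have lin: "frechet_derivative \<phi> (at x) h = (\<Sum>j\<in>UNIV. h $ j * pderiv_at j \<phi> x)" for x h
 proof -
  have l: "linear (frechet_derivative \<phi> (at x))" using d has_derivative_linear by blast
  have "h = (\<Sum>j\<in>UNIV. h $ j *\<^sub>R axis j 1)"
   using basis_expansion[of h] by (simp add: scalar_mult_eq_scaleR)
  then have "frechet_derivative \<phi> (at x) h = (\<Sum>j\<in>UNIV. frechet_derivative \<phi> (at x) (h $ j *\<^sub>R axis j 1))"
   by (subst linear_sum[OF l, symmetric]) simp
  then show ?thesis by (simp add: linear_scale[OF l] pderiv_at_def)
 qed
 show "(\<phi> has_derivative (%h. \<Sum>j\<in>UNIV. h $ j * pderiv_at j \<phi> x)) (at x)"
 proof -
  have "frechet_derivative \<phi> (at x) = (%h. \<Sum>j\<in>UNIV. h $ j * pderiv_at j \<phi> x)"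
   using lin by auto
  with d[of x] show ?thesis by metis
 qed
 have smp: "Ck_on k UNIV (pderiv_at j \<phi>)" for k
 proof -
  obtain f' where f': "\<forall>x. (\<phi> has_derivative f' x) (at x)" "\<forall>b\<in>Basis. Ck_on k UNIV (%x. f' x b)"
   using sm[of "Suc k"] by auto
  then have "f' x = frechet_derivative \<phi> (at x)" for x using frechet_derivative_at by blast
  with f'(2) show ?thesis by (auto simp: pderiv_at_def[abs_def] axis_in_Basis_iff)
 qed
 have sub: "supp_on UNIV (pderiv_at j \<phi>) \<subseteq> supp_on UNIV \<phi>"
 proof -
  have "pderiv_at j \<phi> x = 0" if "x \<notin> supp_on UNIV \<phi>" for x
  proof -
   have "\<forall>\<^sub>F y in nhds x. y \<in> - supp_on UNIV \<phi>"
    using that by (intro eventually_nhds_in_open) (auto simp: supp_on_def)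
   then have "\<forall>\<^sub>F y in nhds x. \<phi> y = 0"
    by (rule eventually_mono) (use closure_subset[of "{x \<in> UNIV. \<phi> x \<noteq> 0}"] in \<open>auto simp: supp_on_def\<close>)
   then have "\<forall>\<^sub>F y in at x. 0 = \<phi> y" "0 = \<phi> x"
    using eventually_nhds_x_imp_x[of "%y. \<phi> y = 0"]
    by (auto simp: eventually_at_filter elim!: eventually_mono)
   then have "(\<phi> has_derivative (%_. 0)) (at x)"
    using has_derivative_transform_eventually[of "%_. 0" "%_. 0" x UNIV \<phi>] by auto
   then show ?thesis using frechet_derivative_at[of \<phi> "%_. 0" x] unfolding pderiv_at_def by metis
  qed
  then have "{x \<in> UNIV. pderiv_at j \<phi> x \<noteq> 0} \<subseteq> supp_on UNIV \<phi>" by blast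
  then show ?thesis unfolding supp_on_def[of UNIV "pderiv_at j \<phi>"]
   by (rule closure_minimal) (simp add: supp_on_def)
 qed
 moreover have "compact (supp_on UNIV \<phi> \<inter> supp_on UNIV (pderiv_at j \<phi>))"
  using assms by (intro compact_Int_closed) (auto simp: Cc_infty_def supp_on_def)
 then have "compact (supp_on UNIV (pderiv_at j \<phi>))"
  using sub by (simp add: Int_absorb1)
 ultimately show "pderiv_at j \<phi> \<in> Cc_infty \<Omega>"
  using assms smp by (auto simp: Cc_infty_def smooth_on_def)
qed

lemma Cc_infty_bounded:
 assumes "\<phi> \<in> Cc_infty \<Omega>"
 shows "\<exists>C\<ge>0. \<forall>x. \<bar>\<phi> x\<bar> <= C"
proof -
 have "compact (\<phi> ` supp_on UNIV \<phi>)"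
  using assms Cc_infty_has_derivative(2)[OF assms]
  by (intro compact_continuous_image) (auto simp: Cc_infty_def intro: continuous_on_subset)
 then obtain C where C: "\<And>x. x \<in> supp_on UNIV \<phi> ==> \<bar>\<phi> x\<bar> <= C"
  using compact_imp_bounded by (fastforce simp: bounded_iff)
 have "\<phi> x = 0" if "x \<notin> supp_on UNIV \<phi>" for x
  using that closure_subset[of "{x \<in> UNIV. \<phi> x \<noteq> 0}"] by (auto simp: supp_on_def)
 then have "\<bar>\<phi> x\<bar> <= max 0 C" for x
  using C[of x] by (cases "x \<in> supp_on UNIV \<phi>") auto
 then show ?thesis by (intro exI[of _ "max 0 C"]) auto
qed

lemma Cc_infty_integrable:
 assumes "\<phi> \<in> Cc_infty \<Omega>"
 shows "integrable lborel \<phi>" "\<phi> \<in> borel_fn"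
proof -
 show "\<phi> \<in> borel_fn"
  using Cc_infty_has_derivative(2)[OF assms] by (rule borel_measurable_continuous_onI)
 have "integrable lborel (%x. indicator (supp_on UNIV \<phi>) x *\<^sub>R \<phi> x)"
  using assms Cc_infty_has_derivative(2)[OF assms]
  by (intro borel_integrable_compact) (auto simp: Cc_infty_def intro: continuous_on_subset)
 moreover have "indicator (supp_on UNIV \<phi>) x *\<^sub>R \<phi> x = \<phi> x" for x
  using closure_subset[of "{x \<in> UNIV. \<phi> x \<noteq> 0}"] by (auto simp: supp_on_def indicator_def)
 ultimately show "integrable lborel \<phi>" by (simp only:)
qed

lemma Cc_infty_translate:
 assumes "\<phi> \<in> Cc_infty UNIV"
 shows "(%y. \<phi> (y - x)) \<in> Cc_infty UNIV"
  and "pderiv_at j (%y. \<phi> (y - x)) y = pderiv_at j \<phi> (y - x)"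
proof -
 have d: "((%y. y - x) has_derivative (%h. h)) (at z)" for z
  by (auto intro!: derivative_eq_intros)
 have "{y. \<phi> (y - x) \<noteq> 0} = (+) x ` {y. \<phi> y \<noteq> 0}"
  by (auto simp: image_iff intro!: exI[of _ "_ - x"])
 then have "supp_on UNIV (%y. \<phi> (y - x)) = (+) x ` supp_on UNIV \<phi>"
  by (simp add: supp_on_def closure_translation)
 moreover have "smooth_on UNIV (%y. \<phi> (y - x))"
  using assms Ck_on_compose_affine[OF _ d] by (auto simp: Cc_infty_def smooth_on_def)
 ultimately show "(%y. \<phi> (y - x)) \<in> Cc_infty UNIV"
  using assms by (auto simp: Cc_infty_def intro: compact_translation)
 have "((%y. \<phi> (y - x)) has_derivative (%h. \<Sum>j\<in>UNIV. h $ j * pderiv_at j \<phi> (y - x))) (at y)"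
  by (rule has_derivative_compose[OF d Cc_infty_has_derivative(1)[OF assms]])
 from frechet_derivative_at[OF this, symmetric]
 show "pderiv_at j (%y. \<phi> (y - x)) y = pderiv_at j \<phi> (y - x)"
  by (simp add: pderiv_at_def[of j "%y. \<phi> (y - x)"] axis_def if_distrib[of "%a. a * _"] cong: if_cong)
qed

lemma Cc_infty_MVT:
 assumes "\<phi> \<in> Cc_infty \<Omega>" "0 < h"
 obtains s where "0 < s" "s < h" "\<phi> (x + h *\<^sub>R axis j 1) - \<phi> x = h * pderiv_at j \<phi> (x + s *\<^sub>R axis j 1)"
proof -
 have "((%s. \<phi> (x + s *\<^sub>R axis j 1)) has_real_derivative pderiv_at j \<phi> (x + s *\<^sub>R axis j 1)) (at s)" for s
 proof -
  have "((%s. x + s *\<^sub>R axis j 1) has_derivative (%h. h *\<^sub>R axis j 1)) (at s)"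
   by (auto intro!: derivative_eq_intros)
  from has_derivative_compose[OF this Cc_infty_has_derivative(1)[OF assms(1)]]
  have "((%s. \<phi> (x + s *\<^sub>R axis j 1)) has_derivative
    (%h. \<Sum>i\<in>UNIV. (h *\<^sub>R axis j 1 :: real^3) $ i * pderiv_at i \<phi> (x + s *\<^sub>R axis j 1))) (at s)" .
  moreover have "(\<Sum>i\<in>UNIV. (h *\<^sub>R axis j 1 :: real^3) $ i * p i) = p j * h" for h :: real and p
   by (simp add: axis_def if_distrib[of "%a. _ * a"] if_distrib[of "%a. a * _"] cong: if_cong)
  ultimately show ?thesis unfolding has_field_derivative_def by (simp only:)
 qed
 from MVT2[OF assms(2) this] obtain s where "s > 0" "s < h"
  "\<phi> (x + h *\<^sub>R axis j 1) - \<phi> (x + 0 *\<^sub>R axis j 1) = (h - 0) * pderiv_at j \<phi> (x + s *\<^sub>R axis j 1)"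
  by metis
 with that show thesis by auto
qed

lemma Cc_infty_Lipschitz:
 assumes "\<phi> \<in> Cc_infty \<Omega>"
 shows "\<exists>C\<ge>0. \<forall>x y. \<bar>\<phi> x - \<phi> y\<bar> <= C * norm (x - y)"
proof -
 obtain C where C: "\<And>j. C j \<ge> 0" "\<And>j x. \<bar>pderiv_at j \<phi> x\<bar> <= C j"
  using Cc_infty_bounded[OF Cc_infty_has_derivative(3)[OF assms]] by metis
 have "\<bar>\<Sum>j\<in>UNIV. h $ j * pderiv_at j \<phi> x\<bar> <= (\<Sum>j\<in>UNIV. C j) * norm h" for x h
  unfolding sum_distrib_right
  by (rule order_trans[OF sum_abs sum_mono])
    (metis C abs_ge_zero abs_mult component_le_norm_cart mult.commute mult_mono)
 then have "norm (\<phi> x - \<phi> y) <= (\<Sum>j\<in>UNIV. C j) * norm (x - y)" for x y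
  by (intro differentiable_bound[of UNIV \<phi> "%x h. \<Sum>j\<in>UNIV. h $ j * pderiv_at j \<phi> x"]
    Cc_infty_has_derivative(1)[OF assms, THEN has_derivative_at_withinI] onorm_le) auto
 then show ?thesis using C(1) by (intro exI[of _ "\<Sum>j\<in>UNIV. C j"]) (auto simp: sum_nonneg)
qed

text \<open>Both bounds come from the Lipschitz constants of the partial derivatives, through the
  mean value theorem on the two intervals of length h next to x. First order is enough for the
  central quotient. The order h^2 of the second difference is what makes the viscosity of the scheme
  harmless.\<close>

lemma Cc_infty_difference_quotients:
 assumes "\<phi> \<in> Cc_infty \<Omega>"
 shows "\<exists>C\<ge>0. \<forall>x j h. 0 < h -->
  \<bar>\<phi> (x + h *\<^sub>R axis j 1) - 2 * \<phi> x + \<phi> (x - h *\<^sub>R axis j 1)\<bar> <= C * h\<^sup>2 \<and>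
  \<bar>(\<phi> (x + h *\<^sub>R axis j 1) - \<phi> (x - h *\<^sub>R axis j 1)) / (2 * h) - pderiv_at j \<phi> x\<bar> <= C * h"
proof -
 obtain C where C: "\<And>j. C j \<ge> 0" "\<And>j x y. \<bar>pderiv_at j \<phi> x - pderiv_at j \<phi> y\<bar> <= C j * norm (x - y)"
  using Cc_infty_Lipschitz[OF Cc_infty_has_derivative(3)[OF assms]] by metis
 define D where "D = 2 * (\<Sum>j\<in>UNIV. C j)"
 have D: "2 * C j <= D" "D \<ge> 0" for j
  using C(1) member_le_sum[of j UNIV C] by (auto simp: D_def sum_nonneg)
 have "\<bar>\<phi> (x + h *\<^sub>R axis j 1) - 2 * \<phi> x + \<phi> (x - h *\<^sub>R axis j 1)\<bar> <= D * h\<^sup>2 \<and>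
  \<bar>(\<phi> (x + h *\<^sub>R axis j 1) - \<phi> (x - h *\<^sub>R axis j 1)) / (2 * h) - pderiv_at j \<phi> x\<bar> <= D * h"
  if h: "0 < h" for x j h
 proof -
  let ?e = "axis j 1 :: real^3" and ?p = "pderiv_at j \<phi>"
  obtain s where s: "0 < s" "s < h" "\<phi> (x + h *\<^sub>R ?e) - \<phi> x = h * ?p (x + s *\<^sub>R ?e)"
   using Cc_infty_MVT[OF assms h] by metis
  obtain r where r: "0 < r" "r < h" "\<phi> x - \<phi> (x - h *\<^sub>R ?e) = h * ?p (x - (h - r) *\<^sub>R ?e)"
   using Cc_infty_MVT[OF assms h, of "x - h *\<^sub>R ?e" j] by (auto simp: algebra_simps)
  have 1: "\<bar>?p (x + s *\<^sub>R ?e) - ?p (x - (h - r) *\<^sub>R ?e)\<bar> <= C j * (s + (h - r))"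
   using C(2)[of j "x + s *\<^sub>R ?e" "x - (h - r) *\<^sub>R ?e"] s r by (simp flip: scaleR_left.add)
  have 2: "\<bar>?p (x + s *\<^sub>R ?e) - ?p x\<bar> <= C j * s"
   using C(2)[of j "x + s *\<^sub>R ?e" x] s by simp
  have 3: "\<bar>?p (x - (h - r) *\<^sub>R ?e) - ?p x\<bar> <= C j * (h - r)"
   using C(2)[of j "x - (h - r) *\<^sub>R ?e" x] r by simp
  have b: "C j * s <= C j * h" "C j * (h - r) <= C j * h" "C j * (s + (h - r)) <= C j * (2 * h)"
   using C(1)[of j] s r by (auto intro!: mult_left_mono)
  have dh: "2 * C j * h <= D * h" using D(1)[of j] h by (simp add: mult_right_mono)
  have "\<phi> (x + h *\<^sub>R ?e) - 2 * \<phi> x + \<phi> (x - h *\<^sub>R ?e) = h * (?p (x + s *\<^sub>R ?e) - ?p (x - (h - r) *\<^sub>R ?e))"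
   using s(3) r(3) by (simp add: algebra_simps)
  then have "\<bar>\<phi> (x + h *\<^sub>R ?e) - 2 * \<phi> x + \<phi> (x - h *\<^sub>R ?e)\<bar> = h * \<bar>?p (x + s *\<^sub>R ?e) - ?p (x - (h - r) *\<^sub>R ?e)\<bar>"
   using h by (simp add: abs_mult)
  also have "\<dots> <= h * (D * h)" using 1 b dh h by (intro mult_left_mono) linarith+
  also have "\<dots> = D * h\<^sup>2" by (simp add: power2_eq_square)
  finally have A: "\<bar>\<phi> (x + h *\<^sub>R ?e) - 2 * \<phi> x + \<phi> (x - h *\<^sub>R ?e)\<bar> <= D * h\<^sup>2" .
  have "\<phi> (x + h *\<^sub>R ?e) - \<phi> (x - h *\<^sub>R ?e) = h * (?p (x + s *\<^sub>R ?e) + ?p (x - (h - r) *\<^sub>R ?e))"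
   using s(3) r(3) by (simp add: algebra_simps)
  then have "(\<phi> (x + h *\<^sub>R ?e) - \<phi> (x - h *\<^sub>R ?e)) / (2 * h) = (?p (x + s *\<^sub>R ?e) + ?p (x - (h - r) *\<^sub>R ?e)) / 2"
   using h by simp
  moreover have "\<bar>(?p (x + s *\<^sub>R ?e) + ?p (x - (h - r) *\<^sub>R ?e)) / 2 - ?p x\<bar> <= D * h"
   using 2 3 b dh by (simp add: abs_if field_simps split: if_splits)
  ultimately show ?thesis using A by (simp only:)
 qed
 then show ?thesis using D(2) by blast
qed

text \<open>The bump exp(-1/q) with q = 1 - |x|^2/\<epsilon>^2, divided by its integral. The point
  is that C does not depend on \<epsilon>: the normalisation costs \<epsilon>^(-3) and the
  derivative one more \<epsilon>^(-1). This leaves 1/\<epsilon> for the L1 norm of the gradient,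
  which the commutator estimate cancels exactly.\<close>

lemma mollifier_exists:
 shows "\<exists>C>0. \<forall>\<epsilon>>0. \<exists>\<rho>\<in>Cc_infty UNIV. (\<forall>x. 0 <= \<rho> x) \<and> (\<forall>x. \<epsilon> < norm x --> \<rho> x = 0)
  \<and> integral\<^sup>L lborel \<rho> = 1 \<and> (\<forall>j x. \<bar>pderiv_at j \<rho> x\<bar> <= C / \<epsilon> ^ 4)"
proof -
 define E where "E = flat_exp 1"
 define E' where "E' = flat_exp ([:0, 0, 1:] * (1 - pderiv 1))"
 have dE: "(E has_real_derivative E' y) (at y)" for y
  unfolding E_def E'_def by (rule flat_exp_has_field_derivative)
 have "continuous_on {0..1} E'"
  using Ck_on_flat_exp[of 0] unfolding E'_def by (auto intro: continuous_on_subset)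
 then obtain K where K: "\<And>y. y \<in> {0..1} ==> \<bar>E' y\<bar> <= K"
  using compact_imp_bounded[OF compact_continuous_image[of "{0..1::real}" E']] by (fastforce simp: bounded_iff)
 \<comment> \<open>The argument \<open>q x\<close> never exceeds 1 and the derivative vanishes at
   negative arguments, so the compact interval [0,1] decides.\<close>
 have K': "\<bar>E' y\<bar> <= K" if "y <= 1" for y
  using K[of y] K[of 0] that by (cases "y \<ge> 0") (auto simp: E'_def flat_exp_eq_0)
 have K0: "K \<ge> 0" using K'[of 0] by linarith
 \<comment> \<open>\<open>K + 1\<close> bounds the derivative of the profile, 2 comes from
   differentiating |x|^2, and exp 2 * 27/8 is the inverse of the lower bound for the mass after
   \<epsilon>^3 is taken out.\<close>
 define C where "C = (K + 1) * 2 * exp 2 * 27 / 8"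
 have "\<exists>\<rho>\<in>Cc_infty UNIV. (\<forall>x. 0 <= \<rho> x) \<and> (\<forall>x. \<epsilon> < norm x --> \<rho> x = 0)
  \<and> integral\<^sup>L lborel \<rho> = 1 \<and> (\<forall>j x. \<bar>pderiv_at j \<rho> x\<bar> <= C / \<epsilon> ^ 4)" if e: "\<epsilon> > 0" for \<epsilon>
 proof -
  define q :: "real^3 => real" where "q x = 1 - (x \<bullet> x) / \<epsilon>\<^sup>2" for x
  have q_neg: "q x <= 0" if "\<epsilon> <= norm x" for x
   using that e by (simp add: q_def dot_square_norm power_mono)
  have smq: "Ck_on k UNIV q" for k
  proof -
   have "Ck_on k UNIV (%x::real^3. 1 + (- 1 / \<epsilon>\<^sup>2) * (\<Sum>b\<in>Basis. (x \<bullet> b) * (x \<bullet> b)))"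
    by (intro Ck_on_add Ck_on_mult Ck_on_sum Ck_on_const Ck_on_bounded_linear bounded_linear_inner_left)
   then show ?thesis by (simp add: q_def[abs_def] euclidean_inner[symmetric])
  qed
  define \<psi> where "\<psi> x = E (q x)" for x
  have \<psi>_nonneg: "\<psi> x \<ge> 0" for x by (simp add: \<psi>_def E_def flat_exp_def)
  have \<psi>_0: "\<psi> x = 0" if "\<epsilon> <= norm x" for x
   using q_neg[OF that] by (simp add: \<psi>_def E_def flat_exp_eq_0)
  have cc: "(%x. c * \<psi> x) \<in> Cc_infty UNIV" for c
  proof -
   have "smooth_on UNIV (%x. c * \<psi> x)"
    unfolding smooth_on_def \<psi>_def E_def
    by (intro allI Ck_on_mult Ck_on_const Ck_on_compose_real[OF Ck_on_flat_exp smq])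
   moreover have "bounded {x. c * \<psi> x \<noteq> 0}"
    using \<psi>_0 unfolding bounded_iff by (intro exI[of _ \<epsilon>]) (metis (mono_tags) linorder_le_cases mem_Collect_eq mult_zero_right)
   ultimately show ?thesis by (simp add: Cc_infty_def supp_on_def compact_closure)
  qed
  have int: "integrable lborel \<psi>" using Cc_infty_integrable(1)[OF cc[of 1]] by simp
  define I where "I = integral\<^sup>L lborel \<psi>"
  \<comment> \<open>On this cube |x|^2 <= \<epsilon>^2/3, so q >= 1/2 and the bump is at least
    exp(-2). The volume (2\<epsilon>/3)^3 turns this into a lower bound for the mass.\<close>
  let ?B = "cbox (- (\<chi> i. \<epsilon> / 3)) (\<chi> i. \<epsilon> / 3) :: (real^3) set"
  have "measure lborel ?B = (2 * \<epsilon> / 3) ^ 3"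
   using e by (subst content_cbox_cart) (auto simp: interval_ne_empty_cart)
  moreover have "integral\<^sup>L lborel (%x. exp (- 2) * indicator ?B x) <= I"
   unfolding I_def
  proof (rule integral_mono[OF _ int])
   show "exp (- 2) * indicator ?B x <= \<psi> x" for x
   proof (cases "x \<in> ?B")
    case True
    have "(x $ i)\<^sup>2 <= (\<epsilon> / 3)\<^sup>2" for i
    proof -
     have "\<bar>x $ i\<bar> <= \<epsilon> / 3" using True by (auto simp: mem_box_cart abs_le_iff dest!: spec[of _ i])
     then show ?thesis using power_mono[of "\<bar>x $ i\<bar>" "\<epsilon> / 3" 2] by simp
    qed
    then have "(\<Sum>i\<in>UNIV. (x $ i)\<^sup>2) <= (\<Sum>i\<in>(UNIV::3 set). (\<epsilon> / 3)\<^sup>2)" by (rule sum_mono)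
    then have "x \<bullet> x <= \<epsilon>\<^sup>2 / 3"
     by (simp add: inner_vec_def power2_eq_square)
    then have "2 * (x \<bullet> x) <= \<epsilon>\<^sup>2" using inner_ge_zero[of x] by linarith
    then have q2: "q x \<ge> 1 / 2" using e unfolding q_def by (simp add: field_simps)
    then have "exp (- 2) <= exp (- (1 / q x))" by (simp add: field_simps)
    with True q2 show ?thesis by (simp add: \<psi>_def E_def flat_exp_def)
   qed (simp add: \<psi>_nonneg)
  qed (auto simp: emeasure_lborel_cbox_eq)
  ultimately have I: "exp (- 2) * (2 * \<epsilon> / 3) ^ 3 <= I" by simp
  have I0: "I > 0" using I e by (smt (verit) exp_gt_zero mult_pos_pos zero_less_power divide_pos_pos)
  have inv: "1 / I <= exp 2 * 27 / 8 / \<epsilon> ^ 3"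
  proof -
   have "1 / I <= 1 / (exp (- 2) * (2 * \<epsilon> / 3) ^ 3)"
    using I e by (intro divide_left_mono mult_pos_pos I0) auto
   also have "\<dots> = exp 2 * 27 / 8 / \<epsilon> ^ 3" by (simp add: exp_minus field_simps power_divide power_mult_distrib)
   finally show ?thesis .
  qed
  define \<rho> where "\<rho> = (%x. (1 / I) * \<psi> x)"
  have d: "pderiv_at j \<rho> x = (1 / I) * (E' (q x) * (- 2 * x $ j / \<epsilon>\<^sup>2))" for j x
  proof -
   have "(q has_derivative (%h. - (2 * (x \<bullet> h)) / \<epsilon>\<^sup>2)) (at x)"
   proof -
    define c where "c = 1 / \<epsilon>\<^sup>2"
    have "((%x. 1 - c * (x \<bullet> x)) has_derivative (%h. - (c * (2 * (x \<bullet> h))))) (at x)"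
     by (auto intro!: derivative_eq_intros simp: inner_commute)
    then show ?thesis by (simp add: q_def[abs_def] c_def)
   qed
   from has_derivative_compose[OF this dE[unfolded has_field_derivative_def]]
   have "(\<rho> has_derivative (%h. (1 / I) * (E' (q x) * (- (2 * (x \<bullet> h)) / \<epsilon>\<^sup>2)))) (at x)"
    unfolding \<rho>_def \<psi>_def by (intro has_derivative_mult_right)
   from frechet_derivative_at[OF this, symmetric] show ?thesis
    by (simp add: pderiv_at_def inner_axis)
  qed
  have "\<bar>pderiv_at j \<rho> x\<bar> <= C / \<epsilon> ^ 4" for j x
  proof (cases "norm x <= \<epsilon>")
   case True
   have "\<bar>pderiv_at j \<rho> x\<bar> = (1 / I) * (\<bar>E' (q x)\<bar> * (2 * \<bar>x $ j\<bar> / \<epsilon>\<^sup>2))"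
    using I0 by (simp add: d abs_mult)
   also have "\<dots> <= (exp 2 * 27 / 8 / \<epsilon> ^ 3) * ((K + 1) * (2 * \<epsilon> / \<epsilon>\<^sup>2))"
   proof (intro mult_mono inv)
    show "\<bar>E' (q x)\<bar> <= K + 1" using K'[of "q x"] by (simp add: q_def)
    show "2 * \<bar>x $ j\<bar> / \<epsilon>\<^sup>2 <= 2 * \<epsilon> / \<epsilon>\<^sup>2"
     using True component_le_norm_cart[of x j] by (intro divide_right_mono) auto
   qed (use I0 e K0 in auto)
   also have "\<dots> = C / \<epsilon> ^ 4" using e by (simp add: C_def field_simps power2_eq_square eval_nat_numeral)
   finally show ?thesis .
  next
   case False
   then show ?thesis using q_neg[of x] K0 e
    by (simp add: d E'_def flat_exp_eq_0 C_def)
  qed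
  moreover have "integral\<^sup>L lborel \<rho> = 1" using I0 int by (simp add: \<rho>_def I_def)
  moreover have "\<rho> x \<ge> 0" for x using I0 \<psi>_nonneg by (simp add: \<rho>_def)
  moreover have "\<rho> x = 0" if "\<epsilon> < norm x" for x using \<psi>_0 that by (simp add: \<rho>_def)
  ultimately show ?thesis using cc[of "1 / I"] by (intro bexI[of _ \<rho>]) (auto simp: \<rho>_def)
 qed
 moreover have "C > 0" using K0 by (simp add: C_def)
 ultimately show ?thesis by blast
qed

section \<open>Translations and averages in \<open>L\<^sup>1\<close>\<close>

lemma nn_integral_lborel_shift:
 fixes a :: "'a::euclidean_space"
 assumes [measurable]: "f \<in> borel_fn"
 shows "(NNINT x. f (x + a)) = (NNINT x. f x)"
proof -
 have "(NNINT x. f x) = (\<integral>\<^sup>+x. f x \<partial>distr lborel borel ((+) a))" by (simp add: lborel_distr_plus)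
 also have "\<dots> = (NNINT x. f (x + a))" by (subst nn_integral_distr) (simp_all add: add.commute)
 finally show ?thesis ..
qed

lemma ennreal_abs_triangle: "ennreal \<bar>a + b\<bar> <= ennreal \<bar>a\<bar> + ennreal \<bar>b\<bar>"
 by (metis abs_ge_zero abs_triangle_ineq ennreal_leI ennreal_plus)

lemma ennreal_abs_diff_triangle: "ennreal \<bar>a - c\<bar> <= ennreal \<bar>a - b\<bar> + ennreal \<bar>b - c\<bar>"
 using ennreal_abs_triangle[of "a - b" "b - c"] by simp

text \<open>Density argument along the induction rule for integrable functions. The case with
  content is an indicator: squeeze A between a compact K and an open U with U - K small. Once the
  shift is smaller than the distance from K to the complement of U, the indicator can change only
  where x or x + k lies in U - K.\<close>

lemma translation_continuous_L1:
 fixes u :: "'a::euclidean_space => real"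
 assumes "integrable lborel u" "0 < e"
 shows "\<exists>d>0. \<forall>k. norm k < d --> (NNINT x. ennreal \<bar>u (x + k) - u x\<bar>) <= ennreal e"
 using assms
proof (induction u arbitrary: e rule: integrable_induct)
 case (base A c)
 then have A[measurable]: "A \<in> sets borel" and fin: "emeasure lborel A < \<infinity>" by auto
 \<comment> \<open>U - K will have measure at most 2\<eta> and is counted twice, for x and for x +
   k; hence the 4. The 1 covers c = 0.\<close>
 define \<eta> where "\<eta> = e / (4 * (\<bar>c\<bar> + 1))"
 have \<eta>: "\<eta> > 0" using base by (simp add: \<eta>_def add_nonneg_pos)
 have AL: "A \<in> sets lebesgue" using A by simp
 obtain U where U: "open U" "A \<subseteq> U" "emeasure lebesgue (U - A) < ennreal \<eta>"
  using sets_lebesgue_outer_open[OF AL \<eta>] by metis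
 obtain F where F: "closed F" "F \<subseteq> A" "emeasure lebesgue (A - F) < ennreal (\<eta> / 2)"
  using sets_lebesgue_inner_closed[OF AL half_gt_zero[OF \<eta>]] by metis
 have [measurable]: "U \<in> sets borel" "F \<in> sets borel" using U F by auto
 \<comment> \<open>Inner regularity yields a closed set only; cutting it with a large ball makes it
   compact at small cost, since F has finite measure.\<close>
 have "(%n. emeasure lborel (F - cball 0 (real n))) \<longlonglongrightarrow> emeasure lborel (\<Inter>n. F - cball 0 (real n))"
 proof (rule Lim_emeasure_decseq)
  show "decseq (%n. F - cball 0 (real n))" by (force simp: decseq_def)
  have "emeasure lborel F <= emeasure lborel A" using F by (intro emeasure_mono) auto
  then show "emeasure lborel (F - cball 0 (real i)) \<noteq> \<infinity>" for i
   using fin emeasure_mono[of "F - cball 0 (real i)" F lborel] by (auto simp: top_unique)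
 qed auto
 moreover have "(\<Inter>n. F - cball 0 (real n)) = {}"
 proof -
  have "\<exists>n. norm x <= real n" for x :: 'a by (rule real_arch_simple)
  then show ?thesis by auto
 qed
 ultimately have "(%n. emeasure lborel (F - cball 0 (real n))) \<longlonglongrightarrow> 0" by (simp only: emeasure_empty)
 then have "\<forall>\<^sub>F n in sequentially. emeasure lborel (F - cball 0 (real n)) < ennreal (\<eta> / 2)"
  using \<eta> by (intro order_tendstoD(2)) auto
 then obtain n where n: "emeasure lborel (F - cball 0 (real n)) < ennreal (\<eta> / 2)"
  by (meson eventually_sequentially order_refl)
 define K where "K = F \<inter> cball 0 (real n)"
 have K: "compact K" "K \<subseteq> A" using F by (auto simp: K_def closed_Int_compact)
 have [measurable]: "K \<in> sets borel" using K by (simp add: borel_compact)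
 have "emeasure lborel (U - K) <= emeasure lborel ((U - A) \<union> ((A - F) \<union> (F - cball 0 (real n))))"
  by (intro emeasure_mono) (auto simp: K_def)
 also have "\<dots> <= emeasure lborel (U - A) + (emeasure lborel (A - F) + emeasure lborel (F - cball 0 (real n)))"
  by (intro order_trans[OF emeasure_subadditive] add_mono order_refl emeasure_subadditive) auto
 also have "\<dots> <= ennreal \<eta> + (ennreal (\<eta> / 2) + ennreal (\<eta> / 2))"
  using U(3) F(3) n by (intro add_mono) auto
 also have "\<dots> = ennreal (2 * \<eta>)" using \<eta> by (simp flip: ennreal_plus)
 finally have UK: "emeasure lborel (U - K) <= ennreal (2 * \<eta>)" .
 obtain d where d: "d > 0" "(\<Union>x\<in>K. ball x d) \<subseteq> U"
  using compact_subset_open_imp_ball_epsilon_subset[OF K(1) U(1)] K U by auto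
 have "(NNINT x. ennreal \<bar>indicator A (x + k) *\<^sub>R c - indicator A x *\<^sub>R c\<bar>) <= ennreal e" if k: "norm k < d" for k
 proof -
  have in_U: "x + k \<in> U" "x - k \<in> U" if "x \<in> K" for x
   using d that k by (auto simp: subset_eq dist_norm)
  have "ennreal \<bar>indicator A (x + k) *\<^sub>R c - indicator A x *\<^sub>R c\<bar>
    <= ennreal \<bar>c\<bar> * (indicator (U - K) x + indicator (U - K) (x + k))" for x
  proof -
   consider "x \<in> A \<longleftrightarrow> x + k \<in> A" | "x \<in> U - K" | "x + k \<in> U - K"
    using in_U(1)[of x] in_U(2)[of "x + k"] K(2) U(2) by auto
   then show ?thesis
   proof cases
    case 1
    then show ?thesis by (simp add: indicator_def)
   next
    case 2
    have "\<bar>indicator A (x + k) *\<^sub>R c - indicator A x *\<^sub>R c\<bar> <= \<bar>c\<bar>" by (simp add: indicator_def)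
    then have "ennreal \<bar>indicator A (x + k) *\<^sub>R c - indicator A x *\<^sub>R c\<bar> <= ennreal \<bar>c\<bar> * (1 + 0)"
     by (simp add: ennreal_leI)
    also have "\<dots> <= ennreal \<bar>c\<bar> * (indicator (U - K) x + indicator (U - K) (x + k))"
     using 2 by (intro mult_left_mono add_mono) auto
    finally show ?thesis .
   next
    case 3
    have "\<bar>indicator A (x + k) *\<^sub>R c - indicator A x *\<^sub>R c\<bar> <= \<bar>c\<bar>" by (simp add: indicator_def)
    then have "ennreal \<bar>indicator A (x + k) *\<^sub>R c - indicator A x *\<^sub>R c\<bar> <= ennreal \<bar>c\<bar> * (0 + 1)"
     by (simp add: ennreal_leI)
    also have "\<dots> <= ennreal \<bar>c\<bar> * (indicator (U - K) x + indicator (U - K) (x + k))"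
     using 3 by (intro mult_left_mono add_mono) auto
    finally show ?thesis .
   qed
  qed
  then have "(NNINT x. ennreal \<bar>indicator A (x + k) *\<^sub>R c - indicator A x *\<^sub>R c\<bar>)
    <= (NNINT x. ennreal \<bar>c\<bar> * (indicator (U - K) x + indicator (U - K) (x + k)))"
   by (rule nn_integral_mono)
  also have "\<dots> = ennreal \<bar>c\<bar> * ((NNINT x. indicator (U - K) x) + (NNINT x. indicator (U - K) (x + k)))"
   by (simp add: nn_integral_cmult nn_integral_add)
  also have "\<dots> = ennreal \<bar>c\<bar> * (emeasure lborel (U - K) + emeasure lborel (U - K))"
   by (subst nn_integral_lborel_shift[of "indicator (U - K)"]) auto
  also have "\<dots> <= ennreal \<bar>c\<bar> * (ennreal (2 * \<eta>) + ennreal (2 * \<eta>))"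
   using UK by (intro mult_left_mono add_mono) auto
  also have "\<dots> = ennreal (\<bar>c\<bar> * (4 * \<eta>))" using \<eta> by (simp flip: ennreal_plus ennreal_mult)
  also have "\<dots> <= ennreal e"
   using base by (intro ennreal_leI) (auto simp: \<eta>_def field_simps)
  finally show ?thesis .
 qed
 then show ?case using d(1) by blast
next
 case (add f g)
 have [measurable]: "f \<in> borel_fn" "g \<in> borel_fn"
  using borel_measurable_integrable[OF add.hyps(1)] borel_measurable_integrable[OF add.hyps(2)] by simp_all
 obtain d1 d2 where d: "d1 > 0" "d2 > 0"
  "\<And>k. norm k < d1 ==> (NNINT x. ennreal \<bar>f (x + k) - f x\<bar>) <= ennreal (e / 2)"
  "\<And>k. norm k < d2 ==> (NNINT x. ennreal \<bar>g (x + k) - g x\<bar>) <= ennreal (e / 2)"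
  using add.IH[of "e / 2"] add.prems by auto
 have "(NNINT x. ennreal \<bar>(f (x + k) + g (x + k)) - (f x + g x)\<bar>) <= ennreal e" if "norm k < min d1 d2" for k
 proof -
  have "(NNINT x. ennreal \<bar>(f (x + k) + g (x + k)) - (f x + g x)\<bar>)
   <= (NNINT x. ennreal \<bar>f (x + k) - f x\<bar> + ennreal \<bar>g (x + k) - g x\<bar>)"
  proof (intro nn_integral_mono)
   show "ennreal \<bar>(f (x + k) + g (x + k)) - (f x + g x)\<bar> <= ennreal \<bar>f (x + k) - f x\<bar> + ennreal \<bar>g (x + k) - g x\<bar>" for x
    unfolding add_diff_add by (rule ennreal_abs_triangle)
  qed
  also have "\<dots> <= ennreal (e / 2) + ennreal (e / 2)"
  proof -
   have "(NNINT x. ennreal \<bar>f (x + k) - f x\<bar> + ennreal \<bar>g (x + k) - g x\<bar>)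
    = (NNINT x. ennreal \<bar>f (x + k) - f x\<bar>) + (NNINT x. ennreal \<bar>g (x + k) - g x\<bar>)"
    by (rule nn_integral_add) measurable
   then show ?thesis using d(3)[of k] d(4)[of k] that by (simp add: add_mono)
  qed
  also have "\<dots> = ennreal e" using add.prems by (simp flip: ennreal_plus)
  finally show ?thesis .
 qed
 then show ?case using d(1,2) by (intro exI[of _ "min d1 d2"]) auto
next
 case (lim f s)
 have [measurable]: "f \<in> borel_fn" "\<And>i. s i \<in> borel_fn"
  using borel_measurable_integrable[OF lim.hyps(4)] borel_measurable_integrable[OF lim.hyps(1)] by simp_all
 have "(%i. integral\<^sup>L lborel (%x. \<bar>s i x - f x\<bar>)) \<longlonglongrightarrow> integral\<^sup>L lborel (%x::'a. 0::real)"
 \<comment> \<open>The induction rule supplies approximants bounded by 2|f|, hence the majorant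
   3|f|.\<close>
 proof (rule integral_dominated_convergence[where w="%x. 3 * \<bar>f x\<bar>" and s="%i x. \<bar>s i x - f x\<bar>" and f="%_. 0"])
  show "AE x in lborel. (%i. \<bar>s i x - f x\<bar>) \<longlonglongrightarrow> 0"
  proof (rule AE_I2)
   fix x
   have "(%i. s i x) \<longlonglongrightarrow> f x" using lim.hyps(2)[of x] by simp
   from tendsto_rabs[OF tendsto_diff[OF this tendsto_const[of "f x"]]]
   show "(%i. \<bar>s i x - f x\<bar>) \<longlonglongrightarrow> 0" by simp
  qed
  show "AE x in lborel. norm \<bar>s i x - f x\<bar> <= 3 * \<bar>f x\<bar>" for i
  proof (rule AE_I2)
   fix x
   have "\<bar>s i x\<bar> <= 2 * \<bar>f x\<bar>" using lim.hyps(3)[of x i] by simp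
   then show "norm \<bar>s i x - f x\<bar> <= 3 * \<bar>f x\<bar>" by simp
  qed
 qed (use lim.hyps(1,4) in simp_all)
 then have "\<forall>\<^sub>F i in sequentially. integral\<^sup>L lborel (%x. \<bar>s i x - f x\<bar>) < e / 3"
  using lim.prems by (intro order_tendstoD(2)) auto
 then obtain i where i: "integral\<^sup>L lborel (%x. \<bar>s i x - f x\<bar>) < e / 3"
  by (meson eventually_sequentially order_refl)
 have si: "(NNINT x. ennreal \<bar>s i x - f x\<bar>) <= ennreal (e / 3)"
  using i lim.hyps(1,4) by (subst nn_integral_eq_integral) (simp_all add: ennreal_leI)
 obtain d where d: "d > 0" "\<And>k. norm k < d ==> (NNINT x. ennreal \<bar>s i (x + k) - s i x\<bar>) <= ennreal (e / 3)"
  using lim.IH[of "e / 3" i] lim.prems by auto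
 have "(NNINT x. ennreal \<bar>f (x + k) - f x\<bar>) <= ennreal e" if "norm k < d" for k
 proof -
  have "(NNINT x. ennreal \<bar>f (x + k) - f x\<bar>) \<le>
   (NNINT x. ennreal \<bar>s i (x + k) - f (x + k)\<bar> + (ennreal \<bar>s i (x + k) - s i x\<bar> + ennreal \<bar>s i x - f x\<bar>))"
  proof (intro nn_integral_mono)
   fix x
   have "\<bar>f (x + k) - f x\<bar> <= \<bar>s i (x + k) - f (x + k)\<bar> + (\<bar>s i (x + k) - s i x\<bar> + \<bar>s i x - f x\<bar>)"
    by linarith
   then show "ennreal \<bar>f (x + k) - f x\<bar> \<le>
     ennreal \<bar>s i (x + k) - f (x + k)\<bar> + (ennreal \<bar>s i (x + k) - s i x\<bar> + ennreal \<bar>s i x - f x\<bar>)"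
    by (simp add: ennreal_leI flip: ennreal_plus)
  qed
  also have "\<dots> = (NNINT x. ennreal \<bar>s i x - f x\<bar>) +
   ((NNINT x. ennreal \<bar>s i (x + k) - s i x\<bar>) + (NNINT x. ennreal \<bar>s i x - f x\<bar>))"
   using nn_integral_lborel_shift[of "%x. ennreal \<bar>s i x - f x\<bar>" k] by (simp add: nn_integral_add)
  also have "\<dots> <= ennreal (e / 3) + (ennreal (e / 3) + ennreal (e / 3))"
   using si d(2)[OF that] by (intro add_mono)
  also have "\<dots> = ennreal e" using lim.prems by (simp flip: ennreal_plus)
  finally show ?thesis .
 qed
 then show ?case using d(1) by blast
qed

section \<open>Averages against probability kernels\<close>

lemma abs_integral_le_nn_integral:
 fixes f :: "'b => real"
 shows "ennreal \<bar>integral\<^sup>L M f\<bar> <= (\<integral>\<^sup>+x. ennreal \<bar>f x\<bar> \<partial>M)"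
 using integral_norm_bound_ennreal[of M f] by (cases "integrable M f") (auto simp: not_integrable_integral_eq)

text \<open>Common core of cell averages and mollification. The kernel itself need not be a
  convolution kernel; it suffices that it is dominated by a translate of some \<kappa>. After
  integration in x, Tonelli then reduces the averaging error to the L1 modulus of continuity of
  u.\<close>

lemma kernel_average_diff_le:
 fixes u :: "'a::euclidean_space => real"
 assumes [measurable]: "u \<in> borel_fn" "k \<in> borel_fn" "\<kappa> \<in> borel_fn"
  and k: "\<And>z. 0 <= k z" "integrable lborel k" "integral\<^sup>L lborel k = 1" "integrable lborel (%z. k z * u z)"
  and le: "\<And>z. k z <= \<kappa> (z - x)"
 shows "ennreal \<bar>(RINT z. k z * u z) - u x\<bar> <= (NNINT y. ennreal (\<kappa> y) * ennreal \<bar>u (x + y) - u x\<bar>)"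
proof -
 have "(RINT z. k z * u z) - u x = (RINT z. k z * u z - k z * u x)"
  using k by (subst Bochner_Integration.integral_diff) auto
 then have "ennreal \<bar>(RINT z. k z * u z) - u x\<bar> <= (NNINT z. ennreal \<bar>k z * u z - k z * u x\<bar>)"
  using abs_integral_le_nn_integral by metis
 also have "\<dots> <= (NNINT z. ennreal (\<kappa> (z - x)) * ennreal \<bar>u z - u x\<bar>)"
  using k(1) le order_trans[OF k(1) le]
  by (intro nn_integral_mono)
    (auto simp flip: ennreal_mult right_diff_distrib simp: abs_mult intro!: ennreal_leI mult_right_mono)
 also have "\<dots> = (NNINT y. ennreal (\<kappa> y) * ennreal \<bar>u (x + y) - u x\<bar>)"
  by (subst nn_integral_lborel_shift[of _ x, symmetric]) (auto simp: add.commute)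
 finally show ?thesis .
qed

lemma nn_integral_kernel_le:
 fixes \<kappa> :: "'a::euclidean_space => real"
 assumes [measurable]: "\<kappa> \<in> borel_fn"
  and "\<And>y. \<kappa> y \<noteq> 0 ==> W y <= ennreal e" "(NNINT y. ennreal (\<kappa> y)) <= ennreal C" "0 <= C" "0 <= e"
 shows "(NNINT y. ennreal (\<kappa> y) * W y) <= ennreal (C * e)"
proof -
 have "(NNINT y. ennreal (\<kappa> y) * W y) <= (NNINT y. ennreal (\<kappa> y) * ennreal e)"
 proof (intro nn_integral_mono)
  show "ennreal (\<kappa> y) * W y <= ennreal (\<kappa> y) * ennreal e" for y
   using assms(2)[of y] by (cases "\<kappa> y = 0") (auto intro: mult_left_mono)
 qed
 also have "\<dots> = (NNINT y. ennreal (\<kappa> y)) * ennreal e" by (simp add: nn_integral_multc)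
 also have "\<dots> <= ennreal C * ennreal e" using assms by (intro mult_right_mono) auto
 finally show ?thesis using assms by (simp add: ennreal_mult)
qed

text \<open>A partition into cells of equal measure is encoded by the map \<open>q\<close> that
  sends a point to the representative of its cell; the cells are the fibres of \<open>q\<close>. The
  same lemmas then serve the cubes of space and the boxes of space-time.\<close>

locale cell_average_setting =
 fixes q :: "'a::euclidean_space => 'a" and m :: real
 assumes q_measurable[measurable]: "q \<in> borel_fn"
  and m_pos: "0 < m"
  and emeasure_cell: "\<And>x. emeasure lborel {z. q z = q x} = ennreal m"
begin

definition cell_kernel :: "'a => 'a => real" where
 "cell_kernel x z = indicator {z. q z = q x} z / m"

definition avg :: "('a => real) => 'a => real" where
 "avg u x = (RINT z. cell_kernel x z * u z)"

lemma cell_measurable[measurable]: "{z. q z = q x} \<in> sets borel"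
 using measurable_equality_set[of q borel "%_. q x"] by simp

lemma kernel_measurable[measurable]: "Measurable.pred (borel \<Otimes>\<^sub>M borel) (%z. q (snd z) = q (fst z))"
 unfolding pred_def using measurable_equality_set[of "%z. q (snd z)" "borel \<Otimes>\<^sub>M borel" "%z. q (fst z)"]
 by simp

lemma avg_measurable[measurable]:
 assumes [measurable]: "u \<in> borel_fn"
 shows "avg u \<in> borel_fn"
 unfolding avg_def cell_kernel_def indicator_def by measurable

lemma kernel_integrable: "integrable lborel (%z. cell_kernel x z)"
 and kernel_integral: "(RINT z. cell_kernel x z) = 1"
 and kernel_mult_integrable: "integrable lborel u ==> integrable lborel (%z. cell_kernel x z * u z)"
 using emeasure_cell[of x] m_pos integrable_real_mult_indicator[of "{z. q z = q x}" lborel u]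
 by (auto simp: cell_kernel_def[abs_def] measure_def integrable_real_indicator field_simps)

lemma avg_cong_cell: "q x = q y ==> avg u x = avg u y"
 by (simp add: avg_def cell_kernel_def)

lemma avg_diff: "integrable lborel u ==> integrable lborel w ==> avg (%x. u x - w x) x = avg u x - avg w x"
 by (simp add: avg_def right_diff_distrib kernel_mult_integrable Bochner_Integration.integral_diff)

lemma avg_cmult: "avg (%x. c * u x) x = c * avg u x"
 by (simp add: avg_def mult.left_commute[of _ c])

lemma avg_sum: "(\<And>i. i \<in> I ==> integrable lborel (u i)) ==> avg (%x. \<Sum>i\<in>I. u i x) x = (\<Sum>i\<in>I. avg (u i) x)"
 by (simp add: avg_def sum_distrib_left kernel_mult_integrable Bochner_Integration.integral_sum)

text \<open>A shift that commutes with \<open>q\<close> carries cells to cells, so averaging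
  commutes with it. For the grids below these are the shifts by grid vectors, in particular those of
  the stencil.\<close>

lemma avg_shift:
 assumes "\<And>z. q (z + a) = q z + a" "u \<in> borel_fn"
 shows "avg u (x + a) = avg (%z. u (z + a)) x"
proof -
 have "avg u (x + a) = (RINT z. cell_kernel (x + a) (z + a) * u (z + a))"
  unfolding avg_def by (subst lborel_distr_plus[of a, symmetric], subst integral_distr)
   (use assms in \<open>auto simp: add.commute cell_kernel_def\<close>)
 then show ?thesis by (simp add: avg_def cell_kernel_def indicator_def assms(1))
qed

lemma avg_bound:
 assumes "\<And>x. \<bar>u x\<bar> <= M" "integrable lborel u"
 shows "\<bar>avg u x\<bar> <= M"
proof -
 have "\<bar>avg u x\<bar> <= (RINT z. \<bar>cell_kernel x z * u z\<bar>)"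
  unfolding avg_def by (rule integral_abs_bound)
 also have "\<dots> <= (RINT z. M * cell_kernel x z)"
  using assms(1) m_pos
  by (intro integral_mono integrable_abs kernel_mult_integrable assms integrable_mult_right kernel_integrable)
    (auto simp: cell_kernel_def indicator_def divide_right_mono)
 also have "\<dots> = M" by (subst integral_mult_right_zero) (simp add: kernel_integral)
 finally show ?thesis .
qed

text \<open>Jensen for the square, read off from the nonnegativity of the variance over the
  cell.\<close>

lemma avg_square_le:
 assumes u: "integrable lborel u" "integrable lborel (%x. (u x)\<^sup>2)"
 shows "(avg u x)\<^sup>2 <= avg (%x. (u x)\<^sup>2) x"
proof -
 let ?k = "cell_kernel x" and ?c = "avg u x"
 have "0 <= (RINT z. ?k z * (u z - ?c)\<^sup>2)"
  using m_pos by (intro Bochner_Integration.integral_nonneg) (auto simp: cell_kernel_def)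
 also have "\<dots> = (RINT z. ?k z * (u z)\<^sup>2 - (2 * ?c) * (?k z * u z) + ?c\<^sup>2 * ?k z)"
  by (intro Bochner_Integration.integral_cong) (auto simp: power2_eq_square algebra_simps)
 also have "\<dots> = avg (%x. (u x)\<^sup>2) x - (2 * ?c) * avg u x + ?c\<^sup>2 * 1"
 proof -
  have "(RINT z. ?k z * (u z)\<^sup>2 - (2 * ?c) * (?k z * u z) + ?c\<^sup>2 * ?k z)
    = (RINT z. ?k z * (u z)\<^sup>2 - (2 * ?c) * (?k z * u z)) + (RINT z. ?c\<^sup>2 * ?k z)"
   by (intro Bochner_Integration.integral_add Bochner_Integration.integrable_diff integrable_mult_right
     kernel_mult_integrable kernel_integrable u)
  also have "(RINT z. ?k z * (u z)\<^sup>2 - (2 * ?c) * (?k z * u z))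
    = (RINT z. ?k z * (u z)\<^sup>2) - (RINT z. (2 * ?c) * (?k z * u z))"
   by (intro Bochner_Integration.integral_diff integrable_mult_right kernel_mult_integrable u)
  finally show ?thesis by (simp only: avg_def[of "%x. (u x)\<^sup>2"] avg_def[of u, symmetric] kernel_integral integral_mult_right_zero)
 qed
 finally show ?thesis by (simp add: power2_eq_square)
qed

text \<open>The kernel is symmetric in its two points, so after Tonelli its integral over the other
  variable is again 1.\<close>

lemma avg_L1_le:
 assumes [measurable]: "u \<in> borel_fn"
 shows "(NNINT x. ennreal \<bar>avg u x\<bar>) <= (NNINT x. ennreal \<bar>u x\<bar>)"
proof -
 have "(NNINT x. ennreal \<bar>avg u x\<bar>)
   <= (NNINT x. NNINT z. (if q z = q x then ennreal (1 / m) * ennreal \<bar>u z\<bar> else 0))"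
  unfolding avg_def using m_pos
  by (intro nn_integral_mono order_trans[OF abs_integral_le_nn_integral])
    (auto simp: cell_kernel_def indicator_def abs_mult simp flip: ennreal_mult)
 also have "\<dots> = (NNINT z. NNINT x. (if q z = q x then ennreal (1 / m) * ennreal \<bar>u z\<bar> else 0))"
  by (rule lborel_pair.Fubini') (simp add: case_prod_beta)
 also have "\<dots> = (NNINT z. NNINT x. ennreal (1 / m) * ennreal \<bar>u z\<bar> * indicator {x. q x = q z} x)"
  by (intro nn_integral_cong) (auto simp: indicator_def)
 also have "\<dots> = (NNINT z. ennreal (1 / m) * ennreal \<bar>u z\<bar> * ennreal m)"
  by (simp add: nn_integral_cmult_indicator emeasure_cell)
 also have "\<dots> = (NNINT z. ennreal \<bar>u z\<bar>)"
  using m_pos by (intro nn_integral_cong) (simp flip: ennreal_mult)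
 finally show ?thesis .
qed

text \<open>The cell of x depends on x in a discontinuous way, but it always lies in x + D.
  Replacing it by x + D gives a translation invariant kernel of mass at most C, at the price of that
  constant.\<close>

lemma avg_L1_diff_le:
 assumes u: "integrable lborel u"
  and D[measurable]: "D \<in> sets borel" and cell: "\<And>x z. q z = q x ==> z - x \<in> D"
  and emD: "emeasure lborel D <= ennreal (C * m)" and C: "0 <= C" and e: "0 <= e"
  and W: "\<And>y. y \<in> D ==> (NNINT x. ennreal \<bar>u (x + y) - u x\<bar>) <= ennreal e"
 shows "(NNINT x. ennreal \<bar>avg u x - u x\<bar>) <= ennreal (C * e)"
proof -
 have [measurable]: "u \<in> borel_fn" using u by auto
 define \<kappa> where "\<kappa> y = indicator D y / m" for y
 have [measurable]: "\<kappa> \<in> borel_fn" unfolding \<kappa>_def by simp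
 have "(NNINT x. ennreal \<bar>avg u x - u x\<bar>)
   <= (NNINT x. NNINT y. ennreal (\<kappa> y) * ennreal \<bar>u (x + y) - u x\<bar>)"
  unfolding avg_def
 proof (intro nn_integral_mono kernel_average_diff_le kernel_integrable kernel_integral kernel_mult_integrable u)
  show "cell_kernel x z <= \<kappa> (z - x)" for x z
   using m_pos cell[of z x] by (auto simp: \<kappa>_def cell_kernel_def indicator_def)
 qed (use m_pos in \<open>auto simp: cell_kernel_def[abs_def]\<close>)
 also have "\<dots> = (NNINT y. ennreal (\<kappa> y) * (NNINT x. ennreal \<bar>u (x + y) - u x\<bar>))"
  by (subst lborel_pair.Fubini') (auto simp: nn_integral_cmult)
 also have "\<dots> <= ennreal (C * e)"
 proof (rule nn_integral_kernel_le)
  have "(NNINT y. ennreal (\<kappa> y)) = (NNINT y. ennreal (1 / m) * indicator D y)"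
   by (intro nn_integral_cong) (auto simp: \<kappa>_def indicator_def)
  also have "\<dots> <= ennreal (1 / m) * ennreal (C * m)"
   using emD by (simp add: nn_integral_cmult_indicator mult_left_mono)
  also have "\<dots> = ennreal C" using m_pos C by (simp flip: ennreal_mult)
  finally show "(NNINT y. ennreal (\<kappa> y)) <= ennreal C" .
 qed (use W C e in \<open>auto simp: \<kappa>_def indicator_def split: if_splits\<close>)
 finally show ?thesis .
qed

end

section \<open>Grid functions as step functions\<close>

text \<open>The centre of the cell of y. Adding 1/2 before the floor matches the half-open cells,
  which contain their lower and not their upper faces.\<close>

definition rd :: "real => R3 => R3" where
 "rd h y = (\<chi> i. h * of_int \<lfloor>y $ i / h + 1 / 2\<rfloor>)"

lemma rd_in_grid: "rd h y \<in> grid h"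
 by (auto simp: rd_def grid_def)

lemma mem_cell_iff_rd:
 assumes "0 < h" "x \<in> grid h"
 shows "y \<in> cell h x \<longleftrightarrow> rd h y = x"
proof -
 have "x $ i - h / 2 <= y $ i \<and> y $ i < x $ i + h / 2 \<longleftrightarrow> h * of_int \<lfloor>y $ i / h + 1 / 2\<rfloor> = x $ i" for i
 proof -
  obtain k :: int where k: "x $ i = h * of_int k" using assms by (auto simp: grid_def)
  have "x $ i - h / 2 <= y $ i \<and> y $ i < x $ i + h / 2 \<longleftrightarrow> of_int k <= y $ i / h + 1 / 2 \<and> y $ i / h + 1 / 2 < of_int k + 1"
   using assms(1) by (auto simp: k field_simps)
  also have "\<dots> \<longleftrightarrow> \<lfloor>y $ i / h + 1 / 2\<rfloor> = k" by (metis floor_eq_iff)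
  also have "\<dots> \<longleftrightarrow> h * of_int \<lfloor>y $ i / h + 1 / 2\<rfloor> = x $ i" using assms(1) by (simp add: k)
  finally show ?thesis .
 qed
 then show ?thesis by (simp add: cell_def rd_def vec_eq_iff)
qed

lemma rd_add_grid:
 assumes "0 < h" "a \<in> grid h"
 shows "rd h (y + a) = rd h y + a"
proof -
 have "h * of_int \<lfloor>(y $ i + a $ i) / h + 1 / 2\<rfloor> = h * of_int \<lfloor>y $ i / h + 1 / 2\<rfloor> + a $ i" for i
 proof -
  obtain k :: int where k: "a $ i = h * of_int k" using assms by (auto simp: grid_def)
  have "(y $ i + a $ i) / h + 1 / 2 = (y $ i / h + 1 / 2) + of_int k"
   using assms(1) by (simp add: k field_simps)
  then have "\<lfloor>(y $ i + a $ i) / h + 1 / 2\<rfloor> = \<lfloor>y $ i / h + 1 / 2\<rfloor> + k" by (metis floor_add_int)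
  then show ?thesis by (simp add: k algebra_simps)
 qed
 then show ?thesis by (simp add: rd_def vec_eq_iff)
qed

lemma axis_in_grid: "h *\<^sub>R axis j 1 \<in> grid h" "- (h *\<^sub>R axis j 1) \<in> grid h"
proof -
 show "h *\<^sub>R axis j 1 \<in> grid h"
 proof -
  have "\<exists>k::int. (h *\<^sub>R axis j 1) $ i = h * of_int k" for i
   by (rule exI[of _ "if i = j then 1 else 0"]) (simp add: axis_def)
  then show ?thesis by (simp add: grid_def)
 qed
 have "\<exists>k::int. (- (h *\<^sub>R axis j 1)) $ i = h * of_int k" for i
  by (rule exI[of _ "if i = j then - 1 else 0"]) (simp add: axis_def)
 then show "- (h *\<^sub>R axis j 1) \<in> grid h" by (simp add: grid_def)
qed

lemma vec_nth_measurable[measurable]: "(%x::real^'n. x $ i) \<in> borel_fn"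
 by (intro borel_measurable_continuous_onI continuous_intros)

lemma vec_lambda_measurable:
 fixes f :: "'a => 'n::finite => real"
 assumes "\<And>i. (%x. f x i) \<in> borel_measurable M"
 shows "(%x. \<chi> i. f x i) \<in> borel_measurable M"
proof -
 have "(\<chi> i. f x i) = (\<Sum>i\<in>UNIV. f x i *\<^sub>R axis i 1)" for x
  using basis_expansion[of "\<chi> i. f x i"] by (simp add: scalar_mult_eq_scaleR)
 then show ?thesis using assms by simp
qed

lemma rd_measurable[measurable]: "rd h \<in> borel_fn"
 unfolding rd_def[abs_def] by (intro vec_lambda_measurable) measurable

lemma cube_emeasure:
 assumes "0 <= c"
 shows "emeasure lborel {y::R3. \<forall>i. x $ i - c <= y $ i \<and> y $ i < x $ i + c} = ennreal ((2 * c) ^ 3)"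
  (is "emeasure lborel ?S = _")
proof (rule antisym)
 have S[measurable]: "?S \<in> sets borel" by measurable
 let ?a = "x - (\<chi> i. c)" and ?b = "x + (\<chi> i. c) :: R3"
 have inner: "\<forall>b\<in>Basis. ?a \<bullet> b <= ?b \<bullet> b"
  using assms by (auto simp: Basis_vec_def inner_axis)
 have prod: "(\<Prod>b\<in>Basis. (?b - ?a) \<bullet> b) = (2 * c) ^ 3"
  using content_cbox_cart[of ?a ?b] content_cbox_if[of ?a ?b] inner assms
  by (auto simp: interval_ne_empty_cart interval_eq_empty_cart not_less split: if_splits)
 have "emeasure lborel ?S <= emeasure lborel (cbox ?a ?b)"
  by (intro emeasure_mono) (auto simp: mem_box_cart less_imp_le)
 then show "emeasure lborel ?S <= ennreal ((2 * c) ^ 3)"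
  using inner prod by (simp add: emeasure_lborel_cbox_eq)
 have "emeasure lborel (box ?a ?b) <= emeasure lborel ?S"
  by (intro emeasure_mono) (auto simp: mem_box_cart less_imp_le)
 then show "ennreal ((2 * c) ^ 3) <= emeasure lborel ?S"
  using inner prod by (simp add: emeasure_lborel_box_eq)
qed

lemma cell_rd: "0 < h ==> {z. rd h z = rd h y} = cell h (rd h y)"
 using mem_cell_iff_rd[OF _ rd_in_grid] by blast

lemma cell_measurable'[measurable]: "cell h x \<in> sets borel"
 unfolding cell_def by measurable

lemma emeasure_cell_R3: "0 < h ==> emeasure lborel (cell h x) = ennreal (h ^ 3)"
 using cube_emeasure[of "h / 2" x] by (simp add: cell_def)

text \<open>Time is rounded down and space to the centre of the cell, so the fibres are exactly the
  boxes over which the discrete velocity is averaged, up to one endpoint in time.\<close>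

definition td :: "real => real => real \<times> R3 => real \<times> R3" where
 "td h \<tau> z = (\<tau> * of_int \<lfloor>fst z / \<tau>\<rfloor>, rd h (snd z))"

lemma floor_cell:
 assumes "0 < \<tau>"
 shows "\<lfloor>s / \<tau>\<rfloor> = k \<longleftrightarrow> s \<in> {\<tau> * of_int k..<\<tau> * (of_int k + 1)}"
proof -
 have "\<lfloor>s / \<tau>\<rfloor> = k \<longleftrightarrow> of_int k <= s / \<tau> \<and> s / \<tau> < of_int k + 1" by (metis floor_eq_iff)
 also have "\<dots> \<longleftrightarrow> \<tau> * of_int k <= s \<and> s < \<tau> * (of_int k + 1)"
  using assms by (simp add: pos_le_divide_eq pos_divide_less_eq mult.commute)
 finally show ?thesis by simp
qed

lemma td_cell:
 assumes "0 < h" "0 < \<tau>"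
 shows "{z. td h \<tau> z = td h \<tau> (s, y)} = {\<tau> * of_int \<lfloor>s / \<tau>\<rfloor>..<\<tau> * (of_int \<lfloor>s / \<tau>\<rfloor> + 1)} \<times> cell h (rd h y)"
proof (rule set_eqI)
 fix z :: "real \<times> R3"
 have "td h \<tau> z = td h \<tau> (s, y) \<longleftrightarrow> \<lfloor>fst z / \<tau>\<rfloor> = \<lfloor>s / \<tau>\<rfloor> \<and> rd h (snd z) = rd h y"
  using assms by (simp add: td_def)
 then show "z \<in> {z. td h \<tau> z = td h \<tau> (s, y)} \<longleftrightarrow>
   z \<in> {\<tau> * of_int \<lfloor>s / \<tau>\<rfloor>..<\<tau> * (of_int \<lfloor>s / \<tau>\<rfloor> + 1)} \<times> cell h (rd h y)"
  unfolding mem_Times_iff mem_Collect_eq floor_cell[OF assms(2)] mem_cell_iff_rd[OF assms(1) rd_in_grid] .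
qed

lemma td_add:
 assumes "0 < h" "a \<in> grid h"
 shows "td h \<tau> (z + (0, a)) = td h \<tau> z + (0, a)"
 using assms by (simp add: td_def rd_add_grid)

lemma space_cell_average_setting: "0 < h ==> cell_average_setting (rd h) (h ^ 3)"
 by unfold_locales (auto simp: cell_rd emeasure_cell_R3)

lemma spacetime_cell_average_setting:
 assumes "0 < h" "0 < \<tau>"
 shows "cell_average_setting (td h \<tau>) (\<tau> * h ^ 3)"
proof
 show "td h \<tau> \<in> borel_fn"
  unfolding td_def[abs_def] borel_prod[symmetric] by measurable
 show "0 < \<tau> * h ^ 3" using assms by simp
 fix z :: "real \<times> R3"
 obtain s y where z: "z = (s, y)" by (cases z)
 show "emeasure lborel {z'. td h \<tau> z' = td h \<tau> z} = ennreal (\<tau> * h ^ 3)"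
  unfolding z td_cell[OF assms]
  by (subst lborel_prod[symmetric], subst lborel.emeasure_pair_measure_Times)
    (use assms in \<open>auto simp: emeasure_cell_R3 ennreal_mult algebra_simps\<close>)
qed

lemma cube_bound:
 fixes x :: R3
 assumes "\<forall>i. \<bar>x $ i\<bar> <= c"
 shows "norm x <= 3 * c"
 using norm_le_l1_cart[of x] sum_mono[of UNIV "%i. \<bar>x $ i\<bar>" "%_. c"] assms by simp

lemma rd_same_cell_diff:
 assumes "0 < h" "rd h z = rd h x"
 shows "z - x \<in> {y. \<forall>i. 0 $ i - h <= y $ i \<and> y $ i < 0 $ i + h}"
proof -
 have "z \<in> cell h (rd h x)" "x \<in> cell h (rd h x)" using mem_cell_iff_rd[OF assms(1) rd_in_grid] assms(2) by auto
 then have "\<bar>z $ i - x $ i\<bar> < h" for i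
  unfolding cell_def mem_Collect_eq by (smt (verit, best) field_sum_of_halves)
 then show ?thesis by (auto simp: abs_less_iff) (smt (verit, best))+
qed

lemma space_average_tendsto:
 assumes u: "integrable lborel (u :: R3 => real)" and e: "0 < e"
 shows "\<exists>d>0. \<forall>h. 0 < h \<and> h < d -->
  (NNINT x. ennreal \<bar>cell_average_setting.avg (rd h) (h ^ 3) u x - u x\<bar>) <= ennreal e"
proof -
 \<comment> \<open>Two points of one cell differ by a vector of a cube with side 2h, whose volume is
   8 times that of a cell.\<close>
 obtain d where d: "d > 0" "\<And>k. norm k < d ==> (NNINT x. ennreal \<bar>u (x + k) - u x\<bar>) <= ennreal (e / 8)"
  using translation_continuous_L1[OF u, of "e / 8"] e by auto
 have "(NNINT x. ennreal \<bar>cell_average_setting.avg (rd h) (h ^ 3) u x - u x\<bar>) <= ennreal e"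
  if h: "0 < h" "h < d / 4" for h
 proof -
  interpret cell_average_setting "rd h" "h ^ 3" using h space_cell_average_setting by simp
  let ?D = "{y::R3. \<forall>i. 0 $ i - h <= y $ i \<and> y $ i < 0 $ i + h}"
  have "(NNINT x. ennreal \<bar>avg u x - u x\<bar>) <= ennreal (8 * (e / 8))"
  proof (rule avg_L1_diff_le[OF u])
   show "?D \<in> sets borel" by measurable
   show "emeasure lborel ?D <= ennreal (8 * h ^ 3)" using cube_emeasure[of h 0] h by (simp add: power_mult_distrib)
   fix y assume "y \<in> ?D"
   then have "\<forall>i. \<bar>y $ i\<bar> <= h" by (auto simp: abs_le_iff) (metis add_diff_cancel minus_le_iff less_imp_le)+
   from cube_bound[OF this] have "norm y < d" using h by linarith
   then show "(NNINT x. ennreal \<bar>u (x + y) - u x\<bar>) <= ennreal (e / 8)" by (rule d(2))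
  qed (use e rd_same_cell_diff[OF h(1)] in auto)
  then show ?thesis by simp
 qed
 then show ?thesis using d(1) by (intro exI[of _ "d / 4"]) auto
qed

lemma spacetime_average_tendsto:
 assumes u: "integrable lborel (u :: real \<times> R3 => real)" and e: "0 < e"
 shows "\<exists>d>0. \<forall>h \<tau>. 0 < h \<and> h < d \<and> 0 < \<tau> \<and> \<tau> < d -->
  (NNINT x. ennreal \<bar>cell_average_setting.avg (td h \<tau>) (\<tau> * h ^ 3) u x - u x\<bar>) <= ennreal e"
proof -
 \<comment> \<open>As in space, with one more factor 2 because times in one cell differ by a number
   in an interval of length 2\<tau>.\<close>
 obtain d where d: "d > 0" "\<And>k. norm k < d ==> (NNINT x. ennreal \<bar>u (x + k) - u x\<bar>) <= ennreal (e / 16)"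
  using translation_continuous_L1[OF u, of "e / 16"] e by auto
 have "(NNINT x. ennreal \<bar>cell_average_setting.avg (td h \<tau>) (\<tau> * h ^ 3) u x - u x\<bar>) <= ennreal e"
  if h: "0 < h" "h < d / 8" and t: "0 < \<tau>" "\<tau> < d / 8" for h \<tau>
 proof -
  interpret cell_average_setting "td h \<tau>" "\<tau> * h ^ 3" using h t spacetime_cell_average_setting by simp
  let ?D = "{- \<tau><..<\<tau>} \<times> {y::R3. \<forall>i. 0 $ i - h <= y $ i \<and> y $ i < 0 $ i + h}"
  have "(NNINT x. ennreal \<bar>avg u x - u x\<bar>) <= ennreal (16 * (e / 16))"
  proof (rule avg_L1_diff_le[OF u])
   show D: "?D \<in> sets borel" unfolding borel_prod[symmetric] by measurable
   have "emeasure lborel ?D = ennreal (2 * \<tau>) * ennreal ((2 * h) ^ 3)"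
    by (subst lborel_prod[symmetric], subst lborel.emeasure_pair_measure_Times)
      (use h t cube_emeasure[of h 0] in auto)
   then show "emeasure lborel ?D <= ennreal (16 * (\<tau> * h ^ 3))"
    using h t by (simp add: power_mult_distrib mult_ac flip: ennreal_mult)
   fix y assume y: "y \<in> ?D"
   then have "\<forall>i. \<bar>snd y $ i\<bar> <= h" by (auto simp: abs_le_iff) (metis add_diff_cancel minus_le_iff less_imp_le)+
   then have "norm (snd y) <= 3 * h" using cube_bound[of "snd y" h] by simp
   moreover have "\<bar>fst y\<bar> < \<tau>" using y by auto
   ultimately have "norm y < d" using norm_Pair_le[of "fst y" "snd y"] h t by simp
   then show "(NNINT x. ennreal \<bar>u (x + y) - u x\<bar>) <= ennreal (e / 16)" by (rule d(2))
  next
   fix x z assume "td h \<tau> z = td h \<tau> x"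
   then have *: "rd h (snd z) = rd h (snd x)" "\<lfloor>fst z / \<tau>\<rfloor> = \<lfloor>fst x / \<tau>\<rfloor>" using t by (auto simp: td_def)
   have "\<bar>fst z - fst x\<bar> < \<tau>"
    using floor_cell[OF t(1), of "fst z" "\<lfloor>fst x / \<tau>\<rfloor>"] floor_cell[OF t(1), of "fst x" "\<lfloor>fst x / \<tau>\<rfloor>"] *(2)
    by (auto simp: algebra_simps)
   then show "z - x \<in> ?D" using rd_same_cell_diff[OF h(1) *(1)] by (auto simp: mem_Times_iff)
  qed (use e in auto)
  then show ?thesis by simp
 qed
 then show ?thesis using d(1) by (intro exI[of _ "d / 8"]) auto
qed

section \<open>The monotone step and the truncation\<close>

lemma truncate_abs_le:
 assumes "0 < h"
 shows "\<bar>truncate h \<beta> r\<bar> <= \<bar>r\<bar>" "\<bar>truncate h \<beta> r\<bar> <= h powr (- \<beta>)"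
 using assms by (auto simp: truncate_def abs_mult sgn_if)

text \<open>Where truncation acts, |r| exceeds h^(-\<beta>), so 1 <= h^\<beta> |r| and the error, at
  most |r|, is at most h^\<beta> r^2. A cut-off thus costs a power of h times the energy.\<close>

lemma truncate_error_le:
 assumes "0 < h"
 shows "\<bar>truncate h \<beta> r - r\<bar> <= h powr \<beta> * r\<^sup>2"
proof (cases "\<bar>r\<bar> <= h powr (- \<beta>)")
 case False
 then have "1 <= h powr \<beta> * \<bar>r\<bar>" using assms by (simp add: powr_minus field_simps)
 then have "\<bar>r\<bar> * 1 <= \<bar>r\<bar> * (h powr \<beta> * \<bar>r\<bar>)" by (intro mult_left_mono) auto
 moreover have "\<bar>truncate h \<beta> r - r\<bar> <= \<bar>r\<bar>" using False assms by (auto simp: truncate_def sgn_if abs_if split: if_splits)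
 ultimately show ?thesis by (simp add: power2_eq_square mult_ac flip: abs_mult)
qed (use assms in \<open>auto simp: truncate_def\<close>)

text \<open>The map r - truncate(r) has Lipschitz constant 1 and is zero on small values. If it does
  not vanish at both a and b, one of them exceeds h^(-\<beta>), and the factor h^\<beta> (|a| + |b|)
  is at least 1. Divided by 2h this controls a difference quotient of the truncation error by that
  of the velocity.\<close>

lemma truncate_error_Lipschitz:
 assumes "0 < h"
 shows "\<bar>(a - truncate h \<beta> a) - (b - truncate h \<beta> b)\<bar> <= \<bar>a - b\<bar> * (h powr \<beta> * (\<bar>a\<bar> + \<bar>b\<bar>))"
proof (cases "\<bar>a\<bar> <= h powr (- \<beta>) \<and> \<bar>b\<bar> <= h powr (- \<beta>)")
 case False
 then have "h powr (- \<beta>) <= \<bar>a\<bar> + \<bar>b\<bar>" by linarith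
 then have "1 <= h powr \<beta> * (\<bar>a\<bar> + \<bar>b\<bar>)" using assms by (simp add: powr_minus field_simps)
 then have "\<bar>a - b\<bar> * 1 <= \<bar>a - b\<bar> * (h powr \<beta> * (\<bar>a\<bar> + \<bar>b\<bar>))" by (intro mult_left_mono) auto
 moreover have "\<bar>(a - truncate h \<beta> a) - (b - truncate h \<beta> b)\<bar> <= \<bar>a - b\<bar>"
  using assms powr_gt_zero[of h "- \<beta>"] by (simp add: truncate_def sgn_if)
 ultimately show ?thesis by simp
qed (use assms in \<open>auto simp: truncate_def\<close>)

lemma truncate_measurable[measurable]: "truncate h \<beta> \<in> borel_fn"
 unfolding truncate_def[abs_def] by measurable

section \<open>Stability of one step of the scheme\<close>

lemma sum_stencil:
 "(\<Sum>\<omega>\<in>stencil. (F \<omega> :: real)) = F 0 + (\<Sum>j\<in>UNIV. F (axis j 1) + F (- axis j 1))"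
proof -
 have ax: "axis i (1::real) = axis j 1 \<longleftrightarrow> i = j" for i j :: 3 by (simp add: axis_eq_axis)
 have ne: "axis i (1::real) \<noteq> - axis j 1" "axis i (1::real) \<noteq> 0" "- axis i (1::real) \<noteq> 0" for i j :: 3
  by (auto simp: vec_eq_iff axis_def split: if_splits dest!: spec[of _ i])
 have "stencil = insert 0 (range (%j. axis j 1) \<union> range (%j. - axis j 1))" by (auto simp: stencil_def)
 then have "(\<Sum>\<omega>\<in>stencil. F \<omega>) = F 0 + (\<Sum>\<omega>\<in>range (%j. axis j 1) \<union> range (%j. - axis j 1). F \<omega>)"
 proof -
  have "0 \<notin> range (%j::3. axis j (1::real)) \<union> range (%j::3. - axis j (1::real))"
   using ne by (metis (no_types, lifting) Un_iff imageE)
  then show ?thesis by (simp add: \<open>stencil = _\<close>)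
 qed
 also have "(\<Sum>\<omega>\<in>range (%j. axis j 1) \<union> range (%j. - axis j 1). F \<omega>)
   = (\<Sum>\<omega>\<in>range (%j. axis j 1). F \<omega>) + (\<Sum>\<omega>\<in>range (%j. - axis j 1). F \<omega>)"
  using ne by (intro sum.union_disjoint) auto
 also have "(\<Sum>\<omega>\<in>range (%j. axis j 1). F \<omega>) = (\<Sum>j\<in>UNIV. F (axis j 1))"
  by (subst sum.reindex) (auto simp: inj_def ax)
 also have "(\<Sum>\<omega>\<in>range (%j. - axis j 1). F \<omega>) = (\<Sum>j\<in>UNIV. F (- axis j 1))"
  by (subst sum.reindex) (auto simp: inj_def ax)
 finally show ?thesis by (simp add: sum.distrib)
qed

text \<open>The step is written for functions of a continuous variable. Shifts by h along the axes
  commute with \<open>rd h\<close>, so the step function of a grid solution obeys the same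
  recursion, and Lebesgue integrals replace sums over the grid. It can also be applied to the
  mollified solution without sampling it.\<close>

definition scheme_step :: "real => real => (3 => R3 => real) => (R3 => real) => R3 => real" where
 "scheme_step h \<tau> a e y = 1 / 7 * (e y + (\<Sum>j\<in>UNIV. e (y + h *\<^sub>R axis j 1) + e (y - h *\<^sub>R axis j 1)))
   - \<tau> * (\<Sum>j\<in>UNIV. a j y * ((e (y + h *\<^sub>R axis j 1) - e (y - h *\<^sub>R axis j 1)) / (2 * h)))"

definition discrete_div :: "real => (3 => R3 => real) => R3 => real" where
 "discrete_div h a y = (\<Sum>j\<in>UNIV. (a j (y + h *\<^sub>R axis j 1) - a j (y - h *\<^sub>R axis j 1)) / (2 * h))"

lemma scheme_step_monotone_form:
 "scheme_step h \<tau> a e y = 1 / 7 * e y + (\<Sum>j\<in>UNIV. (1 / 7 - \<tau> * a j y / (2 * h)) * e (y + h *\<^sub>R axis j 1)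
   + (1 / 7 + \<tau> * a j y / (2 * h)) * e (y - h *\<^sub>R axis j 1))"
proof -
 have eq: "1 / 7 * (e1 + e2) - \<tau> * (c * ((e1 - e2) / (2 * h))) = (1 / 7 - \<tau> * c / (2 * h)) * e1 + (1 / 7 + \<tau> * c / (2 * h)) * e2"
  for c e1 e2 :: real
 proof -
  have "\<tau> * (c * ((e1 - e2) / (2 * h))) = \<tau> * c / (2 * h) * (e1 - e2)" by simp
  then show ?thesis by (simp only: algebra_simps)
 qed
 show ?thesis
  unfolding scheme_step_def
  by (simp only: distrib_left[of "1 / 7" "e y"] sum_distrib_left add_diff_eq[symmetric] sum_subtractf[symmetric] eq)
qed

lemma scheme_step_bound:
 assumes cfl: "\<And>j. \<bar>\<tau> * a j y / (2 * h)\<bar> <= 1 / 7" and e: "\<And>y. \<bar>e y\<bar> <= M"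
 shows "\<bar>scheme_step h \<tau> a e y\<bar> <= M"
proof -
 have "\<bar>scheme_step h \<tau> a e y\<bar> <= 1 / 7 * M + (\<Sum>j\<in>(UNIV::3 set). (1 / 7 - \<tau> * a j y / (2 * h)) * M
   + (1 / 7 + \<tau> * a j y / (2 * h)) * M)"
  unfolding scheme_step_monotone_form
 proof (intro order_trans[OF abs_triangle_ineq] add_mono order_trans[OF sum_abs] sum_mono)
  have pm: "0 <= 1 / 7 - \<tau> * a j y / (2 * h)" "0 <= 1 / 7 + \<tau> * a j y / (2 * h)" for j
   using abs_le_D1[OF cfl[of j]] abs_le_D2[OF cfl[of j]] by linarith+
  show "\<bar>(1 / 7 - \<tau> * a j y / (2 * h)) * e (y + h *\<^sub>R axis j 1)\<bar> <= (1 / 7 - \<tau> * a j y / (2 * h)) * M" for j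
   unfolding abs_mult abs_of_nonneg[OF pm(1)] by (rule mult_left_mono[OF e pm(1)])
  show "\<bar>(1 / 7 + \<tau> * a j y / (2 * h)) * e (y - h *\<^sub>R axis j 1)\<bar> <= (1 / 7 + \<tau> * a j y / (2 * h)) * M" for j
   unfolding abs_mult abs_of_nonneg[OF pm(2)] by (rule mult_left_mono[OF e pm(2)])
  show "\<bar>1 / 7 * e y\<bar> <= 1 / 7 * M" using e[of y] by simp
 qed
 also have "\<dots> = M" by (simp add: algebra_simps flip: sum_distrib_left)
 finally show ?thesis .
qed

text \<open>After each neighbour value is shifted back to y, the total weight of |e(y)| is 1 plus
  \<tau> times the discrete divergence of a at y. The pointwise bound B then turns the divergence
  into an additive error in L1 instead of a growth factor.\<close>

lemma scheme_step_L1: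
 assumes [measurable]: "e \<in> borel_fn" "\<And>j. a j \<in> borel_fn"
  and cfl: "\<And>j y. \<bar>\<tau> * a j y / (2 * h)\<bar> <= 1 / 7" and e: "\<And>y. \<bar>e y\<bar> <= B" and \<tau>: "0 < \<tau>"
 shows "(NNINT y. ennreal \<bar>scheme_step h \<tau> a e y\<bar>)
  <= (NNINT y. ennreal \<bar>e y\<bar>) + ennreal (\<tau> * B) * (NNINT y. ennreal \<bar>discrete_div h a y\<bar>)"
proof -
 let ?x = "%j. h *\<^sub>R axis j 1 :: R3"
 define p where "p j y = 1 / 7 - \<tau> * a j y / (2 * h)" for j y
 define m where "m j y = 1 / 7 + \<tau> * a j y / (2 * h)" for j y
 have [measurable]: "p j \<in> borel_fn" "m j \<in> borel_fn" for j
  unfolding p_def[abs_def] m_def[abs_def] by measurable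
 have pm: "0 <= p j y" "0 <= m j y" for j y
  using abs_le_D1[OF cfl[of j y]] abs_le_D2[OF cfl[of j y]] unfolding p_def m_def by linarith+
 have "(NNINT y. ennreal \<bar>scheme_step h \<tau> a e y\<bar>)
  <= (NNINT y. ennreal (1 / 7 * \<bar>e y\<bar>) + (\<Sum>j\<in>UNIV. ennreal (p j y * \<bar>e (y + ?x j)\<bar>) + ennreal (m j y * \<bar>e (y - ?x j)\<bar>)))"
 proof (intro nn_integral_mono)
  fix y
  have "\<bar>scheme_step h \<tau> a e y\<bar> <= 1 / 7 * \<bar>e y\<bar> + (\<Sum>j\<in>UNIV. p j y * \<bar>e (y + ?x j)\<bar> + m j y * \<bar>e (y - ?x j)\<bar>)"
   unfolding scheme_step_monotone_form p_def[symmetric] m_def[symmetric]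
   using pm[of _ y] by (intro order_trans[OF abs_triangle_ineq] add_mono order_trans[OF sum_abs] sum_mono)
    (auto simp: abs_mult)
  then have "ennreal \<bar>scheme_step h \<tau> a e y\<bar>
    <= ennreal (1 / 7 * \<bar>e y\<bar> + (\<Sum>j\<in>UNIV. p j y * \<bar>e (y + ?x j)\<bar> + m j y * \<bar>e (y - ?x j)\<bar>))"
   by (rule ennreal_leI)
  also have "\<dots> = ennreal (1 / 7 * \<bar>e y\<bar>) + (\<Sum>j\<in>UNIV. ennreal (p j y * \<bar>e (y + ?x j)\<bar>) + ennreal (m j y * \<bar>e (y - ?x j)\<bar>))"
   using pm by (simp add: ennreal_plus sum_nonneg sum_ennreal[symmetric] del: sum_ennreal)
  finally show "ennreal \<bar>scheme_step h \<tau> a e y\<bar> <= \<dots>" .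
 qed
 also have "\<dots> = (NNINT y. ennreal (1 / 7 * \<bar>e y\<bar>))
   + (\<Sum>j\<in>UNIV. (NNINT y. ennreal (p j y * \<bar>e (y + ?x j)\<bar>)) + (NNINT y. ennreal (m j y * \<bar>e (y - ?x j)\<bar>)))"
  by (simp add: nn_integral_add nn_integral_sum)
 also have "\<dots> = (NNINT y. ennreal (1 / 7 * \<bar>e y\<bar>))
   + (\<Sum>j\<in>UNIV. (NNINT y. ennreal (p j (y - ?x j) * \<bar>e y\<bar>)) + (NNINT y. ennreal (m j (y + ?x j) * \<bar>e y\<bar>)))"
 proof -
  have "(NNINT y. ennreal (p j y * \<bar>e (y + ?x j)\<bar>)) = (NNINT y. ennreal (p j (y - ?x j) * \<bar>e y\<bar>))" for j
   using nn_integral_lborel_shift[of "%y. ennreal (p j (y - ?x j) * \<bar>e y\<bar>)" "?x j"] by simp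
  moreover have "(NNINT y. ennreal (m j y * \<bar>e (y - ?x j)\<bar>)) = (NNINT y. ennreal (m j (y + ?x j) * \<bar>e y\<bar>))" for j
   using nn_integral_lborel_shift[of "%y. ennreal (m j (y + ?x j) * \<bar>e y\<bar>)" "- ?x j"] by simp
  ultimately show ?thesis by simp
 qed
 also have "\<dots> = (NNINT y. ennreal (1 / 7 * \<bar>e y\<bar>) + (\<Sum>j\<in>UNIV. ennreal (p j (y - ?x j) * \<bar>e y\<bar>) + ennreal (m j (y + ?x j) * \<bar>e y\<bar>)))"
  by (simp add: nn_integral_add nn_integral_sum)
 also have "\<dots> <= (NNINT y. ennreal \<bar>e y\<bar> + ennreal (\<tau> * B) * ennreal \<bar>discrete_div h a y\<bar>)"
 proof (intro nn_integral_mono)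
  fix y
  have B: "0 <= B" using e[of y] by linarith
  have "1 / 7 * \<bar>e y\<bar> + (\<Sum>j\<in>UNIV. p j (y - ?x j) * \<bar>e y\<bar> + m j (y + ?x j) * \<bar>e y\<bar>) = \<bar>e y\<bar> + \<tau> * \<bar>e y\<bar> * discrete_div h a y"
  proof -
   have "p j (y - ?x j) * \<bar>e y\<bar> + m j (y + ?x j) * \<bar>e y\<bar>
     = 2 / 7 * \<bar>e y\<bar> + \<tau> * \<bar>e y\<bar> * ((a j (y + ?x j) - a j (y - ?x j)) / (2 * h))" for j
    unfolding p_def m_def by (simp add: algebra_simps diff_divide_distrib)
   then show ?thesis
    by (simp add: discrete_div_def sum.distrib sum_distrib_left)
  qed
  also have "\<dots> <= \<bar>e y\<bar> + \<tau> * B * \<bar>discrete_div h a y\<bar>"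
  proof -
   have "\<tau> * \<bar>e y\<bar> * discrete_div h a y <= \<tau> * \<bar>e y\<bar> * \<bar>discrete_div h a y\<bar>"
    using \<tau> by (intro mult_left_mono) auto
   also have "\<dots> <= \<tau> * B * \<bar>discrete_div h a y\<bar>"
    using \<tau> e[of y] by (intro mult_right_mono mult_left_mono) auto
   finally show ?thesis by simp
  qed
  finally have "ennreal (1 / 7 * \<bar>e y\<bar> + (\<Sum>j\<in>UNIV. p j (y - ?x j) * \<bar>e y\<bar> + m j (y + ?x j) * \<bar>e y\<bar>))
    <= ennreal (\<bar>e y\<bar> + \<tau> * B * \<bar>discrete_div h a y\<bar>)" by (rule ennreal_leI)
  then show "ennreal (1 / 7 * \<bar>e y\<bar>) + (\<Sum>j\<in>UNIV. ennreal (p j (y - ?x j) * \<bar>e y\<bar>) + ennreal (m j (y + ?x j) * \<bar>e y\<bar>))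
    <= ennreal \<bar>e y\<bar> + ennreal (\<tau> * B) * ennreal \<bar>discrete_div h a y\<bar>"
   using pm B \<tau> by (simp add: ennreal_plus sum_nonneg sum_ennreal[symmetric] ennreal_mult del: sum_ennreal)
 qed
 also have "\<dots> = (NNINT y. ennreal \<bar>e y\<bar>) + ennreal (\<tau> * B) * (NNINT y. ennreal \<bar>discrete_div h a y\<bar>)"
  by (subst nn_integral_add) (auto simp: nn_integral_cmult discrete_div_def)
 finally show ?thesis .
qed

section \<open>The mollified solution\<close>

lemma Cc_infty_zero: "\<phi> \<in> Cc_infty \<Omega> ==> x \<notin> \<Omega> ==> \<phi> x = 0"
 using closure_subset[of "{x \<in> UNIV. \<phi> x \<noteq> 0}"] by (auto simp: Cc_infty_def supp_on_def)

lemma Cc_infty_bounded_support: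
 assumes "\<phi> \<in> Cc_infty \<Omega>"
 obtains r where "0 < r" "\<And>x. r < norm x ==> \<phi> x = 0"
proof -
 have "bounded (supp_on UNIV \<phi>)" using assms by (auto simp: Cc_infty_def compact_imp_bounded)
 then obtain r where r: "0 < r" "\<And>x. x \<in> supp_on UNIV \<phi> ==> norm x <= r" unfolding bounded_pos by blast
 have "\<phi> x = 0" if "r < norm x" for x
  using that r(2)[of x] closure_subset[of "{x \<in> UNIV. \<phi> x \<noteq> 0}"] by (force simp: supp_on_def)
 with r(1) that show thesis by blast
qed

lemma Cc_infty_mult:
 assumes \<phi>: "\<phi> \<in> Cc_infty \<Omega>" and \<psi>: "\<psi> \<in> Cc_infty UNIV"
 shows "(%x. \<phi> x * \<psi> x) \<in> Cc_infty \<Omega>"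
  and "pderiv_at j (%x. \<phi> x * \<psi> x) x = \<phi> x * pderiv_at j \<psi> x + pderiv_at j \<phi> x * \<psi> x"
proof -
 have sub: "supp_on UNIV (%x. \<phi> x * \<psi> x) \<subseteq> supp_on UNIV \<phi>"
  unfolding supp_on_def by (intro closure_mono) auto
 moreover have "compact (supp_on UNIV \<phi> \<inter> supp_on UNIV (%x. \<phi> x * \<psi> x))"
  using \<phi> by (intro compact_Int_closed) (auto simp: Cc_infty_def supp_on_def)
 ultimately show "(%x. \<phi> x * \<psi> x) \<in> Cc_infty \<Omega>"
  using \<phi> \<psi> by (auto simp: Cc_infty_def smooth_on_def Int_absorb1 intro!: Ck_on_mult)
 have "((%x. \<phi> x * \<psi> x) has_derivative (%h. \<phi> x * (\<Sum>j\<in>UNIV. h $ j * pderiv_at j \<psi> x)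
   + (\<Sum>j\<in>UNIV. h $ j * pderiv_at j \<phi> x) * \<psi> x)) (at x)"
  by (intro has_derivative_mult Cc_infty_has_derivative(1)[OF \<phi>] Cc_infty_has_derivative(1)[OF \<psi>])
 from frechet_derivative_at[OF this, symmetric]
 show "pderiv_at j (%x. \<phi> x * \<psi> x) x = \<phi> x * pderiv_at j \<psi> x + pderiv_at j \<phi> x * \<psi> x"
  by (simp add: pderiv_at_def[of j "%x. \<phi> x * \<psi> x"] axis_def if_distrib[of "%a. a * _"] cong: if_cong)
qed

text \<open>The central difference quotients have integral 0 by translation invariance, and for h <=
  1 they converge to the derivative at rate h uniformly, on a common ball S.\<close>

lemma Cc_infty_integral_pderiv:
 assumes \<phi>: "\<phi> \<in> Cc_infty \<Omega>"
 shows "(RINT x. pderiv_at j \<phi> x) = 0"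
proof -
 obtain C where C: "0 <= C" "\<And>x h. 0 < h ==>
  \<bar>(\<phi> (x + h *\<^sub>R axis j 1) - \<phi> (x - h *\<^sub>R axis j 1)) / (2 * h) - pderiv_at j \<phi> x\<bar> <= C * h"
  using Cc_infty_difference_quotients[OF \<phi>] by metis
 obtain r where r: "0 < r" "\<And>x. r < norm x ==> \<phi> x = 0" using Cc_infty_bounded_support[OF \<phi>] by metis
 obtain r' where r': "0 < r'" "\<And>x. r' < norm x ==> pderiv_at j \<phi> x = 0"
  using Cc_infty_bounded_support[OF Cc_infty_has_derivative(3)[OF \<phi>]] by metis
 note int = Cc_infty_integrable[OF \<phi>] Cc_infty_integrable[OF Cc_infty_has_derivative(3)[OF \<phi>]]
 define S where "S = cball (0::R3) (r + r' + 1)"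
 have S: "emeasure lborel S < \<infinity>" "S \<in> sets borel"
  unfolding S_def using emeasure_lborel_cball_finite by auto
 have shift: "integrable lborel (%x. \<phi> (x + a))" "(RINT x. \<phi> (x + a)) = (RINT x. \<phi> x)" for a
  using integrable_distr_eq[of "(+) a" lborel borel \<phi>] integral_distr[of "(+) a" lborel borel \<phi>] int
  by (auto simp: lborel_distr_plus add.commute)
 have "\<bar>RINT x. pderiv_at j \<phi> x\<bar> <= C * h * measure lborel S" if h: "0 < h" "h <= 1" for h
 proof -
  let ?q = "%x. (\<phi> (x + h *\<^sub>R axis j 1) - \<phi> (x - h *\<^sub>R axis j 1)) / (2 * h)"
  have q: "integrable lborel ?q" "(RINT x. ?q x) = 0"
   using shift[of "h *\<^sub>R axis j 1"] shift[of "- (h *\<^sub>R axis j 1)"] by auto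
  have "\<bar>RINT x. pderiv_at j \<phi> x\<bar> = \<bar>RINT x. pderiv_at j \<phi> x - ?q x\<bar>"
   by (simp only: Bochner_Integration.integral_diff[OF int(3) q(1)] q(2) diff_0_right)
  also have "\<dots> <= (RINT x. \<bar>pderiv_at j \<phi> x - ?q x\<bar>)" by (rule integral_abs_bound)
  also have "\<dots> <= (RINT x. (C * h) * indicator S x)"
  proof (rule integral_mono)
   show "integrable lborel (%x. \<bar>pderiv_at j \<phi> x - ?q x\<bar>)" using q int by simp
   show "integrable lborel (%x. (C * h) * indicator S x)" using S by simp
   fix x
   show "\<bar>pderiv_at j \<phi> x - ?q x\<bar> <= (C * h) * indicator S x"
   proof (cases "x \<in> S")
    case True
    then show ?thesis using C(2)[OF h(1), of x] by (simp add: abs_minus_commute)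
   next
    case False
    then have "r + r' + 1 < norm x" by (simp add: S_def)
    moreover have "norm x - h <= norm (x + h *\<^sub>R axis j 1)" "norm x - h <= norm (x - h *\<^sub>R axis j 1)"
     using norm_diff_ineq[of x "h *\<^sub>R axis j 1"] norm_triangle_ineq2[of x "h *\<^sub>R axis j 1"] h by auto
    ultimately have "\<phi> (x + h *\<^sub>R axis j 1) = 0" "\<phi> (x - h *\<^sub>R axis j 1) = 0" "pderiv_at j \<phi> x = 0"
     using r r' h by (auto intro!: r(2) r'(2))
    then show ?thesis using False by simp
   qed
  qed
  also have "\<dots> = C * h * measure lborel S" using S by simp
  finally show ?thesis .
 qed
 then have "\<forall>\<^sub>F h in at_right 0. \<bar>RINT x. pderiv_at j \<phi> x\<bar> <= C * h * measure lborel S"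
  by (auto simp: eventually_at_right_field intro!: exI[of _ 1])
 moreover have "((%h. C * h * measure lborel S) \<longlongrightarrow> C * 0 * measure lborel S) (at_right 0)"
  by (intro tendsto_intros)
 ultimately have "\<bar>RINT x. pderiv_at j \<phi> x\<bar> <= C * 0 * measure lborel S"
  by (intro tendsto_lowerbound[of _ _ "at_right 0"]) auto
 then show ?thesis by simp
qed

section \<open>Mollification\<close>

lemma nn_integral_lborel_time_space:
 fixes u :: "real \<times> R3 => ennreal"
 assumes "u \<in> borel_fn"
 shows "(NNINT z. u z) = (NNINT t. NNINT y. u (t, y))"
 using lborel.nn_integral_fst[of u lborel] assms by (simp add: lborel_prod)

definition mollifier :: "real => real => (R3 => real) => bool" where
 "mollifier C \<epsilon> \<rho> \<longleftrightarrow> \<rho> \<in> Cc_infty (cball 0 \<epsilon>) \<and> (\<forall>x. 0 <= \<rho> x) \<and> integral\<^sup>L lborel \<rho> = 1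
   \<and> (\<forall>j x. \<bar>pderiv_at j \<rho> x\<bar> <= C / \<epsilon> ^ 4)"

lemma mollifiers:
 obtains C where "0 < C" "\<And>\<epsilon>. 0 < \<epsilon> ==> \<exists>\<rho>. mollifier C \<epsilon> \<rho>"
proof -
 obtain C where C: "0 < C" "\<forall>\<epsilon>>0. \<exists>\<rho>\<in>Cc_infty UNIV. (\<forall>x. 0 <= \<rho> x) \<and> (\<forall>x. \<epsilon> < norm x --> \<rho> x = 0)
  \<and> integral\<^sup>L lborel \<rho> = 1 \<and> (\<forall>j x. \<bar>pderiv_at j \<rho> x\<bar> <= C / \<epsilon> ^ 4)"
  using mollifier_exists by metis
 have "\<rho> \<in> Cc_infty (cball 0 \<epsilon>)" if "\<rho> \<in> Cc_infty UNIV" "\<forall>x. \<epsilon> < norm x --> \<rho> x = 0" for \<rho> and \<epsilon> :: real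
 proof -
  have "supp_on UNIV \<rho> \<subseteq> cball 0 \<epsilon>"
   unfolding supp_on_def using that(2) by (intro closure_minimal) (auto simp: not_less[symmetric])
  with that(1) show ?thesis by (simp add: Cc_infty_def)
 qed
 note support = this
 show thesis
 proof (rule that[OF C(1)])
  fix \<epsilon> :: real assume "0 < \<epsilon>"
  with C(2) obtain \<rho> where \<rho>: "\<rho> \<in> Cc_infty UNIV" "\<forall>x. 0 <= \<rho> x" "\<forall>x. \<epsilon> < norm x --> \<rho> x = 0"
   "integral\<^sup>L lborel \<rho> = 1" "\<forall>j x. \<bar>pderiv_at j \<rho> x\<bar> <= C / \<epsilon> ^ 4"
   by metis
  then have "mollifier C \<epsilon> \<rho>" using support[OF \<rho>(1,3)] by (simp add: mollifier_def)
  then show "\<exists>\<rho>. mollifier C \<epsilon> \<rho>" by blast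
 qed
qed

lemma mollifierD:
 assumes "mollifier C \<epsilon> \<rho>"
 shows "\<rho> \<in> Cc_infty UNIV" "\<And>x. 0 <= \<rho> x" "integrable lborel \<rho>" "integral\<^sup>L lborel \<rho> = 1"
  "\<rho> \<in> borel_fn" "pderiv_at j \<rho> \<in> borel_fn" "integrable lborel (pderiv_at j \<rho>)"
  "\<And>j x. \<bar>pderiv_at j \<rho> x\<bar> <= C / \<epsilon> ^ 4" "\<And>x. \<epsilon> < norm x ==> \<rho> x = 0"
  "\<And>j x. \<epsilon> < norm x ==> pderiv_at j \<rho> x = 0"
proof -
 have \<rho>: "\<rho> \<in> Cc_infty (cball 0 \<epsilon>)" using assms by (simp add: mollifier_def)
 show "\<rho> \<in> Cc_infty UNIV" using \<rho> by (rule Cc_infty_UNIV)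
 show "\<And>x. 0 <= \<rho> x" "integral\<^sup>L lborel \<rho> = 1" "\<And>j x. \<bar>pderiv_at j \<rho> x\<bar> <= C / \<epsilon> ^ 4"
  using assms by (auto simp: mollifier_def)
 show "integrable lborel \<rho>" "\<rho> \<in> borel_fn" using Cc_infty_integrable[OF \<rho>] .
 show "integrable lborel (pderiv_at j \<rho>)" "pderiv_at j \<rho> \<in> borel_fn"
  using Cc_infty_integrable[OF Cc_infty_has_derivative(3)[OF \<rho>]] .
 show "\<rho> x = 0" if "\<epsilon> < norm x" for x using that by (intro Cc_infty_zero[OF \<rho>]) simp
 show "pderiv_at j \<rho> x = 0" if "\<epsilon> < norm x" for j x
  using that by (intro Cc_infty_zero[OF Cc_infty_has_derivative(3)[OF \<rho>]]) simp
qed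

lemma integral_shift_R3:
 fixes p :: "R3 => real"
 assumes "integrable lborel p"
 shows "integrable lborel (%y. p (y - x))" "(RINT y. p (y - x)) = integral\<^sup>L lborel p"
proof -
 have [measurable]: "p \<in> borel_fn" using assms by simp
 show "integrable lborel (%y. p (y - x))" "(RINT y. p (y - x)) = integral\<^sup>L lborel p"
  using integrable_distr_eq[of "(+) (- x)" lborel borel p] integral_distr[of "(+) (- x)" lborel borel p] assms
  by (auto simp: lborel_distr_plus add.commute)
qed

lemma integrable_mult_bounded:
 fixes u p :: "'b => real"
 assumes "integrable M u" "p \<in> borel_measurable M" "\<And>x. \<bar>p x\<bar> <= c"
 shows "integrable M (%x. u x * p x)" "integrable M (%x. p x * u x)"
proof -
 have "integrable M (%x. c * u x)" using assms(1) by simp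
 then show 1: "integrable M (%x. u x * p x)"
 proof (rule Bochner_Integration.integrable_bound)
  have "\<bar>u x\<bar> * \<bar>p x\<bar> <= \<bar>c\<bar> * \<bar>u x\<bar>" for x
   using assms(3)[of x] by (subst mult.commute, intro mult_right_mono) auto
  then show "AE x in M. norm (u x * p x) <= norm (c * u x)" by (simp add: abs_mult)
 qed (use assms in auto)
 then show "integrable M (%x. p x * u x)" by (simp add: mult.commute)
qed

text \<open>The kernel is \<open>\<rho> (y - x)\<close> rather than its reflection: as a function of
  y it is a translated test function, so the weak equation applies to the mollification directly.
  The price is a minus sign whenever x is differentiated.\<close>

lemma mollify_L1_le:
 assumes \<rho>: "mollifier C \<epsilon> \<rho>" and u: "integrable lborel u" and e: "0 <= e"
  and W: "\<And>k. norm k <= \<epsilon> ==> (NNINT x. ennreal \<bar>u (x + k) - u x\<bar>) <= ennreal e"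
 shows "(NNINT x. ennreal \<bar>(RINT y. u y * \<rho> (y - x)) - u x\<bar>) <= ennreal e"
proof -
 note [measurable] = mollifierD(5)[OF \<rho>]
 have [measurable]: "u \<in> borel_fn" using u by simp
 obtain B where B: "\<And>x. \<bar>\<rho> x\<bar> <= B" using Cc_infty_bounded[OF mollifierD(1)[OF \<rho>]] by auto
 have "(NNINT x. ennreal \<bar>(RINT y. u y * \<rho> (y - x)) - u x\<bar>)
  <= (NNINT x. NNINT y. ennreal (\<rho> y) * ennreal \<bar>u (x + y) - u x\<bar>)"
 proof (intro nn_integral_mono)
  fix x
  have "ennreal \<bar>(RINT y. \<rho> (y - x) * u y) - u x\<bar> <= (NNINT y. ennreal (\<rho> y) * ennreal \<bar>u (x + y) - u x\<bar>)"
   by (rule kernel_average_diff_le)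
    (use mollifierD[OF \<rho>] integral_shift_R3[OF mollifierD(3)[OF \<rho>]] integrable_mult_bounded(2)[OF u _ B] in auto)
  then show "ennreal \<bar>(RINT y. u y * \<rho> (y - x)) - u x\<bar> <= (NNINT y. ennreal (\<rho> y) * ennreal \<bar>u (x + y) - u x\<bar>)"
   by (simp add: mult.commute)
 qed
 also have "\<dots> = (NNINT y. ennreal (\<rho> y) * (NNINT x. ennreal \<bar>u (x + y) - u x\<bar>))"
  by (subst lborel_pair.Fubini') (auto simp: nn_integral_cmult)
 also have "\<dots> <= ennreal (1 * e)"
 proof (rule nn_integral_kernel_le)
  show "(NNINT y. ennreal (\<rho> y)) <= ennreal 1"
   using mollifierD[OF \<rho>] by (subst nn_integral_eq_integral) auto
  show "(NNINT x. ennreal \<bar>u (x + y) - u x\<bar>) <= ennreal e" if "\<rho> y \<noteq> 0" for y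
   using that mollifierD(9)[OF \<rho>, of y] by (intro W) force
 qed (use e in auto)
 finally show ?thesis by simp
qed

lemma mollify_spacetime_L1_le:
 fixes u :: "real \<times> R3 => real"
 assumes \<rho>: "mollifier C \<epsilon> \<rho>" and u[measurable]: "u \<in> borel_fn" and e: "0 <= e"
  and int: "\<And>t. integrable lborel (%y. u (t, y))"
  and W: "\<And>k. norm k <= \<epsilon> ==> (NNINT z. ennreal \<bar>u (z + (0, k)) - u z\<bar>) <= ennreal e"
 shows "(NNINT z. ennreal \<bar>(RINT y. u (fst z, y) * \<rho> (y - snd z)) - u z\<bar>) <= ennreal e"
proof -
 note [measurable] = mollifierD(5)[OF \<rho>]
 have u'[measurable]: "u \<in> borel_measurable (borel \<Otimes>\<^sub>M borel)" using u by (simp add: borel_prod)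
 obtain B where B: "\<And>x. \<bar>\<rho> x\<bar> <= B" using Cc_infty_bounded[OF mollifierD(1)[OF \<rho>]] by auto
 have "(NNINT z. ennreal \<bar>(RINT y. u (fst z, y) * \<rho> (y - snd z)) - u z\<bar>)
  <= (NNINT z. NNINT y. ennreal (\<rho> y) * ennreal \<bar>u (z + (0, y)) - u z\<bar>)"
 proof (intro nn_integral_mono)
  fix z :: "real \<times> R3"
  obtain t x where z: "z = (t, x)" by (cases z)
  have "ennreal \<bar>(RINT y. \<rho> (y - x) * u (t, y)) - u (t, x)\<bar>
    <= (NNINT y. ennreal (\<rho> y) * ennreal \<bar>u (t, x + y) - u (t, x)\<bar>)"
   by (rule kernel_average_diff_le)
    (use mollifierD[OF \<rho>] integral_shift_R3[OF mollifierD(3)[OF \<rho>]] integrable_mult_bounded(2)[OF int _ B] in auto)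
  then show "ennreal \<bar>(RINT y. u (fst z, y) * \<rho> (y - snd z)) - u z\<bar>
    <= (NNINT y. ennreal (\<rho> y) * ennreal \<bar>u (z + (0, y)) - u z\<bar>)"
   by (simp add: mult.commute z)
 qed
 also have "\<dots> = (NNINT y. ennreal (\<rho> y) * (NNINT z. ennreal \<bar>u (z + (0, y)) - u z\<bar>))"
  by (subst lborel_pair.Fubini') (auto simp: nn_integral_cmult)
 also have "\<dots> <= ennreal (1 * e)"
 proof (rule nn_integral_kernel_le)
  show "(NNINT y. ennreal (\<rho> y)) <= ennreal 1"
   using mollifierD[OF \<rho>] by (subst nn_integral_eq_integral) auto
  show "(NNINT z. ennreal \<bar>u (z + (0, y)) - u z\<bar>) <= ennreal e" if "\<rho> y \<noteq> 0" for y
   using that mollifierD(9)[OF \<rho>, of y] by (intro W) force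
 qed (use e in auto)
 finally show ?thesis by simp
qed

text \<open>The right side of the equation integrated in time: initial pairing plus the flux up to
  t. The gradient of the test function is a separate argument \<open>P\<close>, so that the
  expression is plainly linear in the pair (p, P) and differences of translated test functions can
  be inserted.\<close>

definition weak_rhs ::
 "(real \<times> R3 => real) => (3 => real \<times> R3 => real) => (R3 => real) => real => (R3 => real) => (3 => R3 => real) => real"
where
 "weak_rhs f w f0 t p P = (RINT y. f0 y * p y)
   + (RINT z. indicator {0..t} (fst z) * (f z * (\<Sum>j\<in>UNIV. w j z * P j (snd z))))"

text \<open>The analytic data after all null sets are removed: Borel functions vanishing outside a
  ball and outside [0,T], with velocity bounds at every single time. \<open>V\<close> carries the
  bound uniform in time, \<open>\<Gamma>\<close> the gradient energy, and \<open>w_quotient\<close>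
  says that the central difference quotients of the divergence tend to 0. In \<open>weak\<close> the
  exceptional times may still depend on the test function.\<close>

locale transport =
 fixes T M R V \<Gamma> :: real
  and f :: "real \<times> R3 => real" and w :: "3 => real \<times> R3 => real" and f0 :: "R3 => real"
 assumes f_meas[measurable]: "f \<in> borel_fn"
  and w_meas[measurable]: "\<And>j. w j \<in> borel_fn"
  and f0_meas[measurable]: "f0 \<in> borel_fn"
  and params: "0 < T" "0 <= M" "0 <= R" "0 <= V" "0 <= \<Gamma>"
  and f_bound: "\<And>z. \<bar>f z\<bar> <= M" and f0_bound: "\<And>x. \<bar>f0 x\<bar> <= M"
  and f_supp: "\<And>z. f z \<noteq> 0 ==> norm (snd z) <= R \<and> fst z \<in> {0..T}"
  and f0_supp: "\<And>x. f0 x \<noteq> 0 ==> norm x <= R"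
  and w_supp: "\<And>j z. w j z \<noteq> 0 ==> norm (snd z) <= R \<and> fst z \<in> {0..T}"
  and w_L1: "\<And>j t. (NNINT y. ennreal \<bar>w j (t, y)\<bar>) <= ennreal V"
  and w_L2: "\<And>j t. (NNINT y. ennreal ((w j (t, y))\<^sup>2)) <= ennreal V"
  and w_div: "\<And>\<psi> t. \<psi> \<in> Cc_infty UNIV ==> (RINT y. (\<Sum>j\<in>UNIV. w j (t, y) * pderiv_at j \<psi> y)) = 0"
  and w_grad: "\<And>j k. (NNINT z. ennreal ((w j (z + (0, k)) - w j z)\<^sup>2)) <= ennreal ((norm k)\<^sup>2 * \<Gamma>)"
  and w_quotient: "\<And>e. 0 < e ==> \<exists>d>0. \<forall>h. 0 < h \<and> h < d -->
   (NNINT z. ennreal \<bar>\<Sum>j\<in>UNIV. (w j (z + (0, h *\<^sub>R axis j 1)) - w j (z - (0, h *\<^sub>R axis j 1))) / (2 * h)\<bar>) <= ennreal e"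
  and weak: "\<And>\<psi>. \<psi> \<in> Cc_infty UNIV ==> AE t in lborel. t \<in> {0..T} -->
   (RINT y. f (t, y) * \<psi> y) = weak_rhs f w f0 t \<psi> (%j. pderiv_at j \<psi>)"
begin

section \<open>The time-integrated equation and its bounds\<close>

lemma pair_measurable[measurable]:
 "f \<in> borel_measurable (borel \<Otimes>\<^sub>M borel)" "w j \<in> borel_measurable (borel \<Otimes>\<^sub>M borel)"
 using f_meas w_meas by (simp_all add: borel_prod)

lemma nn_integral_time_le:
 fixes u :: "real \<times> R3 => ennreal"
 assumes [measurable]: "u \<in> borel_fn"
  and "\<And>z. u z \<noteq> 0 ==> fst z \<in> {a..b}" "\<And>t. (NNINT y. u (t, y)) <= ennreal c" "a <= b" "0 <= c"
 shows "(NNINT z. u z) <= ennreal ((b - a) * c)"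
proof -
 have "(NNINT z. u z) = (NNINT t. NNINT y. u (t, y))"
  by (rule nn_integral_lborel_time_space) measurable
 also have "\<dots> <= (NNINT t. ennreal c * indicator {a..b} t)"
 proof (rule nn_integral_mono)
  fix t
  have "(NNINT y. u (t, y)) = 0" if "t \<notin> {a..b}"
  proof -
   have "u (t, y) = 0" for y using assms(2)[of "(t, y)"] that by auto
   then show ?thesis by simp
  qed
  then show "(NNINT y. u (t, y)) <= ennreal c * indicator {a..b} t"
   using assms(3)[of t] by (cases "t \<in> {a..b}") auto
 qed
 also have "\<dots> = ennreal ((b - a) * c)"
  using assms(4,5) by (simp add: nn_integral_cmult_indicator mult.commute flip: ennreal_mult)
 finally show ?thesis .
qed

lemma w_nn_integral: "(NNINT z. ennreal \<bar>w j z\<bar>) <= ennreal (T * V)"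
 using nn_integral_time_le[of "%z. ennreal \<bar>w j z\<bar>" 0 T V] w_L1[of j] w_supp[of j] params by auto

lemma w_nn_integral_square: "(NNINT z. ennreal ((w j z)\<^sup>2)) <= ennreal (T * V)"
 using nn_integral_time_le[of "%z. ennreal ((w j z)\<^sup>2)" 0 T V] w_L2[of j] w_supp[of j] params by auto

lemma integrable_of_nn_integral_le:
 "u \<in> borel_measurable N ==> (\<integral>\<^sup>+z. ennreal \<bar>u z\<bar> \<partial>N) <= ennreal c ==> integrable N u"
 by (rule integrableI_bounded) (auto simp: le_less_trans[OF _ ennreal_less_top])

lemma w_integrable: "integrable lborel (w j)" "integrable lborel (%z. (w j z)\<^sup>2)" "integrable lborel (%y. w j (t, y))"
 using w_nn_integral[of j] w_nn_integral_square[of j] w_L1[of j t]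
 by (auto intro!: integrable_of_nn_integral_le)

lemma ball_finite: "emeasure lborel (cball (0::R3) r) < \<infinity>"
 by (rule emeasure_lborel_cball_finite)

lemma integrable_bounded_supp:
 fixes u :: "R3 => real"
 assumes "u \<in> borel_fn" "\<And>x. \<bar>u x\<bar> <= M" "\<And>x. u x \<noteq> 0 ==> norm x <= R"
 shows "integrable lborel u"
proof (rule Bochner_Integration.integrable_bound)
 show "integrable lborel (%x::R3. M * indicator (cball 0 R) x)" using ball_finite by simp
 show "AE x in lborel. norm (u x) <= norm (M * indicator (cball 0 R) x)"
 proof (rule AE_I2)
  show "norm (u x) <= norm (M * indicator (cball 0 R) x)" for x
   using assms(2,3)[of x] params(2) by (cases "u x = 0") auto
 qed
qed (use assms in simp)

lemma f0_integrable: "integrable lborel f0"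
 using f0_bound f0_supp by (intro integrable_bounded_supp) auto

lemma f_slice_integrable: "integrable lborel (%y. f (t, y))"
 using f_bound f_supp[of "(t, _)"] by (intro integrable_bounded_supp) auto

lemma f_slice_nn_integral: "(NNINT y. ennreal \<bar>f (t, y)\<bar>) <= ennreal (M * measure lborel (cball (0::R3) R))"
proof -
 have "(NNINT y. ennreal \<bar>f (t, y)\<bar>) <= (NNINT y. ennreal M * indicator (cball (0::R3) R) y)"
 proof (rule nn_integral_mono)
  show "ennreal \<bar>f (t, y)\<bar> <= ennreal M * indicator (cball 0 R) y" for y
   using f_bound[of "(t, y)"] f_supp[of "(t, y)"] by (cases "f (t, y) = 0") (auto intro: ennreal_leI)
 qed
 also have "\<dots> = ennreal (M * measure lborel (cball (0::R3) R))"
  using ball_finite[of R] params by (simp add: nn_integral_cmult_indicator ennreal_mult emeasure_eq_ennreal_measure)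
 finally show ?thesis .
qed

lemma f_integrable: "integrable lborel f"
 using nn_integral_time_le[of "%z. ennreal \<bar>f z\<bar>" 0 T "M * measure lborel (cball (0::R3) R)"]
  f_slice_nn_integral f_supp params
 by (intro integrable_of_nn_integral_le[where c="T * (M * measure lborel (cball (0::R3) R))"]) auto

abbreviation "LL \<equiv> weak_rhs f w f0"

text \<open>One constant for two purposes: the first two summands bound the functional, and the last
  one bounds its growth in time.\<close>

definition K :: real where "K = (RINT y. \<bar>f0 y\<bar>) + M * (\<Sum>j\<in>UNIV. RINT z. \<bar>w j z\<bar>) + 3 * M * V"

lemma K_nonneg: "0 <= K"
 unfolding K_def using params by (intro add_nonneg_nonneg mult_nonneg_nonneg sum_nonneg Bochner_Integration.integral_nonneg) auto

lemma LL_integrable: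
 assumes [measurable]: "p \<in> borel_fn" "\<And>j. P j \<in> borel_fn"
  and b: "\<And>y. \<bar>p y\<bar> <= c" "\<And>j y. \<bar>P j y\<bar> <= c"
 shows "integrable lborel (%y. f0 y * p y)"
  and "integrable lborel (%z. indicator {0..t} (fst z) * (f z * (\<Sum>j\<in>UNIV. w j z * P j (snd z))))"
proof -
 show "integrable lborel (%y. f0 y * p y)"
  by (rule integrable_mult_bounded(1)[OF f0_integrable _ b(1)]) simp
 have ind[measurable]: "(%z. P j (snd z)) \<in> borel_measurable (borel :: (real \<times> R3) measure)"
  "(%z. indicator {0..t} (fst z) :: real) \<in> borel_measurable (borel :: (real \<times> R3) measure)" for j
  unfolding borel_prod[symmetric] by measurable
 have "integrable lborel (%z. (\<Sum>j\<in>UNIV. w j z * P j (snd z)))"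
  using b(2) by (intro Bochner_Integration.integrable_sum integrable_mult_bounded(1)[OF w_integrable(1)]) auto
 then have "integrable lborel (%z. f z * (\<Sum>j\<in>UNIV. w j z * P j (snd z)))"
  using f_bound by (intro integrable_mult_bounded(2)[where c=M]) auto
 then show "integrable lborel (%z. indicator {0..t} (fst z) * (f z * (\<Sum>j\<in>UNIV. w j z * P j (snd z))))"
  by (rule integrable_mult_bounded(2)[where c=1]) (use ind in \<open>simp_all add: indicator_def\<close>)
qed

lemma LL_linear:
 assumes [measurable]: "p1 \<in> borel_fn" "\<And>j. P1 j \<in> borel_fn"
   "p2 \<in> borel_fn" "\<And>j. P2 j \<in> borel_fn"
  and b: "\<And>y. \<bar>p1 y\<bar> <= c1" "\<And>j y. \<bar>P1 j y\<bar> <= c1" "\<And>y. \<bar>p2 y\<bar> <= c2" "\<And>j y. \<bar>P2 j y\<bar> <= c2"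
 shows "LL t (%y. a * p1 y + b * p2 y) (%j y. a * P1 j y + b * P2 j y) = a * LL t p1 P1 + b * LL t p2 P2"
proof -
 have 1: "(RINT y. f0 y * (a * p1 y + b * p2 y)) = (RINT y. a * (f0 y * p1 y) + b * (f0 y * p2 y))"
  by (intro Bochner_Integration.integral_cong) (auto simp: algebra_simps)
 have 2: "(RINT z. indicator {0..t} (fst z) * (f z * (\<Sum>j\<in>UNIV. w j z * (a * P1 j (snd z) + b * P2 j (snd z)))))
  = (RINT z. a * (indicator {0..t} (fst z) * (f z * (\<Sum>j\<in>UNIV. w j z * P1 j (snd z))))
     + b * (indicator {0..t} (fst z) * (f z * (\<Sum>j\<in>UNIV. w j z * P2 j (snd z)))))"
  by (intro Bochner_Integration.integral_cong) (auto simp: algebra_simps sum.distrib sum_distrib_left)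
 note i1 = LL_integrable[of p1 P1 c1, OF assms(1,2) b(1,2)] and i2 = LL_integrable[of p2 P2 c2, OF assms(3,4) b(3,4)]
 have "(RINT y. a * (f0 y * p1 y) + b * (f0 y * p2 y)) = a * (RINT y. f0 y * p1 y) + b * (RINT y. f0 y * p2 y)"
  by (subst Bochner_Integration.integral_add[OF integrable_mult_right[OF i1(1)] integrable_mult_right[OF i2(1)]])
    (simp only: integral_mult_right_zero)
 moreover have "(RINT z. a * (indicator {0..t} (fst z) * (f z * (\<Sum>j\<in>UNIV. w j z * P1 j (snd z))))
     + b * (indicator {0..t} (fst z) * (f z * (\<Sum>j\<in>UNIV. w j z * P2 j (snd z)))))
   = a * (RINT z. indicator {0..t} (fst z) * (f z * (\<Sum>j\<in>UNIV. w j z * P1 j (snd z))))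
     + b * (RINT z. indicator {0..t} (fst z) * (f z * (\<Sum>j\<in>UNIV. w j z * P2 j (snd z))))"
  by (subst Bochner_Integration.integral_add[OF integrable_mult_right[OF i1(2)] integrable_mult_right[OF i2(2)]])
    (simp only: integral_mult_right_zero)
 ultimately show ?thesis unfolding weak_rhs_def 1 2 by (simp add: algebra_simps)
qed

lemma LL_bound:
 assumes [measurable]: "p \<in> borel_fn" "\<And>j. P j \<in> borel_fn"
  and b: "\<And>y. \<bar>p y\<bar> <= c" "\<And>j y. \<bar>P j y\<bar> <= c"
 shows "\<bar>LL t p P\<bar> <= K * c"
proof -
 have c: "0 <= c" using b(1)[of undefined] by linarith
 have "\<bar>RINT y. f0 y * p y\<bar> <= (RINT y. \<bar>f0 y\<bar> * c)"
 proof (intro order_trans[OF integral_abs_bound] integral_mono)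
  show "integrable lborel (%y. \<bar>f0 y * p y\<bar>)" by (intro integrable_abs LL_integrable(1)[OF assms])
  show "integrable lborel (%y. \<bar>f0 y\<bar> * c)" using f0_integrable by simp
  show "\<bar>f0 y * p y\<bar> <= \<bar>f0 y\<bar> * c" for y using b(1)[of y] by (simp add: abs_mult mult_left_mono)
 qed
 moreover have "\<bar>RINT z. indicator {0..t} (fst z) * (f z * (\<Sum>j\<in>UNIV. w j z * P j (snd z)))\<bar>
   <= (RINT z. M * (\<Sum>j\<in>UNIV. \<bar>w j z\<bar> * c))"
 proof (intro order_trans[OF integral_abs_bound] integral_mono)
  show "integrable lborel (%z. \<bar>indicator {0..t} (fst z) * (f z * (\<Sum>j\<in>UNIV. w j z * P j (snd z)))\<bar>)"
   using LL_integrable(2)[OF assms] by simp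
  show "integrable lborel (%z. M * (\<Sum>j\<in>UNIV. \<bar>w j z\<bar> * c))" using w_integrable(1) by auto
  fix z
  have "\<bar>indicator {0..t} (fst z) * (f z * (\<Sum>j\<in>UNIV. w j z * P j (snd z)))\<bar> <= \<bar>f z\<bar> * \<bar>\<Sum>j\<in>UNIV. w j z * P j (snd z)\<bar>"
   by (auto simp: indicator_def abs_mult)
  also have "\<dots> <= M * (\<Sum>j\<in>UNIV. \<bar>w j z\<bar> * c)"
   using params f_bound b(2)
   by (intro mult_mono order_trans[OF sum_abs] sum_mono) (auto simp: abs_mult intro!: mult_left_mono)
  finally show "\<bar>indicator {0..t} (fst z) * (f z * (\<Sum>j\<in>UNIV. w j z * P j (snd z)))\<bar> <= M * (\<Sum>j\<in>UNIV. \<bar>w j z\<bar> * c)" .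
 qed
 moreover have "(RINT z. M * (\<Sum>j\<in>UNIV. \<bar>w j z\<bar> * c)) = M * (\<Sum>j\<in>UNIV. RINT z. \<bar>w j z\<bar>) * c"
 proof -
  have "(RINT z. (\<Sum>j\<in>UNIV. \<bar>w j z\<bar> * c)) = (\<Sum>j\<in>UNIV. (RINT z. \<bar>w j z\<bar> * c))"
   by (rule Bochner_Integration.integral_sum) (simp add: w_integrable(1))
  then show ?thesis by (simp add: sum_distrib_right)
 qed
 moreover have "(RINT y. \<bar>f0 y\<bar> * c) = (RINT y. \<bar>f0 y\<bar>) * c" by simp
 moreover have "0 <= 3 * M * V * c" using params c by simp
 ultimately show ?thesis
  unfolding weak_rhs_def K_def distrib_right by (intro order_trans[OF abs_triangle_ineq]) linarith
qed

text \<open>The spatial L1 norm of w is at most V at every time, so the flux through a time interval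
  is proportional to its length. An integrable bound in time would give continuity only; the rate t
  - s is what the consistency of one step requires.\<close>

lemma LL_time_Lipschitz:
 assumes [measurable]: "p \<in> borel_fn" "\<And>j. P j \<in> borel_fn"
  and b: "\<And>y. \<bar>p y\<bar> <= c" "\<And>j y. \<bar>P j y\<bar> <= c" and t: "0 <= s" "s <= t"
 shows "\<bar>LL t p P - LL s p P\<bar> <= K * c * (t - s)"
  and "LL t p P - LL s p P = (RINT z. indicator {s<..t} (fst z) * (f z * (\<Sum>j\<in>UNIV. w j z * P j (snd z))))"
proof -
 have c: "0 <= c" using b(1)[of undefined] by linarith
 note int = LL_integrable(2)[OF assms(1,2) b]
 have "LL t p P - LL s p P = (RINT z. indicator {0..t} (fst z) * (f z * (\<Sum>j\<in>UNIV. w j z * P j (snd z)))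
   - indicator {0..s} (fst z) * (f z * (\<Sum>j\<in>UNIV. w j z * P j (snd z))))"
  unfolding weak_rhs_def by (subst Bochner_Integration.integral_diff[OF int int]) simp
 also have "\<dots> = (RINT z. indicator {s<..t} (fst z) * (f z * (\<Sum>j\<in>UNIV. w j z * P j (snd z))))"
  using t by (intro Bochner_Integration.integral_cong) (auto simp: indicator_def)
 finally show eq: "LL t p P - LL s p P = \<dots>" .
 have ind[measurable]: "(%z. P j (snd z)) \<in> borel_measurable (borel :: (real \<times> R3) measure)"
  "(%z. indicator {s..t} (fst z) :: ennreal) \<in> borel_measurable (borel :: (real \<times> R3) measure)" for j
  unfolding borel_prod[symmetric] by measurable
 have "ennreal \<bar>LL t p P - LL s p P\<bar> \<le>
  (NNINT z. ennreal \<bar>indicator {s<..t} (fst z) * (f z * (\<Sum>j\<in>UNIV. w j z * P j (snd z)))\<bar>)"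
  unfolding eq by (rule abs_integral_le_nn_integral)
 also have "\<dots> <= (NNINT z. ennreal (M * c) * (\<Sum>j\<in>UNIV. ennreal \<bar>w j z\<bar> * indicator {s..t} (fst z)))"
 proof (rule nn_integral_mono)
  fix z
  have "\<bar>f z * (\<Sum>j\<in>UNIV. w j z * P j (snd z))\<bar> <= M * (\<Sum>j\<in>UNIV. \<bar>w j z\<bar> * c)"
   using params f_bound b(2) unfolding abs_mult
   by (intro mult_mono order_trans[OF sum_abs] sum_mono) (auto simp: abs_mult intro!: mult_left_mono)
  also have "\<dots> = (M * c) * (\<Sum>j\<in>UNIV. \<bar>w j z\<bar>)" by (simp add: sum_distrib_left mult_ac)
  finally have "ennreal \<bar>f z * (\<Sum>j\<in>UNIV. w j z * P j (snd z))\<bar> <= ennreal (M * c) * (\<Sum>j\<in>UNIV. ennreal \<bar>w j z\<bar>)"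
   using params c by (simp add: ennreal_leI sum_nonneg flip: ennreal_mult)
  then show "ennreal \<bar>indicator {s<..t} (fst z) * (f z * (\<Sum>j\<in>UNIV. w j z * P j (snd z)))\<bar>
   <= ennreal (M * c) * (\<Sum>j\<in>UNIV. ennreal \<bar>w j z\<bar> * indicator {s..t} (fst z))"
   by (cases "fst z \<in> {s<..t}") (auto simp: indicator_def)
 qed
 also have "\<dots> = ennreal (M * c) * (\<Sum>j\<in>UNIV. NNINT z. ennreal \<bar>w j z\<bar> * indicator {s..t} (fst z))"
  by (subst nn_integral_cmult, measurable, subst nn_integral_sum, measurable)
 also have "\<dots> <= ennreal (M * c) * (\<Sum>j\<in>(UNIV::3 set). ennreal ((t - s) * V))"
 proof (intro mult_left_mono sum_mono)
  fix j
  have "(NNINT y. ennreal \<bar>w j (u, y)\<bar> * indicator {s..t} u) <= ennreal V" for u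
   using w_L1[of j u] by (cases "u \<in> {s..t}") auto
  moreover have "(%z. ennreal \<bar>w j z\<bar> * indicator {s..t} (fst z)) \<in> borel_fn" by measurable
  ultimately show "(NNINT z. ennreal \<bar>w j z\<bar> * indicator {s..t} (fst z)) <= ennreal ((t - s) * V)"
   using t params by (intro nn_integral_time_le) (auto simp: indicator_def split: if_splits)
 qed auto
 also have "\<dots> = ennreal ((M * c) * (3 * ((t - s) * V)))"
  using params t c by (simp add: ennreal_mult[symmetric] flip: ennreal_numeral)
 finally have "\<bar>LL t p P - LL s p P\<bar> <= (M * c) * (3 * ((t - s) * V))"
  using params t c by (subst (asm) ennreal_le_iff) auto
 also have "\<dots> = (3 * M * V) * c * (t - s)" by simp
 also have "\<dots> <= K * c * (t - s)"
  unfolding K_def using params t c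
  by (intro mult_right_mono) (auto intro!: add_nonneg_nonneg mult_nonneg_nonneg sum_nonneg Bochner_Integration.integral_nonneg)
 finally show "\<bar>LL t p P - LL s p P\<bar> <= K * c * (t - s)" .
qed

text \<open>The mollified solution, but taken from the right side of the equation. It is therefore
  defined at every time and every point and is Lipschitz in t, while for each x it agrees with the
  convolution of f for almost every t in [0,T].\<close>

definition F :: "(R3 => real) => real => R3 => real" where
 "F \<rho> t x = LL t (%y. \<rho> (y - x)) (%j y. pderiv_at j \<rho> (y - x))"

definition DF :: "real => 3 => (R3 => real) => real => R3 => real" where
 "DF h j \<rho> t x = (F \<rho> t (x + h *\<^sub>R axis j 1) - F \<rho> t (x - h *\<^sub>R axis j 1)) / (2 * h)"

definition bb :: "(R3 => real) => real => R3 => real" where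
 "bb \<rho> s x = (RINT y. f (s, y) * (\<Sum>j\<in>UNIV. w j (s, y) * pderiv_at j \<rho> (y - x)))"

text \<open>A difference of values of F in space is the functional \<open>LL\<close> applied to the
  same difference of test functions. All bounds thus come from \<rho> and its partial derivatives,
  and both have to be estimated because \<open>LL\<close> sees the test function and its gradient;
  the finite set \<open>\<Phi>\<close> treats them together. The constant depends on \<rho>, hence
  on \<epsilon>, but not on h.\<close>

lemma F_bounds:
 assumes \<rho>: "\<rho> \<in> Cc_infty UNIV"
 shows "\<exists>C\<ge>0. \<forall>t s x j h. 0 <= s \<and> s <= t \<and> 0 < h -->
  \<bar>F \<rho> t x\<bar> <= C \<and> \<bar>F \<rho> t x - F \<rho> s x\<bar> <= C * (t - s) \<and>
  \<bar>F \<rho> t (x + h *\<^sub>R axis j 1) - 2 * F \<rho> t x + F \<rho> t (x - h *\<^sub>R axis j 1)\<bar> <= C * h\<^sup>2 \<and>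
  \<bar>DF h j \<rho> t x\<bar> <= C \<and> \<bar>DF h j \<rho> t x - DF h j \<rho> s x\<bar> <= C * (t - s)"
proof -
 define \<Phi> where "\<Phi> = insert \<rho> (range (%j. pderiv_at j \<rho>))"
 have \<Phi>: "finite \<Phi>" "\<And>\<phi>. \<phi> \<in> \<Phi> ==> \<phi> \<in> Cc_infty UNIV" "\<rho> \<in> \<Phi>" "\<And>j. pderiv_at j \<rho> \<in> \<Phi>"
  using \<rho> Cc_infty_has_derivative(3)[OF \<rho>] by (auto simp: \<Phi>_def)
 have "\<exists>C\<ge>0. \<forall>x y h j. \<bar>\<phi> x\<bar> <= C \<and> \<bar>\<phi> x - \<phi> y\<bar> <= C * norm (x - y) \<and>
   (0 < h --> \<bar>\<phi> (x + h *\<^sub>R axis j 1) - 2 * \<phi> x + \<phi> (x - h *\<^sub>R axis j 1)\<bar> <= C * h\<^sup>2)" if mem: "\<phi> \<in> \<Phi>" for \<phi>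
 proof -
  obtain C1 where C1: "0 <= C1" "\<And>x. \<bar>\<phi> x\<bar> <= C1" using Cc_infty_bounded[OF \<Phi>(2)[OF mem]] by auto
  obtain C2 where C2: "0 <= C2" "\<And>x y. \<bar>\<phi> x - \<phi> y\<bar> <= C2 * norm (x - y)" using Cc_infty_Lipschitz[OF \<Phi>(2)[OF mem]] by auto
  obtain C3 where C3: "0 <= C3" "\<And>x j h. 0 < h ==> \<bar>\<phi> (x + h *\<^sub>R axis j 1) - 2 * \<phi> x + \<phi> (x - h *\<^sub>R axis j 1)\<bar> <= C3 * h\<^sup>2"
   using Cc_infty_difference_quotients[OF \<Phi>(2)[OF mem]] by metis
  have "C2 * norm (x - y) <= (C1 + C2 + C3) * norm (x - y)" "C3 * h\<^sup>2 <= (C1 + C2 + C3) * h\<^sup>2" for x y :: R3 and h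
   using C1 C2 C3 by (auto intro!: mult_right_mono)
  then show ?thesis using C1 C2 C3 by (intro exI[of _ "C1 + C2 + C3"]) (smt (verit, best))
 qed
 then obtain c where c: "\<And>\<phi>. \<phi> \<in> \<Phi> ==> 0 <= c \<phi>"
  "\<And>\<phi> x. \<phi> \<in> \<Phi> ==> \<bar>\<phi> x\<bar> <= c \<phi>" "\<And>\<phi> x y. \<phi> \<in> \<Phi> ==> \<bar>\<phi> x - \<phi> y\<bar> <= c \<phi> * norm (x - y)"
  "\<And>\<phi> x h j. \<phi> \<in> \<Phi> ==> 0 < h ==> \<bar>\<phi> (x + h *\<^sub>R axis j 1) - 2 * \<phi> x + \<phi> (x - h *\<^sub>R axis j 1)\<bar> <= c \<phi> * h\<^sup>2"
  by metis
 define B where "B = (\<Sum>\<phi>\<in>\<Phi>. c \<phi>)"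
 have B0: "0 <= B" unfolding B_def using c(1) by (rule sum_nonneg)
 have cB: "c \<phi> <= B" if "\<phi> \<in> \<Phi>" for \<phi>
  unfolding B_def using that \<Phi>(1) c(1) by (intro member_le_sum) auto
 have b1: "\<bar>\<phi> x\<bar> <= B" if "\<phi> \<in> \<Phi>" for \<phi> x
  by (rule order_trans[OF c(2)[OF that] cB[OF that]])
 have b2: "\<bar>\<phi> x - \<phi> y\<bar> <= B * norm (x - y)" if "\<phi> \<in> \<Phi>" for \<phi> x y
  by (rule order_trans[OF c(3)[OF that] mult_right_mono[OF cB[OF that]]]) simp
 have b3: "\<bar>\<phi> (x + h *\<^sub>R axis j 1) - 2 * \<phi> x + \<phi> (x - h *\<^sub>R axis j 1)\<bar> <= B * h\<^sup>2"
  if "\<phi> \<in> \<Phi>" "0 < h" for \<phi> x h j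
  by (rule order_trans[OF c(4)[OF that] mult_right_mono[OF cB[OF that(1)]]]) simp
 have meas[measurable]: "\<phi> \<in> borel_fn" if "\<phi> \<in> \<Phi>" for \<phi> using Cc_infty_integrable(2)[OF \<Phi>(2)[OF that]] .
 note meas[OF \<Phi>(3), measurable] meas[OF \<Phi>(4), measurable]
 have lin2: "a * F \<rho> t x1 + b * F \<rho> t x2 = LL t (%y. a * \<rho> (y - x1) + b * \<rho> (y - x2))
   (%j y. a * pderiv_at j \<rho> (y - x1) + b * pderiv_at j \<rho> (y - x2))" for a b t x1 x2
  unfolding F_def by (rule LL_linear[symmetric, where ?c1.0=B and ?c2.0=B]) (use b1 \<Phi> in auto)
 have F1: "\<bar>F \<rho> t x\<bar> <= K * B" for t x
  unfolding F_def by (rule LL_bound) (use b1 \<Phi> in auto)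
 have F2: "\<bar>F \<rho> t x - F \<rho> s x\<bar> <= K * B * (t - s)" if "0 <= s" "s <= t" for t s x
  unfolding F_def by (rule LL_time_Lipschitz(1)) (use b1 \<Phi> that in auto)
 have F3: "\<bar>F \<rho> t (x + h *\<^sub>R axis j 1) - 2 * F \<rho> t x + F \<rho> t (x - h *\<^sub>R axis j 1)\<bar> <= K * (B * h\<^sup>2)"
  if h: "0 < h" for t x h j
 proof -
  let ?p = "%\<phi> y. \<phi> (y - (x + h *\<^sub>R axis j 1)) - 2 * \<phi> (y - x) + \<phi> (y - (x - h *\<^sub>R axis j 1)) :: real"
  have "1 * (F \<rho> t (x + h *\<^sub>R axis j 1) + - 2 * F \<rho> t x) + 1 * F \<rho> t (x - h *\<^sub>R axis j 1)
   = LL t (?p \<rho>) (%j. ?p (pderiv_at j \<rho>))"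
  proof -
   have e: "F \<rho> t (x + h *\<^sub>R axis j 1) + - 2 * F \<rho> t x = LL t (%y. 1 * \<rho> (y - (x + h *\<^sub>R axis j 1)) + (- 2) * \<rho> (y - x))
     (%i y. 1 * pderiv_at i \<rho> (y - (x + h *\<^sub>R axis j 1)) + (- 2) * pderiv_at i \<rho> (y - x))"
    using lin2[of 1 t "x + h *\<^sub>R axis j 1" "- 2" x] by simp
   have b': "\<bar>\<phi> u - 2 * \<phi> v\<bar> <= 3 * B" if "\<phi> \<in> \<Phi>" for \<phi> u v
    using b1[OF that, of u] b1[OF that, of v] by linarith
   show ?thesis
    unfolding e F_def[of \<rho> t "x - _"]
    by (subst LL_linear[symmetric, where ?c1.0="3 * B" and ?c2.0=B])
      (use b' b1 \<Phi> in auto)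
  qed
  moreover have "\<bar>?p \<phi> y\<bar> <= B * h\<^sup>2" if "\<phi> \<in> \<Phi>" for \<phi> y
   using b3[OF that h, of "y - x" j] by (simp add: algebra_simps)
  then have "\<bar>LL t (?p \<rho>) (%j. ?p (pderiv_at j \<rho>))\<bar> <= K * (B * h\<^sup>2)"
   by (intro LL_bound) (use \<Phi> in auto)
  ultimately show ?thesis by (simp add: algebra_simps)
 qed
 have DF_eq: "DF h j \<rho> t x = LL t (%y. (1 / (2 * h)) * \<rho> (y - (x + h *\<^sub>R axis j 1)) + (- 1 / (2 * h)) * \<rho> (y - (x - h *\<^sub>R axis j 1)))
   (%i y. (1 / (2 * h)) * pderiv_at i \<rho> (y - (x + h *\<^sub>R axis j 1)) + (- 1 / (2 * h)) * pderiv_at i \<rho> (y - (x - h *\<^sub>R axis j 1)))" for h j t x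
  unfolding lin2[symmetric] DF_def by (simp add: diff_divide_distrib)
 have dq: "\<bar>(1 / (2 * h)) * \<phi> (y - (x + h *\<^sub>R axis j 1)) + (- 1 / (2 * h)) * \<phi> (y - (x - h *\<^sub>R axis j 1))\<bar> <= B"
  if "\<phi> \<in> \<Phi>" "0 < h" for \<phi> y x h j
 proof -
  have "y - (x + h *\<^sub>R axis j 1) - (y - (x - h *\<^sub>R axis j 1)) = - (2 * h) *\<^sub>R axis j 1"
   by (simp add: algebra_simps flip: scaleR_2)
  then have "norm (y - (x + h *\<^sub>R axis j 1) - (y - (x - h *\<^sub>R axis j 1))) = 2 * h"
   using that by (simp only: norm_scaleR norm_axis_1)
  then have "\<bar>\<phi> (y - (x + h *\<^sub>R axis j 1)) - \<phi> (y - (x - h *\<^sub>R axis j 1))\<bar> <= B * (2 * h)"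
   using b2[OF that(1), of "y - (x + h *\<^sub>R axis j 1)" "y - (x - h *\<^sub>R axis j 1)"] by simp
  moreover have "(1 / (2 * h)) * \<phi> (y - (x + h *\<^sub>R axis j 1)) + (- 1 / (2 * h)) * \<phi> (y - (x - h *\<^sub>R axis j 1))
   = (\<phi> (y - (x + h *\<^sub>R axis j 1)) - \<phi> (y - (x - h *\<^sub>R axis j 1))) / (2 * h)"
   by (simp add: diff_divide_distrib)
  ultimately show ?thesis using that(2) by (simp add: abs_divide pos_divide_le_eq)
 qed
 have F4: "\<bar>DF h j \<rho> t x\<bar> <= K * B" if "0 < h" for h j t x
  unfolding DF_eq by (rule LL_bound) (use dq that \<Phi> in auto)
 have F5: "\<bar>DF h j \<rho> t x - DF h j \<rho> s x\<bar> <= K * B * (t - s)" if "0 < h" "0 <= s" "s <= t" for h j t s x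
  unfolding DF_eq by (rule LL_time_Lipschitz(1)) (use dq that \<Phi> in auto)
 show ?thesis
  using F1 F2 F3 F4 F5 K_nonneg B0 by (intro exI[of _ "K * B"]) (auto simp: mult.assoc)
qed

end

section \<open>Measurability, support and time derivative of the mollified solution\<close>

lemma fst_snd_borel_measurable:
 "fst \<in> borel_measurable (borel :: (real \<times> R3) measure)" "snd \<in> borel_measurable (borel :: (real \<times> R3) measure)"
 by (intro borel_measurable_continuous_onI continuous_intros)+

text \<open>The exceptional set of times may vary with x; joint measurability of the property lets
  Tonelli collect these sets into one null set of space-time.\<close>

lemma AE_time_space:
 assumes "Measurable.pred borel (%z :: real \<times> R3. P (fst z) (snd z))" "\<And>x. AE t in lborel. P t x"
 shows "AE z in lborel. P (fst z) (snd z)"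
proof -
 have m: "Measurable.pred (lborel \<Otimes>\<^sub>M lborel) (%z. P (fst z) (snd z))"
  using assms(1) by (simp add: lborel_prod)
 have "AE x in lborel. AE t in lborel. P t x" using assms(2) by simp
 then have "AE t in lborel. AE x in lborel. P t x"
  using lborel_pair.AE_commute[of P] m by (simp add: pred_def)
 then have "AE z in lborel \<Otimes>\<^sub>M lborel. P (fst z) (snd z)"
  using m by (intro lborel_pair.AE_pair_measure) (auto simp: pred_def)
 then show ?thesis unfolding lborel_prod .
qed

context transport begin

lemma snd_shift_measurable:
 assumes "p \<in> borel_fn"
 shows "(%q. p (snd q - snd (fst q))) \<in> borel_measurable (borel \<Otimes>\<^sub>M borel :: ((real \<times> R3) \<times> R3) measure)"
  "(%q. p (snd (snd q) - snd (fst q))) \<in> borel_measurable (borel \<Otimes>\<^sub>M borel :: ((real \<times> R3) \<times> (real \<times> R3)) measure)"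
 unfolding borel_prod
 by (rule measurable_compose[OF _ assms], intro borel_measurable_continuous_onI continuous_intros)+

lemma f_w_pair_measurable[measurable]:
 "(%q. f (fst (fst q), snd q)) \<in> borel_measurable (borel \<Otimes>\<^sub>M borel :: ((real \<times> R3) \<times> R3) measure)"
 "(%q. w j (fst (fst q), snd q)) \<in> borel_measurable (borel \<Otimes>\<^sub>M borel :: ((real \<times> R3) \<times> R3) measure)"
 unfolding borel_prod
 by (rule measurable_compose[OF _ f_meas] measurable_compose[OF _ w_meas],
   intro borel_measurable_continuous_onI continuous_intros)+

lemma conv_measurable:
 assumes "p \<in> borel_fn"
 shows "(%z. RINT y. f (fst z, y) * p (y - snd z)) \<in> borel_fn"
proof -
 note [measurable] = snd_shift_measurable[OF assms]
 show ?thesis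
  by (intro sigma_finite_measure.borel_measurable_lebesgue_integral) (simp_all add: lborel.sigma_finite_measure_axioms split_beta')
qed

lemma bb_measurable:
 assumes "\<And>j. pderiv_at j \<rho> \<in> borel_fn"
 shows "(%z. bb \<rho> (fst z) (snd z)) \<in> borel_fn"
proof -
 note [measurable] = snd_shift_measurable[OF assms]
 show ?thesis unfolding bb_def
  by (intro sigma_finite_measure.borel_measurable_lebesgue_integral) (simp_all add: lborel.sigma_finite_measure_axioms split_beta')
qed

lemma F_measurable:
 assumes "\<rho> \<in> Cc_infty UNIV"
 shows "(%z. F \<rho> (fst z) (snd z)) \<in> borel_fn"
proof -
 have m: "\<rho> \<in> borel_fn" "pderiv_at j \<rho> \<in> borel_fn" for j
  using Cc_infty_integrable(2)[OF assms] Cc_infty_integrable(2)[OF Cc_infty_has_derivative(3)[OF assms]] by auto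
 note [measurable] = snd_shift_measurable[OF m(1)] snd_shift_measurable[OF m(2)]
 have [measurable]: "(%q. indicator {0..fst (fst q)} (fst (snd q)) :: real) \<in> borel_measurable (borel \<Otimes>\<^sub>M borel :: ((real \<times> R3) \<times> (real \<times> R3)) measure)"
 proof -
  have [measurable]: "(%q. fst (fst q)) \<in> borel_measurable (borel \<Otimes>\<^sub>M borel :: ((real \<times> R3) \<times> (real \<times> R3)) measure)"
   "(%q. fst (snd q)) \<in> borel_measurable (borel \<Otimes>\<^sub>M borel :: ((real \<times> R3) \<times> (real \<times> R3)) measure)"
   unfolding borel_prod by (intro borel_measurable_continuous_onI continuous_intros)+
  show ?thesis unfolding indicator_def atLeastAtMost_iff by measurable
 qed
 have "(%z. RINT z'. indicator {0..fst z} (fst z') * (f z' * (\<Sum>j\<in>UNIV. w j z' * pderiv_at j \<rho> (snd z' - snd z))))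
   \<in> borel_fn"
  by (intro sigma_finite_measure.borel_measurable_lebesgue_integral) (simp_all add: lborel.sigma_finite_measure_axioms split_beta')
 moreover have "(%z :: real \<times> R3. RINT y. f0 y * \<rho> (y - snd z)) \<in> borel_fn"
  by (intro sigma_finite_measure.borel_measurable_lebesgue_integral) (simp_all add: lborel.sigma_finite_measure_axioms split_beta')
 ultimately show ?thesis unfolding F_def weak_rhs_def by simp
qed

lemma F_support:
 assumes \<rho>: "mollifier C \<epsilon> \<rho>" and x: "R + \<epsilon> < norm x"
 shows "F \<rho> t x = 0"
proof -
 have far: "\<epsilon> < norm (y - x)" if "norm y <= R" for y
  using norm_triangle_ineq2[of x y] that x by (simp add: norm_minus_commute)
 have 1: "f0 y * \<rho> (y - x) = 0" for y
  using f0_supp[of y] far[of y] mollifierD(9)[OF \<rho>, of "y - x"] by fastforce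
 have 2: "w j z * pderiv_at j \<rho> (snd z - x) = 0" for j z
  using w_supp[of j z] far[of "snd z"] mollifierD(10)[OF \<rho>, of "snd z - x" j] by fastforce
 show ?thesis by (simp add: F_def weak_rhs_def 1 2)
qed

text \<open>\<open>bb\<close> is the time derivative of F in the integrated sense. It comes from
  slicing the space-time integral of the flux, and no regularity of w in time is involved.\<close>

lemma F_time_integral:
 assumes \<rho>: "mollifier C \<epsilon> \<rho>" and t: "0 <= s" "s <= t"
 shows "F \<rho> t x - F \<rho> s x = (RINT u. indicator {s<..t} u * bb \<rho> u x)"
  and "integrable lborel (%u. indicator {s<..t} u * bb \<rho> u x)"
proof -
 note \<rho>' = mollifierD(1)[OF \<rho>]
 obtain B1 where B1: "\<And>x. \<bar>\<rho> x\<bar> <= B1" using Cc_infty_bounded[OF \<rho>'] by auto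
 obtain B2 where B2: "\<And>j x. \<bar>pderiv_at j \<rho> x\<bar> <= B2" using mollifierD(8)[OF \<rho>] by blast
 have B: "\<bar>\<rho> y\<bar> <= max B1 B2" "\<bar>pderiv_at j \<rho> y\<bar> <= max B1 B2" for j y
  using B1[of y] B2[of j y] by auto
 note [measurable] = mollifierD(5,6)[OF \<rho>]
 let ?g = "%z. f z * (\<Sum>j\<in>UNIV. w j z * pderiv_at j \<rho> (snd z - x))"
 have eq: "F \<rho> t x - F \<rho> s x = (RINT z. indicator {s<..t} (fst z) * ?g z)"
  unfolding F_def by (rule LL_time_Lipschitz(2)[OF _ _ B t]) measurable
 have "integrable lborel (%z. indicator {0..t} (fst z) * ?g z)"
  by (rule LL_integrable(2)[OF _ _ B]) measurable
 from integrable_mult_bounded(2)[OF this, of "%z. indicator {s<..t} (fst z)" 1]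
 have "integrable lborel (%z. indicator {s<..t} (fst z) * (indicator {0..t} (fst z) * ?g z))"
  using fst_snd_borel_measurable(1) by (simp add: indicator_def)
 moreover have "indicator {s<..t} (fst z) * (indicator {0..t} (fst z) * ?g z) = indicator {s<..t} (fst z) * ?g z" for z :: "real \<times> R3"
  using t by (auto simp: indicator_def)
 ultimately have int: "integrable (lborel \<Otimes>\<^sub>M lborel) (%z. indicator {s<..t} (fst z) * ?g z)"
  by (simp add: lborel_prod)
 have b: "(RINT y. indicator {s<..t} (fst (u, y)) * ?g (u, y)) = indicator {s<..t} u * bb \<rho> u x" for u
  by (simp add: bb_def)
 show "F \<rho> t x - F \<rho> s x = (RINT u. indicator {s<..t} u * bb \<rho> u x)"
  unfolding eq using lborel_pair.integral_fst'[OF int] unfolding b by (simp add: lborel_prod)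
 show "integrable lborel (%u. indicator {s<..t} u * bb \<rho> u x)"
  using lborel_pair.integrable_fst'[OF int] unfolding b .
qed

section \<open>The commutator of mollification and transport\<close>

definition conv_grad :: "(R3 => real) => 3 => real \<times> R3 => real" where
 "conv_grad \<rho> j z = (RINT y. f (fst z, y) * pderiv_at j \<rho> (y - snd z))"

text \<open>Since x enters through \<open>\<rho> (y - x)\<close>, \<open>conv_grad\<close> is minus
  the spatial gradient of the mollified solution. Hence this is the residual of F in the transport
  equation, its time derivative plus w times its gradient, which is the DiPerna--Lions
  commutator.\<close>

definition cmt :: "(R3 => real) => real \<times> R3 => real" where
 "cmt \<rho> z = bb \<rho> (fst z) (snd z) - (\<Sum>j\<in>UNIV. w j z * conv_grad \<rho> j z)"

lemma conv_grad_measurable: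
 assumes "mollifier C \<epsilon> \<rho>"
 shows "conv_grad \<rho> j \<in> borel_fn"
 unfolding conv_grad_def[abs_def] by (rule conv_measurable[OF mollifierD(6)[OF assms]])

lemma cmt_measurable:
 assumes "mollifier C \<epsilon> \<rho>"
 shows "cmt \<rho> \<in> borel_fn"
 unfolding cmt_def[abs_def]
 using bb_measurable[OF mollifierD(6)[OF assms]] conv_grad_measurable[OF assms] by measurable

lemma F_AE_eq:
 assumes \<rho>: "mollifier C \<epsilon> \<rho>"
 shows "AE t in lborel. t \<in> {0..T} --> F \<rho> t x = (RINT y. f (t, y) * \<rho> (y - x))"
proof -
 have pd: "(%j. pderiv_at j (%y. \<rho> (y - x))) = (%j y. pderiv_at j \<rho> (y - x))"
  by (intro ext Cc_infty_translate(2)[OF mollifierD(1)[OF \<rho>]])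
 show ?thesis
  using weak[OF Cc_infty_translate(1)[OF mollifierD(1)[OF \<rho>], of x]]
 proof eventually_elim
  case (elim t)
  then show ?case unfolding F_def pd[symmetric] by (intro impI) (erule (1) impE, rule sym)
 qed
qed

lemma F_AE_eq_pair:
 assumes \<rho>: "mollifier C \<epsilon> \<rho>"
 shows "AE z in lborel. fst z \<in> {0..T} --> F \<rho> (fst z) (snd z) = (RINT y. f (fst z, y) * \<rho> (y - snd z))"
proof (rule AE_time_space[of "%t x. t \<in> {0..T} --> F \<rho> t x = (RINT y. f (t, y) * \<rho> (y - x))"])
 note [measurable] = F_measurable[OF mollifierD(1)[OF \<rho>]] conv_measurable[OF mollifierD(5)[OF \<rho>]] fst_snd_borel_measurable
 show "Measurable.pred borel (%z::real \<times> R3. fst z \<in> {0..T} -->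
   F \<rho> (fst z) (snd z) = (RINT y. f (fst z, y) * \<rho> (y - snd z)))"
  unfolding atLeastAtMost_iff by measurable
qed (rule F_AE_eq[OF \<rho>])

lemma DF_measurable:
 assumes "\<rho> \<in> Cc_infty UNIV"
 shows "(%z. DF h j \<rho> (fst z) (snd z)) \<in> borel_fn"
proof -
 have "(%z::real \<times> R3. (fst z, snd z + a)) \<in> borel_fn" for a
  by (intro borel_measurable_continuous_onI continuous_intros)
 from measurable_compose[OF this F_measurable[OF assms]]
 have "(%z. F \<rho> (fst z) (snd z + a)) \<in> borel_fn" for a by simp
 from this[of "h *\<^sub>R axis j 1"] this[of "- (h *\<^sub>R axis j 1)"] show ?thesis unfolding DF_def by simp
qed

text \<open>The plus sign is the sign change from differentiating \<open>\<rho> (y - x)\<close> in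
  x. \<open>DF\<close> is defined at all times and \<open>conv_grad\<close> from the values of f, so
  the two can be compared only for almost every time.\<close>

lemma DF_AE_close:
 assumes \<rho>: "mollifier C \<epsilon> \<rho>"
 shows "\<exists>C'\<ge>0. \<forall>h>0. \<forall>j. AE z in lborel. fst z \<in> {0..T} --> \<bar>DF h j \<rho> (fst z) (snd z) + conv_grad \<rho> j z\<bar> <= C' * h"
proof -
 note \<rho>' = mollifierD(1)[OF \<rho>]
 note [measurable] = mollifierD(5,6)[OF \<rho>]
 obtain c where c: "0 <= c" "\<And>x j h. 0 < h ==> \<bar>(\<rho> (x + h *\<^sub>R axis j 1) - \<rho> (x - h *\<^sub>R axis j 1)) / (2 * h) - pderiv_at j \<rho> x\<bar> <= c * h"
  using Cc_infty_difference_quotients[OF \<rho>'] by metis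
 obtain B1 where B1: "\<And>x. \<bar>\<rho> x\<bar> <= B1" using Cc_infty_bounded[OF \<rho>'] by auto
 let ?m = "M * measure lborel (cball (0::R3) R)"
 have m0: "0 <= ?m" using params by simp
 have "AE z in lborel. fst z \<in> {0..T} --> \<bar>DF h j \<rho> (fst z) (snd z) + conv_grad \<rho> j z\<bar> <= (c * ?m) * h" if h: "0 < h" for h j
 proof -
  have "AE z in lborel. fst z \<in> {0..T} --> \<bar>DF h j \<rho> (fst z) (snd z) + conv_grad \<rho> j (fst z, snd z)\<bar> <= (c * ?m) * h"
  proof (rule AE_time_space[of "%t x. t \<in> {0..T} --> \<bar>DF h j \<rho> t x + conv_grad \<rho> j (t, x)\<bar> <= (c * ?m) * h"])
   note [measurable] = DF_measurable[OF \<rho>'] conv_grad_measurable[OF \<rho>] fst_snd_borel_measurable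
   show "Measurable.pred borel (%z::real \<times> R3. fst z \<in> {0..T} -->
     \<bar>DF h j \<rho> (fst z) (snd z) + conv_grad \<rho> j (fst z, snd z)\<bar> <= (c * ?m) * h)"
    unfolding atLeastAtMost_iff prod.collapse by measurable
   fix x
   show "AE t in lborel. t \<in> {0..T} --> \<bar>DF h j \<rho> t x + conv_grad \<rho> j (t, x)\<bar> <= (c * ?m) * h"
    using F_AE_eq[OF \<rho>, of "x + h *\<^sub>R axis j 1"] F_AE_eq[OF \<rho>, of "x - h *\<^sub>R axis j 1"]
   proof eventually_elim
    case (elim t)
    show ?case
    proof
     assume "t \<in> {0..T}"
     note eqs = elim(1)[rule_format, OF this] elim(2)[rule_format, OF this]
     let ?a = "%y. f (t, y) * \<rho> (y - (x + h *\<^sub>R axis j 1))" and ?b = "%y. f (t, y) * \<rho> (y - (x - h *\<^sub>R axis j 1))"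
      and ?c = "%y. f (t, y) * pderiv_at j \<rho> (y - x)"
     have ints: "integrable lborel ?a" "integrable lborel ?b" "integrable lborel ?c"
      using B1 mollifierD(8)[OF \<rho>] by (auto intro!: integrable_mult_bounded(1)[OF f_slice_integrable])
     have "DF h j \<rho> t x + conv_grad \<rho> j (t, x) = (integral\<^sup>L lborel ?a - integral\<^sup>L lborel ?b) / (2 * h) + integral\<^sup>L lborel ?c"
      unfolding DF_def conv_grad_def eqs by simp
     also have "\<dots> = (RINT y. (?a y - ?b y) / (2 * h) + ?c y)"
      using ints by simp
     finally have "ennreal \<bar>DF h j \<rho> t x + conv_grad \<rho> j (t, x)\<bar> <= (NNINT y. ennreal \<bar>(?a y - ?b y) / (2 * h) + ?c y\<bar>)"
      by (simp only: abs_integral_le_nn_integral)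
     also have "\<dots> <= (NNINT y. ennreal (c * h) * ennreal \<bar>f (t, y)\<bar>)"
     proof (rule nn_integral_mono)
      fix y
      have "(?a y - ?b y) / (2 * h) + ?c y = - f (t, y) * ((\<rho> (y - x + h *\<^sub>R axis j 1) - \<rho> (y - x - h *\<^sub>R axis j 1)) / (2 * h) - pderiv_at j \<rho> (y - x))"
       using h by (simp add: field_simps)
      then have "\<bar>(?a y - ?b y) / (2 * h) + ?c y\<bar> <= \<bar>f (t, y)\<bar> * (c * h)"
       using c(2)[OF h, of "y - x" j] by (simp only: abs_mult abs_minus_cancel) (intro mult_left_mono abs_ge_zero)
      then show "ennreal \<bar>(?a y - ?b y) / (2 * h) + ?c y\<bar> <= ennreal (c * h) * ennreal \<bar>f (t, y)\<bar>"
       using c(1) h by (simp add: ennreal_leI mult.commute flip: ennreal_mult)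
     qed
     also have "\<dots> <= ennreal (c * h) * ennreal ?m"
      by (subst nn_integral_cmult) (use f_slice_nn_integral[of t] in \<open>auto intro: mult_left_mono\<close>)
     also have "\<dots> = ennreal ((c * ?m) * h)" using c(1) h m0 by (simp add: mult_ac flip: ennreal_mult)
     finally show "\<bar>DF h j \<rho> t x + conv_grad \<rho> j (t, x)\<bar> <= (c * ?m) * h"
      using c(1) h m0 by (subst (asm) ennreal_le_iff) auto
    qed
   qed
  qed
  then show ?thesis by simp
 qed
 then show ?thesis using c(1) m0 by (intro exI[of _ "c * ?m"]) auto
qed

text \<open>Because w is divergence-free and the partial derivatives of \<rho> have mean zero, the
  commutator is an integral of products of increments of f and of w against these derivatives.
  Young's inequality with weight \<epsilon> \<theta> bounds such a product by an L1 increment of f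
  and a squared L2 increment of w. The latter is of order \<epsilon>^2, so both terms carry a factor
  \<epsilon>, which cancels the 1/\<epsilon> from the gradient of \<rho>. First \<theta> is taken
  large to suppress the part with \<Gamma>, and then \<epsilon> small to suppress the part with
  f.\<close>

lemma cmt_small:
 assumes C: "0 < C" and \<eta>: "0 < \<eta>"
 shows "\<exists>\<epsilon>0>0. \<forall>\<epsilon> \<rho>. 0 < \<epsilon> \<and> \<epsilon> < \<epsilon>0 \<and> mollifier C \<epsilon> \<rho> --> (NNINT z. ennreal \<bar>cmt \<rho> z\<bar>) <= ennreal \<eta>"
proof -
 \<comment> \<open>The factor 96 is 3 components times the kernel mass 64 C/\<epsilon>, times the
   \<epsilon>/2 in \<mu>. The choice of e below depends on \<theta>, so \<theta> has to come first;
   each of the two parts receives \<eta>/2.\<close>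
 define \<theta> where "\<theta> = 192 * C * \<Gamma> / \<eta> + 1"
 have \<theta>: "0 < \<theta>" "96 * C * (\<Gamma> / \<theta>) <= \<eta> / 2"
  using C \<eta> params by (auto simp: \<theta>_def field_simps add_pos_nonneg)
 define e where "e = \<eta> / (384 * C * (M + 1) * \<theta>)"
 have e: "0 < e" "96 * C * (2 * M * \<theta> * e) <= \<eta> / 2"
 proof -
  have M1: "0 < M + 1" using params by simp
  show "0 < e" unfolding e_def by (intro divide_pos_pos mult_pos_pos \<eta> C M1 \<theta>) auto
  have "96 * C * (2 * M * \<theta> * e) = \<eta> / 2 * (M / (M + 1))"
  proof -
   define m where "m = M + 1"
   have "C \<noteq> 0" "\<theta> \<noteq> 0" "m \<noteq> 0" using C \<theta> M1 by (auto simp: m_def)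
   then show ?thesis unfolding e_def m_def[symmetric] by (simp add: field_simps)
  qed
  also have "\<dots> <= \<eta> / 2 * 1" using params M1 \<eta> by (intro mult_left_mono) auto
  finally show "96 * C * (2 * M * \<theta> * e) <= \<eta> / 2" by simp
 qed
 obtain d where d: "0 < d" "\<And>k. norm k < d ==> (NNINT z. ennreal \<bar>f (z + k) - f z\<bar>) <= ennreal e"
  using translation_continuous_L1[OF f_integrable e(1)] by auto
 have "(NNINT z. ennreal \<bar>cmt \<rho> z\<bar>) <= ennreal \<eta>" if \<epsilon>: "0 < \<epsilon>" "\<epsilon> < d" and \<rho>: "mollifier C \<epsilon> \<rho>" for \<epsilon> \<rho>
 proof -
  note \<rho>' = mollifierD(1)[OF \<rho>]
  note [measurable] = mollifierD(5,6)[OF \<rho>]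
  let ?r = "%j. pderiv_at j \<rho>"
  let ?D = "%u (z :: real \<times> R3) k. u (z + (0, k)) - u z :: real"
  have [measurable]: "(%q. f (fst q + (0, snd q))) \<in> borel_measurable (borel \<Otimes>\<^sub>M borel :: ((real \<times> R3) \<times> R3) measure)"
   "(%q. w j (fst q + (0, snd q))) \<in> borel_measurable (borel \<Otimes>\<^sub>M borel :: ((real \<times> R3) \<times> R3) measure)" for j
   unfolding borel_prod
   by (rule measurable_compose[OF _ f_meas] measurable_compose[OF _ w_meas],
    intro borel_measurable_continuous_onI continuous_intros)+
  have pointwise: "ennreal \<bar>cmt \<rho> z\<bar> <= (NNINT k. (\<Sum>j\<in>UNIV. ennreal \<bar>?r j k\<bar> * ennreal (\<bar>?D f z k\<bar> * \<bar>?D (w j) z k\<bar>)))" for z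
  proof -
   obtain s x where z: "z = (s, x)" by (cases z)
   have i1: "integrable lborel (%y. w j (s, y) * ?r j (y - x))" "integrable lborel (%y. ?r j (y - x))"
    "integrable lborel (%y. f (s, y) * ?r j (y - x))" "(RINT y. ?r j (y - x)) = 0" for j
    using mollifierD(8)[OF \<rho>] integral_shift_R3[OF mollifierD(7)[OF \<rho>]] Cc_infty_integral_pderiv[OF \<rho>']
    by (auto intro!: integrable_mult_bounded(1)[OF f_slice_integrable] integrable_mult_bounded(1)[OF w_integrable(3)])
   have i2: "integrable lborel (%y. \<Sum>j\<in>UNIV. w j (s, y) * ?r j (y - x))"
    using i1 by simp
   have i3: "integrable lborel (%y. f (s, y) * (\<Sum>j\<in>UNIV. w j (s, y) * ?r j (y - x)))"
    by (rule integrable_mult_bounded(2)[OF i2 _ f_bound]) measurable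
   have div0: "(RINT y. (\<Sum>j\<in>UNIV. w j (s, y) * ?r j (y - x))) = 0"
    using w_div[OF Cc_infty_translate(1)[OF \<rho>', of x], of s] by (simp add: Cc_infty_translate(2)[OF \<rho>'])
   let ?I = "%y. f (s, y) * (\<Sum>j\<in>UNIV. w j (s, y) * ?r j (y - x))"
   let ?J = "%y. \<Sum>j\<in>UNIV. w j (s, y) * ?r j (y - x)"
   let ?K = "%y. \<Sum>j\<in>UNIV. w j (s, x) * (f (s, y) * ?r j (y - x))"
   let ?L = "%y. \<Sum>j\<in>UNIV. w j (s, x) * ?r j (y - x)"
   have K: "integrable lborel ?K" "integral\<^sup>L lborel ?K = (\<Sum>j\<in>UNIV. w j z * conv_grad \<rho> j z)"
    using i1 by (auto simp: conv_grad_def z)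
   have L: "integrable lborel ?L" "integral\<^sup>L lborel ?L = 0"
    using i1 by auto
   \<comment> \<open>Subtracting the values of f and w at (s, x) changes nothing: the term
     \<open>?J\<close> has integral 0 by the divergence condition and \<open>?L\<close> because each
     partial derivative of \<rho> has mean zero.\<close>
   have "(RINT y. (\<Sum>j\<in>UNIV. ?r j (y - x) * ((f (s, y) - f (s, x)) * (w j (s, y) - w j (s, x)))))
    = (RINT y. (?I y - f (s, x) * ?J y) - (?K y - f (s, x) * ?L y))"
    by (intro Bochner_Integration.integral_cong)
      (auto simp: algebra_simps sum.distrib sum_subtractf sum_distrib_left)
   also have "\<dots> = (integral\<^sup>L lborel ?I - f (s, x) * integral\<^sup>L lborel ?J) - (integral\<^sup>L lborel ?K - f (s, x) * integral\<^sup>L lborel ?L)"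
   proof -
    have a: "integrable lborel (%y. f (s, x) * ?J y)" "integrable lborel (%y. f (s, x) * ?L y)"
     using i2 L(1) by auto
    show ?thesis
     by (simp only: Bochner_Integration.integral_diff[OF Bochner_Integration.integrable_diff[OF i3 a(1)] Bochner_Integration.integrable_diff[OF K(1) a(2)]]
      Bochner_Integration.integral_diff[OF i3 a(1)] Bochner_Integration.integral_diff[OF K(1) a(2)] integral_mult_right_zero)
   qed
   also have "\<dots> = cmt \<rho> z"
    unfolding div0 L(2) K(2) by (simp add: cmt_def bb_def z)
   finally have eq: "(RINT y. (\<Sum>j\<in>UNIV. ?r j (y - x) * ((f (s, y) - f (s, x)) * (w j (s, y) - w j (s, x))))) = cmt \<rho> z" .
   have "ennreal \<bar>cmt \<rho> z\<bar> <= (NNINT y. ennreal \<bar>\<Sum>j\<in>UNIV. ?r j (y - x) * ((f (s, y) - f (s, x)) * (w j (s, y) - w j (s, x)))\<bar>)"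
    unfolding eq[symmetric] by (rule abs_integral_le_nn_integral)
   also have "\<dots> = (NNINT k. ennreal \<bar>\<Sum>j\<in>UNIV. ?r j k * (?D f z k * ?D (w j) z k)\<bar>)"
    by (subst nn_integral_lborel_shift[of _ x, symmetric]) (auto simp: z add.commute)
   also have "\<dots> <= (NNINT k. (\<Sum>j\<in>UNIV. ennreal \<bar>?r j k\<bar> * ennreal (\<bar>?D f z k\<bar> * \<bar>?D (w j) z k\<bar>)))"
   proof (rule nn_integral_mono)
    fix k
    have "\<bar>\<Sum>j\<in>UNIV. ?r j k * (?D f z k * ?D (w j) z k)\<bar> <= (\<Sum>j\<in>UNIV. \<bar>?r j k\<bar> * (\<bar>?D f z k\<bar> * \<bar>?D (w j) z k\<bar>))"
     by (rule order_trans[OF sum_abs]) (simp add: abs_mult)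
    then show "ennreal \<bar>\<Sum>j\<in>UNIV. ?r j k * (?D f z k * ?D (w j) z k)\<bar> <= (\<Sum>j\<in>UNIV. ennreal \<bar>?r j k\<bar> * ennreal (\<bar>?D f z k\<bar> * \<bar>?D (w j) z k\<bar>))"
     by (simp add: ennreal_leI flip: ennreal_mult)
   qed
   finally show ?thesis .
  qed
  define \<mu> where "\<mu> = \<epsilon> / 2 * (2 * M * \<theta> * e + \<Gamma> / \<theta>)"
  have \<mu>: "0 <= \<mu>" using \<epsilon> params \<theta> e by (simp add: \<mu>_def)
  have inner: "(NNINT z. ennreal (\<bar>?D f z k\<bar> * \<bar>?D (w j) z k\<bar>)) <= ennreal \<mu>" if k: "norm k <= \<epsilon>" for j k
  proof -
   have c: "0 < \<epsilon> * \<theta>" using \<epsilon> \<theta> by simp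
   have m: "(%z. f (z + (0, k))) \<in> borel_fn" "(%z. w j (z + (0, k))) \<in> borel_fn"
    by (rule measurable_compose[OF _ f_meas] measurable_compose[OF _ w_meas], simp)+
   note [measurable] = m
   have "(NNINT z. ennreal (\<bar>?D f z k\<bar> * \<bar>?D (w j) z k\<bar>)) \<le>
    (NNINT z. ennreal (\<epsilon> * \<theta> * M) * ennreal \<bar>?D f z k\<bar> + ennreal (1 / (2 * (\<epsilon> * \<theta>))) * ennreal ((?D (w j) z k)\<^sup>2))"
   proof (rule nn_integral_mono)
    fix z
    define a b where "a = \<bar>?D f z k\<bar>" and "b = \<bar>?D (w j) z k\<bar>"
    have a: "0 <= a" "a <= 2 * M" using f_bound[of "z + (0, k)"] f_bound[of z] by (auto simp: a_def)
    \<comment> \<open>Young's inequality with weight \<epsilon> \<theta>. Since a <= 2M, the square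
      of a is then replaced by 2M a, so that continuity of translations of f in L1 is
      sufficient.\<close>
    have "0 <= (\<epsilon> * \<theta> * a - b)\<^sup>2 / (2 * (\<epsilon> * \<theta>))" using c by simp
    also have "\<dots> = (\<epsilon> * \<theta>) * (a * a) / 2 - a * b + 1 / (2 * (\<epsilon> * \<theta>)) * b\<^sup>2"
    proof -
     have "(c * a - b)\<^sup>2 / (2 * c) = c * (a * a) / 2 - a * b + 1 / (2 * c) * b\<^sup>2" if "0 < c" for c :: real
      using that by (simp add: power2_eq_square field_simps)
     from this[OF c] show ?thesis .
    qed
    finally have "a * b <= (\<epsilon> * \<theta>) * (a * a) / 2 + 1 / (2 * (\<epsilon> * \<theta>)) * b\<^sup>2" by simp
    moreover have "(\<epsilon> * \<theta>) * (a * a) <= (\<epsilon> * \<theta>) * (2 * M * a)" using a c by (intro mult_left_mono mult_right_mono) auto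
    ultimately have "a * b <= \<epsilon> * \<theta> * M * a + 1 / (2 * (\<epsilon> * \<theta>)) * b\<^sup>2" by simp
    then have "ennreal (a * b) <= ennreal (\<epsilon> * \<theta> * M) * ennreal a + ennreal (1 / (2 * (\<epsilon> * \<theta>))) * ennreal (b\<^sup>2)"
     using a c params by (simp add: ennreal_leI flip: ennreal_mult ennreal_plus)
    then show "ennreal (\<bar>?D f z k\<bar> * \<bar>?D (w j) z k\<bar>) <= ennreal (\<epsilon> * \<theta> * M) * ennreal \<bar>?D f z k\<bar> + ennreal (1 / (2 * (\<epsilon> * \<theta>))) * ennreal ((?D (w j) z k)\<^sup>2)"
     by (simp add: a_def b_def)
   qed
   also have "\<dots> = ennreal (\<epsilon> * \<theta> * M) * (NNINT z. ennreal \<bar>?D f z k\<bar>) + ennreal (1 / (2 * (\<epsilon> * \<theta>))) * (NNINT z. ennreal ((?D (w j) z k)\<^sup>2))"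
    by (subst nn_integral_add, measurable, subst (1 2) nn_integral_cmult, measurable)
   also have "\<dots> <= ennreal (\<epsilon> * \<theta> * M) * ennreal e + ennreal (1 / (2 * (\<epsilon> * \<theta>))) * ennreal (\<epsilon>\<^sup>2 * \<Gamma>)"
   proof (intro add_mono mult_left_mono)
    show "(NNINT z. ennreal \<bar>?D f z k\<bar>) <= ennreal e" using k \<epsilon> by (intro d(2)) (simp add: norm_Pair)
    have "(norm k)\<^sup>2 * \<Gamma> <= \<epsilon>\<^sup>2 * \<Gamma>" using k params by (intro mult_right_mono power_mono) auto
    then show "(NNINT z. ennreal ((?D (w j) z k)\<^sup>2)) <= ennreal (\<epsilon>\<^sup>2 * \<Gamma>)"
     using w_grad[of j k] by (meson ennreal_leI order_trans)
   qed auto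
   also have "\<dots> = ennreal (\<epsilon> * \<theta> * M * e + 1 / (2 * (\<epsilon> * \<theta>)) * (\<epsilon>\<^sup>2 * \<Gamma>))"
    using c params e by (simp flip: ennreal_mult ennreal_plus)
   also have "\<epsilon> * \<theta> * M * e + 1 / (2 * (\<epsilon> * \<theta>)) * (\<epsilon>\<^sup>2 * \<Gamma>) = \<mu>"
    using \<epsilon> \<theta> by (simp add: \<mu>_def field_simps power2_eq_square)
   finally show ?thesis .
  qed
  have r_int: "(NNINT k. ennreal \<bar>?r j k\<bar>) <= ennreal (64 * C / \<epsilon>)" for j
  proof -
   \<comment> \<open>A cube of half-side 2\<epsilon> contains the support with room to spare; its
     volume (4\<epsilon>)^3 produces the 64.\<close>
   let ?S = "{y::R3. \<forall>i. 0 $ i - 2 * \<epsilon> <= y $ i \<and> y $ i < 0 $ i + 2 * \<epsilon>}"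
   have [measurable]: "?S \<in> sets borel" by measurable
   have "(NNINT k. ennreal \<bar>?r j k\<bar>) <= (NNINT k. ennreal (C / \<epsilon> ^ 4) * indicator ?S k)"
   proof (rule nn_integral_mono)
    fix k
    show "ennreal \<bar>?r j k\<bar> <= ennreal (C / \<epsilon> ^ 4) * indicator ?S k"
    proof (cases "norm k <= \<epsilon>")
     case True
     then have "\<bar>k $ i\<bar> <= \<epsilon>" for i using component_le_norm_cart[of k i] by linarith
     then have "k \<in> ?S" using \<epsilon>(1) by (auto simp: abs_le_iff) (smt (verit))+
     then show ?thesis using mollifierD(8)[OF \<rho>, of j k] by (simp add: ennreal_leI)
    next
     case False
     then show ?thesis using mollifierD(10)[OF \<rho>, of k j] by simp
    qed
   qed
   also have "\<dots> = ennreal (C / \<epsilon> ^ 4) * ennreal ((2 * (2 * \<epsilon>)) ^ 3)"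
    using cube_emeasure[of "2 * \<epsilon>" 0] \<epsilon>(1) by (simp add: nn_integral_cmult_indicator)
   also have "\<dots> = ennreal (64 * C / \<epsilon>)"
    using C \<epsilon>(1) by (simp add: power_mult_distrib field_simps eval_nat_numeral flip: ennreal_mult)
   finally show ?thesis .
  qed
  have "(NNINT z. ennreal \<bar>cmt \<rho> z\<bar>)
    <= (NNINT z. NNINT k. (\<Sum>j\<in>UNIV. ennreal \<bar>?r j k\<bar> * ennreal (\<bar>?D f z k\<bar> * \<bar>?D (w j) z k\<bar>)))"
   by (intro nn_integral_mono pointwise)
  also have "\<dots> = (NNINT k. NNINT z. (\<Sum>j\<in>UNIV. ennreal \<bar>?r j k\<bar> * ennreal (\<bar>?D f z k\<bar> * \<bar>?D (w j) z k\<bar>)))"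
   by (rule lborel_pair.Fubini') (simp add: split_beta')
  also have "\<dots> = (NNINT k. (\<Sum>j\<in>UNIV. ennreal \<bar>?r j k\<bar> * (NNINT z. ennreal (\<bar>?D f z k\<bar> * \<bar>?D (w j) z k\<bar>))))"
  proof (intro nn_integral_cong)
   fix k :: R3
   have [measurable]: "(%z. f (z + (0, k))) \<in> borel_fn" "(%z. w j (z + (0, k))) \<in> borel_fn" for j
    by (rule measurable_compose[OF _ f_meas] measurable_compose[OF _ w_meas], simp)+
   show "(NNINT z. (\<Sum>j\<in>UNIV. ennreal \<bar>?r j k\<bar> * ennreal (\<bar>?D f z k\<bar> * \<bar>?D (w j) z k\<bar>)))
    = (\<Sum>j\<in>UNIV. ennreal \<bar>?r j k\<bar> * (NNINT z. ennreal (\<bar>?D f z k\<bar> * \<bar>?D (w j) z k\<bar>)))"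
    by (simp add: nn_integral_sum nn_integral_cmult)
  qed
  also have "\<dots> <= (NNINT k. (\<Sum>j\<in>UNIV. ennreal \<bar>?r j k\<bar> * ennreal \<mu>))"
  proof (intro nn_integral_mono sum_mono)
   fix k j
   show "ennreal \<bar>?r j k\<bar> * (NNINT z. ennreal (\<bar>?D f z k\<bar> * \<bar>?D (w j) z k\<bar>)) <= ennreal \<bar>?r j k\<bar> * ennreal \<mu>"
    using inner[of k j] mollifierD(10)[OF \<rho>, of k j] by (cases "norm k <= \<epsilon>") (auto intro: mult_left_mono)
  qed
  also have "\<dots> = (\<Sum>j\<in>UNIV. (NNINT k. ennreal \<bar>?r j k\<bar>) * ennreal \<mu>)"
   by (simp add: nn_integral_sum nn_integral_multc)
  also have "\<dots> <= (\<Sum>j\<in>(UNIV::3 set). ennreal (64 * C / \<epsilon>) * ennreal \<mu>)"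
   by (intro sum_mono mult_right_mono r_int) auto
  also have "\<dots> = ennreal (3 * (64 * C / \<epsilon> * \<mu>))"
   using \<mu> C \<epsilon> by (simp flip: ennreal_mult ennreal_numeral)
  also have "3 * (64 * C / \<epsilon> * \<mu>) = 96 * C * (2 * M * \<theta> * e) + 96 * C * (\<Gamma> / \<theta>)"
   using \<epsilon> \<theta> by (simp add: \<mu>_def field_simps)
  also have "\<dots> <= \<eta>" using \<theta>(2) e(2) by linarith
  finally show ?thesis by (simp add: ennreal_leI)
 qed
 then show ?thesis using d(1) by blast
qed

end

section \<open>The error estimate\<close>

lemma powr_tendsto_0:
 fixes a :: real
 assumes "0 < a"
 shows "((%h. h powr a) \<longlongrightarrow> 0) (at_right 0)"
proof -
 have "\<forall>\<^sub>F h in at_right 0. 0 <= (h :: real)" by (auto simp: eventually_at_right_field intro!: exI[of _ 1])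
 then have "((%h :: real. h powr a) \<longlongrightarrow> 0 powr a) (at_right 0)"
  using assms by (intro tendsto_powr' tendsto_ident_at tendsto_const) auto
 then show ?thesis by simp
qed

lemma eventually_at_right_0D:
 fixes P :: "real => bool"
 assumes "\<forall>\<^sub>F h in at_right 0. P h"
 shows "\<exists>d>0. \<forall>h. 0 < h --> h < d --> P h"
 using assms unfolding eventually_at_right_field by blast

lemma powr_small:
 fixes a e c :: real
 assumes "0 < a" "0 < e"
 shows "\<exists>d>0. \<forall>h. 0 < h --> h < d --> h powr a * c < e"
proof -
 have "((%h. h powr a * c) \<longlongrightarrow> 0 * c) (at_right 0)"
  by (intro tendsto_mult tendsto_const powr_tendsto_0 assms(1))
 then have "\<forall>\<^sub>F h in at_right 0. h powr a * c < e"
  by (rule order_tendstoD(2)) (use assms(2) in simp)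
 then show ?thesis by (rule eventually_at_right_0D)
qed

section \<open>The averaged and truncated velocity\<close>

context transport begin

definition ut :: "real => real => real => 3 => real \<times> R3 => real" where
 "ut h \<tau> \<beta> j z = truncate h \<beta> (cell_average_setting.avg (td h \<tau>) (\<tau> * h ^ 3) (w j) z)"

lemma ut_measurable[measurable]:
 assumes "0 < h" "0 < \<tau>"
 shows "ut h \<tau> \<beta> j \<in> borel_fn"
proof -
 interpret cell_average_setting "td h \<tau>" "\<tau> * h ^ 3" by (rule spacetime_cell_average_setting[OF assms])
 show ?thesis unfolding ut_def[abs_def] by measurable
qed

lemma ut_const_on_cells:
 assumes "0 < h" "0 < \<tau>" "s \<in> {\<tau> * real n..<\<tau> * real (Suc n)}"
 shows "ut h \<tau> \<beta> j (s, y) = ut h \<tau> \<beta> j (\<tau> * real n, y)"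
proof -
 interpret cell_average_setting "td h \<tau>" "\<tau> * h ^ 3" by (rule spacetime_cell_average_setting[OF assms(1,2)])
 have "\<lfloor>s / \<tau>\<rfloor> = int n" "\<lfloor>\<tau> * real n / \<tau>\<rfloor> = int n"
  using floor_cell[OF assms(2), of s "int n"] assms(2,3) by (auto simp: algebra_simps)
 then have "td h \<tau> (s, y) = td h \<tau> (\<tau> * real n, y)" by (simp add: td_def)
 then show ?thesis unfolding ut_def by (metis avg_cong_cell)
qed

lemma ut_nn_integral:
 assumes "0 < h" "0 < \<tau>"
 shows "(NNINT z. ennreal \<bar>ut h \<tau> \<beta> j z\<bar>) <= ennreal (T * V)"
proof -
 interpret cell_average_setting "td h \<tau>" "\<tau> * h ^ 3" by (rule spacetime_cell_average_setting[OF assms])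
 have "(NNINT z. ennreal \<bar>ut h \<tau> \<beta> j z\<bar>) <= (NNINT z. ennreal \<bar>avg (w j) z\<bar>)"
  unfolding ut_def using truncate_abs_le(1)[OF assms(1)] by (intro nn_integral_mono ennreal_leI)
 also have "\<dots> <= (NNINT z. ennreal \<bar>w j z\<bar>)" by (rule avg_L1_le) measurable
 finally show ?thesis using w_nn_integral[of j] by (rule order_trans)
qed

lemma avg_square_nn_integral:
 assumes "cell_average_setting (q :: real \<times> R3 => real \<times> R3) m" "integrable lborel u" "integrable lborel (%z. (u z)\<^sup>2)"
 shows "(NNINT z. ennreal ((cell_average_setting.avg q m u z)\<^sup>2)) <= (NNINT z. ennreal ((u z)\<^sup>2))"
proof -
 interpret cell_average_setting q m by fact
 have "(NNINT z. ennreal ((avg u z)\<^sup>2)) <= (NNINT z. ennreal \<bar>avg (%z. (u z)\<^sup>2) z\<bar>)"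
  using avg_square_le[OF assms(2,3)] by (intro nn_integral_mono ennreal_leI) (simp add: abs_le_iff order_trans[OF _ abs_ge_self])
 also have "\<dots> <= (NNINT z. ennreal \<bar>(u z)\<^sup>2\<bar>)" using assms(3) by (intro avg_L1_le) auto
 finally show ?thesis by simp
qed

text \<open>Averaging converges in L1, and truncation adds at most h^\<beta> times the energy of the
  average, which by Jensen is at most the energy T V of w. Only the averaging error needs a small
  \<tau>.\<close>

lemma ut_close:
 assumes "0 < \<beta>" "0 < e"
 shows "\<exists>d>0. \<forall>h \<tau> j. 0 < h \<and> h < d \<and> 0 < \<tau> \<and> \<tau> < d --> (NNINT z. ennreal \<bar>w j z - ut h \<tau> \<beta> j z\<bar>) <= ennreal e"
proof -
 have "\<forall>j. \<exists>d>0. \<forall>h \<tau>. 0 < h \<and> h < d \<and> 0 < \<tau> \<and> \<tau> < d -->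
   (NNINT x. ennreal \<bar>cell_average_setting.avg (td h \<tau>) (\<tau> * h ^ 3) (w j) x - w j x\<bar>) <= ennreal (e / 2)"
  using spacetime_average_tendsto[OF w_integrable(1)] assms by simp
 from choice[OF this] obtain D where D: "\<forall>j. 0 < D j \<and> (\<forall>h \<tau>. 0 < h \<and> h < D j \<and> 0 < \<tau> \<and> \<tau> < D j -->
   (NNINT x. ennreal \<bar>cell_average_setting.avg (td h \<tau>) (\<tau> * h ^ 3) (w j) x - w j x\<bar>) <= ennreal (e / 2))"
  by blast
 obtain d0 where d0: "0 < d0" "\<And>h. 0 < h ==> h < d0 ==> h powr \<beta> * (T * V) < e / 2"
  using powr_small[OF assms(1) half_gt_zero[OF assms(2)]] by metis
 define d where "d = Min (insert d0 (range D))"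
 have d: "0 < d" "d <= d0" using D d0(1) by (auto simp: d_def)
 have dD: "d <= D j" for j unfolding d_def by (rule Min_le) auto
 have "(NNINT z. ennreal \<bar>w j z - ut h \<tau> \<beta> j z\<bar>) <= ennreal e" if h: "0 < h" "h < d" and t: "0 < \<tau>" "\<tau> < d" for h \<tau> j
 proof -
  interpret cell_average_setting "td h \<tau>" "\<tau> * h ^ 3" by (rule spacetime_cell_average_setting[OF h(1) t(1)])
  note [measurable] = ut_measurable[OF h(1) t(1)]
  have "(NNINT z. ennreal \<bar>w j z - ut h \<tau> \<beta> j z\<bar>)
   <= (NNINT z. ennreal \<bar>avg (w j) z - w j z\<bar> + ennreal (h powr \<beta>) * ennreal ((avg (w j) z)\<^sup>2))"
  proof (rule nn_integral_mono)
   fix z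
   have "\<bar>w j z - ut h \<tau> \<beta> j z\<bar> <= \<bar>avg (w j) z - w j z\<bar> + h powr \<beta> * (avg (w j) z)\<^sup>2"
    using truncate_error_le[OF h(1), of \<beta> "avg (w j) z"] unfolding ut_def by linarith
   then show "ennreal \<bar>w j z - ut h \<tau> \<beta> j z\<bar> <= ennreal \<bar>avg (w j) z - w j z\<bar> + ennreal (h powr \<beta>) * ennreal ((avg (w j) z)\<^sup>2)"
    by (simp add: ennreal_leI flip: ennreal_mult ennreal_plus)
  qed
  also have "\<dots> = (NNINT z. ennreal \<bar>avg (w j) z - w j z\<bar>) + ennreal (h powr \<beta>) * (NNINT z. ennreal ((avg (w j) z)\<^sup>2))"
   by (simp add: nn_integral_add nn_integral_cmult)
  also have "\<dots> <= ennreal (e / 2) + ennreal (h powr \<beta>) * ennreal (T * V)"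
  proof (intro add_mono mult_left_mono)
   show "(NNINT z. ennreal \<bar>avg (w j) z - w j z\<bar>) <= ennreal (e / 2)"
    using D[rule_format, of j] h t dD[of j] by simp
   show "(NNINT z. ennreal ((avg (w j) z)\<^sup>2)) <= ennreal (T * V)"
    by (rule order_trans[OF avg_square_nn_integral[OF cell_average_setting_axioms w_integrable(1,2)] w_nn_integral_square])
  qed auto
  also have "\<dots> = ennreal (e / 2 + h powr \<beta> * (T * V))"
   using params assms by (simp flip: ennreal_mult ennreal_plus)
  also have "\<dots> <= ennreal e" using d0(2)[of h] h d by (intro ennreal_leI) simp
  finally show ?thesis .
 qed
 then show ?thesis using d(1) by blast
qed

text \<open>Averaging commutes with grid shifts. So without truncation the discrete divergence is
  the average of the difference quotients of w, and \<open>w_quotient\<close> makes it small. What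
  truncation changes is a difference quotient of truncation errors, bounded by h^\<beta> times
  squares of averaged difference quotients and of averages. These have bounded integrals, as w has a
  square integrable gradient.\<close>

lemma ut_div_small:
 assumes "0 < \<beta>" "0 < e"
 shows "\<exists>d>0. \<forall>h \<tau>. 0 < h \<and> h < d \<and> 0 < \<tau> -->
  (NNINT z. ennreal \<bar>discrete_div h (%j y. ut h \<tau> \<beta> j (fst z, y)) (snd z)\<bar>) <= ennreal e"
proof -
 obtain d1 where d1: "0 < d1" "\<And>h. 0 < h ==> h < d1 ==>
  (NNINT z. ennreal \<bar>\<Sum>j\<in>UNIV. (w j (z + (0, h *\<^sub>R axis j 1)) - w j (z - (0, h *\<^sub>R axis j 1))) / (2 * h)\<bar>) <= ennreal (e / 2)"
  using w_quotient[of "e / 2"] assms by auto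
 \<comment> \<open>Three components, each with the energy of the difference quotient and that of the
   two shifted averages.\<close>
 let ?c = "3 * (\<Gamma> + (T * V + T * V))"
 obtain d0 where d0: "0 < d0" "\<And>h. 0 < h ==> h < d0 ==> h powr \<beta> * ?c < e / 2"
  using powr_small[OF assms(1) half_gt_zero[OF assms(2)]] by metis
 have "(NNINT z. ennreal \<bar>discrete_div h (%j y. ut h \<tau> \<beta> j (fst z, y)) (snd z)\<bar>) <= ennreal e"
  if h: "0 < h" "h < min d0 d1" and t: "0 < \<tau>" for h \<tau>
 proof -
  interpret cell_average_setting "td h \<tau>" "\<tau> * h ^ 3" by (rule spacetime_cell_average_setting[OF h(1) t])
  define x where "x j = (0 :: real, h *\<^sub>R axis j 1 :: R3)" for j
  have sh: "td h \<tau> (z + x j) = td h \<tau> z + x j" "td h \<tau> (z + - x j) = td h \<tau> z + - x j" for z j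
   using td_add[OF h(1) axis_in_grid(1)] td_add[OF h(1) axis_in_grid(2), where z=z] by (simp_all add: x_def)
  have wsh: "integrable lborel (%z. w j (z + a))" "(%z. w j (z + a)) \<in> borel_fn" for j a
  proof -
   show m: "(%z. w j (z + a)) \<in> borel_fn" by (rule measurable_compose[OF _ w_meas]) simp
   show "integrable lborel (%z. w j (z + a))"
    using w_nn_integral[of j] nn_integral_lborel_shift[of "%z. ennreal \<bar>w j z\<bar>" a] m
    by (intro integrable_of_nn_integral_le[where c="T * V"]) auto
  qed
  let ?U = "%j. avg (w j)"
  define Q where "Q j z = (w j (z + x j) - w j (z + - x j)) / (2 * h)" for j z
  have Qm[measurable]: "Q j \<in> borel_fn" for j
   unfolding Q_def[abs_def] using wsh(2) by measurable
  have Qi: "integrable lborel (Q j)" for j unfolding Q_def[abs_def]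
   by (intro integrable_divide_zero Bochner_Integration.integrable_diff wsh(1))
  have Q2: "(NNINT z. ennreal ((Q j z)\<^sup>2)) <= ennreal \<Gamma>" for j
  proof -
   \<comment> \<open>Shifting by h turns the central quotient into a forward one of step 2h, to
     which \<open>w_grad\<close> applies; the factors 4h^2 cancel.\<close>
   have "(NNINT z. ennreal ((Q j z)\<^sup>2)) = (NNINT z. ennreal ((Q j (z + x j))\<^sup>2))"
    by (rule nn_integral_lborel_shift[symmetric]) measurable
   also have "\<dots> = (NNINT z. ennreal (1 / (4 * h\<^sup>2)) * ennreal ((w j (z + (0, (2 * h) *\<^sub>R axis j 1)) - w j z)\<^sup>2))"
   proof (rule nn_integral_cong)
    fix z
    have "z + x j + x j = z + (0, (2 * h) *\<^sub>R axis j 1)"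
     unfolding x_def mult_2 scaleR_add_left by (cases z) simp
    then have "(Q j (z + x j))\<^sup>2 = 1 / (4 * h\<^sup>2) * (w j (z + (0, (2 * h) *\<^sub>R axis j 1)) - w j z)\<^sup>2"
     unfolding Q_def \<open>z + x j + x j = _\<close> by (simp add: power_divide power_mult_distrib)
    then show "ennreal ((Q j (z + x j))\<^sup>2) = ennreal (1 / (4 * h\<^sup>2)) * ennreal ((w j (z + (0, (2 * h) *\<^sub>R axis j 1)) - w j z)\<^sup>2)"
     by (simp only: ennreal_mult zero_le_power2 zero_le_divide_1_iff mult_nonneg_nonneg zero_le_numeral)
   qed
   also have "\<dots> = ennreal (1 / (4 * h\<^sup>2)) * (NNINT z. ennreal ((w j (z + (0, (2 * h) *\<^sub>R axis j 1)) - w j z)\<^sup>2))"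
    by (rule nn_integral_cmult) (use wsh(2) in measurable)
   also have "\<dots> <= ennreal (1 / (4 * h\<^sup>2)) * ennreal ((norm ((2 * h) *\<^sub>R axis j 1 :: R3))\<^sup>2 * \<Gamma>)"
    by (intro mult_left_mono w_grad) auto
   also have "\<dots> = ennreal \<Gamma>"
    using h params by (simp add: power_mult_distrib norm_axis_1 flip: ennreal_mult)
   finally show ?thesis .
  qed
  have Qsq: "integrable lborel (%z. (Q j z)\<^sup>2)" for j
   using Q2[of j] by (intro integrable_of_nn_integral_le[where c=\<Gamma>]) auto
  have avgQ: "avg (Q j) z = (?U j (z + x j) - ?U j (z + - x j)) / (2 * h)" for j z
  proof -
   have "avg (Q j) z = avg (%z. (1 / (2 * h)) * (w j (z + x j) - w j (z + - x j))) z"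
    by (simp add: Q_def[abs_def])
   also have "\<dots> = (1 / (2 * h)) * (avg (%z. w j (z + x j)) z - avg (%z. w j (z + - x j)) z)"
    by (simp only: avg_cmult avg_diff[OF wsh(1) wsh(1)])
   also have "\<dots> = (1 / (2 * h)) * (?U j (z + x j) - ?U j (z + - x j))"
    by (simp only: avg_shift[OF sh(1) w_meas] avg_shift[OF sh(2) w_meas])
   finally show ?thesis by simp
  qed
  have pointwise: "\<bar>discrete_div h (%j y. ut h \<tau> \<beta> j (fst z, y)) (snd z)\<bar>
   <= \<bar>avg (%z. \<Sum>j\<in>UNIV. Q j z) z\<bar> + (\<Sum>j\<in>UNIV. h powr \<beta> * ((avg (Q j) z)\<^sup>2 + ((?U j (z + x j))\<^sup>2 + (?U j (z + - x j))\<^sup>2)))" for z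
  proof -
   let ?t = "%j a. truncate h \<beta> a" and ?a = "%j. ?U j (z + x j)" and ?b = "%j. ?U j (z + - x j)"
   have "discrete_div h (%j y. ut h \<tau> \<beta> j (fst z, y)) (snd z) = (\<Sum>j\<in>UNIV. (truncate h \<beta> (?a j) - truncate h \<beta> (?b j)) / (2 * h))"
    by (cases z) (simp add: discrete_div_def ut_def x_def)
   also have "\<dots> = (\<Sum>j\<in>UNIV. avg (Q j) z) - (\<Sum>j\<in>UNIV. ((?a j - truncate h \<beta> (?a j)) - (?b j - truncate h \<beta> (?b j))) / (2 * h))"
    by (simp add: avgQ sum_subtractf[symmetric] diff_divide_distrib)
   also have "(\<Sum>j\<in>UNIV. avg (Q j) z) = avg (%z. \<Sum>j\<in>UNIV. Q j z) z" by (rule avg_sum[symmetric]) (rule Qi)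
   finally have "\<bar>discrete_div h (%j y. ut h \<tau> \<beta> j (fst z, y)) (snd z)\<bar> <= \<bar>avg (%z. \<Sum>j\<in>UNIV. Q j z) z\<bar>
     + (\<Sum>j\<in>UNIV. \<bar>((?a j - truncate h \<beta> (?a j)) - (?b j - truncate h \<beta> (?b j))) / (2 * h)\<bar>)"
    using sum_abs[of "%j. ((?a j - truncate h \<beta> (?a j)) - (?b j - truncate h \<beta> (?b j))) / (2 * h)" UNIV] by linarith
   moreover have "\<bar>((?a j - truncate h \<beta> (?a j)) - (?b j - truncate h \<beta> (?b j))) / (2 * h)\<bar>
     <= h powr \<beta> * ((avg (Q j) z)\<^sup>2 + ((?a j)\<^sup>2 + (?b j)\<^sup>2))" for j
   proof -
    define a b where "a = ?a j" and "b = ?b j"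
    have "\<bar>((a - truncate h \<beta> a) - (b - truncate h \<beta> b)) / (2 * h)\<bar> <= \<bar>a - b\<bar> * (h powr \<beta> * (\<bar>a\<bar> + \<bar>b\<bar>)) / (2 * h)"
     using truncate_error_Lipschitz[OF h(1), of a \<beta> b] h(1) by (simp add: abs_divide divide_right_mono)
    also have "\<dots> = h powr \<beta> * (\<bar>(a - b) / (2 * h)\<bar> * (\<bar>a\<bar> + \<bar>b\<bar>))" using h(1) by (simp add: abs_divide)
    also have "\<dots> <= h powr \<beta> * (((a - b) / (2 * h))\<^sup>2 + (a\<^sup>2 + b\<^sup>2))"
    proof (rule mult_left_mono)
     have "p * (A + B) <= p\<^sup>2 + (A\<^sup>2 + B\<^sup>2)" for p A B :: real
     proof -
      have "2 * (p\<^sup>2 + (A\<^sup>2 + B\<^sup>2) - p * (A + B)) = (p - (A + B))\<^sup>2 + (A - B)\<^sup>2 + p\<^sup>2"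
       by (simp add: power2_eq_square algebra_simps)
      also have "0 <= \<dots>" by simp
      finally show ?thesis by simp
     qed
     from this[of "\<bar>(a - b) / (2 * h)\<bar>" "\<bar>a\<bar>" "\<bar>b\<bar>"]
     show "\<bar>(a - b) / (2 * h)\<bar> * (\<bar>a\<bar> + \<bar>b\<bar>) <= ((a - b) / (2 * h))\<^sup>2 + (a\<^sup>2 + b\<^sup>2)"
      by (simp only: power2_abs)
    qed simp
    finally show ?thesis unfolding avgQ a_def b_def .
   qed
   ultimately show ?thesis by (smt (verit) sum_mono)
  qed
  have [measurable]: "(%z. ?U j (z + a)) \<in> borel_fn" for j a
   by (rule measurable_compose[of "%z. z + a" borel borel "?U j"]) auto
  have Usq: "(NNINT z. ennreal ((?U j (z + a))\<^sup>2)) <= ennreal (T * V)" for j a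
   using order_trans[OF avg_square_nn_integral[OF cell_average_setting_axioms w_integrable(1,2)] w_nn_integral_square]
    nn_integral_lborel_shift[of "%z. ennreal ((?U j z)\<^sup>2)" a] by simp
  have "(NNINT z. ennreal \<bar>discrete_div h (%j y. ut h \<tau> \<beta> j (fst z, y)) (snd z)\<bar>)
   <= (NNINT z. ennreal \<bar>avg (%z. \<Sum>j\<in>UNIV. Q j z) z\<bar> + (\<Sum>j\<in>UNIV. ennreal (h powr \<beta>) *
     (ennreal ((avg (Q j) z)\<^sup>2) + (ennreal ((?U j (z + x j))\<^sup>2) + ennreal ((?U j (z + - x j))\<^sup>2)))))"
  proof (rule nn_integral_mono)
   fix z
   have "ennreal \<bar>discrete_div h (%j y. ut h \<tau> \<beta> j (fst z, y)) (snd z)\<bar> <= ennreal (\<bar>avg (%z. \<Sum>j\<in>UNIV. Q j z) z\<bar>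
     + (\<Sum>j\<in>UNIV. h powr \<beta> * ((avg (Q j) z)\<^sup>2 + ((?U j (z + x j))\<^sup>2 + (?U j (z + - x j))\<^sup>2))))"
    by (rule ennreal_leI[OF pointwise])
   also have "\<dots> = ennreal \<bar>avg (%z. \<Sum>j\<in>UNIV. Q j z) z\<bar> + (\<Sum>j\<in>UNIV. ennreal (h powr \<beta>) *
     (ennreal ((avg (Q j) z)\<^sup>2) + (ennreal ((?U j (z + x j))\<^sup>2) + ennreal ((?U j (z + - x j))\<^sup>2))))"
    by (simp add: ennreal_plus sum_nonneg sum_ennreal[symmetric] ennreal_mult del: sum_ennreal)
   finally show "ennreal \<bar>discrete_div h (%j y. ut h \<tau> \<beta> j (fst z, y)) (snd z)\<bar> <= \<dots>" .
  qed
  also have "\<dots> = (NNINT z. ennreal \<bar>avg (%z. \<Sum>j\<in>UNIV. Q j z) z\<bar>) + (\<Sum>j\<in>UNIV. ennreal (h powr \<beta>) *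
     ((NNINT z. ennreal ((avg (Q j) z)\<^sup>2)) + ((NNINT z. ennreal ((?U j (z + x j))\<^sup>2)) + (NNINT z. ennreal ((?U j (z + - x j))\<^sup>2)))))"
   by (simp add: nn_integral_add nn_integral_sum nn_integral_cmult)
  also have "\<dots> <= ennreal (e / 2) + (\<Sum>j\<in>(UNIV::3 set). ennreal (h powr \<beta>) * (ennreal \<Gamma> + (ennreal (T * V) + ennreal (T * V))))"
  proof (intro add_mono sum_mono mult_left_mono Usq)
   have "(NNINT z. ennreal \<bar>avg (%z. \<Sum>j\<in>UNIV. Q j z) z\<bar>) <= (NNINT z. ennreal \<bar>\<Sum>j\<in>UNIV. Q j z\<bar>)"
    by (rule avg_L1_le) measurable
   also have "\<dots> <= ennreal (e / 2)"
   proof -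
    have Qz: "Q j z = (w j (z + (0, h *\<^sub>R axis j 1)) - w j (z - (0, h *\<^sub>R axis j 1))) / (2 * h)" for j z
     unfolding Q_def x_def by (simp only: add_uminus_conv_diff)
    show ?thesis unfolding Qz using d1(2)[of h] h by simp
   qed
   finally show "(NNINT z. ennreal \<bar>avg (%z. \<Sum>j\<in>UNIV. Q j z) z\<bar>) <= ennreal (e / 2)" .
   show "(NNINT z. ennreal ((avg (Q j) z)\<^sup>2)) <= ennreal \<Gamma>" for j
    using avg_square_nn_integral[OF cell_average_setting_axioms Qi Qsq] Q2 by (rule order_trans)
  qed auto
  also have "\<dots> = ennreal (e / 2 + h powr \<beta> * ?c)"
  proof -
   have "ennreal (h powr \<beta>) * (ennreal \<Gamma> + (ennreal (T * V) + ennreal (T * V))) = ennreal (h powr \<beta> * (\<Gamma> + (T * V + T * V)))"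
    using params by (simp flip: ennreal_mult ennreal_plus)
   then show ?thesis using params assms
    by (simp add: mult_ac flip: ennreal_mult ennreal_plus ennreal_numeral)
  qed
  also have "\<dots> <= ennreal e" using d0(2)[of h] h by (intro ennreal_leI) simp
  finally show ?thesis .
 qed
 then show ?thesis using d0(1) d1(1) by (intro exI[of _ "min d0 d1"]) auto
qed

end

section \<open>Consistency of one step and accumulation of the error\<close>

context transport begin

context
 fixes C0 \<epsilon> C h \<tau> \<beta> B :: real and \<rho> :: "R3 => real"
 assumes \<rho>: "mollifier C0 \<epsilon> \<rho>" and C: "0 <= C"
  and h: "0 < h" "h <= 1" and \<tau>: "0 < \<tau>"
  and F_time: "\<And>s t x. 0 <= s ==> s <= t ==> \<bar>F \<rho> t x - F \<rho> s x\<bar> <= C * (t - s)"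
  and F_second: "\<And>t x j. 0 <= t ==> \<bar>F \<rho> t (x + h *\<^sub>R axis j 1) - 2 * F \<rho> t x + F \<rho> t (x - h *\<^sub>R axis j 1)\<bar> <= C * h\<^sup>2"
  and DF_bound: "\<And>t x j. 0 <= t ==> \<bar>DF h j \<rho> t x\<bar> <= C"
  and DF_time: "\<And>s t x j. 0 <= s ==> s <= t ==> \<bar>DF h j \<rho> t x - DF h j \<rho> s x\<bar> <= C * (t - s)"
  and DF_close: "\<And>j. AE z in lborel. fst z \<in> {0..T} --> \<bar>DF h j \<rho> (fst z) (snd z) + conv_grad \<rho> j z\<bar> <= C * h"
begin

text \<open>The mollified solution lives in the ball of radius R + \<epsilon>. The additional 1
  makes room for its neighbours at distance h <= 1, so the viscosity vanishes outside this
  ball.\<close>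

definition far_ind :: "R3 => ennreal" where
 "far_ind y = indicator (cball 0 (R + \<epsilon> + 1)) y"

text \<open>A space-time density for the consistency error. The terms are, in order: viscosity,
  commutator, central quotient against gradient, true against discrete velocity, and the central
  quotient frozen at the start of the step against its value at the running time.\<close>

definition dens :: "real \<times> R3 => ennreal" where
 "dens z = ennreal (C * h\<^sup>2 / \<tau>) * far_ind (snd z) + (ennreal \<bar>cmt \<rho> z\<bar>
   + (\<Sum>j\<in>UNIV. ennreal (C * h) * ennreal \<bar>w j z\<bar> + (ennreal C * ennreal \<bar>w j z - ut h \<tau> \<beta> j z\<bar>
     + ennreal (C * \<tau>) * ennreal \<bar>ut h \<tau> \<beta> j z\<bar>)))"

definition dvg :: "real \<times> R3 => ennreal" where
 "dvg z = ennreal \<bar>discrete_div h (%j y. ut h \<tau> \<beta> j (fst z, y)) (snd z)\<bar>"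

lemma far_ind_measurable:
 "far_ind \<in> borel_fn" "(%z :: real \<times> R3. far_ind (snd z)) \<in> borel_fn"
proof -
 show "far_ind \<in> borel_fn" unfolding far_ind_def[abs_def] by (rule borel_measurable_indicator) simp
 from measurable_compose[OF fst_snd_borel_measurable(2) this]
 show "(%z :: real \<times> R3. far_ind (snd z)) \<in> borel_fn" .
qed

lemma dens_measurable: "dens \<in> borel_fn"
proof -
 note [measurable] = far_ind_measurable ut_measurable[OF h(1) \<tau>] cmt_measurable[OF \<rho>]
 show ?thesis unfolding dens_def by measurable
qed

lemma dvg_measurable: "dvg \<in> borel_fn"
proof -
 have "(%z::real \<times> R3. (fst z, snd z + a)) \<in> borel_fn" for a
  by (intro borel_measurable_continuous_onI continuous_intros)
 from measurable_compose[OF this ut_measurable[OF h(1) \<tau>]]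
 have *: "(%z. ut h \<tau> \<beta> j (fst z, snd z + a)) \<in> borel_fn" for a j by simp
 note [measurable] = *[of _ "h *\<^sub>R axis _ 1"] *[of _ "- (h *\<^sub>R axis _ 1)", simplified]
 show ?thesis unfolding dvg_def discrete_div_def by measurable
qed

lemma time_ind_measurable: "(%z :: real \<times> R3. indicator {a..<b} (fst z) :: ennreal) \<in> borel_fn"
 by (rule measurable_compose[OF fst_snd_borel_measurable(1)]) simp

abbreviation "tn n \<equiv> \<tau> * real n"

text \<open>The integrand over one time step of the residual, apart from viscosity. The time
  derivative \<open>bb\<close> runs with the time of z, while the central quotient is frozen at the
  beginning of the step, as in the scheme.\<close>

definition XX :: "nat => real \<times> R3 => real" where
 "XX n z = - bb \<rho> (fst z) (snd z) - (\<Sum>j\<in>UNIV. ut h \<tau> \<beta> j z * DF h j \<rho> (tn n) (snd z))"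

lemma XX_measurable: "XX n \<in> borel_fn"
proof -
 have "(%z::real \<times> R3. (tn n, snd z)) \<in> borel_fn"
  by (intro borel_measurable_continuous_onI continuous_intros)
 from measurable_compose[OF this DF_measurable[OF mollifierD(1)[OF \<rho>]]]
 have [measurable]: "(%z::real \<times> R3. DF h j \<rho> (tn n) (snd z)) \<in> borel_fn" for j unfolding fst_conv snd_conv .
 note [measurable] = ut_measurable[OF h(1) \<tau>] bb_measurable[OF mollifierD(6)[OF \<rho>]]
 show ?thesis unfolding XX_def by measurable
qed

lemma XX_le:
 assumes "tn (Suc n) <= T"
 shows "AE z in lborel. fst z \<in> {tn n..<tn (Suc n)} -->
  ennreal (C * h\<^sup>2 / \<tau>) * far_ind (snd z) + ennreal \<bar>XX n z\<bar> <= dens z"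
proof -
 have "AE z in lborel. \<forall>j\<in>UNIV. fst z \<in> {0..T} --> \<bar>DF h j \<rho> (fst z) (snd z) + conv_grad \<rho> j z\<bar> <= C * h"
  using DF_close by (intro AE_finite_allI) auto
 then show ?thesis
 proof eventually_elim
  case (elim z)
  show ?case
  proof
   assume z: "fst z \<in> {tn n..<tn (Suc n)}"
   have tn0: "0 <= tn n" using \<tau> by simp
   then have zT: "fst z \<in> {0..T}" using z assms by auto
   let ?s = "fst z" and ?y = "snd z" and ?u = "%j. ut h \<tau> \<beta> j z"
   let ?c = "%j. DF h j \<rho> ?s ?y + conv_grad \<rho> j z"
   let ?d = "%j. DF h j \<rho> ?s ?y - DF h j \<rho> (tn n) ?y"
   \<comment> \<open>Telescoping from the discrete flux to the exact one: w against the gradient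
     gives the commutator, and three corrections exchange gradient for quotient, w for
     \<open>ut\<close>, and the running time for the grid time. Each matches one term of
     \<open>dens\<close>.\<close>
   have "XX n z = - cmt \<rho> z + (\<Sum>j\<in>UNIV. - (w j z * ?c j) + ((w j z - ?u j) * DF h j \<rho> ?s ?y + ?u j * ?d j))"
    unfolding XX_def cmt_def
    by (simp add: sum.distrib sum_subtractf sum_negf algebra_simps)
   then have "\<bar>XX n z\<bar> <= \<bar>cmt \<rho> z\<bar> + (\<Sum>j\<in>UNIV. \<bar>- (w j z * ?c j) + ((w j z - ?u j) * DF h j \<rho> ?s ?y + ?u j * ?d j)\<bar>)"
    using sum_abs[of "%j. - (w j z * ?c j) + ((w j z - ?u j) * DF h j \<rho> ?s ?y + ?u j * ?d j)" UNIV] by linarith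
   also have "\<dots> <= \<bar>cmt \<rho> z\<bar> + (\<Sum>j\<in>UNIV. (C * h) * \<bar>w j z\<bar> + (C * \<bar>w j z - ?u j\<bar> + (C * \<tau>) * \<bar>?u j\<bar>))"
   proof (intro add_left_mono sum_mono)
    fix j
    have "\<bar>w j z * ?c j\<bar> <= (C * h) * \<bar>w j z\<bar>"
     using elim[rule_format, OF UNIV_I zT, of j] unfolding abs_mult
     by (subst mult.commute) (intro mult_right_mono abs_ge_zero)
    moreover have "\<bar>(w j z - ?u j) * DF h j \<rho> ?s ?y\<bar> <= C * \<bar>w j z - ?u j\<bar>"
     using DF_bound[of ?s j ?y] zT unfolding abs_mult
     by (subst mult.commute) (intro mult_right_mono abs_ge_zero, simp)
    moreover have "\<bar>?u j * ?d j\<bar> <= (C * \<tau>) * \<bar>?u j\<bar>"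
    proof -
     have "\<bar>?d j\<bar> <= C * (?s - tn n)" using z tn0 by (intro DF_time) auto
     also have "\<dots> <= C * \<tau>" using z C by (intro mult_left_mono) (auto simp: algebra_simps)
     finally show ?thesis unfolding abs_mult by (subst mult.commute) (intro mult_right_mono abs_ge_zero)
    qed
    ultimately show "\<bar>- (w j z * ?c j) + ((w j z - ?u j) * DF h j \<rho> ?s ?y + ?u j * ?d j)\<bar>
      <= (C * h) * \<bar>w j z\<bar> + (C * \<bar>w j z - ?u j\<bar> + (C * \<tau>) * \<bar>?u j\<bar>)"
     by linarith
   qed
   finally have "ennreal \<bar>XX n z\<bar> <= ennreal \<dots>" by (rule ennreal_leI)
   also have "\<dots> = ennreal \<bar>cmt \<rho> z\<bar>
     + (\<Sum>j\<in>UNIV. ennreal (C * h) * ennreal \<bar>w j z\<bar> + (ennreal C * ennreal \<bar>w j z - ?u j\<bar> + ennreal (C * \<tau>) * ennreal \<bar>?u j\<bar>))"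
    using C h \<tau> by (simp add: ennreal_plus sum_nonneg sum_ennreal[symmetric] ennreal_mult del: sum_ennreal)
   finally show "ennreal (C * h\<^sup>2 / \<tau>) * far_ind (snd z) + ennreal \<bar>XX n z\<bar> <= dens z"
    unfolding dens_def by (rule add_left_mono)
  qed
 qed
qed

text \<open>The mean over seven points is F plus 1/7 of its second differences, which are the
  viscosity. The remaining drift over a step is compared with the exact time increment of F under
  one integral over the step. The viscosity, being constant in time, is spread over the step too;
  this produces the quotient h^2/\<tau>.\<close>

lemma residual_pointwise:
 shows "ennreal \<bar>scheme_step h \<tau> (%j y. ut h \<tau> \<beta> j (tn n, y)) (F \<rho> (tn n)) y - F \<rho> (tn (Suc n)) y\<bar>
  <= (NNINT s. indicator {tn n..<tn (Suc n)} s * (ennreal (C * h\<^sup>2 / \<tau>) * far_ind y + ennreal \<bar>XX n (s, y)\<bar>))"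
proof -
 let ?a = "%j. ut h \<tau> \<beta> j (tn n, y)" and ?F = "F \<rho> (tn n)" and ?I = "{tn n<..tn (Suc n)}"
 let ?x = "%j. h *\<^sub>R axis j 1 :: R3"
 define c where "c = (\<Sum>j\<in>UNIV. ?a j * DF h j \<rho> (tn n) y)"
 define visc where "visc = 1 / 7 * (\<Sum>j\<in>UNIV. ?F (y + ?x j) - 2 * ?F y + ?F (y - ?x j))"
 have tn: "0 <= tn n" "tn n <= tn (Suc n)" "tn (Suc n) - tn n = \<tau>" using \<tau> by (auto simp: algebra_simps)
 note int = F_time_integral[OF \<rho> tn(1,2), of y]
 have cint: "integrable lborel (%s. indicator ?I s * c)" "(RINT s. indicator ?I s * c) = \<tau> * c"
  using tn by auto
 have "scheme_step h \<tau> (%j y. ut h \<tau> \<beta> j (tn n, y)) ?F y = ?F y + visc - \<tau> * c"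
 proof -
  have "(\<Sum>j\<in>UNIV. ?F (y + ?x j) - 2 * ?F y + ?F (y - ?x j)) = (\<Sum>j\<in>UNIV. ?F (y + ?x j) + ?F (y - ?x j)) - 6 * ?F y"
   by (simp add: sum.distrib sum_subtractf)
  then show ?thesis unfolding scheme_step_def visc_def c_def DF_def by (simp add: field_simps)
 qed
 moreover have "F \<rho> (tn (Suc n)) y = ?F y + (RINT s. indicator ?I s * bb \<rho> s y)" using int(1) by simp
 moreover have "(RINT s. indicator ?I s * (- bb \<rho> s y - c)) = - (RINT s. indicator ?I s * bb \<rho> s y) - \<tau> * c"
 proof -
  have "(RINT s. indicator ?I s * (- bb \<rho> s y - c)) = (RINT s. - (indicator ?I s * bb \<rho> s y) - indicator ?I s * c)"
   by (intro Bochner_Integration.integral_cong refl) (simp add: right_diff_distrib)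
  then show ?thesis using int(2) cint by simp
 qed
 ultimately have eq: "scheme_step h \<tau> (%j y. ut h \<tau> \<beta> j (tn n, y)) ?F y - F \<rho> (tn (Suc n)) y
   = visc + (RINT s. indicator ?I s * (- bb \<rho> s y - c))" by simp
 have visc: "ennreal \<bar>visc\<bar> <= ennreal (C * h\<^sup>2) * far_ind y"
 proof (cases "norm y <= R + \<epsilon> + 1")
  case True
  have "\<bar>visc\<bar> <= 1 / 7 * (\<Sum>j\<in>(UNIV :: 3 set). C * h\<^sup>2)"
   unfolding visc_def abs_mult using F_second[OF tn(1)]
   by (intro mult_mono order_trans[OF sum_abs] sum_mono) auto
  also have "\<dots> <= C * h\<^sup>2" using C by simp
  finally show ?thesis using True by (simp add: far_ind_def ennreal_leI)
 next
  case False
  have "R + \<epsilon> < norm (y + ?x j)" "R + \<epsilon> < norm (y - ?x j)" for j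
   using norm_diff_ineq[of y "?x j"] norm_triangle_ineq2[of y "?x j"] h False by auto
  then have "visc = 0" using False unfolding visc_def by (simp add: F_support[OF \<rho>])
  then show ?thesis by simp
 qed
 have "ennreal \<bar>RINT s. indicator ?I s * (- bb \<rho> s y - c)\<bar> <= (NNINT s. ennreal \<bar>indicator ?I s * (- bb \<rho> s y - c)\<bar>)"
  by (rule abs_integral_le_nn_integral)
 also have "\<dots> = (NNINT s. indicator {tn n..<tn (Suc n)} s * ennreal \<bar>XX n (s, y)\<bar>)"
 proof (rule nn_integral_cong_AE)
  \<comment> \<open>The time increment of F comes with an interval open on the left, whereas the
    velocity is constant on one open on the right. They differ by two points.\<close>
  have "AE s in lborel. s \<noteq> tn n" "AE s in lborel. s \<noteq> tn (Suc n)" by (rule AE_lborel_singleton)+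
  then show "AE s in lborel. ennreal \<bar>indicator ?I s * (- bb \<rho> s y - c)\<bar> = indicator {tn n..<tn (Suc n)} s * ennreal \<bar>XX n (s, y)\<bar>"
  proof eventually_elim
   case (elim s)
   show ?case
   proof (cases "s \<in> {tn n..<tn (Suc n)}")
    case True
    then have "s \<in> ?I" using elim by auto
    moreover have "XX n (s, y) = - bb \<rho> s y - c"
     using ut_const_on_cells[OF h(1) \<tau> True] by (simp add: XX_def c_def)
    ultimately show ?thesis using True by simp
   next
    case False
    then have "s \<notin> ?I" using elim by auto
    with False show ?thesis by simp
   qed
  qed
 qed
 finally have main: "ennreal \<bar>RINT s. indicator ?I s * (- bb \<rho> s y - c)\<bar> <= \<dots>" .
 have "ennreal \<bar>visc + (RINT s. indicator ?I s * (- bb \<rho> s y - c))\<bar>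
   <= ennreal \<bar>visc\<bar> + ennreal \<bar>RINT s. indicator ?I s * (- bb \<rho> s y - c)\<bar>" by (rule ennreal_abs_triangle)
 also have "\<dots> <= ennreal (C * h\<^sup>2) * far_ind y + (NNINT s. indicator {tn n..<tn (Suc n)} s * ennreal \<bar>XX n (s, y)\<bar>)"
  by (rule add_mono[OF visc main])
 also have "ennreal (C * h\<^sup>2) * far_ind y = (NNINT s. indicator {tn n..<tn (Suc n)} s * (ennreal (C * h\<^sup>2 / \<tau>) * far_ind y))"
 proof -
  have "(NNINT s. indicator {tn n..<tn (Suc n)} s * (ennreal (C * h\<^sup>2 / \<tau>) * far_ind y))
   = ennreal \<tau> * (ennreal (C * h\<^sup>2 / \<tau>) * far_ind y)"
   using tn by (subst nn_integral_multc) (auto simp del: mult_Suc_right)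
  also have "\<dots> = ennreal (C * h\<^sup>2) * far_ind y"
   using C \<tau> by (simp add: mult.assoc[symmetric] flip: ennreal_mult)
  finally show ?thesis ..
 qed
 also have "(NNINT s. indicator {tn n..<tn (Suc n)} s * (ennreal (C * h\<^sup>2 / \<tau>) * far_ind y))
   + (NNINT s. indicator {tn n..<tn (Suc n)} s * ennreal \<bar>XX n (s, y)\<bar>)
  = (NNINT s. indicator {tn n..<tn (Suc n)} s * (ennreal (C * h\<^sup>2 / \<tau>) * far_ind y) + indicator {tn n..<tn (Suc n)} s * ennreal \<bar>XX n (s, y)\<bar>)"
 proof (rule nn_integral_add[symmetric])
  have "(%s. XX n (s, y)) \<in> borel_fn"
   by (rule measurable_compose[OF _ XX_measurable]) (intro borel_measurable_continuous_onI continuous_intros)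
  then show "(%s. indicator {tn n..<tn (Suc n)} s * ennreal \<bar>XX n (s, y)\<bar>) \<in> borel_measurable lborel" by simp
 qed simp
 finally show ?thesis unfolding eq by (simp only: distrib_left)
qed

lemma residual_L1:
 assumes "tn (Suc n) <= T"
 shows "(NNINT y. ennreal \<bar>scheme_step h \<tau> (%j y. ut h \<tau> \<beta> j (tn n, y)) (F \<rho> (tn n)) y - F \<rho> (tn (Suc n)) y\<bar>)
  <= (NNINT z. indicator {tn n..<tn (Suc n)} (fst z) * dens z)"
proof -
 note [measurable] = far_ind_measurable XX_measurable time_ind_measurable
 let ?g = "%z. indicator {tn n..<tn (Suc n)} (fst z) * (ennreal (C * h\<^sup>2 / \<tau>) * far_ind (snd z) + ennreal \<bar>XX n z\<bar>)"
 have g: "?g \<in> borel_fn" by measurable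
 then have g': "?g \<in> borel_measurable (lborel \<Otimes>\<^sub>M lborel)" by (simp add: lborel_prod)
 have "(NNINT y. ennreal \<bar>scheme_step h \<tau> (%j y. ut h \<tau> \<beta> j (tn n, y)) (F \<rho> (tn n)) y - F \<rho> (tn (Suc n)) y\<bar>)
  <= (NNINT y. NNINT s. ?g (s, y))"
  unfolding fst_conv snd_conv by (intro nn_integral_mono residual_pointwise)
 also have "\<dots> = (NNINT s. NNINT y. ?g (s, y))"
  using lborel_pair.Fubini[OF g'] by simp
 also have "\<dots> = (NNINT z. ?g z)" by (rule nn_integral_lborel_time_space[OF g, symmetric])
 also have "\<dots> <= (NNINT z. indicator {tn n..<tn (Suc n)} (fst z) * dens z)"
 proof (rule nn_integral_mono_AE)
  show "AE z in lborel. ?g z <= indicator {tn n..<tn (Suc n)} (fst z) * dens z"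
   using XX_le[OF assms]
  proof eventually_elim
   case (elim z)
   then show ?case by (cases "fst z \<in> {tn n..<tn (Suc n)}") (simp_all del: mult_Suc_right of_nat_Suc)
  qed
 qed
 finally show ?thesis .
qed

text \<open>Induction over the steps. The scheme is linear, so the new error is the step applied to
  the old error plus the residual of F. The maximum principle keeps G below M, hence the error below
  B, and this bound is what converts the discrete divergence into the additive term
  \<open>B * dvg\<close>. The contributions sit on disjoint time slabs and simply add up.\<close>

lemma error_L1:
 assumes cfl: "\<tau> * h powr (- \<beta>) / (2 * h) <= 1 / 7"
  and N: "tn N <= T"
  and G0: "G 0 \<in> borel_fn" "\<And>y. \<bar>G 0 y\<bar> <= M"
  and G: "\<And>n y. n < N ==> G (Suc n) y = scheme_step h \<tau> (%j y. ut h \<tau> \<beta> j (tn n, y)) (G n) y"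
  and B: "M + C1 <= B" "\<And>t x. 0 <= t ==> \<bar>F \<rho> t x\<bar> <= C1"
  and n: "n <= N"
 shows "G n \<in> borel_fn \<and> (\<forall>y. \<bar>G n y\<bar> <= M) \<and>
  (NNINT y. ennreal \<bar>G n y - F \<rho> (tn n) y\<bar>) <= (NNINT y. ennreal \<bar>G 0 y - F \<rho> 0 y\<bar>)
   + (NNINT z. indicator {0..<tn n} (fst z) * (dens z + ennreal B * dvg z))"
 using n
proof (induction n)
 case 0
 then show ?case using G0 by simp
next
 case (Suc n)
 let ?a = "%j y. ut h \<tau> \<beta> j (tn n, y)"
 have nN: "n < N" "n <= N" using Suc.prems by auto
 from Suc.IH[OF nN(2)] have Gn[measurable]: "G n \<in> borel_fn" and bd: "\<And>y. \<bar>G n y\<bar> <= M"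
  and IH: "(NNINT y. ennreal \<bar>G n y - F \<rho> (tn n) y\<bar>) <= (NNINT y. ennreal \<bar>G 0 y - F \<rho> 0 y\<bar>)
   + (NNINT z. indicator {0..<tn n} (fst z) * (dens z + ennreal B * dvg z))" by auto
 have tn0: "0 <= tn n" "tn n <= tn (Suc n)" using \<tau> by auto
 have tT: "tn (Suc n) <= T"
 proof -
  have "tn (Suc n) <= tn N" using Suc.prems \<tau> by (intro mult_left_mono) auto
  then show ?thesis using N by linarith
 qed
 have am[measurable]: "?a j \<in> borel_fn" for j
  by (rule measurable_compose[OF _ ut_measurable[OF h(1) \<tau>]]) (intro borel_measurable_continuous_onI continuous_intros)
 have Fm[measurable]: "F \<rho> t \<in> borel_fn" for t
 proof -
  have "(%x::R3. (t, x)) \<in> borel_fn" by (intro borel_measurable_continuous_onI continuous_intros)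
  from measurable_compose[OF this F_measurable[OF mollifierD(1)[OF \<rho>]]] show ?thesis by simp
 qed
 have cfl': "\<bar>\<tau> * ?a j y / (2 * h)\<bar> <= 1 / 7" for j y
 proof -
  have "\<bar>\<tau> * ?a j y / (2 * h)\<bar> <= \<tau> * h powr (- \<beta>) / (2 * h)"
   using truncate_abs_le(2)[OF h(1)] h \<tau> unfolding ut_def by (simp add: abs_mult abs_divide divide_right_mono mult_left_mono)
  then show ?thesis using cfl by linarith
 qed
 have GS: "G (Suc n) = scheme_step h \<tau> ?a (G n)" using G[OF nN(1)] by auto
 have GSm: "G (Suc n) \<in> borel_fn"
  unfolding GS scheme_step_def by measurable
 have GSb: "\<bar>G (Suc n) y\<bar> <= M" for y
  unfolding GS by (rule scheme_step_bound[OF cfl' bd])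
 define e where "e y = G n y - F \<rho> (tn n) y" for y
 have em[measurable]: "e \<in> borel_fn" unfolding e_def[abs_def] by measurable
 have eB: "\<bar>e y\<bar> <= B" for y using bd[of y] B(2)[OF tn0(1), of y] B(1) unfolding e_def by linarith
 have B0: "0 <= B" using eB[of 0] by linarith
 have split: "G (Suc n) y - F \<rho> (tn (Suc n)) y
   = scheme_step h \<tau> ?a e y + (scheme_step h \<tau> ?a (F \<rho> (tn n)) y - F \<rho> (tn (Suc n)) y)" for y
 proof -
  have "scheme_step h \<tau> ?a e y = scheme_step h \<tau> ?a (G n) y - scheme_step h \<tau> ?a (F \<rho> (tn n)) y"
   unfolding scheme_step_monotone_form e_def
   by (simp only: right_diff_distrib sum.distrib sum_subtractf)
  then show ?thesis by (simp add: GS)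
 qed
 \<comment> \<open>The discrete velocity is constant in time on a step, so \<tau> times the spatial
   integral is the space-time integral over the slab.\<close>
 have div: "ennreal (\<tau> * B) * (NNINT y. ennreal \<bar>discrete_div h ?a y\<bar>)
   = (NNINT z. indicator {tn n..<tn (Suc n)} (fst z) * (ennreal B * dvg z))"
 proof -
  have "(NNINT z. indicator {tn n..<tn (Suc n)} (fst z) * (ennreal B * dvg z))
   = (NNINT s. NNINT y. indicator {tn n..<tn (Suc n)} s * (ennreal B * dvg (s, y)))"
   using nn_integral_lborel_time_space[of "%z. indicator {tn n..<tn (Suc n)} (fst z) * (ennreal B * dvg z)"]
    dvg_measurable time_ind_measurable by simp
  also have "\<dots> = (NNINT s. indicator {tn n..<tn (Suc n)} s * (ennreal B * (NNINT y. ennreal \<bar>discrete_div h ?a y\<bar>)))"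
  proof (rule nn_integral_cong)
   fix s
   show "(NNINT y. indicator {tn n..<tn (Suc n)} s * (ennreal B * dvg (s, y)))
    = indicator {tn n..<tn (Suc n)} s * (ennreal B * (NNINT y. ennreal \<bar>discrete_div h ?a y\<bar>))"
   proof (cases "s \<in> {tn n..<tn (Suc n)}")
    case True
    have "dvg (s, y) = ennreal \<bar>discrete_div h ?a y\<bar>" for y
     unfolding dvg_def discrete_div_def fst_conv snd_conv ut_const_on_cells[OF h(1) \<tau> True] ..
    moreover have "(%y. ennreal \<bar>discrete_div h ?a y\<bar>) \<in> borel_fn"
     unfolding discrete_div_def by measurable
    ultimately show ?thesis using True by (simp add: nn_integral_cmult)
   next
    case False
    then show ?thesis by simp
   qed
  qed
  also have "\<dots> = emeasure lborel {tn n..<tn (Suc n)} * (ennreal B * (NNINT y. ennreal \<bar>discrete_div h ?a y\<bar>))"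
   by (subst nn_integral_multc) simp_all
  also have "emeasure lborel {tn n..<tn (Suc n)} = ennreal \<tau>"
   using tn0(2) by (subst emeasure_lborel_Ico) (simp_all add: algebra_simps)
  finally show ?thesis using \<tau> B0 by (simp add: ennreal_mult mult.assoc)
 qed
 have "(NNINT y. ennreal \<bar>G (Suc n) y - F \<rho> (tn (Suc n)) y\<bar>)
   <= (NNINT y. ennreal \<bar>scheme_step h \<tau> ?a e y\<bar> + ennreal \<bar>scheme_step h \<tau> ?a (F \<rho> (tn n)) y - F \<rho> (tn (Suc n)) y\<bar>)"
  unfolding split by (intro nn_integral_mono ennreal_abs_triangle)
 also have "\<dots> = (NNINT y. ennreal \<bar>scheme_step h \<tau> ?a e y\<bar>)
   + (NNINT y. ennreal \<bar>scheme_step h \<tau> ?a (F \<rho> (tn n)) y - F \<rho> (tn (Suc n)) y\<bar>)"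
  by (rule nn_integral_add; unfold scheme_step_def; measurable)
 also have "\<dots> <= ((NNINT y. ennreal \<bar>e y\<bar>) + (NNINT z. indicator {tn n..<tn (Suc n)} (fst z) * (ennreal B * dvg z)))
   + (NNINT z. indicator {tn n..<tn (Suc n)} (fst z) * dens z)"
  using scheme_step_L1[where a="?a", OF em am cfl' eB \<tau>] residual_L1[OF tT] unfolding div by (rule add_mono)
 also have "\<dots> <= (((NNINT y. ennreal \<bar>G 0 y - F \<rho> 0 y\<bar>)
   + (NNINT z. indicator {0..<tn n} (fst z) * (dens z + ennreal B * dvg z))) + (NNINT z. indicator {tn n..<tn (Suc n)} (fst z) * (ennreal B * dvg z)))
   + (NNINT z. indicator {tn n..<tn (Suc n)} (fst z) * dens z)"
  using IH unfolding e_def by (intro add_mono order_refl)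
 also have "\<dots> = (NNINT y. ennreal \<bar>G 0 y - F \<rho> 0 y\<bar>)
   + (NNINT z. indicator {0..<tn (Suc n)} (fst z) * (dens z + ennreal B * dvg z))"
 proof -
  note [measurable] = dens_measurable dvg_measurable time_ind_measurable
  have "(NNINT z. indicator {0..<tn (Suc n)} (fst z) * (dens z + ennreal B * dvg z))
   = (NNINT z. indicator {0..<tn n} (fst z) * (dens z + ennreal B * dvg z)
     + (indicator {tn n..<tn (Suc n)} (fst z) * (ennreal B * dvg z) + indicator {tn n..<tn (Suc n)} (fst z) * dens z))"
  proof (rule nn_integral_cong)
   fix z :: "real \<times> R3"
   have "indicator {0..<tn (Suc n)} (fst z) = (indicator {0..<tn n} (fst z) + indicator {tn n..<tn (Suc n)} (fst z) :: ennreal)"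
    using tn0 by (auto simp: indicator_def simp del: mult_Suc_right of_nat_Suc)
   then show "indicator {0..<tn (Suc n)} (fst z) * (dens z + ennreal B * dvg z)
    = indicator {0..<tn n} (fst z) * (dens z + ennreal B * dvg z)
     + (indicator {tn n..<tn (Suc n)} (fst z) * (ennreal B * dvg z) + indicator {tn n..<tn (Suc n)} (fst z) * dens z)"
    by (simp only: distrib_right distrib_left add_ac)
  qed
  also have "\<dots> = (NNINT z. indicator {0..<tn n} (fst z) * (dens z + ennreal B * dvg z))
     + ((NNINT z. indicator {tn n..<tn (Suc n)} (fst z) * (ennreal B * dvg z)) + (NNINT z. indicator {tn n..<tn (Suc n)} (fst z) * dens z))"
   by (subst nn_integral_add, measurable, subst nn_integral_add, measurable)
  finally show ?thesis by (simp only: add.assoc)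
 qed
 finally show ?case using GSm GSb by simp
qed

text \<open>Everything for fixed \<epsilon>: besides the three smallness parameters only h^2/\<tau>,
  h and \<tau> occur, with constant factors. The viscous term is integrable because it is confined
  to a ball and to the times below T.\<close>

lemma dens_total:
 assumes "t <= T" "0 <= B" "0 <= \<epsilon>"
  and cm: "(NNINT z. ennreal \<bar>cmt \<rho> z\<bar>) <= ennreal e1" and cl: "\<And>j. (NNINT z. ennreal \<bar>w j z - ut h \<tau> \<beta> j z\<bar>) <= ennreal e2"
  and dv: "(NNINT z. dvg z) <= ennreal e3" and e: "0 <= e1" "0 <= e2" "0 <= e3"
 shows "(NNINT z. indicator {0..<t} (fst z) * (dens z + ennreal B * dvg z))
  <= ennreal (T * (C * h\<^sup>2 / \<tau> * measure lborel (cball (0::R3) (R + \<epsilon> + 1))) + (e1 + 3 * (C * h * (T * V) + (C * e2 + C * \<tau> * (T * V)))) + B * e3)"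
proof -
 note [measurable] = far_ind_measurable ut_measurable[OF h(1) \<tau>] cmt_measurable[OF \<rho>] dvg_measurable time_ind_measurable
 let ?m = "measure lborel (cball (0::R3) (R + \<epsilon> + 1))"
 let ?A = "%z :: real \<times> R3. indicator {0..<t} (fst z) * (ennreal (C * h\<^sup>2 / \<tau>) * far_ind (snd z))"
 let ?S = "%z. \<Sum>j\<in>UNIV. ennreal (C * h) * ennreal \<bar>w j z\<bar> + (ennreal C * ennreal \<bar>w j z - ut h \<tau> \<beta> j z\<bar>
     + ennreal (C * \<tau>) * ennreal \<bar>ut h \<tau> \<beta> j z\<bar>)"
 have m0: "0 <= ?m" by simp
 have A: "(NNINT z. ?A z) <= ennreal ((T - 0) * (C * h\<^sup>2 / \<tau> * ?m))"
 proof (rule nn_integral_time_le)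
  show "?A \<in> borel_fn" by measurable
  show "fst z \<in> {0..T}" if "?A z \<noteq> 0" for z using that assms(1) by (auto simp: indicator_def split: if_splits)
  show "(NNINT y. ?A (s, y)) <= ennreal (C * h\<^sup>2 / \<tau> * ?m)" for s
  proof -
   have "(NNINT y. ?A (s, y)) <= (NNINT y. ennreal (C * h\<^sup>2 / \<tau>) * far_ind y)"
    by (intro nn_integral_mono) (simp add: indicator_def)
   also have "\<dots> = ennreal (C * h\<^sup>2 / \<tau>) * emeasure lborel (cball (0::R3) (R + \<epsilon> + 1))"
    unfolding far_ind_def by (simp add: nn_integral_cmult_indicator)
   also have "\<dots> = ennreal (C * h\<^sup>2 / \<tau> * ?m)"
    using ball_finite[of "R + \<epsilon> + 1"] C \<tau> m0 by (simp add: emeasure_eq_ennreal_measure flip: ennreal_mult)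
   finally show ?thesis .
  qed
 qed (use params C \<tau> m0 in auto)
 have "(NNINT z. indicator {0..<t} (fst z) * (dens z + ennreal B * dvg z))
  <= (NNINT z. (?A z + (ennreal \<bar>cmt \<rho> z\<bar> + ?S z)) + ennreal B * dvg z)"
 proof (rule nn_integral_mono)
  fix z :: "real \<times> R3"
  show "indicator {0..<t} (fst z) * (dens z + ennreal B * dvg z) <= (?A z + (ennreal \<bar>cmt \<rho> z\<bar> + ?S z)) + ennreal B * dvg z"
   unfolding dens_def by (cases "fst z \<in> {0..<t}") simp_all
 qed
 also have "\<dots> = ((NNINT z. ?A z) + ((NNINT z. ennreal \<bar>cmt \<rho> z\<bar>) + (NNINT z. ?S z))) + (NNINT z. ennreal B * dvg z)"
  by (subst nn_integral_add, measurable, subst nn_integral_add, measurable, subst nn_integral_add, measurable)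
 also have "\<dots> <= (ennreal ((T - 0) * (C * h\<^sup>2 / \<tau> * ?m)) + (ennreal e1 + ennreal (3 * (C * h * (T * V) + (C * e2 + C * \<tau> * (T * V)))))) + ennreal (B * e3)"
 proof (intro add_mono A cm)
  have "(NNINT z. ?S z) = (\<Sum>j\<in>UNIV. ennreal (C * h) * (NNINT z. ennreal \<bar>w j z\<bar>) + (ennreal C * (NNINT z. ennreal \<bar>w j z - ut h \<tau> \<beta> j z\<bar>)
     + ennreal (C * \<tau>) * (NNINT z. ennreal \<bar>ut h \<tau> \<beta> j z\<bar>)))"
   by (simp add: nn_integral_sum nn_integral_add nn_integral_cmult)
  also have "\<dots> <= (\<Sum>j\<in>(UNIV::3 set). ennreal (C * h) * ennreal (T * V) + (ennreal C * ennreal e2 + ennreal (C * \<tau>) * ennreal (T * V)))"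
   by (intro sum_mono add_mono mult_left_mono w_nn_integral cl ut_nn_integral h \<tau>) auto
  also have "\<dots> = (\<Sum>j\<in>(UNIV::3 set). ennreal (C * h * (T * V) + (C * e2 + C * \<tau> * (T * V))))"
   using C h \<tau> params e by (simp flip: ennreal_mult ennreal_plus)
  also have "\<dots> = ennreal (\<Sum>j\<in>(UNIV::3 set). C * h * (T * V) + (C * e2 + C * \<tau> * (T * V)))"
   using C h \<tau> params e by (intro sum_ennreal) simp
  also have "(\<Sum>j\<in>(UNIV::3 set). C * h * (T * V) + (C * e2 + C * \<tau> * (T * V))) = 3 * (C * h * (T * V) + (C * e2 + C * \<tau> * (T * V)))"
   by (simp only: sum_constant) simp
  finally show "(NNINT z. ?S z) <= \<dots>" .
  have "(NNINT z. ennreal B * dvg z) = ennreal B * (NNINT z. dvg z)" by (rule nn_integral_cmult) measurable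
  also have "\<dots> <= ennreal B * ennreal e3" by (intro mult_left_mono dv) auto
  finally show "(NNINT z. ennreal B * dvg z) <= ennreal (B * e3)" using assms(2) e by (simp add: ennreal_mult)
 qed
 also have "\<dots> = ennreal (T * (C * h\<^sup>2 / \<tau> * ?m) + (e1 + 3 * (C * h * (T * V) + (C * e2 + C * \<tau> * (T * V)))) + B * e3)"
  using C h \<tau> params e assms(2) m0 by (simp flip: ennreal_plus)
 finally show ?thesis .
qed

end

end

text \<open>The index of a time s <= T never exceeds \<open>num_steps\<close>, so on [0,T] the step
  function reads only values that the scheme determines, including the last interval, on which T may
  fall before the end.\<close>

lemma num_steps_bounds:
 assumes "0 < \<tau>" "0 <= T"
 shows "\<tau> * real (num_steps T \<tau>) <= T"
  and "0 <= s ==> s <= T ==> nat \<lfloor>s / \<tau>\<rfloor> <= num_steps T \<tau>"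
  and "0 <= s ==> \<tau> * real (nat \<lfloor>s / \<tau>\<rfloor>) <= s"
  and "0 <= s ==> s < \<tau> * real (nat \<lfloor>s / \<tau>\<rfloor>) + \<tau>"
proof -
 have *: "\<tau> * real (nat \<lfloor>r / \<tau>\<rfloor>) <= r" "r < \<tau> * real (nat \<lfloor>r / \<tau>\<rfloor>) + \<tau>" if "0 <= r" for r
 proof -
  have "0 <= \<lfloor>r / \<tau>\<rfloor>" using assms(1) that by simp
  then have n: "real (nat \<lfloor>r / \<tau>\<rfloor>) = of_int \<lfloor>r / \<tau>\<rfloor>" by simp
  have "of_int \<lfloor>r / \<tau>\<rfloor> <= r / \<tau>" "r / \<tau> < of_int \<lfloor>r / \<tau>\<rfloor> + 1" by linarith+
  then have "\<tau> * of_int \<lfloor>r / \<tau>\<rfloor> <= \<tau> * (r / \<tau>)" "\<tau> * (r / \<tau>) < \<tau> * (of_int \<lfloor>r / \<tau>\<rfloor> + 1)"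
   using assms(1) by (intro mult_left_mono mult_strict_left_mono; simp)+
  moreover have "\<tau> * (r / \<tau>) = r" using assms(1) by simp
  ultimately show "\<tau> * real (nat \<lfloor>r / \<tau>\<rfloor>) <= r" "r < \<tau> * real (nat \<lfloor>r / \<tau>\<rfloor>) + \<tau>"
   unfolding n distrib_left by linarith+
 qed
 show "\<tau> * real (num_steps T \<tau>) <= T" unfolding num_steps_def by (rule *(1)[OF assms(2)])
 show "\<tau> * real (nat \<lfloor>s / \<tau>\<rfloor>) <= s" "s < \<tau> * real (nat \<lfloor>s / \<tau>\<rfloor>) + \<tau>" if "0 <= s" using *[OF that] by auto
 show "nat \<lfloor>s / \<tau>\<rfloor> <= num_steps T \<tau>" if "0 <= s" "s <= T"
  unfolding num_steps_def using assms(1) that by (intro nat_mono floor_mono divide_right_mono) auto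
qed

section \<open>Convergence in L1\<close>

context transport begin

lemma F_0:
 shows "F \<rho> 0 x = (RINT y. f0 y * \<rho> (y - x))"
proof -
 have "AE z :: real \<times> R3 in lborel. fst z \<noteq> 0"
 proof (rule AE_time_space[of "%t (x::R3). t \<noteq> (0::real)"])
  note [measurable] = fst_snd_borel_measurable
  show "Measurable.pred borel (%z :: real \<times> R3. fst z \<noteq> 0)" by measurable
 qed (rule AE_lborel_singleton)
 then have "(RINT z. indicator {0..0} (fst z) * (f z * (\<Sum>j\<in>UNIV. w j z * pderiv_at j \<rho> (snd z - x)))) = 0"
  by (intro integral_eq_zero_AE) (auto elim!: eventually_mono)
 then show ?thesis by (simp add: F_def weak_rhs_def)
qed

text \<open>The order of the choices is the proof: \<epsilon> from the commutator and from the L1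
  moduli of f and f0, then the constants C1 and C2, which depend on the chosen \<rho>, then the
  accuracies e2 and e3 of the discrete velocity in terms of these constants, and finally the bound
  on h.\<close>

lemma core_convergence:
 assumes \<alpha>: "0 < \<alpha>" and \<beta>: "0 < \<beta>" and \<alpha>\<beta>: "\<alpha> + \<beta> < 1" and e: "0 < e"
 shows "\<exists>d>0. \<forall>h \<tau> G. (h, \<tau>) \<in> admissible \<alpha> \<beta> \<and> h < d
  \<and> (\<forall>y. G 0 y = cell_average_setting.avg (rd h) (h ^ 3) f0 y)
  \<and> (\<forall>n<num_steps T \<tau>. \<forall>y. G (Suc n) y = scheme_step h \<tau> (%j y. ut h \<tau> \<beta> j (\<tau> * real n, y)) (G n) y)
  --> (\<forall>n\<le>num_steps T \<tau>. G n \<in> borel_fn \<and> (\<forall>y. \<bar>G n y\<bar> <= M))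
   \<and> (NNINT s. indicator {0..T} s * (NNINT y. ennreal \<bar>G (nat \<lfloor>s / \<tau>\<rfloor>) y - f (s, y)\<bar>)) <= ennreal e"
proof -
 \<comment> \<open>At each time the error is at most 9 e1 plus the mollification error: two e1 from
   the initial data, six from the sum of all steps, one from the time lag within a step. Integrating
   gives 9 e1 T, and the mollification error, which is small only after integration in time, adds
   e1.\<close>
 define e1 where "e1 = e / (9 * T + 1)"
 have e1: "0 < e1" "9 * e1 * T + e1 = e" 
 proof -
  have T1: "0 < 9 * T + 1" using params by simp
  then show "0 < e1" using e by (simp add: e1_def)
  have "e1 * (9 * T + 1) = e" using T1 unfolding e1_def by (intro nonzero_eq_divide_eq[THEN iffD1]) auto
  then show "9 * e1 * T + e1 = e" by (simp add: algebra_simps)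
 qed
 obtain C0 where C0: "0 < C0" "\<And>\<epsilon>. 0 < \<epsilon> ==> \<exists>\<rho>. mollifier C0 \<epsilon> \<rho>" using mollifiers by metis
 obtain d1 where d1: "0 < d1" "\<forall>\<epsilon> \<rho>. 0 < \<epsilon> \<and> \<epsilon> < d1 \<and> mollifier C0 \<epsilon> \<rho> --> (NNINT z. ennreal \<bar>cmt \<rho> z\<bar>) <= ennreal e1"
  using cmt_small[OF C0(1) e1(1)] by blast
 obtain d2 where d2: "0 < d2" "\<forall>k. norm k < d2 --> (NNINT z. ennreal \<bar>f (z + k) - f z\<bar>) <= ennreal e1"
  using translation_continuous_L1[OF f_integrable e1(1)] by blast
 obtain d3 where d3: "0 < d3" "\<forall>k. norm k < d3 --> (NNINT z. ennreal \<bar>f0 (z + k) - f0 z\<bar>) <= ennreal e1"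
  using translation_continuous_L1[OF f0_integrable e1(1)] by blast
 define \<epsilon> where "\<epsilon> = min d1 (min d2 d3) / 2"
 have \<epsilon>: "0 < \<epsilon>" "\<epsilon> < d1" "\<epsilon> < d2" "\<epsilon> < d3" using d1(1) d2(1) d3(1) by (auto simp: \<epsilon>_def)
 obtain \<rho> where \<rho>: "mollifier C0 \<epsilon> \<rho>" using C0(2)[OF \<epsilon>(1)] by blast
 have cm: "(NNINT z. ennreal \<bar>cmt \<rho> z\<bar>) <= ennreal e1" using d1(2) \<epsilon> \<rho> by blast
 have conv_f: "(NNINT z. ennreal \<bar>(RINT y. f (fst z, y) * \<rho> (y - snd z)) - f z\<bar>) <= ennreal e1"
 proof (rule mollify_spacetime_L1_le[OF \<rho> f_meas _ f_slice_integrable])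
  show "(NNINT z. ennreal \<bar>f (z + (0, k)) - f z\<bar>) <= ennreal e1" if "norm k <= \<epsilon>" for k
   using d2(2)[rule_format, of "(0, k)"] that \<epsilon> by (simp add: norm_Pair)
 qed (use e1 in simp)
 have conv_f0: "(NNINT x. ennreal \<bar>(RINT y. f0 y * \<rho> (y - x)) - f0 x\<bar>) <= ennreal e1"
 proof (rule mollify_L1_le[OF \<rho> f0_integrable])
  show "(NNINT z. ennreal \<bar>f0 (z + k) - f0 z\<bar>) <= ennreal e1" if "norm k <= \<epsilon>" for k
   using d3(2)[rule_format, of k] that \<epsilon> by simp
 qed (use e1 in simp)
 obtain C1 where C1: "0 <= C1" "\<forall>t s x j h. 0 <= s \<and> s <= t \<and> 0 < h -->
  \<bar>F \<rho> t x\<bar> <= C1 \<and> \<bar>F \<rho> t x - F \<rho> s x\<bar> <= C1 * (t - s) \<and>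
  \<bar>F \<rho> t (x + h *\<^sub>R axis j 1) - 2 * F \<rho> t x + F \<rho> t (x - h *\<^sub>R axis j 1)\<bar> <= C1 * h\<^sup>2 \<and>
  \<bar>DF h j \<rho> t x\<bar> <= C1 \<and> \<bar>DF h j \<rho> t x - DF h j \<rho> s x\<bar> <= C1 * (t - s)"
  using F_bounds[OF mollifierD(1)[OF \<rho>]] by blast
 obtain C2 where C2: "0 <= C2" "\<forall>h>0. \<forall>j. AE z in lborel. fst z \<in> {0..T} --> \<bar>DF h j \<rho> (fst z) (snd z) + conv_grad \<rho> j z\<bar> <= C2 * h"
  using DF_AE_close[OF \<rho>] by blast
 define C where "C = C1 + C2"
 have C: "0 <= C" using C1(1) C2(1) by (simp add: C_def)
 have C1C: "C1 * a <= C * a" and C2C: "C2 * a <= C * a" if "0 <= a" for a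
  using that C1(1) C2(1) by (auto simp: C_def intro!: mult_right_mono)
 define B where "B = M + C1"
 have B: "0 <= B" using params C1(1) by (simp add: B_def)
 define vol where "vol = measure lborel (cball (0::R3) (R + \<epsilon> + 1))"
 have vol: "0 <= vol" by (simp add: vol_def)
 \<comment> \<open>The velocity error enters through three components with factor C, and the
   divergence error e3 below enters with factor B.\<close>
 define e2 where "e2 = e1 / (3 * C + 1)"
 have e2: "0 < e2" "3 * (C * e2) <= e1" using e1(1) C by (auto simp: e2_def field_simps add_nonneg_pos)
 define e3 where "e3 = e1 / (B + 1)"
 have e3: "0 < e3" "B * e3 <= e1" using e1(1) B by (auto simp: e3_def field_simps add_nonneg_pos)
 have a2: "0 < 2 - \<alpha>" using \<alpha>\<beta> \<beta> by linarith
 obtain b1 where b1: "0 < b1" "\<forall>h \<tau> j. 0 < h \<and> h < b1 \<and> 0 < \<tau> \<and> \<tau> < b1 --> (NNINT z. ennreal \<bar>w j z - ut h \<tau> \<beta> j z\<bar>) <= ennreal e2"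
  using ut_close[OF \<beta> e2(1)] by blast
 obtain b2 where b2: "0 < b2" "\<forall>h \<tau>. 0 < h \<and> h < b2 \<and> 0 < \<tau> -->
  (NNINT z. ennreal \<bar>discrete_div h (%j y. ut h \<tau> \<beta> j (fst z, y)) (snd z)\<bar>) <= ennreal e3"
  using ut_div_small[OF \<beta> e3(1)] by blast
 obtain b3 where b3: "0 < b3" "\<forall>h. 0 < h \<and> h < b3 -->
  (NNINT x. ennreal \<bar>cell_average_setting.avg (rd h) (h ^ 3) f0 x - f0 x\<bar>) <= ennreal e1"
  using space_average_tendsto[OF f0_integrable e1(1)] by blast
 obtain b4 where b4: "0 < b4" "\<forall>h. 0 < h --> h < b4 --> h powr \<alpha> * (T * C * vol) < e1"
  using powr_small[OF \<alpha> e1(1)] by blast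
 obtain b5 where b5: "0 < b5" "\<forall>h. 0 < h --> h < b5 --> h powr 1 * (3 * C * T * V) < e1"
  using powr_small[OF zero_less_one e1(1)] by blast
 obtain b6 where b6: "0 < b6" "\<forall>h. 0 < h --> h < b6 --> h powr (2 - \<alpha>) * (3 * C * T * V) < e1"
  using powr_small[OF a2 e1(1)] by blast
 obtain b7 where b7: "0 < b7" "\<forall>h. 0 < h --> h < b7 --> h powr (2 - \<alpha>) * (C * vol) < e1"
  using powr_small[OF a2 e1(1)] by blast
 \<comment> \<open>\<open>ut_close\<close> also asks for a small time step; this keeps \<tau> =
   h^(2-\<alpha>) below b1.\<close>
 obtain b8 where b8: "0 < b8" "\<forall>h. 0 < h --> h < b8 --> h powr (2 - \<alpha>) * 1 < b1"
  using powr_small[OF a2 b1(1)] by blast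
 define S where "S = {1, b1, b2, b3, b4, b5, b6, b7, b8}"
 have S: "finite S" "S \<noteq> {}" "\<forall>b\<in>S. 0 < b"
  unfolding S_def using b1(1) b2(1) b3(1) b4(1) b5(1) b6(1) b7(1) b8(1) by simp_all
 define d where "d = Min S"
 have d0: "0 < d" unfolding d_def using Min_in[OF S(1,2)] S(3) by blast
 have dle: "d <= 1" "d <= b1" "d <= b2" "d <= b3" "d <= b4" "d <= b5" "d <= b6" "d <= b7" "d <= b8"
  unfolding d_def by (rule Min_le[OF S(1)], simp add: S_def)+
 have "(\<forall>n\<le>num_steps T \<tau>. G n \<in> borel_fn \<and> (\<forall>y. \<bar>G n y\<bar> <= M))
   \<and> (NNINT s. indicator {0..T} s * (NNINT y. ennreal \<bar>G (nat \<lfloor>s / \<tau>\<rfloor>) y - f (s, y)\<bar>)) <= ennreal e"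
  if adm: "(h, \<tau>) \<in> admissible \<alpha> \<beta>" and hd: "h < d"
   and G0: "\<forall>y. G 0 y = cell_average_setting.avg (rd h) (h ^ 3) f0 y"
   and GS: "\<forall>n<num_steps T \<tau>. \<forall>y. G (Suc n) y = scheme_step h \<tau> (%j y. ut h \<tau> \<beta> j (\<tau> * real n, y)) (G n) y"
  for h \<tau> and G :: "nat => R3 => real"
 proof -
  have h: "0 < h" "h <= 1" and \<tau>: "0 < \<tau>" "\<tau> = h powr (2 - \<alpha>)" and cfl0: "h powr (1 - (\<alpha> + \<beta>)) <= 2 / 7"
   using adm hd dle(1) by (auto simp: admissible_def)
  interpret cell_average_setting "rd h" "h ^ 3" by (rule space_cell_average_setting[OF h(1)])
  define N where "N = num_steps T \<tau>"
  have T0: "0 <= T" using params by simp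
  note ns = num_steps_bounds[OF \<tau>(1) T0, folded N_def]
  have cfl: "\<tau> * h powr (- \<beta>) / (2 * h) <= 1 / 7"
  proof -
   have "\<tau> * h powr (- \<beta>) = h powr (1 - (\<alpha> + \<beta>)) * h powr 1"
    unfolding \<tau>(2) powr_add[symmetric] by (simp add: algebra_simps)
   then have "\<tau> * h powr (- \<beta>) / (2 * h) = h powr (1 - (\<alpha> + \<beta>)) / 2" using h(1) by simp
   then show ?thesis using cfl0 by simp
  qed
  have hh: "h\<^sup>2 / \<tau> = h powr \<alpha>"
  proof -
   have "h\<^sup>2 = h powr \<alpha> * \<tau>" unfolding \<tau>(2) powr_add[symmetric] using h(1) by simp
   then show ?thesis using \<tau>(1) by simp
  qed
  have G0m: "G 0 \<in> borel_fn" "\<And>y. \<bar>G 0 y\<bar> <= M"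
  proof -
   have "G 0 = avg f0" using G0 by auto
   then show "G 0 \<in> borel_fn" "\<And>y. \<bar>G 0 y\<bar> <= M"
    using avg_measurable[OF f0_meas] avg_bound[OF f0_bound f0_integrable] by auto
  qed
  have GS': "\<And>n y. n < N ==> G (Suc n) y = scheme_step h \<tau> (%j y. ut h \<tau> \<beta> j (\<tau> * real n, y)) (G n) y"
   using GS by (simp add: N_def)
  have Fb: "\<And>s t x. 0 <= s ==> s <= t ==> \<bar>F \<rho> t x - F \<rho> s x\<bar> <= C * (t - s)"
   "\<And>t x j. 0 <= t ==> \<bar>F \<rho> t (x + h *\<^sub>R axis j 1) - 2 * F \<rho> t x + F \<rho> t (x - h *\<^sub>R axis j 1)\<bar> <= C * h\<^sup>2"
   "\<And>t x j. 0 <= t ==> \<bar>DF h j \<rho> t x\<bar> <= C"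
   "\<And>s t x j. 0 <= s ==> s <= t ==> \<bar>DF h j \<rho> t x - DF h j \<rho> s x\<bar> <= C * (t - s)"
   "\<And>t x. 0 <= t ==> \<bar>F \<rho> t x\<bar> <= C1"
  proof -
   note b = C1(2)[rule_format, OF conjI[OF _ conjI[OF _ h(1)]]]
   show "\<bar>F \<rho> t x - F \<rho> s x\<bar> <= C * (t - s)" if "0 <= s" "s <= t" for s t x
    using b[OF that, of x, THEN conjunct2, THEN conjunct1] C1C[of "t - s"] that by simp
   show "\<bar>F \<rho> t (x + h *\<^sub>R axis j 1) - 2 * F \<rho> t x + F \<rho> t (x - h *\<^sub>R axis j 1)\<bar> <= C * h\<^sup>2" if "0 <= t" for t x j
    using b[OF that order_refl, of x j, THEN conjunct2, THEN conjunct2, THEN conjunct1] C1C[of "h\<^sup>2", OF zero_le_power2]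
    by (rule order_trans)
   show "\<bar>DF h j \<rho> t x\<bar> <= C" if "0 <= t" for t x j
    using b[OF that order_refl, of x j, THEN conjunct2, THEN conjunct2, THEN conjunct2, THEN conjunct1] C1C[of 1] by simp
   show "\<bar>DF h j \<rho> t x - DF h j \<rho> s x\<bar> <= C * (t - s)" if "0 <= s" "s <= t" for s t x j
    using b[OF that, of x j, THEN conjunct2, THEN conjunct2, THEN conjunct2, THEN conjunct2] C1C[of "t - s"] that by simp
   show "\<bar>F \<rho> t x\<bar> <= C1" if "0 <= t" for t x
    using b[OF that order_refl, of x] by blast
  qed
  have DFc: "AE z in lborel. fst z \<in> {0..T} --> \<bar>DF h j \<rho> (fst z) (snd z) + conv_grad \<rho> j z\<bar> <= C * h" for j
   using C2(2)[rule_format, OF h(1), of j] order_trans[OF _ C2C[OF less_imp_le[OF h(1)]]]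
   by (auto elim!: eventually_mono simp del: split_paired_All)
  note ctx = \<rho> C h \<tau>(1) Fb(1-4) DFc
  have BM: "M + C1 <= B" by (simp add: B_def)
  have E0: "(NNINT y. ennreal \<bar>G 0 y - F \<rho> 0 y\<bar>) <= ennreal (e1 + e1)"
  proof -
   note [measurable] = avg_measurable[OF f0_meas]
   have [measurable]: "(%x. RINT y. f0 y * \<rho> (y - x)) \<in> borel_fn"
   proof -
    note [measurable] = mollifierD(5)[OF \<rho>]
    show ?thesis by measurable
   qed
   have "(NNINT y. ennreal \<bar>G 0 y - F \<rho> 0 y\<bar>)
    <= (NNINT x. ennreal \<bar>avg f0 x - f0 x\<bar> + ennreal \<bar>(RINT y. f0 y * \<rho> (y - x)) - f0 x\<bar>)"
    unfolding F_0 G0[rule_format]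
   proof (rule nn_integral_mono)
    fix x
    show "ennreal \<bar>avg f0 x - (RINT y. f0 y * \<rho> (y - x))\<bar>
      <= ennreal \<bar>avg f0 x - f0 x\<bar> + ennreal \<bar>(RINT y. f0 y * \<rho> (y - x)) - f0 x\<bar>"
     using ennreal_abs_diff_triangle[of "avg f0 x" "RINT y. f0 y * \<rho> (y - x)" "f0 x"]
     by (simp add: abs_minus_commute)
   qed
   also have "\<dots> = (NNINT x. ennreal \<bar>avg f0 x - f0 x\<bar>) + (NNINT x. ennreal \<bar>(RINT y. f0 y * \<rho> (y - x)) - f0 x\<bar>)"
    by (rule nn_integral_add) measurable
   also have "\<dots> <= ennreal e1 + ennreal e1"
    using b3(2) h hd dle(4) by (intro add_mono conv_f0) auto
   also have "\<dots> = ennreal (e1 + e1)" using e1(1) by (intro ennreal_plus[symmetric]) auto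
   finally show ?thesis .
  qed
  have total: "(NNINT z. indicator {0..<\<tau> * real n} (fst z) * (dens \<epsilon> C h \<tau> \<beta> \<rho> z + ennreal B * dvg h \<tau> \<beta> z)) <= ennreal (6 * e1)"
   if n: "n <= N" for n
  proof -
   have tT: "\<tau> * real n <= T"
    using mult_left_mono[of "real n" "real N" \<tau>] n ns(1) \<tau>(1) by linarith
   have cl: "(NNINT z. ennreal \<bar>w j z - ut h \<tau> \<beta> j z\<bar>) <= ennreal e2" for j
    using b1(2) b8(2)[rule_format, OF h(1)] h hd dle(2,9) \<tau> by auto
   have dv: "(NNINT z. dvg h \<tau> \<beta> z) <= ennreal e3"
   proof -
    have "dvg h \<tau> \<beta> = (%z. ennreal \<bar>discrete_div h (%j y. ut h \<tau> \<beta> j (fst z, y)) (snd z)\<bar>)"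
     by (intro ext dvg_def[OF ctx])
    then show ?thesis using b2(2) h hd dle(3) \<tau>(1) by simp
   qed
   have "(NNINT z. indicator {0..<\<tau> * real n} (fst z) * (dens \<epsilon> C h \<tau> \<beta> \<rho> z + ennreal B * dvg h \<tau> \<beta> z))
    <= ennreal (T * (C * h\<^sup>2 / \<tau> * vol) + (e1 + 3 * (C * h * (T * V) + (C * e2 + C * \<tau> * (T * V)))) + B * e3)"
    unfolding vol_def
    by (rule dens_total[OF ctx tT B _ cm cl dv]) (use \<epsilon> e1 e2 e3 in auto)
   also have "\<dots> <= ennreal (6 * e1)"
   \<comment> \<open>One e1 for each of viscosity, commutator, central quotient, velocity, time
     freezing and divergence.\<close>
   proof (rule ennreal_leI)
    have "T * (C * h\<^sup>2 / \<tau> * vol) = h powr \<alpha> * (T * C * vol)" unfolding hh[symmetric] by simp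
    also have "\<dots> < e1" using b4(2) h hd dle(5) by auto
    finally have 1: "T * (C * h\<^sup>2 / \<tau> * vol) < e1" .
    have "h powr 1 * (3 * C * T * V) < e1" using b5(2) h hd dle(6) by auto
    then have 2: "3 * (C * h * (T * V)) < e1" using h(1) by (simp add: mult_ac)
    have "\<tau> * (3 * C * T * V) < e1" unfolding \<tau>(2) using b6(2) h hd dle(7) by auto
    then have 3: "3 * (C * \<tau> * (T * V)) < e1" by (simp add: mult_ac)
    show "T * (C * h\<^sup>2 / \<tau> * vol) + (e1 + 3 * (C * h * (T * V) + (C * e2 + C * \<tau> * (T * V)))) + B * e3 <= 6 * e1"
     using 1 2 3 e2(2) e3(2) by (simp add: distrib_left)
   qed
   finally show ?thesis .
  qed
  have err': "G n \<in> borel_fn" "\<bar>G n y\<bar> <= M"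
   "(NNINT y. ennreal \<bar>G n y - F \<rho> (\<tau> * real n) y\<bar>) <= ennreal (8 * e1)" if n: "n <= N" for n y
  proof -
   have e: "G n \<in> borel_fn \<and> (\<forall>y. \<bar>G n y\<bar> <= M) \<and>
    (NNINT y. ennreal \<bar>G n y - F \<rho> (\<tau> * real n) y\<bar>) <= (NNINT y. ennreal \<bar>G 0 y - F \<rho> 0 y\<bar>)
     + (NNINT z. indicator {0..<\<tau> * real n} (fst z) * (dens \<epsilon> C h \<tau> \<beta> \<rho> z + ennreal B * dvg h \<tau> \<beta> z))"
    by (rule error_L1[OF ctx cfl ns(1) G0m GS' BM Fb(5) n])
   show "G n \<in> borel_fn" "\<bar>G n y\<bar> <= M" using e by auto
   have "(NNINT y. ennreal \<bar>G n y - F \<rho> (\<tau> * real n) y\<bar>) <= ennreal (e1 + e1) + ennreal (6 * e1)"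
    using e add_mono[OF E0 total[OF n]] by (meson order_trans)
   also have "\<dots> = ennreal (8 * e1)" using e1(1) by (simp flip: ennreal_plus)
   finally show "(NNINT y. ennreal \<bar>G n y - F \<rho> (\<tau> * real n) y\<bar>) <= ennreal (8 * e1)" .
  qed
  have Fm[measurable]: "F \<rho> t \<in> borel_fn" for t
  proof -
   have "(%x::R3. (t, x)) \<in> borel_fn" by (intro borel_measurable_continuous_onI continuous_intros)
   from measurable_compose[OF this F_measurable[OF mollifierD(1)[OF \<rho>]]] show ?thesis by simp
  qed
  have fm[measurable]: "(%y. f (t, y)) \<in> borel_fn" for t
   by (rule measurable_compose[OF _ f_meas]) (intro borel_measurable_continuous_onI continuous_intros)
  \<comment> \<open>F equals the convolution of f only for almost every point of space-time, so the
    distance from F to f is not bounded at single times; it is carried along and estimated in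
    \<open>XT\<close> after integration.\<close>
  define X where "X s = (NNINT y. ennreal \<bar>F \<rho> s y - f (s, y)\<bar>)" for s
  have FFm: "(%z. ennreal \<bar>F \<rho> (fst z) (snd z) - f z\<bar>) \<in> borel_fn"
   using F_measurable[OF mollifierD(1)[OF \<rho>]] by measurable
  have Xm[measurable]: "X \<in> borel_fn"
  proof -
   have "(%z. ennreal \<bar>F \<rho> (fst z) (snd z) - f z\<bar>) \<in> borel_measurable (lborel \<Otimes>\<^sub>M lborel)"
    using FFm by (simp add: lborel_prod)
   from lborel.borel_measurable_nn_integral_fst[OF this] show ?thesis by (simp add: X_def[abs_def])
  qed
  have inner: "(NNINT y. ennreal \<bar>G (nat \<lfloor>s / \<tau>\<rfloor>) y - f (s, y)\<bar>) <= ennreal (9 * e1) + X s" if s: "s \<in> {0..T}" for s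
  proof -
   define n where "n = nat \<lfloor>s / \<tau>\<rfloor>"
   have n: "n <= N" "\<tau> * real n <= s" "s < \<tau> * real n + \<tau>" "0 <= \<tau> * real n"
    using ns(2-4)[of s] s \<tau>(1) by (auto simp: n_def)
   note [measurable] = err'(1)[OF n(1)]
   have Ft: "ennreal \<bar>F \<rho> (\<tau> * real n) y - F \<rho> s y\<bar> <= ennreal (C * \<tau>) * indicator (cball 0 (R + \<epsilon> + 1)) y" for y
   proof (cases "norm y <= R + \<epsilon> + 1")
    case True
    have "\<bar>F \<rho> s y - F \<rho> (\<tau> * real n) y\<bar> <= C * (s - \<tau> * real n)" using n by (intro Fb(1)) auto
    also have "\<dots> <= C * \<tau>" using n C by (intro mult_left_mono) auto
    finally show ?thesis using True by (simp add: ennreal_leI abs_minus_commute)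
   next
    case False
    then show ?thesis by (simp add: F_support[OF \<rho>])
   qed
   have "(NNINT y. ennreal \<bar>G n y - f (s, y)\<bar>)
    <= (NNINT y. ennreal \<bar>G n y - F \<rho> (\<tau> * real n) y\<bar> + (ennreal (C * \<tau>) * indicator (cball 0 (R + \<epsilon> + 1)) y + ennreal \<bar>F \<rho> s y - f (s, y)\<bar>))"
   proof (rule nn_integral_mono)
    fix y
    have "ennreal \<bar>F \<rho> (\<tau> * real n) y - f (s, y)\<bar> <= ennreal (C * \<tau>) * indicator (cball 0 (R + \<epsilon> + 1)) y + ennreal \<bar>F \<rho> s y - f (s, y)\<bar>"
     using ennreal_abs_diff_triangle[of "F \<rho> (\<tau> * real n) y" "f (s, y)" "F \<rho> s y"] add_right_mono[OF Ft[of y]]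
     by (rule order_trans)
    with ennreal_abs_diff_triangle[of "G n y" "f (s, y)" "F \<rho> (\<tau> * real n) y"]
    show "ennreal \<bar>G n y - f (s, y)\<bar> <= ennreal \<bar>G n y - F \<rho> (\<tau> * real n) y\<bar>
      + (ennreal (C * \<tau>) * indicator (cball 0 (R + \<epsilon> + 1)) y + ennreal \<bar>F \<rho> s y - f (s, y)\<bar>)"
     by (meson add_left_mono order_trans)
   qed
   also have "\<dots> = (NNINT y. ennreal \<bar>G n y - F \<rho> (\<tau> * real n) y\<bar>)
     + ((NNINT y. ennreal (C * \<tau>) * indicator (cball 0 (R + \<epsilon> + 1)) (y::R3)) + X s)"
   proof -
    have m: "(%y. ennreal \<bar>G n y - F \<rho> (\<tau> * real n) y\<bar>) \<in> borel_measurable lborel"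
     "(%y. ennreal \<bar>F \<rho> s y - f (s, y)\<bar>) \<in> borel_measurable lborel"
     using err'(1)[OF n(1)] Fm[of "\<tau> * real n"] Fm[of s] fm[of s] by simp_all
    have "cball (0::R3) (R + \<epsilon> + 1) \<in> sets lborel" by simp
    then have m3: "(%y::R3. ennreal (C * \<tau>) * indicator (cball 0 (R + \<epsilon> + 1)) y) \<in> borel_measurable lborel"
     by (intro borel_measurable_times_ennreal borel_measurable_const borel_measurable_indicator)
    show ?thesis
     unfolding X_def nn_integral_add[OF m3 m(2), symmetric]
     by (rule nn_integral_add[OF m(1) borel_measurable_add[OF m3 m(2)]])
   qed
   also have "\<dots> <= ennreal (8 * e1) + (ennreal e1 + X s)"
   proof (intro add_mono order_refl err'(3)[OF n(1)])
    have "(NNINT y. ennreal (C * \<tau>) * indicator (cball 0 (R + \<epsilon> + 1)) (y::R3)) = ennreal (C * \<tau>) * emeasure lborel (cball (0::R3) (R + \<epsilon> + 1))"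
     by (rule nn_integral_cmult_indicator) simp
    also have "\<dots> = ennreal (\<tau> * (C * vol))"
     using ball_finite[of "R + \<epsilon> + 1"] C \<tau>(1) vol unfolding vol_def by (simp add: emeasure_eq_ennreal_measure mult_ac flip: ennreal_mult)
    also have "\<dots> <= ennreal e1"
    proof (rule ennreal_leI)
     show "\<tau> * (C * vol) <= e1" unfolding \<tau>(2) using b7(2) h hd dle(8) by (simp add: less_imp_le)
    qed
    finally show "(NNINT y. ennreal (C * \<tau>) * indicator (cball 0 (R + \<epsilon> + 1)) (y::R3)) <= ennreal e1" .
   qed
   also have "\<dots> = ennreal (9 * e1) + X s" using e1(1) by (simp add: add.assoc[symmetric] flip: ennreal_plus)
   finally show ?thesis unfolding n_def .
  qed
  have XT: "(NNINT s. indicator {0..T} s * X s) <= ennreal e1"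
  proof -
   have i: "(%z :: real \<times> R3. indicator {0..T} (fst z) :: ennreal) \<in> borel_fn"
    by (rule measurable_compose[OF fst_snd_borel_measurable(1)]) simp
   have "(NNINT s. indicator {0..T} s * X s) = (NNINT s. NNINT y. indicator {0..T} s * ennreal \<bar>F \<rho> s y - f (s, y)\<bar>)"
    unfolding X_def by (intro nn_integral_cong nn_integral_cmult[symmetric]) measurable
   also have "\<dots> = (NNINT z. indicator {0..T} (fst z) * ennreal \<bar>F \<rho> (fst z) (snd z) - f z\<bar>)"
    using nn_integral_lborel_time_space[of "%z. indicator {0..T} (fst z) * ennreal \<bar>F \<rho> (fst z) (snd z) - f z\<bar>"] FFm i by simp
   also have "\<dots> <= (NNINT z. ennreal \<bar>(RINT y. f (fst z, y) * \<rho> (y - snd z)) - f z\<bar>)"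
    using F_AE_eq_pair[OF \<rho>] by (intro nn_integral_mono_AE) (auto simp: indicator_def elim!: eventually_mono)
   also have "\<dots> <= ennreal e1" by (rule conv_f)
   finally show ?thesis .
  qed
  have "(NNINT s. indicator {0..T} s * (NNINT y. ennreal \<bar>G (nat \<lfloor>s / \<tau>\<rfloor>) y - f (s, y)\<bar>))
   <= (NNINT s. ennreal (9 * e1) * indicator {0..T} s + indicator {0..T} s * X s)"
  proof (rule nn_integral_mono)
   fix s
   show "indicator {0..T} s * (NNINT y. ennreal \<bar>G (nat \<lfloor>s / \<tau>\<rfloor>) y - f (s, y)\<bar>)
     <= ennreal (9 * e1) * indicator {0..T} s + indicator {0..T} s * X s"
    using inner[of s] by (cases "s \<in> {0..T}") simp_all
  qed
  also have "\<dots> = ennreal (9 * e1) * ennreal T + (NNINT s. indicator {0..T} s * X s)"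
   using T0 by (subst nn_integral_add) (simp_all add: nn_integral_cmult_indicator)
  also have "\<dots> <= ennreal (9 * e1) * ennreal T + ennreal e1" by (intro add_left_mono XT)
  also have "\<dots> = ennreal e" using e1 T0 by (simp flip: ennreal_mult ennreal_plus)
  finally show ?thesis using err'(1,2) by (auto simp: N_def)
 qed
 then show ?thesis using d0 by (intro exI[of _ d]) blast
qed

end

section \<open>Functions in \<open>H\<^sup>1\<^sub>0\<close>\<close>

lemma lebesgue_measurable_AE_eq:
 fixes g g' :: "'a::euclidean_space => real"
 assumes ae: "AE x in lborel. g x = g' x" and g': "g' \<in> borel_fn"
 shows "g \<in> borel_measurable lebesgue"
proof (rule measurableI)
 fix A :: "real set" assume A: "A \<in> sets borel"
 have gs: "g' -` A \<in> sets lebesgue" using measurable_sets_borel[OF g' A] by simp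
 have "AE x in lebesgue. x \<in> g' -` A \<longleftrightarrow> x \<in> g -` A"
  using AE_completion[OF ae] by eventually_elim auto
 from completion.in_sets_AE[OF this gs] have "g -` A \<in> sets lebesgue" by simp
 then show "g -` A \<inter> space lebesgue \<in> sets lebesgue" by simp
qed simp

text \<open>The passage from integrals over restricted Lebesgue measure to \<open>lborel\<close> and
  Borel representatives. Completeness of Lebesgue measure supplies the measurability of g from that
  of g'.\<close>

lemma integral_lebesgue_on_eq:
 fixes g g' :: "'a::euclidean_space => real"
 assumes S: "S \<in> sets borel" and g': "g' \<in> borel_fn"
  and ae: "AE x in lborel. x \<in> S --> g x = g' x"
 shows "integral\<^sup>L (lebesgue_on S) g = (RINT x. indicator S x * g' x)"
proof -
 have m: "(%x. indicator S x * g' x) \<in> borel_fn" using S g' by simp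
 have ae': "AE x in lborel. indicator S x * g x = indicator S x * g' x"
  using ae by eventually_elim (auto simp: indicator_def)
 have "integral\<^sup>L (lebesgue_on S) g = integral\<^sup>L lebesgue (%x. indicator S x * g x)"
  using S by (subst integral_restrict_space) auto
 also have "\<dots> = integral\<^sup>L lebesgue (%x. indicator S x * g' x)"
  using lebesgue_measurable_AE_eq[OF ae' m] m AE_completion[OF ae'] by (intro integral_cong_AE) (auto intro: measurable_completion)
 also have "\<dots> = (RINT x. indicator S x * g' x)" by (rule integral_completion) (use m in simp)
 finally show ?thesis .
qed

lemma nn_integral_lebesgue_on_eq:
 fixes g :: "'a::euclidean_space => ennreal"
 assumes S: "S \<in> sets borel" and ae: "AE x in lborel. x \<in> S --> g x = g' x"
 shows "integral\<^sup>N (lebesgue_on S) g = (NNINT x. g' x * indicator S x)"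
proof -
 have "integral\<^sup>N (lebesgue_on S) g = (\<integral>\<^sup>+x. g x * indicator S x \<partial>lebesgue)"
  using S by (subst nn_integral_restrict_space) auto
 also have "\<dots> = (NNINT x. g x * indicator S x)" by (rule nn_integral_completion)
 also have "\<dots> = (NNINT x. g' x * indicator S x)"
  using ae by (intro nn_integral_cong_AE) (auto simp: indicator_def elim!: eventually_mono)
 finally show ?thesis .
qed

lemma AE_lebesgue_on_iff:
 fixes P :: "'a::euclidean_space => bool"
 assumes "S \<in> sets borel"
 shows "(AE x in lebesgue_on S. P x) \<longleftrightarrow> (AE x in lborel. x \<in> S --> P x)"
 using assms by (subst AE_restrict_space_iff) (auto simp: AE_completion_iff)

lemma borel_representative:
 fixes u :: "'a::euclidean_space => real"
 assumes S: "S \<in> sets borel" and u: "u \<in> borel_measurable (lebesgue_on S)"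
 obtains u' where "u' \<in> borel_fn" "AE x in lborel. x \<in> S --> u x = u' x"
proof -
 have "(%x. indicator S x *\<^sub>R u x) \<in> borel_measurable lebesgue"
  using u S by (subst (asm) borel_measurable_restrict_space_iff) auto
 then obtain u' where u': "u' \<in> borel_measurable lborel" "AE x in lborel. indicator S x *\<^sub>R u x = u' x"
  using completion_ex_borel_measurable_real by blast
 then have "AE x in lborel. x \<in> S --> u x = u' x"
  by (auto elim!: eventually_mono)
 with u'(1) that show thesis by auto
qed

section \<open>Translations and difference quotients of functions in the closure of test
  functions\<close>

lemma square_sum3_le: "(a + b + c)\<^sup>2 <= 3 * (a\<^sup>2 + b\<^sup>2 + (c::real)\<^sup>2)"
proof -
 have "3 * (a\<^sup>2 + b\<^sup>2 + c\<^sup>2) - (a + b + c)\<^sup>2 = (a - b)\<^sup>2 + (b - c)\<^sup>2 + (a - c)\<^sup>2"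
  by (simp add: power2_eq_square algebra_simps)
 also have "\<dots> \<ge> 0" by simp
 finally show ?thesis by simp
qed

text \<open>The increment is the integral of the directional derivative along the segment; its
  square is at most the integral of the square, and Cauchy--Schwarz separates k from the gradient.
  Integration in x removes the shift along the segment.\<close>

lemma Cc_infty_translation_L2:
 assumes \<phi>: "\<phi> \<in> Cc_infty \<Omega>"
 shows "(NNINT x. ennreal ((\<phi> (x + k) - \<phi> x)\<^sup>2))
  <= ennreal ((norm k)\<^sup>2) * (\<Sum>j\<in>UNIV. NNINT x. ennreal ((pderiv_at j \<phi> x)\<^sup>2))"
proof -
 note [measurable] = Cc_infty_integrable(2)[OF \<phi>] Cc_infty_integrable(2)[OF Cc_infty_has_derivative(3)[OF \<phi>]]
 have m: "(%q. pderiv_at j \<phi> (snd q + fst q *\<^sub>R k)) \<in> borel_measurable (borel \<Otimes>\<^sub>M borel :: (real \<times> R3) measure)" for j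
  by measurable
 have pw: "ennreal ((\<phi> (x + k) - \<phi> x)\<^sup>2) <= (NNINT s. indicator {0..1} s * (ennreal ((norm k)\<^sup>2) * (\<Sum>j\<in>UNIV. ennreal ((pderiv_at j \<phi> (x + s *\<^sub>R k))\<^sup>2))))" for x
 proof -
  define g where "g s = (\<Sum>j\<in>UNIV. k $ j * pderiv_at j \<phi> (x + s *\<^sub>R k))" for s
  have "((%s. \<phi> (x + s *\<^sub>R k)) has_vector_derivative g s) (at s within {0..1})" for s
  proof -
   have "((%s. x + s *\<^sub>R k) has_derivative (%h. h *\<^sub>R k)) (at s)" by (auto intro!: derivative_eq_intros)
   from has_derivative_compose[OF this Cc_infty_has_derivative(1)[OF \<phi>]]
   have "((%s. \<phi> (x + s *\<^sub>R k)) has_derivative (%h. h *\<^sub>R g s)) (at s)"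
    by (simp add: g_def sum_distrib_left mult_ac)
   then show ?thesis unfolding has_vector_derivative_def by (rule has_derivative_at_withinI)
  qed
  moreover have gc: "continuous_on {0..1} g"
   unfolding g_def
   by (intro continuous_intros continuous_on_compose2[OF Cc_infty_has_derivative(2)[OF Cc_infty_has_derivative(3)[OF \<phi>]]]) auto
  ultimately have ftc: "(RINT s. indicator {0..1} s *\<^sub>R g s) = \<phi> (x + 1 *\<^sub>R k) - \<phi> (x + 0 *\<^sub>R k)"
   by (intro integral_FTC_Icc) auto
  define c where "c = \<phi> (x + k) - \<phi> x"
  have i1: "integrable lborel (%s. indicator {0..1} s *\<^sub>R g s)" "integrable lborel (%s. indicator {0..1} s *\<^sub>R (g s)\<^sup>2)"
   by (intro borel_integrable_compact compact_Icc gc continuous_intros)+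
  have i2: "integrable lborel (%s::real. indicator {0..1} s :: real)" "(RINT s. indicator {0..1::real} s) = (1::real)"
   using integrable_real_indicator[of "{0..1::real}" lborel] by auto
  \<comment> \<open>Since c is the mean of g over [0,1], this is its variance, and expanding it
    yields Jensen's inequality.\<close>
  have "0 <= (RINT s. indicator {0..1} s * (g s - c)\<^sup>2)" by (intro Bochner_Integration.integral_nonneg) auto
  also have "\<dots> = (RINT s. (indicator {0..1} s *\<^sub>R (g s)\<^sup>2 - 2 * c * (indicator {0..1} s *\<^sub>R g s)) + c\<^sup>2 * indicator {0..1} s)"
   by (intro Bochner_Integration.integral_cong) (auto simp: power2_eq_square algebra_simps)
  also have "\<dots> = ((RINT s. indicator {0..1} s *\<^sub>R (g s)\<^sup>2) - 2 * c * (RINT s. indicator {0..1} s *\<^sub>R g s)) + c\<^sup>2 * (RINT s. indicator {0..1::real} s)"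
   by (simp only: Bochner_Integration.integral_add[OF Bochner_Integration.integrable_diff[OF i1(2) integrable_mult_right[OF i1(1)]] integrable_mult_right[OF i2(1)]]
     Bochner_Integration.integral_diff[OF i1(2) integrable_mult_right[OF i1(1)]] integral_mult_right_zero)
  finally have nn: "0 <= ((RINT s. indicator {0..1} s *\<^sub>R (g s)\<^sup>2) - 2 * c * (RINT s. indicator {0..1} s *\<^sub>R g s)) + c\<^sup>2 * (RINT s. indicator {0..1::real} s)" .
  have "(RINT s. indicator {0..1} s *\<^sub>R g s) = c" unfolding ftc c_def by simp
  with nn have "c\<^sup>2 <= (RINT s. indicator {0..1} s *\<^sub>R (g s)\<^sup>2)"
   unfolding i2(2) by (simp add: power2_eq_square)
  then have "ennreal (c\<^sup>2) <= ennreal (RINT s. indicator {0..1} s *\<^sub>R (g s)\<^sup>2)" by (rule ennreal_leI)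
  also have "\<dots> = (NNINT s. ennreal (indicator {0..1} s *\<^sub>R (g s)\<^sup>2))"
   by (rule nn_integral_eq_integral[symmetric, OF i1(2)]) auto
  also have "\<dots> <= (NNINT s. indicator {0..1} s * (ennreal ((norm k)\<^sup>2) * (\<Sum>j\<in>UNIV. ennreal ((pderiv_at j \<phi> (x + s *\<^sub>R k))\<^sup>2))))"
  proof (rule nn_integral_mono)
   fix s
   have "g s = k \<bullet> (\<chi> j. pderiv_at j \<phi> (x + s *\<^sub>R k))" by (simp add: g_def inner_vec_def)
   then have "(g s)\<^sup>2 <= (norm k)\<^sup>2 * (norm (\<chi> j. pderiv_at j \<phi> (x + s *\<^sub>R k)))\<^sup>2"
    using Cauchy_Schwarz_ineq[of k "\<chi> j. pderiv_at j \<phi> (x + s *\<^sub>R k)"] by (simp add: power2_norm_eq_inner)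
   also have "(norm (\<chi> j. pderiv_at j \<phi> (x + s *\<^sub>R k)))\<^sup>2 = (\<Sum>j\<in>UNIV. (pderiv_at j \<phi> (x + s *\<^sub>R k))\<^sup>2)"
    unfolding power2_norm_eq_inner inner_vec_def by (simp add: power2_eq_square)
   finally have "ennreal ((g s)\<^sup>2) <= ennreal ((norm k)\<^sup>2) * (\<Sum>j\<in>UNIV. ennreal ((pderiv_at j \<phi> (x + s *\<^sub>R k))\<^sup>2))"
    by (simp add: ennreal_leI sum_nonneg flip: ennreal_mult)
   then show "ennreal (indicator {0..1} s *\<^sub>R (g s)\<^sup>2) <= indicator {0..1} s * (ennreal ((norm k)\<^sup>2) * (\<Sum>j\<in>UNIV. ennreal ((pderiv_at j \<phi> (x + s *\<^sub>R k))\<^sup>2)))"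
    by (cases "s \<in> {0..1}") auto
  qed
  finally show ?thesis unfolding c_def .
 qed
 have "(NNINT x. ennreal ((\<phi> (x + k) - \<phi> x)\<^sup>2))
  <= (NNINT x. NNINT s. indicator {0..1} s * (ennreal ((norm k)\<^sup>2) * (\<Sum>j\<in>UNIV. ennreal ((pderiv_at j \<phi> (x + s *\<^sub>R k))\<^sup>2))))"
  by (rule nn_integral_mono) (rule pw)
 also have "\<dots> = (NNINT s. NNINT x. indicator {0..1} s * (ennreal ((norm k)\<^sup>2) * (\<Sum>j\<in>UNIV. ennreal ((pderiv_at j \<phi> (x + s *\<^sub>R k))\<^sup>2))))"
  by (rule lborel_pair.Fubini') (simp add: split_beta')
 also have "\<dots> = (NNINT s. indicator {0..1::real} s * (ennreal ((norm k)\<^sup>2) * (\<Sum>j\<in>UNIV. NNINT x. ennreal ((pderiv_at j \<phi> x)\<^sup>2))))"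
 proof (rule nn_integral_cong)
  fix s :: real
  have "(NNINT x. ennreal ((pderiv_at j \<phi> (x + s *\<^sub>R k))\<^sup>2)) = (NNINT x. ennreal ((pderiv_at j \<phi> x)\<^sup>2))" for j
   using nn_integral_lborel_shift[of "%x. ennreal ((pderiv_at j \<phi> x)\<^sup>2)" "s *\<^sub>R k"] by simp
  then show "(NNINT x. indicator {0..1} s * (ennreal ((norm k)\<^sup>2) * (\<Sum>j\<in>UNIV. ennreal ((pderiv_at j \<phi> (x + s *\<^sub>R k))\<^sup>2))))
   = indicator {0..1} s * (ennreal ((norm k)\<^sup>2) * (\<Sum>j\<in>UNIV. NNINT x. ennreal ((pderiv_at j \<phi> x)\<^sup>2)))"
   by (simp add: nn_integral_cmult nn_integral_sum del: sum_ennreal)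
 qed
 also have "\<dots> = ennreal ((norm k)\<^sup>2) * (\<Sum>j\<in>UNIV. NNINT x. ennreal ((pderiv_at j \<phi> x)\<^sup>2))"
  by (subst nn_integral_multc) auto
 finally show ?thesis .
qed

text \<open>Membership in the closure of the test functions on \<Omega>, with limit gradient
  \<open>W\<close>, expressed entirely on the whole space. Keeping the approximants, rather than
  only weak derivatives, lets every estimate be proved for smooth functions first.\<close>

definition H1_approx :: "R3 set => (R3 => real) => (3 => R3 => real) => bool" where
 "H1_approx \<Omega> u W \<longleftrightarrow> u \<in> borel_fn \<and> (\<forall>j. W j \<in> borel_fn) \<and>
  (\<forall>e>0. \<exists>\<phi>\<in>Cc_infty \<Omega>. (NNINT x. ennreal ((u x - \<phi> x)\<^sup>2)) <= ennreal e \<and>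
   (\<forall>j. (NNINT x. ennreal ((W j x - pderiv_at j \<phi> x)\<^sup>2)) <= ennreal e))"

lemma Cc_infty_diff:
 assumes "\<phi> \<in> Cc_infty \<Omega>" "\<psi> \<in> Cc_infty \<Omega>"
 shows "(%x. \<phi> x - \<psi> x) \<in> Cc_infty \<Omega>" "pderiv_at j (%x. \<phi> x - \<psi> x) x = pderiv_at j \<phi> x - pderiv_at j \<psi> x"
proof -
 have c: "compact (supp_on UNIV \<phi> \<union> supp_on UNIV \<psi>)" "supp_on UNIV \<phi> \<union> supp_on UNIV \<psi> \<subseteq> \<Omega>"
  using assms by (auto simp: Cc_infty_def)
 have sub: "supp_on UNIV (%x. \<phi> x - \<psi> x) \<subseteq> supp_on UNIV \<phi> \<union> supp_on UNIV \<psi>"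
  unfolding supp_on_def closure_Un[symmetric] by (intro closure_mono) auto
 have "compact ((supp_on UNIV \<phi> \<union> supp_on UNIV \<psi>) \<inter> supp_on UNIV (%x. \<phi> x - \<psi> x))"
  using c(1) by (rule compact_Int_closed) (simp add: supp_on_def)
 then have "compact (supp_on UNIV (%x. \<phi> x - \<psi> x))" using sub by (simp add: Int_absorb1)
 moreover have "smooth_on UNIV (%x. \<phi> x - \<psi> x)"
 proof -
  have "smooth_on UNIV (%x. \<phi> x + (- 1) * \<psi> x)"
   using assms unfolding smooth_on_def Cc_infty_def mem_Collect_eq by (intro allI Ck_on_add Ck_on_mult Ck_on_const) auto
  moreover have "(%x. \<phi> x + (- 1) * \<psi> x) = (%x. \<phi> x - \<psi> x)" by auto
  ultimately show ?thesis by (simp only:)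
 qed
 ultimately show "(%x. \<phi> x - \<psi> x) \<in> Cc_infty \<Omega>" using sub c(2) by (auto simp: Cc_infty_def)
 have "((%x. \<phi> x - \<psi> x) has_derivative (%h. (\<Sum>j\<in>UNIV. h $ j * pderiv_at j \<phi> x) - (\<Sum>j\<in>UNIV. h $ j * pderiv_at j \<psi> x))) (at x)"
  by (intro has_derivative_diff Cc_infty_has_derivative(1)[OF assms(1)] Cc_infty_has_derivative(1)[OF assms(2)])
 from frechet_derivative_at[OF this, symmetric]
 show "pderiv_at j (%x. \<phi> x - \<psi> x) x = pderiv_at j \<phi> x - pderiv_at j \<psi> x"
  by (simp add: pderiv_at_def[of j "%x. \<phi> x - \<psi> x"] axis_def if_distrib[of "%a. a * _"] cong: if_cong)
qed

lemma H1_approx_diff: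
 assumes H: "H1_approx \<Omega> u W" and \<psi>: "\<psi> \<in> Cc_infty \<Omega>"
 shows "H1_approx \<Omega> (%x. u x - \<psi> x) (%j x. W j x - pderiv_at j \<psi> x)"
proof -
 have m: "u \<in> borel_fn" "W j \<in> borel_fn" for j using H by (auto simp: H1_approx_def)
 note [measurable] = m Cc_infty_integrable(2)[OF \<psi>] Cc_infty_integrable(2)[OF Cc_infty_has_derivative(3)[OF \<psi>]]
 show ?thesis
  unfolding H1_approx_def
 proof (intro conjI allI impI)
  fix e :: real assume "0 < e"
  then obtain \<phi> where \<phi>: "\<phi> \<in> Cc_infty \<Omega>" "(NNINT x. ennreal ((u x - \<phi> x)\<^sup>2)) <= ennreal e"
   "\<forall>j. (NNINT x. ennreal ((W j x - pderiv_at j \<phi> x)\<^sup>2)) <= ennreal e"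
   using H unfolding H1_approx_def by blast
  show "\<exists>\<phi>\<in>Cc_infty \<Omega>. (NNINT x. ennreal ((u x - \<psi> x - \<phi> x)\<^sup>2)) <= ennreal e \<and>
   (\<forall>j. (NNINT x. ennreal ((W j x - pderiv_at j \<psi> x - pderiv_at j \<phi> x)\<^sup>2)) <= ennreal e)"
   by (rule bexI[OF _ Cc_infty_diff(1)[OF \<phi>(1) \<psi>]])
     (use \<phi>(2,3) in \<open>simp add: Cc_infty_diff(2)[OF \<phi>(1) \<psi>]\<close>)
 qed (use m in measurable)
qed

text \<open>Three-term split through an approximant. The constant 6 is 3 from squaring the sum times
  2 from replacing the gradient of the approximant by W; the sharp constant 1 would bring nothing
  here.\<close>

lemma H1_approx_translation:
 assumes H: "H1_approx \<Omega> u W"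
 shows "(NNINT x. ennreal ((u (x + k) - u x)\<^sup>2)) <= ennreal (6 * (norm k)\<^sup>2) * (\<Sum>j\<in>UNIV. NNINT x. ennreal ((W j x)\<^sup>2))"
proof -
 have m[measurable]: "u \<in> borel_fn" "W j \<in> borel_fn" for j using H by (auto simp: H1_approx_def)
 let ?S = "\<Sum>j\<in>UNIV. NNINT x. ennreal ((W j x)\<^sup>2)"
 have main: "(NNINT x. ennreal ((u (x + k) - u x)\<^sup>2)) <= ennreal (6 * (norm k)\<^sup>2) * ?S + ennreal (6 * e + 18 * (norm k)\<^sup>2 * e)"
  if e: "0 < e" for e
 proof -
  obtain \<phi> where \<phi>: "\<phi> \<in> Cc_infty \<Omega>" "(NNINT x. ennreal ((u x - \<phi> x)\<^sup>2)) <= ennreal e"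
   "\<forall>j. (NNINT x. ennreal ((W j x - pderiv_at j \<phi> x)\<^sup>2)) <= ennreal e"
   using H e unfolding H1_approx_def by blast
  note [measurable] = Cc_infty_integrable(2)[OF \<phi>(1)] Cc_infty_integrable(2)[OF Cc_infty_has_derivative(3)[OF \<phi>(1)]]
  have d: "(NNINT x. ennreal ((pderiv_at j \<phi> x)\<^sup>2)) <= ennreal 2 * (NNINT x. ennreal ((W j x)\<^sup>2)) + ennreal (2 * e)" for j
  proof -
   have "(NNINT x. ennreal ((pderiv_at j \<phi> x)\<^sup>2))
    <= (NNINT x. ennreal 2 * ennreal ((W j x)\<^sup>2) + ennreal 2 * ennreal ((W j x - pderiv_at j \<phi> x)\<^sup>2))"
   proof (rule nn_integral_mono)
    fix x
    have "2 * a\<^sup>2 + 2 * (a - b)\<^sup>2 - b\<^sup>2 = (2 * a - b)\<^sup>2" for a b :: real by (simp add: power2_eq_square algebra_simps)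
    then have "b\<^sup>2 <= 2 * a\<^sup>2 + 2 * (a - b)\<^sup>2" for a b :: real by (smt (verit) zero_le_power2)
    then have "ennreal ((pderiv_at j \<phi> x)\<^sup>2) <= ennreal (2 * (W j x)\<^sup>2 + 2 * (W j x - pderiv_at j \<phi> x)\<^sup>2)" by (intro ennreal_leI)
    also have "\<dots> = ennreal 2 * ennreal ((W j x)\<^sup>2) + ennreal 2 * ennreal ((W j x - pderiv_at j \<phi> x)\<^sup>2)"
     by (simp add: ennreal_plus ennreal_mult del: ennreal_numeral)
    finally show "ennreal ((pderiv_at j \<phi> x)\<^sup>2) <= \<dots>" .
   qed
   also have "\<dots> = ennreal 2 * (NNINT x. ennreal ((W j x)\<^sup>2)) + ennreal 2 * (NNINT x. ennreal ((W j x - pderiv_at j \<phi> x)\<^sup>2))"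
    by (subst nn_integral_add, measurable, subst (1 2) nn_integral_cmult, measurable)
   also have "\<dots> <= ennreal 2 * (NNINT x. ennreal ((W j x)\<^sup>2)) + ennreal 2 * ennreal e"
    using \<phi>(3) by (intro add_left_mono mult_left_mono) auto
   finally show ?thesis using e by (simp add: ennreal_mult del: ennreal_numeral)
  qed
  have "(NNINT x. ennreal ((u (x + k) - u x)\<^sup>2))
   <= (NNINT x. ennreal 3 * ((ennreal ((u (x + k) - \<phi> (x + k))\<^sup>2) + ennreal ((\<phi> (x + k) - \<phi> x)\<^sup>2)) + ennreal ((u x - \<phi> x)\<^sup>2)))"
  proof (rule nn_integral_mono)
   fix x
   have "(u (x + k) - u x)\<^sup>2 <= 3 * ((u (x + k) - \<phi> (x + k))\<^sup>2 + (\<phi> (x + k) - \<phi> x)\<^sup>2 + (\<phi> x - u x)\<^sup>2)"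
    using square_sum3_le[of "u (x + k) - \<phi> (x + k)" "\<phi> (x + k) - \<phi> x" "\<phi> x - u x"] by simp
   also have "(\<phi> x - u x)\<^sup>2 = (u x - \<phi> x)\<^sup>2" by (rule power2_commute)
   finally have "ennreal ((u (x + k) - u x)\<^sup>2) <= ennreal (3 * ((u (x + k) - \<phi> (x + k))\<^sup>2 + (\<phi> (x + k) - \<phi> x)\<^sup>2 + (u x - \<phi> x)\<^sup>2))"
    by (rule ennreal_leI)
   also have "\<dots> = ennreal 3 * ((ennreal ((u (x + k) - \<phi> (x + k))\<^sup>2) + ennreal ((\<phi> (x + k) - \<phi> x)\<^sup>2)) + ennreal ((u x - \<phi> x)\<^sup>2))"
    by (simp add: ennreal_plus ennreal_mult distrib_left del: ennreal_numeral)
   finally show "ennreal ((u (x + k) - u x)\<^sup>2) <= \<dots>" .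
  qed
  also have "\<dots> = ennreal 3 * (((NNINT x. ennreal ((u (x + k) - \<phi> (x + k))\<^sup>2)) + (NNINT x. ennreal ((\<phi> (x + k) - \<phi> x)\<^sup>2))) + (NNINT x. ennreal ((u x - \<phi> x)\<^sup>2)))"
   by (subst nn_integral_cmult, measurable, subst nn_integral_add, measurable, subst nn_integral_add, measurable)
  also have "(NNINT x. ennreal ((u (x + k) - \<phi> (x + k))\<^sup>2)) = (NNINT x. ennreal ((u x - \<phi> x)\<^sup>2))"
   using nn_integral_lborel_shift[of "%x. ennreal ((u x - \<phi> x)\<^sup>2)" k] by simp
  also have "ennreal 3 * (((NNINT x. ennreal ((u x - \<phi> x)\<^sup>2)) + (NNINT x. ennreal ((\<phi> (x + k) - \<phi> x)\<^sup>2))) + (NNINT x. ennreal ((u x - \<phi> x)\<^sup>2)))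
   <= ennreal 3 * ((ennreal e + ennreal ((norm k)\<^sup>2) * (\<Sum>j\<in>UNIV. ennreal 2 * (NNINT x. ennreal ((W j x)\<^sup>2)) + ennreal (2 * e))) + ennreal e)"
   by (intro mult_left_mono add_mono \<phi>(2) order_trans[OF Cc_infty_translation_L2[OF \<phi>(1)]] sum_mono d) auto
  also have "(\<Sum>j\<in>UNIV. ennreal 2 * (NNINT x. ennreal ((W j x)\<^sup>2)) + ennreal (2 * e)) = ennreal 2 * ?S + ennreal (6 * e)"
  proof -
   have "(\<Sum>j\<in>(UNIV::3 set). ennreal (2 * e)) = ennreal (\<Sum>j\<in>(UNIV::3 set). 2 * e)" using e by (intro sum_ennreal) simp
   then show ?thesis by (simp add: sum.distrib sum_distrib_left)
  qed
  also have "ennreal 3 * ((ennreal e + ennreal ((norm k)\<^sup>2) * (ennreal 2 * ?S + ennreal (6 * e))) + ennreal e)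
   = (ennreal 3 * ennreal ((norm k)\<^sup>2) * ennreal 2) * ?S + (ennreal 3 * ennreal e + ennreal 3 * (ennreal ((norm k)\<^sup>2) * ennreal (6 * e)) + ennreal 3 * ennreal e)"
   by (simp only: distrib_left mult.assoc add_ac)
  also have "ennreal 3 * ennreal ((norm k)\<^sup>2) * ennreal 2 = ennreal (6 * (norm k)\<^sup>2)"
   by (simp flip: ennreal_mult del: ennreal_numeral)
  also have "ennreal 3 * ennreal e + ennreal 3 * (ennreal ((norm k)\<^sup>2) * ennreal (6 * e)) + ennreal 3 * ennreal e = ennreal (6 * e + 18 * (norm k)\<^sup>2 * e)"
   using e by (simp add: algebra_simps flip: ennreal_mult ennreal_plus del: ennreal_numeral)
  finally show ?thesis .
 qed
 show ?thesis
 proof (rule ennreal_le_epsilon)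
  fix e :: real assume e: "0 < e"
  define e' where "e' = e / (6 + 18 * (norm k)\<^sup>2)"
  have p: "0 < 6 + 18 * (norm k)\<^sup>2" by (simp add: add_pos_nonneg)
  have "0 < e'" using e p by (simp add: e'_def)
  moreover have "6 * e' + 18 * (norm k)\<^sup>2 * e' = e"
  proof -
   have "e' * (6 + 18 * (norm k)\<^sup>2) = e" using p by (simp add: e'_def)
   then show ?thesis by (simp add: algebra_simps)
  qed
  ultimately show "(NNINT x. ennreal ((u (x + k) - u x)\<^sup>2)) <= ennreal (6 * (norm k)\<^sup>2) * ?S + ennreal e"
   using main[of e'] by simp
 qed
qed


text \<open>Pointwise |a| <= \<delta> + a^2/\<delta> on the ball. This replaces Cauchy--Schwarz, and
  the free \<delta> lets the right side be made small when the square integral is.\<close>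

lemma nn_integral_abs_le_square:
 fixes a :: "R3 => real"
 assumes [measurable]: "a \<in> borel_fn" and supp: "\<And>x. r < norm x ==> a x = 0" and \<delta>: "0 < \<delta>"
  and sq: "(NNINT x. ennreal ((a x)\<^sup>2)) <= ennreal c" and c: "0 <= c"
 shows "(NNINT x. ennreal \<bar>a x\<bar>) <= ennreal (\<delta> * measure lborel (cball (0::R3) r) + c / \<delta>)"
proof -
 have "(NNINT x. ennreal \<bar>a x\<bar>) <= (NNINT x. ennreal \<delta> * indicator (cball 0 r) x + ennreal (1 / \<delta>) * ennreal ((a x)\<^sup>2))"
 proof (rule nn_integral_mono)
  fix x
  show "ennreal \<bar>a x\<bar> <= ennreal \<delta> * indicator (cball 0 r) x + ennreal (1 / \<delta>) * ennreal ((a x)\<^sup>2)"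
  proof (cases "norm x <= r")
   case True
   have "\<bar>a x\<bar> <= \<delta> + 1 / \<delta> * (a x)\<^sup>2"
   proof (cases "\<bar>a x\<bar> <= \<delta>")
    case False
    then have "\<delta> * \<bar>a x\<bar> <= \<bar>a x\<bar> * \<bar>a x\<bar>" by (intro mult_right_mono) auto
    then have "\<bar>a x\<bar> <= 1 / \<delta> * (a x)\<^sup>2" using \<delta> by (simp add: field_simps power2_eq_square)
    then show ?thesis using \<delta> by linarith
   qed (use \<delta> in \<open>auto intro: add_increasing2\<close>)
   then show ?thesis using True \<delta> by (simp add: ennreal_leI flip: ennreal_mult ennreal_plus)
  next
   case False
   then show ?thesis using supp[of x] by simp
  qed
 qed
 also have "\<dots> = ennreal \<delta> * emeasure lborel (cball (0::R3) r) + ennreal (1 / \<delta>) * (NNINT x. ennreal ((a x)\<^sup>2))"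
 proof -
  have S: "cball (0::R3) r \<in> sets lborel" by simp
  then have "(%x::R3. ennreal \<delta> * indicator (cball 0 r) x) \<in> borel_measurable lborel"
   by (intro borel_measurable_times_ennreal borel_measurable_const borel_measurable_indicator)
  moreover have "(%x. ennreal (1 / \<delta>) * ennreal ((a x)\<^sup>2)) \<in> borel_measurable lborel" by measurable
  moreover have "(NNINT x. ennreal (1 / \<delta>) * ennreal ((a x)\<^sup>2)) = ennreal (1 / \<delta>) * (NNINT x. ennreal ((a x)\<^sup>2))"
   by (rule nn_integral_cmult) measurable
  ultimately show ?thesis
   by (simp only: nn_integral_add nn_integral_cmult_indicator[OF S])
 qed
 also have "\<dots> <= ennreal \<delta> * emeasure lborel (cball (0::R3) r) + ennreal (1 / \<delta>) * ennreal c"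
  using sq by (intro add_left_mono mult_left_mono) auto
 also have "\<dots> = ennreal (\<delta> * measure lborel (cball (0::R3) r) + c / \<delta>)"
  using \<delta> c emeasure_lborel_cball_finite[of "0::R3" r]
  by (simp add: emeasure_eq_ennreal_measure flip: ennreal_mult ennreal_plus)
 finally show ?thesis .
qed

text \<open>With an approximant \<phi> of u, the quotient of u splits into the quotient of u -
  \<phi>, controlled in L2 by the gradient of the difference uniformly in h, the error of the
  quotient of \<phi>, which is O(h), and the distance between the derivative of \<phi> and W. What
  remains is the trace of W, which vanishes. So \<phi> is fixed first and h afterwards.\<close>

lemma H1_approx_quotient:
 fixes u :: "3 => R3 => real" and W :: "3 => 3 => R3 => real"
 assumes H: "\<And>j. H1_approx \<Omega> (u j) (W j)" and \<Omega>: "\<Omega> \<subseteq> cball 0 r" and r: "0 <= r"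
  and u0: "\<And>j x. r < norm x ==> u j x = 0" and W0: "\<And>i j x. r < norm x ==> W i j x = 0"
  and div: "AE x in lborel. (\<Sum>j\<in>UNIV. W j j x) = 0" and e: "0 < e"
 shows "\<exists>d>0. \<forall>h. 0 < h \<and> h < d -->
  (NNINT x. ennreal \<bar>\<Sum>j\<in>UNIV. (u j (x + h *\<^sub>R axis j 1) - u j (x - h *\<^sub>R axis j 1)) / (2 * h)\<bar>) <= ennreal e"
proof -
 define vol where "vol = measure lborel (cball (0::R3) (r + 1))"
 have vol: "0 <= vol" by (simp add: vol_def)
 \<comment> \<open>The final sum is 6 \<delta> vol + 57 \<epsilon>/\<delta> + 3 C' h vol, where 57 =
   3 (18 + 1). Each term is to be at most e/3; the 333 below is generous.\<close>
 define \<delta> where "\<delta> = e / (18 * (vol + 1))"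
 have \<delta>: "0 < \<delta>" "18 * (\<delta> * vol) <= e" using e vol by (auto simp: \<delta>_def field_simps)
 define \<epsilon> where "\<epsilon> = \<delta> * e / 333"
 have \<epsilon>: "0 < \<epsilon>" "333 * (\<epsilon> / \<delta>) = e" using e \<delta> by (auto simp: \<epsilon>_def)
 have "\<exists>\<phi>\<in>Cc_infty \<Omega>. (NNINT x. ennreal ((u j x - \<phi> x)\<^sup>2)) <= ennreal \<epsilon> \<and>
   (\<forall>i. (NNINT x. ennreal ((W j i x - pderiv_at i \<phi> x)\<^sup>2)) <= ennreal \<epsilon>)" for j
  using H[of j] \<epsilon>(1) unfolding H1_approx_def by blast
 then obtain \<phi> where \<phi>: "\<And>j. \<phi> j \<in> Cc_infty \<Omega>"
  "\<And>j i. (NNINT x. ennreal ((W j i x - pderiv_at i (\<phi> j) x)\<^sup>2)) <= ennreal \<epsilon>"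
  by metis
 have m[measurable]: "u j \<in> borel_fn" "W j i \<in> borel_fn" for i j
  using H[of j] by (auto simp: H1_approx_def)
 note [measurable] = Cc_infty_integrable(2)[OF \<phi>(1)] Cc_infty_integrable(2)[OF Cc_infty_has_derivative(3)[OF \<phi>(1)]]
 have \<phi>0: "\<phi> j x = 0" "pderiv_at i (\<phi> j) x = 0" if "r < norm x" for i j x
 proof -
  have "x \<notin> \<Omega>" using \<Omega> that by auto
  then show "\<phi> j x = 0" "pderiv_at i (\<phi> j) x = 0"
   using Cc_infty_zero[OF \<phi>(1)] Cc_infty_zero[OF Cc_infty_has_derivative(3)[OF \<phi>(1)]] by auto
 qed
 have "\<exists>C\<ge>0. \<forall>x i h. 0 < h -->
  \<bar>\<phi> j (x + h *\<^sub>R axis i 1) - 2 * \<phi> j x + \<phi> j (x - h *\<^sub>R axis i 1)\<bar> <= C * h\<^sup>2 \<and>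
  \<bar>(\<phi> j (x + h *\<^sub>R axis i 1) - \<phi> j (x - h *\<^sub>R axis i 1)) / (2 * h) - pderiv_at i (\<phi> j) x\<bar> <= C * h" for j
  by (rule Cc_infty_difference_quotients[OF \<phi>(1)])
 then obtain C where C: "\<And>j. 0 <= C j" "\<And>j x i h. 0 < h ==>
  \<bar>(\<phi> j (x + h *\<^sub>R axis i 1) - \<phi> j (x - h *\<^sub>R axis i 1)) / (2 * h) - pderiv_at i (\<phi> j) x\<bar> <= C j * h"
  by metis
 define C' where "C' = (\<Sum>j\<in>UNIV. C j)"
 have C': "0 <= C'" "C j <= C'" for j
  using C(1) member_le_sum[of j UNIV C] by (auto simp: C'_def sum_nonneg)
 define d where "d = min 1 (e / (9 * (C' * vol + 1)))"
 have Cv: "0 < 9 * (C' * vol + 1)" using C' vol by (simp add: add_nonneg_pos)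
 have d: "0 < d" using e Cv by (simp add: d_def)
 have "(NNINT x. ennreal \<bar>\<Sum>j\<in>UNIV. (u j (x + h *\<^sub>R axis j 1) - u j (x - h *\<^sub>R axis j 1)) / (2 * h)\<bar>) <= ennreal e"
  if h: "0 < h" "h < d" for h
 proof -
  have h1: "h <= 1" using h by (simp add: d_def)
  have hC: "9 * (C' * h * vol) <= e"
  proof -
   have "h < e / (9 * (C' * vol + 1))" using h by (simp add: d_def)
   then have "h * (9 * (C' * vol + 1)) < e" using Cv by (simp only: pos_less_divide_eq)
   then show ?thesis using h by (simp add: algebra_simps)
  qed
  have shift0: "r < norm (x + h *\<^sub>R axis j 1)" "r < norm (x - h *\<^sub>R axis j 1)" "r < norm x" if "r + 1 < norm x" for x :: R3 and j
   using norm_diff_ineq[of x "h *\<^sub>R axis j 1"] norm_triangle_ineq2[of x "h *\<^sub>R axis j 1"] h h1 that by auto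
  let ?Q = "%p j (x::R3). (p (x + h *\<^sub>R axis j 1) - p (x - h *\<^sub>R axis j 1)) / (2 * h) :: real"
  let ?A = "%j x. ?Q (%x. u j x - \<phi> j x) j x"
  let ?B = "%j x. ?Q (\<phi> j) j x - pderiv_at j (\<phi> j) x"
  let ?C = "%j x. W j j x - pderiv_at j (\<phi> j) x"
  have A: "(NNINT x. ennreal \<bar>?A j x\<bar>) <= ennreal (\<delta> * vol + 18 * \<epsilon> / \<delta>)" for j
   unfolding vol_def
  proof (rule nn_integral_abs_le_square)
   let ?v = "%x. u j x - \<phi> j x"
   have "(NNINT x. ennreal ((?A j x)\<^sup>2)) = (NNINT x. ennreal ((?A j ((x::R3) + h *\<^sub>R axis j 1))\<^sup>2))"
    by (rule nn_integral_lborel_shift[symmetric]) measurable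
   also have "\<dots> = (NNINT x. ennreal (1 / (4 * h\<^sup>2)) * ennreal ((?v (x + (2 * h) *\<^sub>R axis j 1) - ?v x)\<^sup>2))"
   proof (rule nn_integral_cong)
    fix x :: R3
    have "x + h *\<^sub>R axis j 1 + h *\<^sub>R axis j 1 = x + (2 * h) *\<^sub>R axis j 1"
     unfolding mult_2 scaleR_add_left by simp
    moreover have "(a / (2 * h))\<^sup>2 = 1 / (4 * h\<^sup>2) * a\<^sup>2" for a by (simp add: power_divide power_mult_distrib)
    ultimately show "ennreal ((?A j (x + h *\<^sub>R axis j 1))\<^sup>2) = ennreal (1 / (4 * h\<^sup>2)) * ennreal ((?v (x + (2 * h) *\<^sub>R axis j 1) - ?v x)\<^sup>2)"
     by (simp only: add_diff_cancel_right' ennreal_mult zero_le_power2 zero_le_divide_1_iff mult_nonneg_nonneg zero_le_numeral)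
   qed
   also have "\<dots> = ennreal (1 / (4 * h\<^sup>2)) * (NNINT x. ennreal ((?v (x + (2 * h) *\<^sub>R axis j 1) - ?v x)\<^sup>2))"
    by (rule nn_integral_cmult) measurable
   also have "\<dots> <= ennreal (1 / (4 * h\<^sup>2)) * (ennreal (6 * (norm ((2 * h) *\<^sub>R axis j 1 :: R3))\<^sup>2) * (\<Sum>i\<in>(UNIV::3 set). ennreal \<epsilon>))"
    by (intro mult_left_mono order_trans[OF H1_approx_translation[OF H1_approx_diff[OF H \<phi>(1)]]] sum_mono \<phi>(2)) auto
   also have "(\<Sum>i\<in>(UNIV::3 set). ennreal \<epsilon>) = ennreal (\<Sum>i\<in>(UNIV::3 set). \<epsilon>)" using \<epsilon> by (intro sum_ennreal) simp
   also have "ennreal (1 / (4 * h\<^sup>2)) * (ennreal (6 * (norm ((2 * h) *\<^sub>R axis j 1 :: R3))\<^sup>2) * ennreal (\<Sum>i\<in>(UNIV::3 set). \<epsilon>)) = ennreal (18 * \<epsilon>)"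
    using h \<epsilon> by (simp add: power_mult_distrib flip: ennreal_mult)
   finally show "(NNINT x. ennreal ((?A j x)\<^sup>2)) <= ennreal (18 * \<epsilon>)" .
   show "?A j x = 0" if "r + 1 < norm x" for x
    using shift0(1)[OF that, of j] shift0(2)[OF that, of j] by (simp add: u0 \<phi>0)
  qed (use \<delta> \<epsilon> in auto)
  have B: "(NNINT x. ennreal \<bar>?B j x\<bar>) <= ennreal (C' * h * vol)" for j
  proof -
   have "(NNINT x. ennreal \<bar>?B j x\<bar>) <= (NNINT x. ennreal (C' * h) * indicator (cball 0 (r + 1)) (x::R3))"
   proof (rule nn_integral_mono)
    fix x :: R3
    show "ennreal \<bar>?B j x\<bar> <= ennreal (C' * h) * indicator (cball 0 (r + 1)) x"
    proof (cases "norm x <= r + 1")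
     case True
     have "\<bar>?B j x\<bar> <= C j * h" by (rule C(2)[OF h(1)])
     also have "\<dots> <= C' * h" using C'(2) h by (intro mult_right_mono) auto
     finally show ?thesis using True by (simp add: ennreal_leI)
    next
     case False
     then have "r + 1 < norm x" by simp
     from shift0(1)[OF this, of j] shift0(2)[OF this, of j] shift0(3)[OF this] have "?B j x = 0" by (simp add: \<phi>0)
     then show ?thesis by simp
    qed
   qed
   also have "\<dots> = ennreal (C' * h) * emeasure lborel (cball (0::R3) (r + 1))" by (rule nn_integral_cmult_indicator) simp
   also have "\<dots> = ennreal (C' * h * vol)"
    using emeasure_lborel_cball_finite[of "0::R3" "r + 1"] C' h vol unfolding vol_def
    by (simp add: emeasure_eq_ennreal_measure flip: ennreal_mult)
   finally show ?thesis .
  qed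
  have Cj: "(NNINT x. ennreal \<bar>?C j x\<bar>) <= ennreal (\<delta> * vol + \<epsilon> / \<delta>)" for j
   unfolding vol_def
  proof (rule nn_integral_abs_le_square)
   show "?C j x = 0" if "r + 1 < norm x" for x
    using shift0(3)[OF that] by (simp add: W0 \<phi>0)
  qed (use \<phi>(2) \<delta> \<epsilon> in auto)
  have "(NNINT x. ennreal \<bar>\<Sum>j\<in>UNIV. ?Q (u j) j x\<bar>)
   <= (NNINT x. (\<Sum>j\<in>UNIV. (ennreal \<bar>?A j x\<bar> + ennreal \<bar>?B j x\<bar>) + ennreal \<bar>?C j x\<bar>))"
  proof (rule nn_integral_mono_AE)
   show "AE x in lborel. ennreal \<bar>\<Sum>j\<in>UNIV. ?Q (u j) j x\<bar> <= (\<Sum>j\<in>UNIV. (ennreal \<bar>?A j x\<bar> + ennreal \<bar>?B j x\<bar>) + ennreal \<bar>?C j x\<bar>)"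
    using div
   proof eventually_elim
    case (elim x)
    have "?Q (u j) j x = (?A j x + ?B j x - ?C j x) + W j j x" for j by (simp add: diff_divide_distrib)
    then have "(\<Sum>j\<in>UNIV. ?Q (u j) j x) = (\<Sum>j\<in>UNIV. ?A j x + ?B j x - ?C j x) + (\<Sum>j\<in>UNIV. W j j x)"
     by (simp only: sum.distrib)
    then have "(\<Sum>j\<in>UNIV. ?Q (u j) j x) = (\<Sum>j\<in>UNIV. ?A j x + ?B j x - ?C j x)" using elim by simp
    then have "\<bar>\<Sum>j\<in>UNIV. ?Q (u j) j x\<bar> <= (\<Sum>j\<in>UNIV. \<bar>?A j x\<bar> + \<bar>?B j x\<bar> + \<bar>?C j x\<bar>)"
     by (simp only:) (rule order_trans[OF sum_abs sum_mono], linarith)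
    then have "ennreal \<bar>\<Sum>j\<in>UNIV. ?Q (u j) j x\<bar> <= ennreal (\<Sum>j\<in>UNIV. \<bar>?A j x\<bar> + \<bar>?B j x\<bar> + \<bar>?C j x\<bar>)" by (rule ennreal_leI)
    also have "\<dots> = (\<Sum>j\<in>UNIV. (ennreal \<bar>?A j x\<bar> + ennreal \<bar>?B j x\<bar>) + ennreal \<bar>?C j x\<bar>)"
     by (subst sum_ennreal[symmetric]) (simp_all only: ennreal_plus abs_ge_zero add_nonneg_nonneg)
    finally show ?case .
   qed
  qed
  also have "\<dots> = (\<Sum>j\<in>UNIV. ((NNINT x. ennreal \<bar>?A j x\<bar>) + (NNINT x. ennreal \<bar>?B j x\<bar>)) + (NNINT x. ennreal \<bar>?C j x\<bar>))"
   by (simp add: nn_integral_sum nn_integral_add)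
  also have "\<dots> <= (\<Sum>j\<in>(UNIV::3 set). (ennreal (\<delta> * vol + 18 * \<epsilon> / \<delta>) + ennreal (C' * h * vol)) + ennreal (\<delta> * vol + \<epsilon> / \<delta>))"
   by (intro sum_mono add_mono A B Cj)
  also have "\<dots> = (\<Sum>j\<in>(UNIV::3 set). ennreal ((\<delta> * vol + 18 * \<epsilon> / \<delta>) + (C' * h * vol) + (\<delta> * vol + \<epsilon> / \<delta>)))"
  proof -
   have "0 <= \<delta> * vol + 18 * \<epsilon> / \<delta>" "0 <= C' * h * vol" "0 <= \<delta> * vol + \<epsilon> / \<delta>" using \<delta> \<epsilon> vol C' h by auto
   then show ?thesis by (simp only: ennreal_plus add_nonneg_nonneg)
  qed
  also have "\<dots> = ennreal (\<Sum>j\<in>(UNIV::3 set). (\<delta> * vol + 18 * \<epsilon> / \<delta>) + (C' * h * vol) + (\<delta> * vol + \<epsilon> / \<delta>))"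
   using \<delta> \<epsilon> vol C' h by (intro sum_ennreal) simp
  also have "\<dots> <= ennreal e"
  proof (rule ennreal_leI)
   have "(\<Sum>j\<in>(UNIV::3 set). (\<delta> * vol + 18 * \<epsilon> / \<delta>) + (C' * h * vol) + (\<delta> * vol + \<epsilon> / \<delta>))
    = 6 * (\<delta> * vol) + 57 * (\<epsilon> / \<delta>) + 3 * (C' * h * vol)" by (simp only: sum_constant) simp
   also have "\<dots> <= e" using \<delta>(2) \<epsilon>(2) hC e by linarith
   finally show "(\<Sum>j\<in>(UNIV::3 set). (\<delta> * vol + 18 * \<epsilon> / \<delta>) + (C' * h * vol) + (\<delta> * vol + \<epsilon> / \<delta>)) <= e" .
  qed
  finally show ?thesis .
 qed
 then show ?thesis using d by blast
qed

section \<open>Projection and integration by parts\<close>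

lemma square_integrable_mult:
 fixes a b :: "'b => real"
 assumes "a \<in> borel_measurable N" "b \<in> borel_measurable N" "integrable N (%x. (a x)\<^sup>2)" "integrable N (%x. (b x)\<^sup>2)"
 shows "integrable N (%x. a x * b x)"
proof (rule Bochner_Integration.integrable_bound[OF Bochner_Integration.integrable_add[OF assms(3,4)]])
 show "AE x in N. norm (a x * b x) <= norm ((a x)\<^sup>2 + (b x)\<^sup>2)"
 proof (rule AE_I2)
  fix x
  have "0 <= (\<bar>a x\<bar> - \<bar>b x\<bar>)\<^sup>2" by simp
  then have "2 * (\<bar>a x\<bar> * \<bar>b x\<bar>) <= (a x)\<^sup>2 + (b x)\<^sup>2" by (simp add: power2_diff)
  then show "norm (a x * b x) <= norm ((a x)\<^sup>2 + (b x)\<^sup>2)"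
   using mult_nonneg_nonneg[OF abs_ge_zero[of "a x"] abs_ge_zero[of "b x"]]
   unfolding real_norm_def abs_mult by linarith
 qed
qed (use assms in measurable)

lemma square_nn_integral_real:
 fixes a :: "'b => real"
 assumes "integrable N (%x. (a x)\<^sup>2)"
 shows "(\<integral>\<^sup>+x. ennreal ((a x)\<^sup>2) \<partial>N) = ennreal (\<integral>x. (a x)\<^sup>2 \<partial>N)"
 by (rule nn_integral_eq_integral[OF assms]) auto

text \<open>Young's inequality with weight \<epsilon>, as a substitute for Cauchy--Schwarz: if the
  L2 norm of a is at most \<epsilon>, its pairing with a fixed b is of order \<epsilon>.\<close>

lemma integral_mult_small:
 fixes a b :: "'b => real"
 assumes "a \<in> borel_measurable N" "b \<in> borel_measurable N" "integrable N (%x. (a x)\<^sup>2)" "integrable N (%x. (b x)\<^sup>2)"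
  and "(\<integral>x. (a x)\<^sup>2 \<partial>N) <= \<epsilon>\<^sup>2" and \<epsilon>: "0 < \<epsilon>"
 shows "\<bar>\<integral>x. a x * b x \<partial>N\<bar> <= \<epsilon> * (1 + (\<integral>x. (b x)\<^sup>2 \<partial>N))"
proof -
 have i: "integrable N (%x. a x * b x)" by (rule square_integrable_mult[OF assms(1-4)])
 have "\<bar>\<integral>x. a x * b x \<partial>N\<bar> <= (\<integral>x. \<bar>a x * b x\<bar> \<partial>N)" by (rule integral_abs_bound)
 also have "\<dots> <= (\<integral>x. (1 / \<epsilon>) * (a x)\<^sup>2 + \<epsilon> * (b x)\<^sup>2 \<partial>N)"
 proof (rule integral_mono)
  fix x
  have "0 <= (\<bar>a x\<bar> - \<epsilon> * \<bar>b x\<bar>)\<^sup>2 / \<epsilon>" using \<epsilon> by simp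
  also have "\<dots> = (1 / \<epsilon>) * (a x)\<^sup>2 + \<epsilon> * (b x)\<^sup>2 - 2 * (\<bar>a x\<bar> * \<bar>b x\<bar>)"
   using \<epsilon> by (simp add: power2_diff power_mult_distrib field_simps power2_eq_square)
  finally show "\<bar>a x * b x\<bar> <= (1 / \<epsilon>) * (a x)\<^sup>2 + \<epsilon> * (b x)\<^sup>2"
   using mult_nonneg_nonneg[OF abs_ge_zero[of "a x"] abs_ge_zero[of "b x"]] unfolding abs_mult by linarith
 qed (use i assms in auto)
 also have "\<dots> = (1 / \<epsilon>) * (\<integral>x. (a x)\<^sup>2 \<partial>N) + \<epsilon> * (\<integral>x. (b x)\<^sup>2 \<partial>N)"
  using assms by simp
 also have "(1 / \<epsilon>) * (\<integral>x. (a x)\<^sup>2 \<partial>N) <= \<epsilon>"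
  using assms(5) \<epsilon> by (simp add: field_simps power2_eq_square)
 finally show ?thesis by (simp add: algebra_simps)
qed

lemma Cc_infty_square_integrable:
 assumes "\<phi> \<in> Cc_infty \<Omega>"
 shows "integrable lborel (%x. (\<phi> x)\<^sup>2)"
 using Cc_infty_integrable(1)[OF Cc_infty_mult(1)[OF assms Cc_infty_UNIV[OF assms]]] by (simp add: power2_eq_square)

lemma square_integrable_diff:
 fixes a b :: "'b => real"
 assumes "a \<in> borel_measurable N" "b \<in> borel_measurable N" "integrable N (%x. (a x)\<^sup>2)" "integrable N (%x. (b x)\<^sup>2)"
 shows "integrable N (%x. (a x - b x)\<^sup>2)"
 using square_integrable_mult[OF assms] assms by (simp add: power2_diff mult.assoc)

text \<open>X lies in the L2 closure of the test functions and X - Y is orthogonal to them, so X is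
  the projection of Y and has the smaller norm. This plays the part of uniqueness of weak
  derivatives: it compares two gradients of the same function, and with Y = 0 it shows that X
  vanishes.\<close>

lemma approx_norm_le:
 fixes X Y :: "R3 => real"
 assumes X: "X \<in> borel_fn" "integrable lborel (%x. (X x)\<^sup>2)"
  and Y: "Y \<in> borel_fn" "integrable lborel (%x. (Y x)\<^sup>2)"
  and approx: "\<And>e. 0 < e ==> \<exists>\<phi>\<in>Cc_infty \<Omega>. (NNINT x. ennreal ((X x - \<phi> x)\<^sup>2)) <= ennreal e"
  and orth: "\<And>\<phi>. \<phi> \<in> Cc_infty \<Omega> ==> (RINT x. X x * \<phi> x) = (RINT x. Y x * \<phi> x)"
 shows "(RINT x. (X x)\<^sup>2) <= (RINT x. (Y x)\<^sup>2)"
proof -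
 let ?Z = "%x. X x - Y x"
 have Z: "?Z \<in> borel_fn" "integrable lborel (%x. (?Z x)\<^sup>2)"
  using X Y square_integrable_diff[of X lborel Y] by auto
 have ZX: "integrable lborel (%x. ?Z x * X x)" using square_integrable_mult[of ?Z lborel X] X Z by simp
 define b where "b = (RINT x. (?Z x)\<^sup>2)"
 have b: "0 <= b" unfolding b_def by (intro Bochner_Integration.integral_nonneg) auto
 have small: "\<bar>RINT x. ?Z x * X x\<bar> <= \<epsilon> * (1 + b)" if \<epsilon>: "0 < \<epsilon>" for \<epsilon>
 proof -
  obtain \<phi> where \<phi>: "\<phi> \<in> Cc_infty \<Omega>" "(NNINT x. ennreal ((X x - \<phi> x)\<^sup>2)) <= ennreal (\<epsilon>\<^sup>2)"
   using approx[of "\<epsilon>\<^sup>2"] \<epsilon> by auto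
  note pm = Cc_infty_integrable(2)[OF \<phi>(1)] and ps = Cc_infty_square_integrable[OF \<phi>(1)]
  have i: "integrable lborel (%x. (X x - \<phi> x)\<^sup>2)" using square_integrable_diff[of X lborel \<phi>] X pm ps by simp
  have le: "(RINT x. (X x - \<phi> x)\<^sup>2) <= \<epsilon>\<^sup>2"
   using \<phi>(2) unfolding square_nn_integral_real[OF i] by simp
  have "integrable lborel (%x. X x * \<phi> x)" "integrable lborel (%x. Y x * \<phi> x)"
   using square_integrable_mult[of _ lborel \<phi>] X Y pm ps by auto
  then have "(RINT x. ?Z x * \<phi> x) = 0" and ip: "integrable lborel (%x. ?Z x * \<phi> x)"
   using orth[OF \<phi>(1)] by (simp_all add: left_diff_distrib)
  then have "(RINT x. ?Z x * X x) = (RINT x. ?Z x * X x - ?Z x * \<phi> x)" using ZX by simp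
  also have "\<dots> = (RINT x. (X x - \<phi> x) * ?Z x)" by (intro Bochner_Integration.integral_cong) (auto simp: algebra_simps)
  finally show ?thesis
   using integral_mult_small[of "%x. X x - \<phi> x" lborel ?Z \<epsilon>] X pm Z i le \<epsilon> unfolding b_def by simp
 qed
 have lim: "\<bar>RINT x. ?Z x * X x\<bar> <= 0 + e" if "0 < e" for e
  using small[of "e / (1 + b)"] b that by (simp add: add_pos_nonneg)
 have "\<bar>RINT x. ?Z x * X x\<bar> <= 0" by (rule field_le_epsilon) (rule lim)
 moreover have XY: "integrable lborel (%x. X x * Y x)" using square_integrable_mult[of X lborel Y] X Y by simp
 moreover have "(RINT x. ?Z x * X x) = (RINT x. (X x)\<^sup>2 - X x * Y x)"
  by (intro Bochner_Integration.integral_cong) (auto simp: power2_eq_square algebra_simps)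
 ultimately have eq: "(RINT x. (X x)\<^sup>2) = (RINT x. X x * Y x)" using X by simp
 have "0 <= (RINT x. (?Z x)\<^sup>2)" by (intro Bochner_Integration.integral_nonneg) auto
 also have "\<dots> = (RINT x. ((X x)\<^sup>2 + (Y x)\<^sup>2) - 2 * (X x * Y x))"
  by (intro Bochner_Integration.integral_cong) (auto simp: power2_diff)
 also have "\<dots> = (RINT x. (X x)\<^sup>2) + (RINT x. (Y x)\<^sup>2) - 2 * (RINT x. X x * Y x)"
  using X(2) Y(2) XY by simp
 finally show ?thesis using eq by linarith
qed

text \<open>For an approximant \<phi> the product \<phi> \<psi> has compact support and its
  derivative integrates to 0. The boundary condition is carried by \<phi>, so \<psi> may be any test
  function on the whole space; both sides are continuous in the L2 norms.\<close>

lemma H1_approx_integration_by_parts: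
 assumes H: "H1_approx \<Omega> u W" and u2: "integrable lborel (%x. (u x)\<^sup>2)" and W2: "integrable lborel (%x. (W j x)\<^sup>2)"
  and \<psi>: "\<psi> \<in> Cc_infty UNIV"
 shows "(RINT x. u x * pderiv_at j \<psi> x) = - (RINT x. W j x * \<psi> x)"
proof -
 have m: "u \<in> borel_fn" "W j \<in> borel_fn" using H by (auto simp: H1_approx_def)
 note p1 = Cc_infty_integrable(2)[OF \<psi>] Cc_infty_square_integrable[OF \<psi>]
 note p2 = Cc_infty_integrable(2)[OF Cc_infty_has_derivative(3)[OF \<psi>], of j] Cc_infty_square_integrable[OF Cc_infty_has_derivative(3)[OF \<psi>], of j]
 define b where "b = (1 + (RINT x. (pderiv_at j \<psi> x)\<^sup>2)) + (1 + (RINT x. (\<psi> x)\<^sup>2))"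
 have b: "0 < b" unfolding b_def by (intro add_pos_pos add_pos_nonneg Bochner_Integration.integral_nonneg) auto
 have small: "\<bar>(RINT x. u x * pderiv_at j \<psi> x) + (RINT x. W j x * \<psi> x)\<bar> <= \<epsilon> * b" if \<epsilon>: "0 < \<epsilon>" for \<epsilon>
 proof -
  obtain \<phi> where \<phi>: "\<phi> \<in> Cc_infty \<Omega>" "(NNINT x. ennreal ((u x - \<phi> x)\<^sup>2)) <= ennreal (\<epsilon>\<^sup>2)"
   "(NNINT x. ennreal ((W j x - pderiv_at j \<phi> x)\<^sup>2)) <= ennreal (\<epsilon>\<^sup>2)"
   using H \<epsilon> unfolding H1_approx_def by (meson zero_less_power)
  note q1 = Cc_infty_integrable(2)[OF \<phi>(1)] Cc_infty_square_integrable[OF \<phi>(1)]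
  note q2 = Cc_infty_integrable(2)[OF Cc_infty_has_derivative(3)[OF \<phi>(1)], of j] Cc_infty_square_integrable[OF Cc_infty_has_derivative(3)[OF \<phi>(1)], of j]
  have i1: "integrable lborel (%x. (u x - \<phi> x)\<^sup>2)" using square_integrable_diff[of u lborel \<phi>] m q1 u2 by simp
  have i2: "integrable lborel (%x. (W j x - pderiv_at j \<phi> x)\<^sup>2)" using square_integrable_diff[of "W j" lborel "pderiv_at j \<phi>"] m q2 W2 by simp
  have le1: "(RINT x. (u x - \<phi> x)\<^sup>2) <= \<epsilon>\<^sup>2" using \<phi>(2) unfolding square_nn_integral_real[OF i1] by simp
  have le2: "(RINT x. (W j x - pderiv_at j \<phi> x)\<^sup>2) <= \<epsilon>\<^sup>2" using \<phi>(3) unfolding square_nn_integral_real[OF i2] by simp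
  have e1: "\<bar>RINT x. (u x - \<phi> x) * pderiv_at j \<psi> x\<bar> <= \<epsilon> * (1 + (RINT x. (pderiv_at j \<psi> x)\<^sup>2))"
   using integral_mult_small[of "%x. u x - \<phi> x" lborel "pderiv_at j \<psi>" \<epsilon>] m q1 p2 i1 le1 \<epsilon> by simp
  have e2: "\<bar>RINT x. (W j x - pderiv_at j \<phi> x) * \<psi> x\<bar> <= \<epsilon> * (1 + (RINT x. (\<psi> x)\<^sup>2))"
   using integral_mult_small[of "%x. W j x - pderiv_at j \<phi> x" lborel \<psi> \<epsilon>] m q2 p1 i2 le2 \<epsilon> by simp
  have ints: "integrable lborel (%x. u x * pderiv_at j \<psi> x)" "integrable lborel (%x. \<phi> x * pderiv_at j \<psi> x)"
   "integrable lborel (%x. W j x * \<psi> x)" "integrable lborel (%x. pderiv_at j \<phi> x * \<psi> x)"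
   using square_integrable_mult[of _ lborel "pderiv_at j \<psi>"] square_integrable_mult[of _ lborel \<psi>] m p1 p2 q1 q2 u2 W2 by auto
  have "(RINT x. \<phi> x * pderiv_at j \<psi> x + pderiv_at j \<phi> x * \<psi> x) = 0"
   using Cc_infty_integral_pderiv[OF Cc_infty_mult(1)[OF \<phi>(1) \<psi>], of j] by (simp add: Cc_infty_mult(2)[OF \<phi>(1) \<psi>])
  then have z: "(RINT x. \<phi> x * pderiv_at j \<psi> x) + (RINT x. pderiv_at j \<phi> x * \<psi> x) = 0" using ints by simp
  have "(RINT x. u x * pderiv_at j \<psi> x) + (RINT x. W j x * \<psi> x)
   = (RINT x. (u x - \<phi> x) * pderiv_at j \<psi> x) + (RINT x. (W j x - pderiv_at j \<phi> x) * \<psi> x)"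
   using ints z by (simp add: left_diff_distrib)
  then show ?thesis using e1 e2 unfolding b_def distrib_left by linarith
 qed
 have "\<bar>(RINT x. u x * pderiv_at j \<psi> x) + (RINT x. W j x * \<psi> x)\<bar> <= 0 + e" if "0 < e" for e
  using small[of "e / b"] b that by simp
 then have "\<bar>(RINT x. u x * pderiv_at j \<psi> x) + (RINT x. W j x * \<psi> x)\<bar> <= 0" by (rule field_le_epsilon)
 then show ?thesis by linarith
qed

section \<open>From test functions to an identity for almost every time\<close>

text \<open>The positive and the negative part are densities of two measures that agree, and are
  finite, on all right half-lines; hence the measures and then the densities coincide.\<close>

lemma AE_zero_of_half_line_integrals:
 fixes g :: "real => real"
 assumes g: "integrable lborel g" and half: "\<And>s. (RINT x. indicator {..s} x * g x) = 0" and total: "(RINT x. g x) = 0"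
 shows "AE x in lborel. g x = 0"
proof -
 have [measurable]: "g \<in> borel_fn" using g by simp
 let ?p = "%x. ennreal (g x)" and ?m = "%x. ennreal (- g x)"
 have upper: "(NNINT x. ?p x * indicator {s<..} x) = (NNINT x. ?m x * indicator {s<..} x)"
  and fin: "(NNINT x. ?p x * indicator {s<..} x) < \<infinity>" for s
 proof -
  let ?g = "%x. indicator {s<..} x * g x"
  have gi: "integrable lborel ?g" by (rule integrable_mult_bounded(2)[OF g, where c=1]) (auto simp: indicator_def)
  have gl: "integrable lborel (%x. indicator {..s} x * g x)"
   by (rule integrable_mult_bounded(2)[OF g, where c=1]) (auto simp: indicator_def)
  have "(RINT x. ?g x) = (RINT x. g x - indicator {..s} x * g x)"
   by (intro Bochner_Integration.integral_cong) (auto simp: indicator_def)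
  also have "\<dots> = 0" using g gl half total by simp
  finally have z: "(RINT x. ?g x) = 0" .
  have "integral\<^sup>L lborel ?g = enn2real (NNINT x. ennreal (?g x)) - enn2real (NNINT x. ennreal (- ?g x))"
   by (rule real_lebesgue_integral_def[OF gi])
  moreover have p: "(NNINT x. ennreal (?g x)) = (NNINT x. ?p x * indicator {s<..} x)"
   and m: "(NNINT x. ennreal (- ?g x)) = (NNINT x. ?m x * indicator {s<..} x)"
   by (auto intro!: nn_integral_cong simp: indicator_def)
  moreover have f: "(NNINT x. ennreal (?g x)) < \<infinity>" "(NNINT x. ennreal (- ?g x)) < \<infinity>"
   using gi unfolding real_integrable_def by (auto simp: less_top)
  ultimately have "enn2real (NNINT x. ?p x * indicator {s<..} x) = enn2real (NNINT x. ?m x * indicator {s<..} x)"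
   using z by simp
  then have "ennreal (enn2real (NNINT x. ?p x * indicator {s<..} x)) = ennreal (enn2real (NNINT x. ?m x * indicator {s<..} x))"
   by (rule arg_cong)
  then show "(NNINT x. ?p x * indicator {s<..} x) = (NNINT x. ?m x * indicator {s<..} x)"
   using f unfolding p m by (simp only: ennreal_enn2real infinity_ennreal_def)
  show "(NNINT x. ?p x * indicator {s<..} x) < \<infinity>" using f(1) unfolding p .
 qed
 have "density lborel ?p = density lborel ?m"
 proof (rule measure_eqI_lessThan)
  show "emeasure (density lborel ?p) {x<..} < \<infinity>" for x using fin[of x] by (simp add: emeasure_density)
  show "emeasure (density lborel ?p) {x<..} = emeasure (density lborel ?m) {x<..}" for x
   using upper[of x] by (simp add: emeasure_density)
 qed auto
 then have "AE x in lborel. ?p x = ?m x" by (subst (asm) sigma_finite_measure.density_unique_iff[OF lborel.sigma_finite_measure_axioms]) auto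
 then show ?thesis
 proof eventually_elim
  case (elim x)
  show ?case
  proof (cases "0 <= g x")
   case True
   then have "ennreal (g x) = 0" using elim by (simp add: ennreal_neg)
   then show ?thesis using True by (simp add: ennreal_eq_0_iff)
  next
   case False
   then have "ennreal (- g x) = 0" using elim by (simp add: ennreal_neg)
   then show ?thesis using False by (simp add: ennreal_eq_0_iff)
  qed
 qed
qed

text \<open>A smooth approximation of the positive part of s - t, the time factor of the test
  functions. The tent is preferred to a smoothed indicator because its derivative stays between -1
  and 0 for all n, so dominated convergence applies to the time derivative as well; the indicator
  reappears as the limit of that derivative.\<close>

definition cutoff :: "real => nat => real => real" where
 "cutoff s n t = (s - t) * flat_exp 1 (real (Suc n) * (s - t))"

definition cutoff_deriv :: "real => nat => real => real" where
 "cutoff_deriv s n t = - flat_exp 1 (real (Suc n) * (s - t))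
   - (s - t) * (real (Suc n) * flat_exp ([:0, 0, 1:] * (1 - pderiv 1)) (real (Suc n) * (s - t)))"

lemma cutoff_has_derivative: "(cutoff s n has_real_derivative cutoff_deriv s n t) (at t)"
proof -
 have "((%t. real (Suc n) * (s - t)) has_real_derivative - real (Suc n)) (at t)"
  by (auto intro!: derivative_eq_intros)
 from DERIV_chain2[OF flat_exp_has_field_derivative[of 1] this]
 have "((%t. (s - t) * flat_exp 1 (real (Suc n) * (s - t))) has_real_derivative
   (s - t) * (flat_exp ([:0, 0, 1:] * (1 - pderiv 1)) (real (Suc n) * (s - t)) * (- real (Suc n)))
   + (0 - 1) * flat_exp 1 (real (Suc n) * (s - t))) (at t)"
  by (intro DERIV_mult') (auto intro!: derivative_eq_intros)
 then show ?thesis unfolding cutoff_def[abs_def] cutoff_deriv_def by (simp add: algebra_simps del: mult_pCons_left)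
qed

lemma Ck_on_cutoff: "Ck_on k UNIV (cutoff s n)"
proof -
 have a: "Ck_on k UNIV (%t::real. a + b * t)" for a b
  by (intro Ck_on_add Ck_on_const Ck_on_bounded_linear bounded_linear_mult_right)
 have "Ck_on k UNIV (%t. (s + (-1) * t) * flat_exp 1 (real (Suc n) * s + (- real (Suc n)) * t))"
  by (intro Ck_on_mult Ck_on_compose_real[OF Ck_on_flat_exp] a)
 moreover have "(s + (-1) * t) * flat_exp 1 (real (Suc n) * s + (- real (Suc n)) * t) = cutoff s n t" for t
  by (simp add: cutoff_def algebra_simps)
 ultimately show ?thesis by (simp only:) 
qed

lemma cutoff_eq_0: "s <= t ==> cutoff s n t = 0" "s <= t ==> cutoff_deriv s n t = 0"
 by (simp_all add: cutoff_def cutoff_deriv_def flat_exp_eq_0 mult_nonneg_nonpos del: of_nat_Suc mult_pCons_left)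

lemma cutoff_formulas:
 assumes "t < s"
 shows "cutoff s n t = (s - t) * exp (- (1 / (real (Suc n) * (s - t))))"
  and "cutoff_deriv s n t = - (1 + 1 / (real (Suc n) * (s - t))) * exp (- (1 / (real (Suc n) * (s - t))))"
proof -
 define x where "x = real (Suc n) * (s - t)"
 have x: "0 < x" using assms by (simp add: x_def)
 show "cutoff s n t = (s - t) * exp (- (1 / (real (Suc n) * (s - t))))"
  using x by (simp add: cutoff_def flat_exp_def x_def[symmetric] del: of_nat_Suc)
 have "flat_exp ([:0, 0, 1:] * (1 - pderiv 1)) x = 1 / (x * x) * exp (- (1 / x))"
  using x by (simp add: flat_exp_def)
 then have "cutoff_deriv s n t = - exp (- (1 / x)) - x * (1 / (x * x) * exp (- (1 / x)))"
  using x unfolding cutoff_deriv_def x_def[symmetric] by (simp add: flat_exp_def x_def mult_ac)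
 then show "cutoff_deriv s n t = - (1 + 1 / (real (Suc n) * (s - t))) * exp (- (1 / (real (Suc n) * (s - t))))"
  unfolding x_def[symmetric] using x by (simp add: field_simps)
qed

lemma cutoff_bounds:
 shows "\<bar>cutoff s n t\<bar> <= \<bar>s - t\<bar>" "\<bar>cutoff_deriv s n t\<bar> <= 1"
proof -
 show "\<bar>cutoff s n t\<bar> <= \<bar>s - t\<bar>"
 proof (cases "t < s")
  case True
  then show ?thesis unfolding cutoff_formulas(1)[OF True] abs_mult by (simp add: mult_left_le)
 qed (simp add: cutoff_eq_0)
 show "\<bar>cutoff_deriv s n t\<bar> <= 1"
 proof (cases "t < s")
  case True
  define u where "u = 1 / (real (Suc n) * (s - t))"
  have u: "0 <= u" using True by (simp add: u_def)
  \<comment> \<open>The derivative is -(1 + u) exp(-u), and 1 + u <= exp u bounds it by 1 for every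
    n.\<close>
  have "(1 + u) * exp (- u) <= exp u * exp (- u)" by (intro mult_right_mono exp_ge_add_one_self) simp
  then show ?thesis unfolding cutoff_formulas(2)[OF True] u_def[symmetric] using u
   by (simp add: abs_mult mult_exp_exp add.commute)
 qed (simp add: cutoff_eq_0)
qed

lemma cutoff_limits:
 "(%n. cutoff s n t) \<longlonglongrightarrow> indicator {..<s} t * (s - t)"
 "(%n. cutoff_deriv s n t) \<longlonglongrightarrow> - indicator {..<s} t"
proof -
 have u: "(%n. 1 / (real (Suc n) * (s - t))) \<longlonglongrightarrow> 0"
  using tendsto_mult[OF LIMSEQ_inverse_real_of_nat tendsto_const[of "1 / (s - t)"]] by (simp add: field_simps)
 have e: "(%n. exp (- (1 / (real (Suc n) * (s - t))))) \<longlonglongrightarrow> 1"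
  using tendsto_exp[OF tendsto_minus[OF u]] by simp
 show "(%n. cutoff s n t) \<longlonglongrightarrow> indicator {..<s} t * (s - t)"
 proof (cases "t < s")
  case True
  then show ?thesis using tendsto_mult[OF tendsto_const[of "s - t"] e] by (simp add: cutoff_formulas(1) del: of_nat_Suc)
 qed (simp add: cutoff_eq_0)
 show "(%n. cutoff_deriv s n t) \<longlonglongrightarrow> - indicator {..<s} t"
 proof (cases "t < s")
  case True
  then show ?thesis using tendsto_mult[OF tendsto_minus[OF tendsto_add[OF tendsto_const[of 1] u]] e]
   by (simp add: cutoff_formulas(2) del: of_nat_Suc)
 qed (simp add: cutoff_eq_0)
qed

lemma cutoff_measurable: "cutoff s n \<in> borel_fn" "cutoff_deriv s n \<in> borel_fn"
proof -
 have [measurable]: "flat_exp p \<in> borel_fn" for p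
  using Ck_on_flat_exp[of 0 p] by (intro borel_measurable_continuous_onI) simp
 show "cutoff s n \<in> borel_fn" "cutoff_deriv s n \<in> borel_fn"
  unfolding cutoff_def[abs_def] cutoff_deriv_def[abs_def] by measurable
qed

section \<open>The equation for almost every time\<close>

lemma integrable_bounded_interval:
 fixes p :: "real => real"
 assumes "p \<in> borel_fn" "\<And>t. t \<in> {a..b} ==> \<bar>p t\<bar> <= c" "\<And>t. t \<notin> {a..b} ==> p t = 0"
 shows "integrable lborel p"
proof (rule Bochner_Integration.integrable_bound)
 show "integrable lborel (%t::real. \<bar>c\<bar> * indicator {a..b} t)"
  using integrable_real_indicator[of "{a..b}" lborel] by (cases "a <= b") auto
 show "AE t in lborel. norm (p t) <= norm (\<bar>c\<bar> * indicator {a..b} t)"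
 proof (rule AE_I2)
  show "norm (p t) <= norm (\<bar>c\<bar> * indicator {a..b} t)" for t
   using assms(2,3)[of t] by (cases "t \<in> {a..b}") auto
 qed
qed (use assms in simp)

text \<open>As n tends to infinity the tested equation says that the integral of a over [0,s] is c s
  plus the integral of (s - t) b(t). By Fubini the right side is the integral over [0,s] of the
  candidate P. So a - P has zero integral over every [0,s], hence vanishes almost
  everywhere.\<close>

lemma weak_time_identity:
 fixes a b :: "real => real"
 assumes T: "0 < T" and [measurable]: "a \<in> borel_fn" "b \<in> borel_fn"
  and bd: "\<And>t. \<bar>a t\<bar> <= A" "\<And>t. \<bar>b t\<bar> <= B"
  and test: "\<And>s n. 0 < s ==> s < T ==>
   (RINT t. indicator {0..T} t * (cutoff_deriv s n t * a t + cutoff s n t * b t)) + c * cutoff s n 0 = 0"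
 shows "AE t in lborel. t \<in> {0..T} --> a t = c + (RINT u. indicator {0..t} u * b u)"
proof -
 have A0: "0 <= A" and B0: "0 <= B" using bd[of 0] by linarith+
 define P where "P t = c + (RINT u. indicator {0..t} u * b u)" for t
 note [measurable] = cutoff_measurable
 have meas2: "(%z. indicator {0..fst z} (snd z) * b (snd z) :: real) \<in> borel_measurable (borel \<Otimes>\<^sub>M borel)"
  unfolding indicator_def atLeastAtMost_iff by measurable
 have [measurable]: "P \<in> borel_fn"
  unfolding P_def using meas2
  by (intro borel_measurable_add borel_measurable_const sigma_finite_measure.borel_measurable_lebesgue_integral)
    (simp_all add: lborel.sigma_finite_measure_axioms split_beta')
 have Pb: "\<bar>P t\<bar> <= \<bar>c\<bar> + B * T" if "t \<in> {0..T}" for t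
 proof -
  have i: "integrable lborel (%u. indicator {0..t} u * b u)"
   using bd(2) by (intro integrable_bounded_interval[of _ 0 t B]) auto
  have "\<bar>RINT u. indicator {0..t} u * b u\<bar> <= (RINT u. \<bar>indicator {0..t} u * b u\<bar>)" by (rule integral_abs_bound)
  also have "\<dots> <= (RINT u. B * indicator {0..t} u)"
  proof (rule integral_mono)
   show "integrable lborel (%u::real. B * indicator {0..t} u)"
    using integrable_real_indicator[of "{0..t}" lborel] that by auto
  qed (use i bd(2) B0 in \<open>auto simp: indicator_def\<close>)
  also have "\<dots> = B * t" using that by simp
  also have "\<dots> <= B * T" using that B0 by (intro mult_left_mono) auto
  finally show ?thesis unfolding P_def by linarith
 qed
 have key: "(RINT t. indicator {0..s} t * (a t - P t)) = 0" if s: "0 < s" "s < T" for s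
 proof -
  let ?h = "%n t. indicator {0..T} t * (cutoff_deriv s n t * a t + cutoff s n t * b t)"
  let ?l = "%t. indicator {0..T} t * (- indicator {..<s} t * a t + indicator {..<s} t * (s - t) * b t)"
  have "(%n. integral\<^sup>L lborel (?h n)) \<longlonglongrightarrow> integral\<^sup>L lborel ?l"
  proof (rule integral_dominated_convergence[where w="%t. (A + T * B) * indicator {0..T} t"])
   show "integrable lborel (%t::real. (A + T * B) * indicator {0..T} t)"
    using integrable_real_indicator[of "{0..T}" lborel] T by auto
   show "AE t in lborel. (%n. ?h n t) \<longlonglongrightarrow> ?l t"
    by (intro AE_I2 tendsto_intros cutoff_limits)
   show "AE t in lborel. norm (?h n t) <= (A + T * B) * indicator {0..T} t" for n
   proof (rule AE_I2)
    fix t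
    show "norm (?h n t) <= (A + T * B) * indicator {0..T} t"
    proof (cases "t \<in> {0..T}")
     case True
     have "\<bar>cutoff s n t\<bar> <= T" using cutoff_bounds(1)[of s n t] True s by auto
     then have "\<bar>cutoff_deriv s n t * a t\<bar> <= 1 * A" "\<bar>cutoff s n t * b t\<bar> <= T * B"
      unfolding abs_mult using cutoff_bounds(2) bd T by (intro mult_mono; simp)+
     then show ?thesis using True by simp
    qed simp
   qed
  qed measurable
  moreover have "(%n. c * cutoff s n 0) \<longlonglongrightarrow> c * (indicator {..<s} 0 * (s - 0))"
   by (intro tendsto_intros cutoff_limits)
  ultimately have "(%n. integral\<^sup>L lborel (?h n) + c * cutoff s n 0) \<longlonglongrightarrow> integral\<^sup>L lborel ?l + c * (indicator {..<s} 0 * (s - 0))"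
   by (rule tendsto_add)
  then have lim: "integral\<^sup>L lborel ?l + c * s = 0"
   unfolding test[OF s] using s by (simp add: LIMSEQ_const_iff)
  have ia: "integrable lborel (%t. indicator {0..s} t * a t)" "integrable lborel (%t. indicator {0..s} t * ((s - t) * b t))"
   "integrable lborel (%t. indicator {0..s} t * P t)"
  proof -
   show "integrable lborel (%t. indicator {0..s} t * a t)" using bd by (intro integrable_bounded_interval[of _ 0 s A]) auto
   show "integrable lborel (%t. indicator {0..s} t * ((s - t) * b t))"
   proof (rule integrable_bounded_interval[of _ 0 s "s * B"])
    show "\<bar>indicator {0..s} t * ((s - t) * b t)\<bar> <= s * B" if "t \<in> {0..s}" for t
     using that bd(2)[of t] s unfolding abs_mult by (simp add: mult_mono)
   qed auto
   show "integrable lborel (%t. indicator {0..s} t * P t)"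
    using Pb s by (intro integrable_bounded_interval[of _ 0 s "\<bar>c\<bar> + B * T"]) auto
  qed
  have "integral\<^sup>L lborel ?l = (RINT t. indicator {0..s} t * ((s - t) * b t) - indicator {0..s} t * a t)"
  proof (rule integral_cong_AE)
   show "AE t in lborel. ?l t = indicator {0..s} t * ((s - t) * b t) - indicator {0..s} t * a t"
    using AE_lborel_singleton[of s]
   proof eventually_elim
    case (elim t)
    then show ?case using s by (auto simp: indicator_def)
   qed
  qed measurable
  then have eq1: "(RINT t. indicator {0..s} t * ((s - t) * b t)) + c * s = (RINT t. indicator {0..s} t * a t)"
   using lim ia by simp
  \<comment> \<open>Fubini over the triangle u <= t <= s: the inner integral of b up to t becomes
    the weight s - u.\<close>
  have "(RINT t. indicator {0..s} t * P t) = (RINT t. c * indicator {0..s} t + (RINT u. indicator {0..s} t * (indicator {0..t} u * b u)))"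
   unfolding integral_mult_right_zero by (intro Bochner_Integration.integral_cong) (simp_all add: P_def distrib_left mult.commute)
  also have "\<dots> = c * s + (RINT t. RINT u. indicator {0..s} t * (indicator {0..t} u * b u))"
  proof -
   have "integrable lborel (%t::real. c * indicator {0..s} t)" using integrable_real_indicator[of "{0..s}" lborel] s by auto
   moreover have "integrable lborel (%t. RINT u. indicator {0..s} t * (indicator {0..t} u * b u))"
   proof -
    have "indicator {0..s} t * P t - c * indicator {0..s} t = (RINT u. indicator {0..s} t * (indicator {0..t} u * b u))" for t
     unfolding integral_mult_right_zero by (simp add: P_def distrib_left)
    then show ?thesis using Bochner_Integration.integrable_diff[OF ia(3) calculation] by simp
   qed
   ultimately show ?thesis using s by simp
  qed
  also have "(RINT t. RINT u. indicator {0..s} t * (indicator {0..t} u * b u))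
   = (RINT u. RINT t. indicator {0..s} t * (indicator {0..t} u * b u))"
  proof (rule lborel_pair.Fubini_integral)
   have S: "({0..s} \<times> {0..s}) \<in> sets (lborel \<Otimes>\<^sub>M lborel)" "emeasure (lborel \<Otimes>\<^sub>M lborel) ({0..s} \<times> {0..s}) < \<infinity>"
    using s by (auto simp: lborel.emeasure_pair_measure_Times ennreal_mult_less_top)
   show "integrable (lborel \<Otimes>\<^sub>M lborel) (%(u, t). indicator {0..s} t * (indicator {0..t} u * b u))"
   proof (rule Bochner_Integration.integrable_bound)
    show "integrable (lborel \<Otimes>\<^sub>M lborel) (%z. B * indicator ({0..s} \<times> {0..s}) z)"
     using S by auto
    show "AE z in lborel \<Otimes>\<^sub>M lborel. norm (case z of (u, t) => indicator {0..s} t * (indicator {0..t} u * b u)) <= norm (B * indicator ({0..s} \<times> {0..s}) z)"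
     using bd(2) B0 by (intro AE_I2) (auto simp: indicator_def)
    show "(%(u, t). indicator {0..s} t * (indicator {0..t} u * b u)) \<in> borel_measurable (lborel \<Otimes>\<^sub>M lborel)"
     unfolding indicator_def atLeastAtMost_iff split_beta' by measurable
   qed
  qed
  also have "\<dots> = (RINT u. indicator {0..s} u * ((s - u) * b u))"
  proof (rule Bochner_Integration.integral_cong[OF refl])
   fix u
   have "(RINT t. indicator {0..s} t * (indicator {0..t} u * b u)) = (RINT t. (indicator {0..s} u * b u) * indicator {u..s} t)"
    by (intro Bochner_Integration.integral_cong) (auto simp: indicator_def)
   also have "\<dots> = indicator {0..s} u * ((s - u) * b u)" by (cases "u \<in> {0..s}") auto
   finally show "(RINT t. indicator {0..s} t * (indicator {0..t} u * b u)) = indicator {0..s} u * ((s - u) * b u)" .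
  qed
  finally have "(RINT t. indicator {0..s} t * P t) = (RINT t. indicator {0..s} t * a t)" using eq1 by simp
  then show ?thesis using ia by (simp add: right_diff_distrib)
 qed
 have part: "AE t in lborel. t \<in> {0..s0} --> a t = P t" if s0: "0 < s0" "s0 < T" for s0
 proof -
  let ?g = "%t. indicator {0..s0} t * (a t - P t)"
  have ig: "integrable lborel ?g"
  proof (rule integrable_bounded_interval[of _ 0 s0 "A + (\<bar>c\<bar> + B * T)"])
   show "\<bar>?g t\<bar> <= A + (\<bar>c\<bar> + B * T)" if "t \<in> {0..s0}" for t
    using bd(1)[of t] Pb[of t] that s0 by (simp add: abs_le_iff)
  qed auto
  have "AE t in lborel. ?g t = 0"
  proof (rule AE_zero_of_half_line_integrals[OF ig])
   show "(RINT t. ?g t) = 0" by (rule key[OF s0])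
   show "(RINT x. indicator {..s} x * ?g x) = 0" for s
   proof (cases "0 < s")
    case True
    have "(RINT x. indicator {..s} x * ?g x) = (RINT t. indicator {0..min s s0} t * (a t - P t))"
     by (intro Bochner_Integration.integral_cong) (auto simp: indicator_def)
    also have "\<dots> = 0" using True s0 by (intro key) auto
    finally show ?thesis .
   next
    case False
    show ?thesis
    proof (rule integral_eq_zero_AE)
     show "AE x in lborel. indicator {..s} x * ?g x = 0"
      using AE_lborel_singleton[of 0]
     proof eventually_elim
      case (elim x)
      then show ?case using False by (auto simp: indicator_def)
     qed
    qed
   qed
  qed
  then show ?thesis by eventually_elim (auto simp: indicator_def)
 qed
 \<comment> \<open>The test functions need s < T, so [0,T) is exhausted from below; k + 2 makes all
   factors lie strictly between 0 and 1, and the single time T is a null set.\<close>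
 have "AE t in lborel. \<forall>k::nat. t \<in> {0..T * (1 - 1 / real (k + 2))} --> a t = P t"
  unfolding AE_all_countable
 proof
  fix k :: nat
  have "0 < 1 - 1 / real (k + 2)" "1 - 1 / real (k + 2) < 1" by auto
  then have "0 < T * (1 - 1 / real (k + 2))" "T * (1 - 1 / real (k + 2)) < T" using T by (auto simp del: of_nat_add)
  then show "AE t in lborel. t \<in> {0..T * (1 - 1 / real (k + 2))} --> a t = P t" by (rule part)
 qed
 then show ?thesis
  using AE_lborel_singleton[of T]
 proof eventually_elim
  case (elim t)
  show ?case
  proof
   assume t: "t \<in> {0..T}"
   with elim(2) have "t / T < 1" using T by auto
   then obtain k where k: "inverse (real (Suc k)) < 1 - t / T" using reals_Archimedean[of "1 - t / T"] by auto
   have "1 / real (k + 2) <= inverse (real (Suc k))" by (simp add: field_simps)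
   then have "t / T <= 1 - 1 / real (k + 2)" using k by linarith
   then have "t <= T * (1 - 1 / real (k + 2))" using T by (simp add: pos_divide_le_eq mult.commute del: of_nat_add)
   then have "a t = P t" using elim(1) t by auto
   then show "a t = c + (RINT u. indicator {0..t} u * b u)" unfolding P_def .
  qed
 qed
qed

text \<open>Against a test function supported outside the ball both the initial pairing and the flux
  vanish, so the mollification of f is zero there for almost every time. As the radius tends to 0
  the mollification converges to f in L1. This is what confines bounded whole-space solutions to a
  fixed ball.\<close>

lemma weak_identity_support:
 fixes f :: "real \<times> R3 => real"
 assumes f[measurable]: "f \<in> borel_fn" and bd: "\<And>z. \<bar>f z\<bar> <= M"
  and time: "\<And>z. f z \<noteq> 0 ==> fst z \<in> {0..T}"
  and f0_supp: "\<And>x. f0 x \<noteq> 0 ==> norm x <= R"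
  and w_supp: "\<And>j z. w j z \<noteq> 0 ==> norm (snd z) <= R"
  and weak: "\<And>\<psi>. \<psi> \<in> Cc_infty UNIV ==> AE t in lborel. t \<in> {0..T} -->
   (RINT y. f (t, y) * \<psi> y) = weak_rhs f w f0 t \<psi> (%j. pderiv_at j \<psi>)"
 shows "AE z in lborel. R < norm (snd z) --> f z = 0"
proof -
 note [measurable] = fst_snd_borel_measurable
 have M0: "0 <= M" using bd[of undefined] by linarith
 have local: "AE z in lborel. R + \<delta> < norm (snd z) \<and> norm (snd z) < r - \<delta> --> f z = 0" if \<delta>: "0 < \<delta>" for \<delta> r
 proof -
  \<comment> \<open>f is so far only bounded, so it is cut off at radius r to become integrable. On
    the shell between R + \<delta> and r - \<delta> a mollifier of radius at most \<delta> sees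
    neither the cut nor the inner ball.\<close>
  let ?u = "%z. indicator (cball (0::R3) r) (snd z) * f z"
  let ?A = "%z :: real \<times> R3. R + \<delta> < norm (snd z) \<and> norm (snd z) < r - \<delta>"
  have [measurable]: "(%z :: real \<times> R3. indicator (cball (0::R3) r) (snd z) :: real) \<in> borel_fn"
   by (rule measurable_compose[OF fst_snd_borel_measurable(2) borel_measurable_indicator[OF borel_closed[OF closed_cball]]])
  have um[measurable]: "?u \<in> borel_fn" by (rule borel_measurable_times) (fact | simp)+
  have box: "emeasure lborel ({0..T} \<times> cball (0::R3) r) < \<infinity>"
   by (intro emeasure_bounded_finite bounded_Times) auto
  have ui: "integrable lborel ?u"
  proof (rule Bochner_Integration.integrable_bound)
   show "integrable lborel (%z. M * indicator ({0..T} \<times> cball (0::R3) r) z)"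
    using box borel_closed[OF closed_Times[OF closed_atLeastAtMost closed_cball], of 0 T 0 r] by (auto intro!: integrable_real_indicator)
   show "AE z in lborel. norm (?u z) <= norm (M * indicator ({0..T} \<times> cball (0::R3) r) z)"
   proof (rule AE_I2)
    fix z
    show "norm (?u z) <= norm (M * indicator ({0..T} \<times> cball (0::R3) r) z)"
     using bd[of z] time[of z] M0 by (cases z) (auto simp: indicator_def)
   qed
  qed simp
  have us: "integrable lborel (%y. ?u (t, y))" for t
  proof (rule Bochner_Integration.integrable_bound)
   show "integrable lborel (%y. M * indicator (cball (0::R3) r) y)"
    using emeasure_bounded_finite[OF bounded_cball, of "0::R3" r] by (auto intro!: integrable_real_indicator)
   show "AE y in lborel. norm (?u (t, y)) <= norm (M * indicator (cball (0::R3) r) y)"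
    using bd M0 by (intro AE_I2) (auto simp: indicator_def)
  qed measurable
  have le: "(NNINT z. ennreal \<bar>?u z\<bar> * indicator {z. ?A z} z) <= ennreal e" if e: "0 < e" for e
  proof -
   obtain d where d: "0 < d" "\<And>k. norm k < d ==> (NNINT z. ennreal \<bar>?u (z + k) - ?u z\<bar>) <= ennreal e"
    using translation_continuous_L1[OF ui e] by blast
   define \<epsilon> where "\<epsilon> = min (d / 2) \<delta>"
   have \<epsilon>: "0 < \<epsilon>" "\<epsilon> < d" "\<epsilon> <= \<delta>" using d(1) \<delta> by (auto simp: \<epsilon>_def)
   obtain C \<rho> where \<rho>: "mollifier C \<epsilon> \<rho>" using mollifiers \<epsilon>(1) by metis
   note [measurable] = mollifierD(5)[OF \<rho>]
   let ?c = "%z. RINT y. ?u (fst z, y) * \<rho> (y - snd z)"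
   have cm[measurable]: "?c \<in> borel_fn"
   proof -
    have [measurable]: "f \<in> borel_measurable (borel \<Otimes>\<^sub>M borel)" using f by (simp add: borel_prod)
    have "?c \<in> borel_measurable (borel \<Otimes>\<^sub>M borel)" by measurable
    then show ?thesis by (simp add: borel_prod)
   qed
   have "AE z in lborel. ?A z --> ?c (fst z, snd z) = 0"
   proof (rule AE_time_space[of "%t x. R + \<delta> < norm x \<and> norm x < r - \<delta> --> ?c (t, x) = 0"])
    show "Measurable.pred borel (%z. ?A z --> ?c (fst z, snd z) = 0)"
     unfolding prod.collapse by measurable
    fix x :: R3
    let ?\<psi> = "%y. \<rho> (y - x)"
    note \<psi> = Cc_infty_translate[OF mollifierD(1)[OF \<rho>], where x=x]
    show "AE t in lborel. R + \<delta> < norm x \<and> norm x < r - \<delta> --> ?c (t, x) = 0"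
     using weak[OF \<psi>(1)]
    proof eventually_elim
     case (elim t)
     show ?case
     proof
      assume x: "R + \<delta> < norm x \<and> norm x < r - \<delta>"
      have near: "R < norm y \<and> norm y <= r" if "norm (y - x) <= \<epsilon>" for y
       using that x \<epsilon>(3) norm_triangle_ineq2[of x y] norm_triangle_ineq2[of y x] by (auto simp: norm_minus_commute)
      have far: "\<rho> (y - x) = 0" "pderiv_at j \<rho> (y - x) = 0" if "norm y <= R \<or> r < norm y" for y j
       using near[of y] that mollifierD(9,10)[OF \<rho>, of "y - x"] by (auto simp: not_le[symmetric])
      have "?c (t, x) = (RINT y. f (t, y) * \<rho> (y - x))"
       using far(1) by (intro Bochner_Integration.integral_cong refl) (auto simp: indicator_def not_le)
      also have "\<dots> = 0"
      proof (cases "t \<in> {0..T}")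
       case True
       have a: "f0 y * \<rho> (y - x) = 0" for y using f0_supp[of y] far(1)[of y] by auto
       have b: "w j z * pderiv_at j ?\<psi> (snd z) = 0" for j z
        using w_supp[of j z] far(2)[of "snd z" j] unfolding \<psi>(2) by auto
       show ?thesis using elim True by (simp only: weak_rhs_def a b sum.neutral_const mult_zero_right Bochner_Integration.integral_zero add_0)
      next
       case False
       then have "f (t, y) = 0" for y using time[of "(t, y)"] by auto
       then show ?thesis by simp
      qed
      finally show "?c (t, x) = 0" .
     qed
    qed
   qed
   then have "(NNINT z. ennreal \<bar>?u z\<bar> * indicator {z. ?A z} z) <= (NNINT z. ennreal \<bar>?c z - ?u z\<bar>)"
    by (intro nn_integral_mono_AE) (auto elim!: eventually_mono simp: indicator_def)
   also have "\<dots> <= ennreal e"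
   proof (rule mollify_spacetime_L1_le[OF \<rho> um])
    show "(NNINT z. ennreal \<bar>?u (z + (0, k)) - ?u z\<bar>) <= ennreal e" if "norm k <= \<epsilon>" for k
     using d(2)[of "(0, k)"] that \<epsilon>(2) by (simp add: norm_Pair)
   qed (use e us in auto)
   finally show ?thesis .
  qed
  have "(NNINT z. ennreal \<bar>?u z\<bar> * indicator {z. ?A z} z) <= 0"
  proof (rule ennreal_le_epsilon)
   show "(NNINT z. ennreal \<bar>?u z\<bar> * indicator {z. ?A z} z) <= 0 + ennreal e" if "0 < e" for e
    using le[OF that] by simp
  qed
  then have "(NNINT z. ennreal \<bar>?u z\<bar> * indicator {z. ?A z} z) = 0" by simp
  then have "AE z in lborel. ennreal \<bar>?u z\<bar> * indicator {z. ?A z} z = 0"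
   by (subst (asm) nn_integral_0_iff_AE) measurable
  then show ?thesis
  proof eventually_elim
   case (elim z)
   then show ?case using \<delta> by (auto simp: indicator_def)
  qed
 qed
 \<comment> \<open>One index serves both limits: \<delta> = 1/(n+1) shrinks and the outer radius n
   grows, and countably many shells cover the outside of the ball.\<close>
 have "AE z in lborel. \<forall>n::nat. R + inverse (real (Suc n)) < norm (snd z) \<and> norm (snd z) < real n - inverse (real (Suc n)) --> f z = 0"
  unfolding AE_all_countable by (intro allI local) simp
 then show ?thesis
 proof eventually_elim
  case (elim z)
  show ?case
  proof
   assume R: "R < norm (snd z)"
   obtain m where m: "inverse (real (Suc m)) < norm (snd z) - R" using reals_Archimedean[of "norm (snd z) - R"] R by auto
   obtain n where n: "norm (snd z) + 1 < real n" using reals_Archimedean2 by blast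
   let ?N = "max m n"
   have "inverse (real (Suc ?N)) <= inverse (real (Suc m))" "inverse (real (Suc ?N)) <= 1" "real n <= real ?N"
    by (auto intro!: le_imp_inverse_le simp: inverse_le_1_iff)
   then have "R + inverse (real (Suc ?N)) < norm (snd z)" "norm (snd z) < real ?N - inverse (real (Suc ?N))"
    using m n by linarith+
   then show "f z = 0" using elim by blast
  qed
 qed
qed

section \<open>The velocity field\<close>

lemma integrable_lebesgue_on_representative:
 fixes g g' :: "'a::euclidean_space => real"
 assumes S: "S \<in> sets borel" and g': "g' \<in> borel_fn"
  and ae: "AE x in lborel. x \<in> S --> g x = g' x" and off: "\<And>x. x \<notin> S ==> g' x = 0"
  and g: "integrable (lebesgue_on S) g"
 shows "integrable lborel g'"
proof -
 have "(NNINT x. ennreal (norm (g' x))) = (NNINT x. ennreal (norm (g' x)) * indicator S x)"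
  by (intro nn_integral_cong) (auto simp: indicator_def off)
 also have "\<dots> = (\<integral>\<^sup>+x. ennreal (norm (g x)) \<partial>lebesgue_on S)"
  by (rule nn_integral_lebesgue_on_eq[OF S, symmetric]) (use ae in \<open>eventually_elim, auto\<close>)
 also have "\<dots> < \<infinity>" using g by (simp add: integrable_iff_bounded)
 finally show ?thesis using g' by (simp add: integrable_iff_bounded)
qed

lemma weak_pderiv_representative:
 assumes \<Omega>: "open \<Omega>" and wp: "weak_pderiv \<Omega> j q p"
  and u: "u \<in> borel_fn" "AE x in lborel. x \<in> \<Omega> --> q x = u x" "\<forall>x. x \<notin> \<Omega> --> u x = 0"
  and Y: "Y \<in> borel_fn" "AE x in lborel. x \<in> \<Omega> --> p x = Y x" "\<forall>x. x \<notin> \<Omega> --> Y x = 0"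
 shows "integrable lborel (%x. (u x)\<^sup>2)" "integrable lborel (%x. (Y x)\<^sup>2)"
  "\<And>\<phi>. \<phi> \<in> Cc_infty \<Omega> ==> (RINT x. u x * pderiv_at j \<phi> x) = - (RINT x. Y x * \<phi> x)"
proof -
 have S: "\<Omega> \<in> sets borel" using \<Omega> by simp
 have L: "integrable (lebesgue_on \<Omega>) (%x. (q x)\<^sup>2)" "integrable (lebesgue_on \<Omega>) (%x. (p x)\<^sup>2)"
  using wp by (auto simp: weak_pderiv_def L2_def)
 show "integrable lborel (%x. (u x)\<^sup>2)"
  by (rule integrable_lebesgue_on_representative[OF S _ _ _ L(1)])
    (use u in \<open>auto elim!: eventually_mono\<close>)
 show "integrable lborel (%x. (Y x)\<^sup>2)"
  by (rule integrable_lebesgue_on_representative[OF S _ _ _ L(2)])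
    (use Y in \<open>auto elim!: eventually_mono\<close>)
 fix \<phi> assume \<phi>: "\<phi> \<in> Cc_infty \<Omega>"
 have "(RINT x. u x * pderiv_at j \<phi> x) = (RINT x. indicator \<Omega> x * (u x * pderiv_at j \<phi> x))"
  using u(3) by (intro Bochner_Integration.integral_cong) (auto simp: indicator_def)
 also have "\<dots> = (LINT x|lebesgue_on \<Omega>. q x * pderiv_at j \<phi> x)"
  by (rule integral_lebesgue_on_eq[OF S, symmetric])
    (use u Cc_infty_integrable(2)[OF Cc_infty_has_derivative(3)[OF \<phi>]] in \<open>auto elim!: eventually_mono\<close>)
 also have "\<dots> = - (LINT x|lebesgue_on \<Omega>. p x * \<phi> x)" using wp \<phi> by (auto simp: weak_pderiv_def)
 also have "(LINT x|lebesgue_on \<Omega>. p x * \<phi> x) = (RINT x. indicator \<Omega> x * (Y x * \<phi> x))"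
  by (rule integral_lebesgue_on_eq[OF S])
    (use Y Cc_infty_integrable(2)[OF \<phi>] in \<open>auto elim!: eventually_mono\<close>)
 also have "\<dots> = (RINT x. Y x * \<phi> x)"
  using Y(3) by (intro Bochner_Integration.integral_cong) (auto simp: indicator_def)
 finally show "(RINT x. u x * pderiv_at j \<phi> x) = - (RINT x. Y x * \<phi> x)" .
qed

lemma extended_representative:
 fixes q :: "R3 => real"
 assumes "open \<Omega>" "q \<in> borel_measurable (lebesgue_on \<Omega>)"
 obtains u where "u \<in> borel_fn" "AE x in lborel. x \<in> \<Omega> --> q x = u x" "\<forall>x. x \<notin> \<Omega> --> u x = 0"
proof -
 have S: "\<Omega> \<in> sets borel" using assms by simp
 obtain u where u: "u \<in> borel_fn" "AE x in lborel. x \<in> \<Omega> --> q x = u x"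
  using borel_representative[OF S assms(2)] by blast
 show thesis
 proof (rule that[of "%x. indicator \<Omega> x * u x"])
  show "AE x in lborel. x \<in> \<Omega> --> q x = indicator \<Omega> x * u x" using u(2) by eventually_elim auto
 qed (use u S in auto)
qed

text \<open>Both the representatives and the test functions vanish off \<Omega>, so the
  approximation on \<Omega> is the same as one on the whole space; extension by 0 creates no error
  at the boundary.\<close>

lemma H10_representative:
 assumes \<Omega>: "open \<Omega>" and H: "H10 \<Omega> q"
  and u: "u \<in> borel_fn" "AE x in lborel. x \<in> \<Omega> --> q x = u x" "\<forall>x. x \<notin> \<Omega> --> u x = 0"
 shows "\<exists>W. H1_approx \<Omega> u W \<and> (\<forall>j x. x \<notin> \<Omega> --> W j x = 0) \<and> (\<forall>j. integrable lborel (%x. (W j x)\<^sup>2)) \<and>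
  (\<forall>j. \<forall>\<phi>\<in>Cc_infty \<Omega>. (RINT x. u x * pderiv_at j \<phi> x) = - (RINT x. W j x * \<phi> x))"
proof -
 have S: "\<Omega> \<in> sets borel" using \<Omega> by simp
 obtain p where p: "\<And>j. weak_pderiv \<Omega> j q (p j)"
  and approx: "\<And>\<epsilon>. \<epsilon> > 0 ==> \<exists>\<phi>\<in>Cc_infty \<Omega>. (LINT x|lebesgue_on \<Omega>. (q x - \<phi> x)\<^sup>2)
    + (\<Sum>j\<in>UNIV. LINT x|lebesgue_on \<Omega>. (p j x - pderiv_at j \<phi> x)\<^sup>2) < \<epsilon>"
  using H unfolding H10_def by blast
 have "\<forall>j. \<exists>W. W \<in> borel_fn \<and> (AE x in lborel. x \<in> \<Omega> --> p j x = W x) \<and> (\<forall>x. x \<notin> \<Omega> --> W x = 0)" (is "\<forall>j. ?P j")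
 proof
  fix j
  have "p j \<in> borel_measurable (lebesgue_on \<Omega>)" using p[of j] by (simp add: weak_pderiv_def L2_def)
  from extended_representative[OF \<Omega> this] show "?P j" by blast
 qed
 from choice[OF this] obtain W where W: "\<And>j. W j \<in> borel_fn" "\<And>j. AE x in lborel. x \<in> \<Omega> --> p j x = W j x" "\<And>j. \<forall>x. x \<notin> \<Omega> --> W j x = 0"
  by blast
 note rep = weak_pderiv_representative[OF \<Omega> p u W]
 have eq: "(NNINT x. ennreal ((U x - \<phi> x)\<^sup>2)) = ennreal (LINT x|lebesgue_on \<Omega>. (Q x - \<phi> x)\<^sup>2)"
  if \<phi>: "\<phi> \<in> Cc_infty \<Omega>" and U: "U \<in> borel_fn" "AE x in lborel. x \<in> \<Omega> --> Q x = U x" "\<forall>x. x \<notin> \<Omega> --> U x = 0"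
   "integrable lborel (%x. (U x)\<^sup>2)" for U Q \<phi>
 proof -
  note pm = Cc_infty_integrable(2)[OF \<phi>]
  have "(NNINT x. ennreal ((U x - \<phi> x)\<^sup>2)) = ennreal (RINT x. (U x - \<phi> x)\<^sup>2)"
   using square_integrable_diff[of U lborel \<phi>] U pm Cc_infty_square_integrable[OF \<phi>] by (intro square_nn_integral_real) simp
  also have "(RINT x. (U x - \<phi> x)\<^sup>2) = (RINT x. indicator \<Omega> x * (U x - \<phi> x)\<^sup>2)"
   using U(3) Cc_infty_zero[OF \<phi>] by (intro Bochner_Integration.integral_cong) (auto simp: indicator_def)
  also have "\<dots> = (LINT x|lebesgue_on \<Omega>. (Q x - \<phi> x)\<^sup>2)"
   by (rule integral_lebesgue_on_eq[OF S, symmetric]) (use U pm in \<open>auto elim!: eventually_mono\<close>)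
  finally show ?thesis .
 qed
 have "H1_approx \<Omega> u W"
  unfolding H1_approx_def
 proof (intro conjI allI impI)
  fix e :: real assume "0 < e"
  then obtain \<phi> where \<phi>: "\<phi> \<in> Cc_infty \<Omega>" and small: "(LINT x|lebesgue_on \<Omega>. (q x - \<phi> x)\<^sup>2)
    + (\<Sum>j\<in>UNIV. LINT x|lebesgue_on \<Omega>. (p j x - pderiv_at j \<phi> x)\<^sup>2) < e"
   using approx by blast
  have nn: "0 <= (LINT x|lebesgue_on \<Omega>. (a x)\<^sup>2)" for a :: "R3 => real" by (intro Bochner_Integration.integral_nonneg) simp
  have member: "(LINT x|lebesgue_on \<Omega>. (p j x - pderiv_at j \<phi> x)\<^sup>2) <= (\<Sum>j\<in>UNIV. LINT x|lebesgue_on \<Omega>. (p j x - pderiv_at j \<phi> x)\<^sup>2)" for j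
   by (rule member_le_sum) (auto simp: nn)
  have le2: "(LINT x|lebesgue_on \<Omega>. (p j x - pderiv_at j \<phi> x)\<^sup>2) <= e" for j
  proof -
   have "0 <= (LINT x|lebesgue_on \<Omega>. (q x - \<phi> x)\<^sup>2)" by (rule nn)
   then show ?thesis using small member[of j] by linarith
  qed
  have le1: "(LINT x|lebesgue_on \<Omega>. (q x - \<phi> x)\<^sup>2) <= e"
  proof -
   have "0 <= (\<Sum>j\<in>UNIV. LINT x|lebesgue_on \<Omega>. (p j x - pderiv_at j \<phi> x)\<^sup>2)" by (intro sum_nonneg nn)
   then show ?thesis using small by linarith
  qed
  show "\<exists>\<phi>\<in>Cc_infty \<Omega>. (NNINT x. ennreal ((u x - \<phi> x)\<^sup>2)) <= ennreal e \<and>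
   (\<forall>j. (NNINT x. ennreal ((W j x - pderiv_at j \<phi> x)\<^sup>2)) <= ennreal e)"
  proof (rule bexI[OF _ \<phi>], intro conjI allI)
   show "(NNINT x. ennreal ((u x - \<phi> x)\<^sup>2)) <= ennreal e"
    unfolding eq[OF \<phi> u rep(1)] by (rule ennreal_leI[OF le1])
   show "(NNINT x. ennreal ((W j x - pderiv_at j \<phi> x)\<^sup>2)) <= ennreal e" for j
    unfolding eq[OF Cc_infty_has_derivative(3)[OF \<phi>] W rep(2)] by (rule ennreal_leI[OF le2])
  qed
 qed (use u W in auto)
 then show ?thesis using W(3) rep(2,3) by blast
qed

text \<open>At one time there are three a priori unrelated families of weak derivatives: those from
  \<open>H10\<close>, which are approximable, those from the integrable gradient, which carry the
  energy, and those whose trace vanishes. Since W is approximable, the projection argument bounds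
  its energy by that of Y and makes its trace vanish, so W inherits what each of the others
  provides.\<close>

lemma divergence_free_slice:
 fixes u :: "3 => R3 => real" and Y p :: "3 => 3 => R3 => real" and q :: "R3 => R3"
 assumes \<Omega>: "open \<Omega>" and H: "\<And>i. H10 \<Omega> (%x. q x $ i)"
  and u: "\<And>i. u i \<in> borel_fn" "\<And>i. AE x in lborel. x \<in> \<Omega> --> q x $ i = u i x" "\<And>i. \<forall>x. x \<notin> \<Omega> --> u i x = 0"
  and p: "\<And>i j. weak_pderiv \<Omega> j (%x. q x $ i) (p i j)"
  and Y: "\<And>i j. Y i j \<in> borel_fn" "\<And>i j. AE x in lborel. x \<in> \<Omega> --> p i j x = Y i j x" "\<And>i j. \<forall>x. x \<notin> \<Omega> --> Y i j x = 0"
  and d: "\<And>j. weak_pderiv \<Omega> j (%x. q x $ j) (d j)" "AE x in lebesgue_on \<Omega>. (\<Sum>j\<in>UNIV. d j x) = 0"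
 obtains W where "\<And>i. H1_approx \<Omega> (u i) (W i)" "\<And>i j x. x \<notin> \<Omega> ==> W i j x = 0"
  "\<And>i j. (NNINT x. ennreal ((W i j x)\<^sup>2)) <= (NNINT x. ennreal ((Y i j x)\<^sup>2))"
  "\<And>i. integrable lborel (%x. (u i x)\<^sup>2)" "\<And>i j. integrable lborel (%x. (W i j x)\<^sup>2)"
  "AE x in lborel. (\<Sum>j\<in>UNIV. W j j x) = 0"
proof -
 have S: "\<Omega> \<in> sets borel" using \<Omega> by simp
 have "\<forall>i. \<exists>W. H1_approx \<Omega> (u i) W \<and> (\<forall>j x. x \<notin> \<Omega> --> W j x = 0) \<and> (\<forall>j. integrable lborel (%x. (W j x)\<^sup>2)) \<and>
  (\<forall>j. \<forall>\<phi>\<in>Cc_infty \<Omega>. (RINT x. u i x * pderiv_at j \<phi> x) = - (RINT x. W j x * \<phi> x))"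
  by (intro allI H10_representative[OF \<Omega> H u])
 from choice[OF this] obtain W where W: "\<And>i. H1_approx \<Omega> (u i) (W i)" "\<And>i j x. x \<notin> \<Omega> ==> W i j x = 0"
  "\<And>i j. integrable lborel (%x. (W i j x)\<^sup>2)"
  "\<And>i j \<phi>. \<phi> \<in> Cc_infty \<Omega> ==> (RINT x. u i x * pderiv_at j \<phi> x) = - (RINT x. W i j x * \<phi> x)"
  by blast
 have Wm[measurable]: "W i j \<in> borel_fn" for i j using W(1)[of i] by (simp add: H1_approx_def)
 have W_approx: "\<exists>\<phi>\<in>Cc_infty \<Omega>. (NNINT x. ennreal ((W i j x - \<phi> x)\<^sup>2)) <= ennreal e" if e: "0 < e" for i j e
 proof -
  obtain \<phi> where \<phi>: "\<phi> \<in> Cc_infty \<Omega>" "\<And>j. (NNINT x. ennreal ((W i j x - pderiv_at j \<phi> x)\<^sup>2)) <= ennreal e"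
   using W(1)[of i] e unfolding H1_approx_def by blast
  show ?thesis using \<phi>(2) Cc_infty_has_derivative(3)[OF \<phi>(1)] by blast
 qed
 note rep = weak_pderiv_representative[OF \<Omega> p u Y]
 have le: "(NNINT x. ennreal ((W i j x)\<^sup>2)) <= (NNINT x. ennreal ((Y i j x)\<^sup>2))" for i j
 proof -
  have "(RINT x. (W i j x)\<^sup>2) <= (RINT x. (Y i j x)\<^sup>2)"
  proof (rule approx_norm_le[where \<Omega>=\<Omega>, OF Wm W(3) Y(1) rep(2)])
   show "\<exists>\<phi>\<in>Cc_infty \<Omega>. (NNINT x. ennreal ((W i j x - \<phi> x)\<^sup>2)) <= ennreal e" if "0 < e" for e
    by (rule W_approx[OF that])
   show "(RINT x. W i j x * \<phi> x) = (RINT x. Y i j x * \<phi> x)" if "\<phi> \<in> Cc_infty \<Omega>" for \<phi>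
    using W(4)[OF that, of i j] rep(3)[OF that, of i j] by simp
  qed
  then show ?thesis unfolding square_nn_integral_real[OF W(3)] square_nn_integral_real[OF rep(2)] by (rule ennreal_leI)
 qed
 have "\<forall>j. \<exists>D. D \<in> borel_fn \<and> (AE x in lborel. x \<in> \<Omega> --> d j x = D x) \<and> (\<forall>x. x \<notin> \<Omega> --> D x = 0)" (is "\<forall>j. ?P j")
 proof
  fix j
  have "d j \<in> borel_measurable (lebesgue_on \<Omega>)" using d(1)[of j] by (simp add: weak_pderiv_def L2_def)
  from extended_representative[OF \<Omega> this] show "?P j" by blast
 qed
 from choice[OF this] obtain D where D: "\<And>j. D j \<in> borel_fn" "\<And>j. AE x in lborel. x \<in> \<Omega> --> d j x = D j x" "\<And>j. \<forall>x. x \<notin> \<Omega> --> D j x = 0"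
  by blast
 note repD = weak_pderiv_representative[OF \<Omega> d(1) u D]
 have D0: "AE x in lborel. (\<Sum>j\<in>UNIV. D j x) = 0"
 proof -
  have "AE x in lborel. \<forall>j. x \<in> \<Omega> --> d j x = D j x"
   by (rule eventually_all_finite) (rule D(2))
  moreover have "AE x in lborel. x \<in> \<Omega> --> (\<Sum>j\<in>UNIV. d j x) = 0" using d(2) by (simp only: AE_lebesgue_on_iff[OF S])
  ultimately show ?thesis
  proof eventually_elim
   case (elim x)
   then show ?case using D(3) by (cases "x \<in> \<Omega>") auto
  qed
 qed
 let ?X = "%x. \<Sum>j\<in>UNIV. W j j x"
 have X2: "integrable lborel (%x. (?X x)\<^sup>2)"
 proof (rule Bochner_Integration.integrable_bound)
  show "integrable lborel (%x. 3 * (\<Sum>j\<in>UNIV. (W j j x)\<^sup>2))" using W(3) by simp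
  show "AE x in lborel. norm ((?X x)\<^sup>2) <= norm (3 * (\<Sum>j\<in>UNIV. (W j j x)\<^sup>2))"
   using square_sum3_le by (intro AE_I2) (simp add: sum_3)
 qed measurable
 \<comment> \<open>The projection lemma with Y = 0: the trace of W pairs with test functions as the
   trace of D does, and that one is zero.\<close>
 have "(RINT x. (?X x)\<^sup>2) <= (\<integral>x. 0\<^sup>2 \<partial>(lborel :: R3 measure))"
 proof (rule approx_norm_le[where \<Omega>=\<Omega>, OF _ X2])
  show "\<exists>\<phi>\<in>Cc_infty \<Omega>. (NNINT x. ennreal ((?X x - \<phi> x)\<^sup>2)) <= ennreal e" if e: "0 < e" for e
  proof -
   have "\<forall>j. \<exists>\<phi>. \<phi> \<in> Cc_infty \<Omega> \<and> (NNINT x. ennreal ((W j j x - \<phi> x)\<^sup>2)) <= ennreal (e / 9)"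
   proof
    fix j
    have "0 < e / 9" using e by simp
    from W_approx[OF this, of j j] show "\<exists>\<phi>. \<phi> \<in> Cc_infty \<Omega> \<and> (NNINT x. ennreal ((W j j x - \<phi> x)\<^sup>2)) <= ennreal (e / 9)" by blast
   qed
   from choice[OF this] obtain \<phi> where \<phi>: "\<And>j. \<phi> j \<in> Cc_infty \<Omega>" "\<And>j. (NNINT x. ennreal ((W j j x - \<phi> j x)\<^sup>2)) <= ennreal (e / 9)"
    by blast
   note [measurable] = Cc_infty_integrable(2)[OF \<phi>(1)]
   \<comment> \<open>The sum of three test functions, written with differences only so that
     \<open>Cc_infty_diff\<close> applies.\<close>
   have "(%x. \<phi> 1 x - ((\<phi> 1 x - \<phi> 1 x) - \<phi> 2 x) - ((\<phi> 1 x - \<phi> 1 x) - \<phi> 3 x)) \<in> Cc_infty \<Omega>"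
    by (intro Cc_infty_diff(1) \<phi>(1))
   then have "(%x. \<Sum>j\<in>UNIV. \<phi> j x) \<in> Cc_infty \<Omega>" by (simp add: sum_3)
   moreover have "(NNINT x. ennreal ((?X x - (\<Sum>j\<in>UNIV. \<phi> j x))\<^sup>2)) <= ennreal e"
   proof -
    have "(NNINT x. ennreal ((?X x - (\<Sum>j\<in>UNIV. \<phi> j x))\<^sup>2))
     <= (NNINT x. ennreal 3 * (\<Sum>j\<in>UNIV. ennreal ((W j j x - \<phi> j x)\<^sup>2)))"
    proof (rule nn_integral_mono)
     fix x
     have "(?X x - (\<Sum>j\<in>UNIV. \<phi> j x))\<^sup>2 <= 3 * (\<Sum>j\<in>UNIV. (W j j x - \<phi> j x)\<^sup>2)"
      using square_sum3_le[of "W 1 1 x - \<phi> 1 x" "W 2 2 x - \<phi> 2 x" "W 3 3 x - \<phi> 3 x"] by (simp add: sum_3 algebra_simps)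
     then have "ennreal ((?X x - (\<Sum>j\<in>UNIV. \<phi> j x))\<^sup>2) <= ennreal (3 * (\<Sum>j\<in>UNIV. (W j j x - \<phi> j x)\<^sup>2))" by (rule ennreal_leI)
     also have "\<dots> = ennreal 3 * (\<Sum>j\<in>UNIV. ennreal ((W j j x - \<phi> j x)\<^sup>2))"
      by (subst ennreal_mult) (auto intro: sum_nonneg)
     finally show "ennreal ((?X x - (\<Sum>j\<in>UNIV. \<phi> j x))\<^sup>2) <= ennreal 3 * (\<Sum>j\<in>UNIV. ennreal ((W j j x - \<phi> j x)\<^sup>2))" .
    qed
    also have "\<dots> = ennreal 3 * (\<Sum>j\<in>UNIV. NNINT x. ennreal ((W j j x - \<phi> j x)\<^sup>2))"
     by (simp add: nn_integral_cmult nn_integral_sum del: sum_ennreal)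
    also have "\<dots> <= ennreal 3 * (\<Sum>j\<in>(UNIV::3 set). ennreal (e / 9))"
     by (intro mult_left_mono sum_mono \<phi>(2)) simp
    also have "\<dots> = ennreal (3 * (e / 9 + e / 9 + e / 9))"
     unfolding sum_3 using e by (simp add: ennreal_plus[symmetric] ennreal_mult[symmetric] del: ennreal_plus ennreal_numeral)
    also have "\<dots> = ennreal e" by simp
    finally show ?thesis .
   qed
   ultimately show ?thesis by (intro bexI[of _ "%x. \<Sum>j\<in>UNIV. \<phi> j x"])
  qed
  show "(RINT x. ?X x * \<phi> x) = (RINT x. 0 * \<phi> x)" if \<phi>: "\<phi> \<in> Cc_infty \<Omega>" for \<phi>
  proof -
   note pm = Cc_infty_integrable(2)[OF \<phi>] Cc_infty_square_integrable[OF \<phi>]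
   have i: "integrable lborel (%x. W j j x * \<phi> x)" "integrable lborel (%x. D j x * \<phi> x)" for j
    using square_integrable_mult[of "W j j" lborel \<phi>] square_integrable_mult[of "D j" lborel \<phi>] pm W(3) D(1) repD(2) by auto
   have "(RINT x. ?X x * \<phi> x) = (\<Sum>j\<in>UNIV. RINT x. W j j x * \<phi> x)"
    unfolding sum_distrib_right using i by (intro Bochner_Integration.integral_sum)
   also have "\<dots> = (\<Sum>j\<in>UNIV. RINT x. D j x * \<phi> x)"
    using W(4)[OF \<phi>] repD(3)[OF \<phi>] by (intro sum.cong) (auto simp: minus_equation_iff)
   also have "\<dots> = (RINT x. (\<Sum>j\<in>UNIV. D j x) * \<phi> x)"
    unfolding sum_distrib_right using i by (intro Bochner_Integration.integral_sum[symmetric])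
   also have "\<dots> = 0" by (rule integral_eq_zero_AE) (use D0 in \<open>eventually_elim, simp\<close>)
   finally show ?thesis by simp
  qed
 qed auto
 moreover have "0 <= (RINT x. (?X x)\<^sup>2)" by (intro Bochner_Integration.integral_nonneg) simp
 ultimately have "(RINT x. (?X x)\<^sup>2) = 0" by simp
 then have "AE x in lborel. (?X x)\<^sup>2 = 0" using integral_nonneg_eq_0_iff_AE[OF X2] by simp
 then have "AE x in lborel. ?X x = 0" by eventually_elim simp
 with W(1-3) le rep(1) show thesis by (intro that)
qed

text \<open>The first two claims integrate estimates that hold at each time. For the difference
  quotients the threshold for h depends on the time slice, so the integrated statement follows by
  dominated convergence in t; the majorant comes from the translation estimate and is integrable
  because G is square integrable.\<close>

lemma slices_imp_estimates:
 fixes w :: "3 => real \<times> R3 => real" and G :: "3 => 3 => real \<times> R3 => real"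
 assumes \<Omega>: "\<Omega> \<subseteq> cball 0 R" and R: "0 <= R" and T: "0 < T"
  and wm[measurable]: "\<And>j. w j \<in> borel_fn" and Gm[measurable]: "\<And>i j. G i j \<in> borel_fn"
  and w_supp: "\<And>j z. w j z \<noteq> 0 ==> snd z \<in> \<Omega> \<and> fst z \<in> {0..T}"
  and slice: "\<And>t. \<exists>W. (\<forall>i. H1_approx \<Omega> (%x. w i (t, x)) (W i)) \<and> (\<forall>i j x. x \<notin> \<Omega> --> W i j x = 0) \<and>
   (\<forall>i j. (NNINT x. ennreal ((W i j x)\<^sup>2)) <= (NNINT x. ennreal ((G i j (t, x))\<^sup>2))) \<and>
   (\<forall>i. integrable lborel (%x. (w i (t, x))\<^sup>2)) \<and> (\<forall>i j. integrable lborel (%x. (W i j x)\<^sup>2)) \<and>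
   (AE x in lborel. (\<Sum>j\<in>UNIV. W j j x) = 0)"
  and fin: "\<And>i j. (NNINT z. ennreal ((G i j z)\<^sup>2)) < \<infinity>"
 shows "\<And>\<psi> t. \<psi> \<in> Cc_infty UNIV ==> (RINT y. (\<Sum>j\<in>UNIV. w j (t, y) * pderiv_at j \<psi> y)) = 0"
  and "\<And>j k. (NNINT z. ennreal ((w j (z + (0, k)) - w j z)\<^sup>2))
   <= ennreal ((norm k)\<^sup>2 * (6 * (\<Sum>i\<in>UNIV. \<Sum>j\<in>UNIV. enn2real (NNINT z. ennreal ((G i j z)\<^sup>2)))))"
  and "\<And>e. 0 < e ==> \<exists>d>0. \<forall>h. 0 < h \<and> h < d -->
   (NNINT z. ennreal \<bar>\<Sum>j\<in>UNIV. (w j (z + (0, h *\<^sub>R axis j 1)) - w j (z - (0, h *\<^sub>R axis j 1))) / (2 * h)\<bar>) <= ennreal e"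
proof -
 have wm'[measurable]: "w j \<in> borel_measurable (borel \<Otimes>\<^sub>M borel)" for j using wm[of j] by (simp only: borel_prod)
 have Gm'[measurable]: "G i j \<in> borel_measurable (borel \<Otimes>\<^sub>M borel)" for i j using Gm[of i j] by (simp only: borel_prod)
 have ws: "(%z. w j (z + c)) \<in> borel_fn" "(%z. w j (z - c)) \<in> borel_fn" for c j
  by (rule measurable_compose[OF borel_measurable_continuous_onI wm], intro continuous_intros)+
 have Gt[measurable]: "(%t. NNINT y. ennreal ((G i j (t, y))\<^sup>2)) \<in> borel_fn" for i j by measurable
 have Gz: "(NNINT t. NNINT y. ennreal ((G i j (t, y))\<^sup>2)) = (NNINT z. ennreal ((G i j z)\<^sup>2))" for i j
  by (subst nn_integral_lborel_time_space) measurable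
 have translate: "(NNINT y. ennreal ((w j (t, y + k) - w j (t, y))\<^sup>2))
  <= ennreal (6 * (norm k)\<^sup>2) * (\<Sum>i\<in>UNIV. NNINT y. ennreal ((G j i (t, y))\<^sup>2))" for j t k
 proof -
  obtain W where W: "H1_approx \<Omega> (%x. w j (t, x)) (W j)"
   "\<And>i. (NNINT x. ennreal ((W j i x)\<^sup>2)) <= (NNINT x. ennreal ((G j i (t, x))\<^sup>2))"
   using slice[of t] by blast
  have "(NNINT y. ennreal ((w j (t, y + k) - w j (t, y))\<^sup>2))
   <= ennreal (6 * (norm k)\<^sup>2) * (\<Sum>i\<in>UNIV. NNINT y. ennreal ((W j i y)\<^sup>2))"
   by (rule H1_approx_translation[OF W(1)])
  also have "\<dots> <= ennreal (6 * (norm k)\<^sup>2) * (\<Sum>i\<in>UNIV. NNINT y. ennreal ((G j i (t, y))\<^sup>2))"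
   by (intro mult_left_mono sum_mono W(2)) simp
  finally show ?thesis .
 qed
 show "(RINT y. (\<Sum>j\<in>UNIV. w j (t, y) * pderiv_at j \<psi> y)) = 0" if \<psi>: "\<psi> \<in> Cc_infty UNIV" for \<psi> t
 proof -
  obtain W where W: "\<And>i. H1_approx \<Omega> (%x. w i (t, x)) (W i)" "\<And>i. integrable lborel (%x. (w i (t, x))\<^sup>2)"
   "\<And>i j. integrable lborel (%x. (W i j x)\<^sup>2)" "AE x in lborel. (\<Sum>j\<in>UNIV. W j j x) = 0"
   using slice[of t] by blast
  have Wm: "W i j \<in> borel_fn" for i j using W(1)[of i] by (simp add: H1_approx_def)
  note p = Cc_infty_integrable(2)[OF \<psi>] Cc_infty_square_integrable[OF \<psi>]
  note dp = Cc_infty_integrable(2)[OF Cc_infty_has_derivative(3)[OF \<psi>]] Cc_infty_square_integrable[OF Cc_infty_has_derivative(3)[OF \<psi>]]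
  have i: "integrable lborel (%y. w j (t, y) * pderiv_at j \<psi> y)" "integrable lborel (%y. W j j y * \<psi> y)" for j
   using square_integrable_mult[of "%y. w j (t, y)" lborel "pderiv_at j \<psi>"] square_integrable_mult[of "W j j" lborel \<psi>] W Wm p dp by auto
  have "(RINT y. (\<Sum>j\<in>UNIV. w j (t, y) * pderiv_at j \<psi> y)) = (\<Sum>j\<in>UNIV. RINT y. w j (t, y) * pderiv_at j \<psi> y)"
   using i by (intro Bochner_Integration.integral_sum)
  also have "\<dots> = (\<Sum>j\<in>UNIV. - (RINT y. W j j y * \<psi> y))"
   by (intro sum.cong refl H1_approx_integration_by_parts[OF W(1,2,3) \<psi>])
  also have "\<dots> = - (RINT y. (\<Sum>j\<in>UNIV. W j j y) * \<psi> y)"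
   unfolding sum_distrib_right sum_negf using i by (subst Bochner_Integration.integral_sum) auto
  also have "(RINT y. (\<Sum>j\<in>UNIV. W j j y) * \<psi> y) = 0"
   by (rule integral_eq_zero_AE) (use W(4) in \<open>eventually_elim, simp\<close>)
  finally show ?thesis by simp
 qed
 show "(NNINT z. ennreal ((w j (z + (0, k)) - w j z)\<^sup>2))
   <= ennreal ((norm k)\<^sup>2 * (6 * (\<Sum>i\<in>UNIV. \<Sum>j\<in>UNIV. enn2real (NNINT z. ennreal ((G i j z)\<^sup>2)))))" for j k
 proof -
  let ?g = "%i j. enn2real (NNINT z. ennreal ((G i j z)\<^sup>2))"
  have g: "(NNINT z. ennreal ((G i j z)\<^sup>2)) = ennreal (?g i j)" for i j using fin[of i j] by simp
  have "(NNINT z. ennreal ((w j (z + (0, k)) - w j z)\<^sup>2)) = (NNINT t. NNINT y. ennreal ((w j (t, y + k) - w j (t, y))\<^sup>2))"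
  proof -
   have "(%z. ennreal ((w j (z + (0, k)) - w j z)\<^sup>2)) \<in> borel_fn"
    by (intro measurable_compose[OF _ measurable_ennreal] borel_measurable_power borel_measurable_diff ws wm)
   from nn_integral_lborel_time_space[OF this] show ?thesis by simp
  qed
  also have "\<dots> <= (NNINT t. ennreal (6 * (norm k)\<^sup>2) * (\<Sum>i\<in>UNIV. NNINT y. ennreal ((G j i (t, y))\<^sup>2)))"
   by (intro nn_integral_mono translate)
  also have "\<dots> = ennreal (6 * (norm k)\<^sup>2) * (\<Sum>i\<in>UNIV. NNINT z. ennreal ((G j i z)\<^sup>2))"
   by (subst nn_integral_cmult, measurable) (subst nn_integral_sum, measurable, simp only: Gz)
  also have "\<dots> = ennreal (6 * (norm k)\<^sup>2) * (\<Sum>i\<in>UNIV. ennreal (?g j i))" by (simp only: g[symmetric])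
  also have "\<dots> = ennreal (6 * (norm k)\<^sup>2 * (\<Sum>i\<in>UNIV. ?g j i))" by (simp add: ennreal_mult sum_nonneg)
  also have "\<dots> <= ennreal ((norm k)\<^sup>2 * (6 * (\<Sum>i\<in>UNIV. \<Sum>j\<in>UNIV. ?g i j)))"
  proof -
   have "(\<Sum>i\<in>UNIV. ?g j i) <= (\<Sum>i\<in>UNIV. \<Sum>j\<in>UNIV. ?g i j)"
    by (rule member_le_sum[of j UNIV "%i. \<Sum>j\<in>UNIV. ?g i j"]) (auto intro!: sum_nonneg)
   then have "(6 * (norm k)\<^sup>2) * (\<Sum>i\<in>UNIV. ?g j i) <= (6 * (norm k)\<^sup>2) * (\<Sum>i\<in>UNIV. \<Sum>j\<in>UNIV. ?g i j)"
    by (intro mult_left_mono) auto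
   then show ?thesis by (intro ennreal_leI) (simp add: mult_ac)
  qed
  finally show ?thesis .
 qed
 show "\<exists>d>0. \<forall>h. 0 < h \<and> h < d -->
   (NNINT z. ennreal \<bar>\<Sum>j\<in>UNIV. (w j (z + (0, h *\<^sub>R axis j 1)) - w j (z - (0, h *\<^sub>R axis j 1))) / (2 * h)\<bar>) <= ennreal e"
  if e: "0 < e" for e
 proof (rule ccontr)
  define a where "a h j t y = (w j (t, y + h *\<^sub>R axis j 1) - w j (t, y - h *\<^sub>R axis j 1)) / (2 * h)" for h j t and y :: R3
  have am[measurable]: "(%z. a h j (fst z) (snd z)) \<in> borel_measurable (borel \<Otimes>\<^sub>M borel)" for h j
   unfolding a_def by measurable
  have am2[measurable]: "(%y. a h j t y) \<in> borel_fn" for h j t unfolding a_def by measurable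
  define q where "q h t = (NNINT y. ennreal \<bar>\<Sum>j\<in>UNIV. a h j t y\<bar>)" for h t
  have qm[measurable]: "q h \<in> borel_fn" for h unfolding q_def a_def by measurable
  have Q: "(NNINT z. ennreal \<bar>\<Sum>j\<in>UNIV. (w j (z + (0, h *\<^sub>R axis j 1)) - w j (z - (0, h *\<^sub>R axis j 1))) / (2 * h)\<bar>) = (NNINT t. q h t)" for h
  proof -
   have "(%z. ennreal \<bar>\<Sum>j\<in>UNIV. (w j (z + (0, h *\<^sub>R axis j 1)) - w j (z - (0, h *\<^sub>R axis j 1))) / (2 * h)\<bar>) \<in> borel_fn"
    by (intro measurable_compose[OF _ measurable_ennreal] borel_measurable_abs borel_measurable_sum borel_measurable_divide borel_measurable_diff borel_measurable_const ws)
   from nn_integral_lborel_time_space[OF this] show ?thesis unfolding q_def a_def by simp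
  qed
  assume neg: "\<not> ?thesis"
  \<comment> \<open>Dominated convergence runs along sequences, so the failure of the claim is
    turned into a sequence of step sizes below 1/(n+1).\<close>
  have "\<forall>n. \<exists>h. 0 < h \<and> h < inverse (real (Suc n)) \<and> ennreal e < (NNINT t. q h t)"
  proof (intro allI)
   fix n
   show "\<exists>h. 0 < h \<and> h < inverse (real (Suc n)) \<and> ennreal e < (NNINT t. q h t)"
   proof (rule ccontr)
    assume no: "\<not> (\<exists>h. 0 < h \<and> h < inverse (real (Suc n)) \<and> ennreal e < (NNINT t. q h t))"
    have "\<exists>d>0. \<forall>h. 0 < h \<and> h < d --> (NNINT t. q h t) <= ennreal e"
    proof (intro exI[of _ "inverse (real (Suc n))"] conjI allI impI)
     fix h assume "0 < h \<and> h < inverse (real (Suc n))"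
     with no have "\<not> ennreal e < (NNINT t. q h t)" by blast
     then show "(NNINT t. q h t) <= ennreal e" by (simp only: not_less)
    qed simp
    with neg[unfolded Q] show False by (rule notE)
   qed
  qed
  from choice[OF this] obtain h where h: "\<And>n. 0 < h n" "\<And>n. h n < inverse (real (Suc n))" "\<And>n. ennreal e < (NNINT t. q (h n) t)"
   by blast
  define vol where "vol = measure lborel (cball (0::R3) (R + 1))"
  \<comment> \<open>From |a| <= 1 + a^2, where the 1 is needed only on the ball of radius R + 1. The
    quotients have step 2h, and 6 (2h)^2/(2h)^2 = 6 leaves a bound free of h.\<close>
  define dom where "dom t = ennreal (3 * vol) * indicator {0..T} t + ennreal 6 * (\<Sum>j\<in>UNIV. \<Sum>i\<in>UNIV. NNINT y. ennreal ((G j i (t, y))\<^sup>2))" for t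
  have "(%n. NNINT t. q (h n) t) \<longlonglongrightarrow> (\<integral>\<^sup>+t. 0 \<partial>(lborel :: real measure))"
  proof (rule nn_integral_dominated_convergence[where w=dom])
   show "dom \<in> borel_measurable lborel" unfolding dom_def by measurable
   have "(NNINT t. dom t) = ennreal (3 * vol) * ennreal T + ennreal 6 * (\<Sum>j\<in>UNIV. \<Sum>i\<in>UNIV. NNINT z. ennreal ((G j i z)\<^sup>2))"
   proof -
    define Q where "Q t = (\<Sum>j\<in>UNIV. \<Sum>i\<in>UNIV. NNINT y. ennreal ((G j i (t, y))\<^sup>2))" for t
    have Gs: "(%t. \<Sum>i\<in>UNIV. NNINT y. ennreal ((G j i (t, y))\<^sup>2)) \<in> borel_measurable lborel" for j
     using Gt by (intro borel_measurable_sum) simp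
    have Qm[measurable]: "Q \<in> borel_fn" unfolding Q_def by (intro borel_measurable_sum Gt)
    have "(NNINT t. Q t) = (\<Sum>j\<in>UNIV. NNINT t. (\<Sum>i\<in>UNIV. NNINT y. ennreal ((G j i (t, y))\<^sup>2)))"
     unfolding Q_def by (rule nn_integral_sum) (rule Gs)
    also have "\<dots> = (\<Sum>j\<in>UNIV. \<Sum>i\<in>UNIV. NNINT z. ennreal ((G j i z)\<^sup>2))"
    proof (intro sum.cong refl)
     show "(NNINT t. (\<Sum>i\<in>UNIV. NNINT y. ennreal ((G j i (t, y))\<^sup>2))) = (\<Sum>i\<in>UNIV. NNINT z. ennreal ((G j i z)\<^sup>2))" for j
      by (subst nn_integral_sum) (use Gt in simp, simp only: Gz)
    qed
    finally have Qi: "(NNINT t. Q t) = (\<Sum>j\<in>UNIV. \<Sum>i\<in>UNIV. NNINT z. ennreal ((G j i z)\<^sup>2))" .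
    have "(NNINT t. ennreal (3 * vol) * indicator {0..T} t + ennreal 6 * Q t)
     = (NNINT t. ennreal (3 * vol) * indicator {0..T} t) + (NNINT t. ennreal 6 * Q t)"
     by (rule nn_integral_add) measurable
    also have "\<dots> = ennreal (3 * vol) * ennreal T + ennreal 6 * (NNINT t. Q t)"
    proof -
     have "(NNINT t. ennreal 6 * Q t) = ennreal 6 * (NNINT t. Q t)" by (rule nn_integral_cmult) measurable
     moreover have "(NNINT t. ennreal (3 * vol) * indicator {0..T} t) = ennreal (3 * vol) * ennreal T"
      using T by (subst nn_integral_cmult) simp_all
     ultimately show ?thesis by (simp only:)
    qed
    finally show ?thesis unfolding dom_def Q_def[symmetric] Qi .
   qed
   also have "\<dots> < \<infinity>" using fin by (simp add: ennreal_mult_less_top sum_3 less_top)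
   finally show "(NNINT t. dom t) < \<infinity>" .
   show "AE t in lborel. q (h n) t <= dom t" for n
   proof (rule AE_I2)
    fix t
    let ?c = "%y. indicator (cball (0::R3) (R + 1)) y * indicator {0..T} t :: ennreal"
    have cb: "cball (0::R3) (R + 1) \<in> sets borel" by (rule borel_closed[OF closed_cball])
    then have cm[measurable]: "?c \<in> borel_fn" by measurable
    have h1: "h n < 1" by (rule less_le_trans[OF h(2)[of n]]) (simp add: inverse_le_1_iff)
    have bnd: "ennreal \<bar>a (h n) j t y\<bar> <= ?c y + ennreal ((a (h n) j t y)\<^sup>2)" for j y
    proof (cases "a (h n) j t y = 0")
     case False
     then have "w j (t, y + h n *\<^sub>R axis j 1) \<noteq> 0 \<or> w j (t, y - h n *\<^sub>R axis j 1) \<noteq> 0" by (auto simp: a_def)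
     then have "t \<in> {0..T} \<and> (norm (y + h n *\<^sub>R axis j 1) <= R \<or> norm (y - h n *\<^sub>R axis j 1) <= R)"
      using w_supp[of j "(t, y + h n *\<^sub>R axis j 1)"] w_supp[of j "(t, y - h n *\<^sub>R axis j 1)"] \<Omega> by fastforce
     moreover have "norm (h n *\<^sub>R axis j (1::real)) <= 1" using h(1)[of n] h1 by (simp add: norm_axis_1)
     ultimately have "t \<in> {0..T}" "norm y <= R + 1"
      using norm_triangle_ineq2[of y "- (h n *\<^sub>R axis j (1::real))"] norm_triangle_ineq2[of y "h n *\<^sub>R axis j (1::real)"] by auto
     then have c: "?c y = ennreal 1" by (simp add: indicator_def)
     have "0 <= (\<bar>a (h n) j t y\<bar> - 1)\<^sup>2" by simp
     then have "\<bar>a (h n) j t y\<bar> <= 1 + (a (h n) j t y)\<^sup>2" using abs_ge_zero[of "a (h n) j t y"] by (simp add: power2_diff)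
     then have "ennreal \<bar>a (h n) j t y\<bar> <= ennreal (1 + (a (h n) j t y)\<^sup>2)" by (rule ennreal_leI)
     also have "\<dots> = ennreal 1 + ennreal ((a (h n) j t y)\<^sup>2)" by (rule ennreal_plus) simp_all
     finally show ?thesis unfolding c .
    qed simp
    have sq: "(NNINT y. ennreal ((a (h n) j t y)\<^sup>2)) <= ennreal 6 * (\<Sum>i\<in>UNIV. NNINT y. ennreal ((G j i (t, y))\<^sup>2))" for j
    proof -
     let ?k = "(2 * h n) *\<^sub>R axis j (1::real) :: R3"
     let ?D = "%y. ennreal ((w j (t, y + ?k) - w j (t, y))\<^sup>2)"
     have hn: "0 < h n" by (rule h(1))
     have "(NNINT y. ennreal ((a (h n) j t y)\<^sup>2)) = (NNINT y. ennreal (1 / (2 * h n)\<^sup>2) * ?D (y + - (h n *\<^sub>R axis j 1)))"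
     proof (intro nn_integral_cong)
      fix y
      have "(2 * h n) *\<^sub>R axis j (1::real) = h n *\<^sub>R axis j 1 + h n *\<^sub>R (axis j 1 :: R3)"
       unfolding mult_2 by (rule scaleR_left_distrib)
      then have e1: "y + - (h n *\<^sub>R axis j 1) + ?k = y + h n *\<^sub>R axis j 1" by simp
      have e2: "?D (y + - (h n *\<^sub>R axis j 1)) = ennreal ((w j (t, y + h n *\<^sub>R axis j 1) - w j (t, y - h n *\<^sub>R axis j 1))\<^sup>2)"
       by (simp only: e1 diff_conv_add_uminus)
      show "ennreal ((a (h n) j t y)\<^sup>2) = ennreal (1 / (2 * h n)\<^sup>2) * ?D (y + - (h n *\<^sub>R axis j 1))"
       unfolding e2 a_def power_divide by (subst ennreal_mult[symmetric]) simp_all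
     qed
     also have "\<dots> = ennreal (1 / (2 * h n)\<^sup>2) * (NNINT y. ?D (y + - (h n *\<^sub>R axis j 1)))"
      by (rule nn_integral_cmult) measurable
     also have "(NNINT y. ?D (y + - (h n *\<^sub>R axis j 1))) = (NNINT y. ?D y)"
      by (rule nn_integral_lborel_shift) measurable
     also have "ennreal (1 / (2 * h n)\<^sup>2) * (NNINT y. ?D y)
      <= ennreal (1 / (2 * h n)\<^sup>2) * (ennreal (6 * (norm ?k)\<^sup>2) * (\<Sum>i\<in>UNIV. NNINT y. ennreal ((G j i (t, y))\<^sup>2)))"
      by (intro mult_left_mono translate) simp
     also have "\<dots> = ennreal 6 * (\<Sum>i\<in>UNIV. NNINT y. ennreal ((G j i (t, y))\<^sup>2))"
     proof -
      have "ennreal (1 / (2 * h n)\<^sup>2) * ennreal (6 * (norm ?k)\<^sup>2) = ennreal 6"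
       using hn by (simp add: ennreal_mult[symmetric] norm_axis_1 power_mult_distrib)
      then show ?thesis by (simp only: mult.assoc[symmetric])
     qed
     finally show ?thesis .
    qed
    have "q (h n) t <= (NNINT y. (\<Sum>j\<in>UNIV. ?c y + ennreal ((a (h n) j t y)\<^sup>2)))"
     unfolding q_def
    proof (rule nn_integral_mono)
     fix y
     have "ennreal \<bar>\<Sum>j\<in>UNIV. a (h n) j t y\<bar> <= (\<Sum>j\<in>UNIV. ennreal \<bar>a (h n) j t y\<bar>)"
      by (subst sum_ennreal) (auto intro!: ennreal_leI sum_abs)
     also have "\<dots> <= (\<Sum>j\<in>UNIV. ?c y + ennreal ((a (h n) j t y)\<^sup>2))" by (intro sum_mono bnd)
     finally show "ennreal \<bar>\<Sum>j\<in>UNIV. a (h n) j t y\<bar> <= (\<Sum>j\<in>UNIV. ?c y + ennreal ((a (h n) j t y)\<^sup>2))" .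
    qed
    also have "\<dots> = (\<Sum>j\<in>(UNIV :: 3 set). (NNINT y. ?c y) + (NNINT y. ennreal ((a (h n) j t y)\<^sup>2)))"
    proof -
     have "(NNINT y. (\<Sum>j\<in>(UNIV :: 3 set). ?c y + ennreal ((a (h n) j t y)\<^sup>2))) = (\<Sum>j\<in>UNIV. NNINT y. ?c y + ennreal ((a (h n) j t y)\<^sup>2))"
      by (rule nn_integral_sum) (use cm in measurable)
     moreover have "(NNINT y. ?c y + ennreal ((a (h n) j t y)\<^sup>2)) = (NNINT y. ?c y) + (NNINT y. ennreal ((a (h n) j t y)\<^sup>2))" for j
      by (rule nn_integral_add) (use cm in measurable)
     ultimately show ?thesis by (simp only:)
    qed
    also have "\<dots> <= (\<Sum>j\<in>UNIV. ennreal vol * indicator {0..T} t + ennreal 6 * (\<Sum>i\<in>UNIV. NNINT y. ennreal ((G j i (t, y))\<^sup>2)))"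
    proof (intro sum_mono add_mono sq)
     have "(NNINT y. ?c y) = emeasure lborel (cball (0::R3) (R + 1)) * indicator {0..T} t"
      by (subst nn_integral_multc) (simp_all add: borel_measurable_indicator[OF cb] cb)
     also have "emeasure lborel (cball (0::R3) (R + 1)) = ennreal vol"
      unfolding vol_def using emeasure_bounded_finite[OF bounded_cball, of "0::R3" "R + 1"]
      by (intro emeasure_eq_ennreal_measure) (simp add: less_top)
     finally show "(NNINT y. ?c y) <= ennreal vol * indicator {0..T} t" by simp
    qed
    also have "\<dots> = dom t"
    proof -
     have v3: "ennreal (3 * vol) = 3 * ennreal vol" by (simp add: ennreal_mult vol_def)
     show ?thesis unfolding dom_def v3 by (simp add: sum.distrib sum_distrib_left mult_ac)
    qed
    finally show "q (h n) t <= dom t" .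
   qed
   show "AE t in lborel. (%n. q (h n) t) \<longlonglongrightarrow> 0"
   proof (rule AE_I2)
    fix t
    obtain W where W: "\<And>i. H1_approx \<Omega> (%x. w i (t, x)) (W i)" "\<forall>i j x. x \<notin> \<Omega> --> W i j x = 0" "AE x in lborel. (\<Sum>j\<in>UNIV. W j j x) = 0"
     using slice[of t] by blast
    have small: "\<exists>d>0. \<forall>h. 0 < h \<and> h < d --> q h t <= ennreal \<epsilon>" if "0 < \<epsilon>" for \<epsilon>
     unfolding q_def a_def
    proof (rule H1_approx_quotient[OF W(1) \<Omega> R _ _ W(3) that])
     show "w j (t, x) = 0" if "R < norm x" for j x using w_supp[of j "(t, x)"] \<Omega> that by fastforce
     show "W i j x = 0" if "R < norm x" for i j x using W(2) \<Omega> that by fastforce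
    qed
    show "(%n. q (h n) t) \<longlonglongrightarrow> 0"
    proof (rule order_tendstoI)
     fix b :: ennreal assume "0 < b"
     then obtain c where c: "0 < c" "c < b" using dense by blast
     then obtain \<epsilon> where \<epsilon>: "c = ennreal \<epsilon>" "0 <= \<epsilon>" by (cases c) auto
     with c have "0 < \<epsilon>" by auto
     then obtain d where d: "0 < d" "\<And>h. 0 < h ==> h < d ==> q h t <= ennreal \<epsilon>" using small by blast
     obtain N where N: "inverse (real (Suc N)) < d" using reals_Archimedean[OF d(1)] by blast
     show "\<forall>\<^sub>F n in sequentially. q (h n) t < b"
     proof (rule eventually_sequentiallyI[of N])
      fix n assume "N <= n"
      then have "inverse (real (Suc n)) <= inverse (real (Suc N))" by (intro le_imp_inverse_le) auto
      from less_trans[OF less_le_trans[OF h(2)[of n] this] N] have "q (h n) t <= ennreal \<epsilon>" by (rule d(2)[OF h(1)])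
      then show "q (h n) t < b" using c(2) unfolding \<epsilon>(1) by (rule le_less_trans)
     qed
    qed simp
   qed
  qed measurable
  then have "(%n. NNINT t. q (h n) t) \<longlonglongrightarrow> 0" by simp
  then have "ennreal e <= 0" by (rule LIMSEQ_le_const) (use h(3) in \<open>auto intro: less_imp_le\<close>)
  then show False using e by simp
 qed
qed

text \<open>All conditions on v hold for almost every time only. The representative is set to 0 at
  the bad times, where every estimate becomes trivial, so that afterwards the bounds and the
  divergence condition hold at each time without exception.\<close>

lemma velocity_representative:
 fixes v :: "real => R3 => R3"
 assumes T: "0 < T" and \<Omega>: "bounded \<Omega>" "open \<Omega>"
  and v: "L2_H10 T \<Omega> v" "Linf_L2 T \<Omega> v" "divergence_free T \<Omega> v"
 obtains R V \<Gamma> w where "0 <= R" "0 <= V" "0 <= \<Gamma>" "\<Omega> \<subseteq> cball 0 R" "\<And>j. w j \<in> borel_fn"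
  "\<And>j z. w j z \<noteq> 0 ==> snd z \<in> \<Omega> \<and> fst z \<in> {0..T}"
  "AE z in lborel. fst z \<in> {0..T} --> (\<forall>j. w j z = ext0 \<Omega> (v (fst z)) (snd z) $ j)"
  "\<And>j t. (NNINT y. ennreal \<bar>w j (t, y)\<bar>) <= ennreal V"
  "\<And>j t. (NNINT y. ennreal ((w j (t, y))\<^sup>2)) <= ennreal V"
  "\<And>\<psi> t. \<psi> \<in> Cc_infty UNIV ==> (RINT y. (\<Sum>j\<in>UNIV. w j (t, y) * pderiv_at j \<psi> y)) = 0"
  "\<And>j k. (NNINT z. ennreal ((w j (z + (0, k)) - w j z)\<^sup>2)) <= ennreal ((norm k)\<^sup>2 * \<Gamma>)"
  "\<And>e. 0 < e ==> \<exists>d>0. \<forall>h. 0 < h \<and> h < d -->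
   (NNINT z. ennreal \<bar>\<Sum>j\<in>UNIV. (w j (z + (0, h *\<^sub>R axis j 1)) - w j (z - (0, h *\<^sub>R axis j 1))) / (2 * h)\<bar>) <= ennreal e"
proof -
 have S: "\<Omega> \<in> sets borel" using \<Omega> by simp
 have TS: "{0..T} \<times> \<Omega> \<in> sets borel" using S by (intro borel_Times) auto
 obtain R0 where R0: "\<And>x. x \<in> \<Omega> ==> norm x <= R0" using \<Omega>(1) unfolding bounded_iff by blast
 define R where "R = max R0 0"
 have R: "0 <= R" "\<Omega> \<subseteq> cball 0 R" using R0 by (fastforce simp: R_def)+
 obtain G where Gj: "joint_measurable T \<Omega> G"
  and Gw: "AE t in lebesgue_on {0..T}. \<forall>i j. weak_pderiv \<Omega> j (%x. v t x $ i) (%x. G t x $ i $ j)"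
  and Gf: "(\<integral>\<^sup>+t. (\<integral>\<^sup>+x. ennreal ((norm (v t x))\<^sup>2 + (norm (G t x))\<^sup>2) \<partial>lebesgue_on \<Omega>) \<partial>lebesgue_on {0..T}) < \<infinity>"
  using v(1) unfolding L2_H10_def by blast
 obtain Mv where Mv: "AE t in lebesgue_on {0..T}. (\<integral>\<^sup>+x. ennreal ((norm (v t x))\<^sup>2) \<partial>lebesgue_on \<Omega>) <= ennreal Mv"
  using v(2) unfolding Linf_L2_def by blast
 have nth: "(%x :: R3. x $ j) \<in> borel_fn" "(%x :: real^3^3. x $ i $ j) \<in> borel_fn" for i j
  by (intro borel_measurable_continuous_onI continuous_intros)+
 have "\<forall>j. \<exists>u. u \<in> borel_fn \<and> (AE z in lborel. z \<in> {0..T} \<times> \<Omega> --> v (fst z) (snd z) $ j = u z)"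
 proof
  fix j
  have "(%z. (case z of (t, x) => v t x) $ j) \<in> borel_measurable (lebesgue_on ({0..T} \<times> \<Omega>))"
   using v(1) unfolding L2_H10_def joint_measurable_def by (intro measurable_compose[OF _ nth(1)]) blast
  from borel_representative[OF TS this] show "\<exists>u. u \<in> borel_fn \<and> (AE z in lborel. z \<in> {0..T} \<times> \<Omega> --> v (fst z) (snd z) $ j = u z)"
   unfolding split_beta' by blast
 qed
 from choice[OF this] obtain v1 where v1[measurable]: "\<And>j. v1 j \<in> borel_fn"
  and v1e: "\<And>j. AE z in lborel. z \<in> {0..T} \<times> \<Omega> --> v (fst z) (snd z) $ j = v1 j z" by blast
 have "\<forall>ij. \<exists>u. u \<in> borel_fn \<and> (AE z in lborel. z \<in> {0..T} \<times> \<Omega> --> G (fst z) (snd z) $ fst ij $ snd ij = u z)"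
 proof
  fix ij
  have "(%z. (case z of (t, x) => G t x) $ fst ij $ snd ij) \<in> borel_measurable (lebesgue_on ({0..T} \<times> \<Omega>))"
   using Gj unfolding joint_measurable_def by (intro measurable_compose[OF _ nth(2)]) blast
  from borel_representative[OF TS this] show "\<exists>u. u \<in> borel_fn \<and> (AE z in lborel. z \<in> {0..T} \<times> \<Omega> --> G (fst z) (snd z) $ fst ij $ snd ij = u z)"
   unfolding split_beta' by blast
 qed
 from choice[OF this] obtain G0 where G0: "\<And>ij. G0 ij \<in> borel_fn"
  "\<And>ij. AE z in lborel. z \<in> {0..T} \<times> \<Omega> --> G (fst z) (snd z) $ fst ij $ snd ij = G0 ij z" by blast
 \<comment> \<open>Every property of a single slice that is used later, including agreement with the
   jointly measurable Borel representatives.\<close>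
 define good where "good t \<longleftrightarrow> (\<forall>j. AE x in lborel. x \<in> \<Omega> --> v t x $ j = v1 j (t, x)) \<and>
  (\<forall>i j. AE x in lborel. x \<in> \<Omega> --> G t x $ i $ j = G0 (i, j) (t, x)) \<and> (\<forall>i. H10 \<Omega> (%x. v t x $ i)) \<and>
  (\<forall>i j. weak_pderiv \<Omega> j (%x. v t x $ i) (%x. G t x $ i $ j)) \<and>
  (\<integral>\<^sup>+x. ennreal ((norm (v t x))\<^sup>2) \<partial>lebesgue_on \<Omega>) <= ennreal Mv \<and>
  (\<exists>d. (\<forall>j. weak_pderiv \<Omega> j (%x. v t x $ j) (d j)) \<and> (AE x in lebesgue_on \<Omega>. (\<Sum>j\<in>UNIV. d j x) = 0))" for t
 have slice_ae: "AE t in lborel. AE x in lborel. (t, x) \<in> {0..T} \<times> \<Omega> --> a t x = b (t, x)"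
  if "AE z in lborel. z \<in> {0..T} \<times> \<Omega> --> a (fst z) (snd z) = b z" for a b :: "_ => _"
 proof -
  have "AE z in lborel \<Otimes>\<^sub>M lborel. z \<in> {0..T} \<times> \<Omega> --> a (fst z) (snd z) = b z" using that unfolding lborel_prod .
  from lborel_pair.AE_pair[OF this] show ?thesis by simp
 qed
 have "AE t in lborel. \<forall>j. AE x in lborel. (t, x) \<in> {0..T} \<times> \<Omega> --> v t x $ j = v1 j (t, x)"
  by (rule eventually_all_finite) (rule slice_ae[OF v1e])
 moreover have "AE t in lborel. \<forall>i j. AE x in lborel. (t, x) \<in> {0..T} \<times> \<Omega> --> G t x $ i $ j = G0 (i, j) (t, x)"
  by (intro eventually_all_finite slice_ae) (use G0(2)[of "(_, _)"] in simp)
 moreover have "AE t in lborel. t \<in> {0..T} --> (\<forall>i. H10 \<Omega> (%x. v t x $ i))"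
  using v(1) unfolding L2_H10_def by (simp add: AE_lebesgue_on_iff)
 moreover have "AE t in lborel. t \<in> {0..T} --> (\<exists>d. (\<forall>j. weak_pderiv \<Omega> j (%x. v t x $ j) (d j)) \<and> (AE x in lebesgue_on \<Omega>. (\<Sum>j\<in>UNIV. d j x) = 0))"
  using v(3) unfolding divergence_free_def by (subst (asm) AE_lebesgue_on_iff) auto
 moreover have "AE t in lborel. t \<in> {0..T} --> (\<forall>i j. weak_pderiv \<Omega> j (%x. v t x $ i) (%x. G t x $ i $ j))"
  using Gw by (subst (asm) AE_lebesgue_on_iff) auto
 moreover have "AE t in lborel. t \<in> {0..T} --> (\<integral>\<^sup>+x. ennreal ((norm (v t x))\<^sup>2) \<partial>lebesgue_on \<Omega>) <= ennreal Mv"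
  using Mv by (subst (asm) AE_lebesgue_on_iff) auto
 ultimately have "AE t in lborel. t \<in> {0..T} --> good t"
 proof eventually_elim
  case (elim t)
  show ?case
  proof
   assume t: "t \<in> {0..T}"
   then have "(t, x) \<in> {0..T} \<times> \<Omega> \<longleftrightarrow> x \<in> \<Omega>" for x by auto
   note m = this
   show "good t" unfolding good_def using elim t unfolding m by (intro conjI; blast)
  qed
 qed
 then obtain N where N: "N \<in> null_sets lborel" "{t. \<not> (t \<in> {0..T} --> good t)} \<subseteq> N"
  unfolding eventually_ae_filter by auto
 \<comment> \<open>The set of good times need not be measurable; removing a Borel null set N that
   covers the bad ones gives a Borel set of good times.\<close>
 define E where "E = {0..T} - N"
 have E: "E \<in> sets borel" using N(1) by (auto simp: E_def null_sets_def)
 have ET: "t \<in> {0..T}" "good t" if "t \<in> E" for t using that N(2) by (auto simp: E_def)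
 have ES[measurable]: "E \<times> \<Omega> \<in> sets borel" using E S by (rule borel_Times)
 define w where "w j z = indicator (E \<times> \<Omega>) z * v1 j z" for j z
 define Y where "Y i j z = indicator (E \<times> \<Omega>) z * G0 (i, j) z" for i j z
 have wm: "w j \<in> borel_fn" for j unfolding w_def by measurable
 have Ym: "Y i j \<in> borel_fn" for i j unfolding Y_def using G0(1) by measurable
 have w_bad: "w j (t, x) = 0" "Y i j (t, x) = 0" if "t \<notin> E" for i j t x using that by (auto simp: w_def Y_def)
 have w_off: "\<forall>x. x \<notin> \<Omega> --> w j (t, x) = 0" "\<forall>x. x \<notin> \<Omega> --> Y i j (t, x) = 0" for i j t by (auto simp: w_def Y_def)
 have w_ae: "AE x in lborel. x \<in> \<Omega> --> v t x $ j = w j (t, x)" "AE x in lborel. x \<in> \<Omega> --> G t x $ i $ j = Y i j (t, x)" if "t \<in> E" for t i j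
 proof -
  have g: "AE x in lborel. x \<in> \<Omega> --> v t x $ j = v1 j (t, x)" "AE x in lborel. x \<in> \<Omega> --> G t x $ i $ j = G0 (i, j) (t, x)"
   using ET(2)[OF that] unfolding good_def by blast+
  show "AE x in lborel. x \<in> \<Omega> --> v t x $ j = w j (t, x)" using g(1) by eventually_elim (use that in \<open>auto simp: w_def\<close>)
  show "AE x in lborel. x \<in> \<Omega> --> G t x $ i $ j = Y i j (t, x)" using g(2) by eventually_elim (use that in \<open>auto simp: Y_def\<close>)
 qed
 have slice_m: "(%x. w j (t, x)) \<in> borel_fn" "(%x. Y i j (t, x)) \<in> borel_fn" for i j t
  by (rule measurable_compose[OF borel_measurable_continuous_onI wm], intro continuous_intros)
    (rule measurable_compose[OF borel_measurable_continuous_onI Ym], intro continuous_intros)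
 have le_slice: "(NNINT x. ennreal ((U x)\<^sup>2)) <= (\<integral>\<^sup>+x. ennreal (P x) \<partial>lebesgue_on \<Omega>)"
  if "AE x in lborel. x \<in> \<Omega> --> Q x = U x" "\<forall>x. x \<notin> \<Omega> --> U x = 0" "\<And>x. (Q x)\<^sup>2 <= P x" for U Q P
 proof -
  have "(NNINT x. ennreal ((U x)\<^sup>2)) = (NNINT x. ennreal ((U x)\<^sup>2) * indicator \<Omega> x)"
   using that(2) by (intro nn_integral_cong) (auto simp: indicator_def)
  also have "\<dots> = (\<integral>\<^sup>+x. ennreal ((Q x)\<^sup>2) \<partial>lebesgue_on \<Omega>)"
   by (rule nn_integral_lebesgue_on_eq[OF S, symmetric]) (use that(1) in \<open>eventually_elim, auto\<close>)
  also have "\<dots> <= (\<integral>\<^sup>+x. ennreal (P x) \<partial>lebesgue_on \<Omega>)" by (intro nn_integral_mono ennreal_leI that(3))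
  finally show ?thesis .
 qed
 define vol where "vol = measure lborel (cball (0::R3) R)"
 \<comment> \<open>One bound for both norms: |w| <= 1 + w^2 on the ball gives L1 at most vol plus
   the energy.\<close>
 define V where "V = vol + max Mv 0"
 have vol: "0 <= vol" by (simp add: vol_def)
 have L2: "(NNINT y. ennreal ((w j (t, y))\<^sup>2)) <= ennreal (max Mv 0)" for j t
 proof (cases "t \<in> E")
  case True
  have "(NNINT y. ennreal ((w j (t, y))\<^sup>2)) <= (\<integral>\<^sup>+x. ennreal ((norm (v t x))\<^sup>2) \<partial>lebesgue_on \<Omega>)"
  proof (rule le_slice[OF w_ae(1)[OF True] w_off(1)])
   show "(v t x $ j)\<^sup>2 <= (norm (v t x))\<^sup>2" for x
    using component_le_norm_cart[of "v t x" j] power_mono[of "\<bar>v t x $ j\<bar>" "norm (v t x)" 2] by simp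
  qed
  also have "\<dots> <= ennreal Mv" using ET(2)[OF True] unfolding good_def by blast
  also have "\<dots> <= ennreal (max Mv 0)" by (intro ennreal_leI) simp
  finally show ?thesis .
 qed (simp add: w_bad)
 have wsupp: "snd z \<in> \<Omega> \<and> fst z \<in> {0..T}" if "w j z \<noteq> 0" for j z
  using that ET(1) by (auto simp: w_def indicator_def mem_Times_iff split: if_splits)
 have L1: "(NNINT y. ennreal \<bar>w j (t, y)\<bar>) <= ennreal V" for j t
 proof -
  have "(NNINT y. ennreal \<bar>w j (t, y)\<bar>) <= (NNINT y. indicator (cball (0::R3) R) y + ennreal ((w j (t, y))\<^sup>2))"
  proof (rule nn_integral_mono)
   fix y
   show "ennreal \<bar>w j (t, y)\<bar> <= indicator (cball (0::R3) R) y + ennreal ((w j (t, y))\<^sup>2)"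
   proof (cases "w j (t, y) = 0")
    case False
    then have "y \<in> cball 0 R" using wsupp[of j "(t, y)"] R(2) by auto
    then have c: "indicator (cball (0::R3) R) y = ennreal 1" by simp
    have "0 <= (\<bar>w j (t, y)\<bar> - 1)\<^sup>2" by simp
    then have "\<bar>w j (t, y)\<bar> <= 1 + (w j (t, y))\<^sup>2" using abs_ge_zero[of "w j (t, y)"] by (simp add: power2_diff)
    then have "ennreal \<bar>w j (t, y)\<bar> <= ennreal (1 + (w j (t, y))\<^sup>2)" by (rule ennreal_leI)
    also have "\<dots> = ennreal 1 + ennreal ((w j (t, y))\<^sup>2)" by (rule ennreal_plus) simp_all
    finally show ?thesis unfolding c .
   qed simp
  qed
  also have "\<dots> = emeasure lborel (cball (0::R3) R) + (NNINT y. ennreal ((w j (t, y))\<^sup>2))"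
   using slice_m(1) by (subst nn_integral_add)
    (simp_all add: borel_measurable_indicator[OF borel_closed[OF closed_cball]] borel_closed[OF closed_cball])
  also have "emeasure lborel (cball (0::R3) R) = ennreal vol"
   unfolding vol_def using emeasure_bounded_finite[OF bounded_cball, of "0::R3" R] by (intro emeasure_eq_ennreal_measure) (simp add: less_top)
  also have "ennreal vol + (NNINT y. ennreal ((w j (t, y))\<^sup>2)) <= ennreal vol + ennreal (max Mv 0)" by (intro add_left_mono L2)
  also have "\<dots> = ennreal V" unfolding V_def using vol by (intro ennreal_plus[symmetric]) auto
  finally show ?thesis .
 qed
 have fin: "(NNINT z. ennreal ((Y i j z)\<^sup>2)) < \<infinity>" for i j
 proof -
  have "(NNINT z. ennreal ((Y i j z)\<^sup>2)) = (NNINT t. NNINT y. ennreal ((Y i j (t, y))\<^sup>2))"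
   using Ym by (intro nn_integral_lborel_time_space) measurable
  also have "\<dots> <= (NNINT t. (\<integral>\<^sup>+x. ennreal ((norm (v t x))\<^sup>2 + (norm (G t x))\<^sup>2) \<partial>lebesgue_on \<Omega>) * indicator {0..T} t)"
  proof (rule nn_integral_mono)
   fix t
   show "(NNINT y. ennreal ((Y i j (t, y))\<^sup>2)) <= (\<integral>\<^sup>+x. ennreal ((norm (v t x))\<^sup>2 + (norm (G t x))\<^sup>2) \<partial>lebesgue_on \<Omega>) * indicator {0..T} t"
   proof (cases "t \<in> E")
    case True
    have "(NNINT y. ennreal ((Y i j (t, y))\<^sup>2)) <= (\<integral>\<^sup>+x. ennreal ((norm (v t x))\<^sup>2 + (norm (G t x))\<^sup>2) \<partial>lebesgue_on \<Omega>)"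
    proof (rule le_slice[OF w_ae(2)[OF True] w_off(2)])
     fix x
     have "\<bar>G t x $ i $ j\<bar> <= norm (G t x)"
      using order_trans[OF component_le_norm_cart[of "G t x $ i" j] Finite_Cartesian_Product.norm_nth_le[of "G t x" i]] .
     then have "(G t x $ i $ j)\<^sup>2 <= (norm (G t x))\<^sup>2" using power_mono[of "\<bar>G t x $ i $ j\<bar>" "norm (G t x)" 2] by simp
     then show "(G t x $ i $ j)\<^sup>2 <= (norm (v t x))\<^sup>2 + (norm (G t x))\<^sup>2" using zero_le_power2[of "norm (v t x)"] by linarith
    qed
    then show ?thesis using ET(1)[OF True] by simp
   qed (simp add: w_bad)
  qed
  also have "\<dots> = (\<integral>\<^sup>+t. (\<integral>\<^sup>+x. ennreal ((norm (v t x))\<^sup>2 + (norm (G t x))\<^sup>2) \<partial>lebesgue_on \<Omega>) \<partial>lebesgue_on {0..T})"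
   by (rule nn_integral_lebesgue_on_eq[symmetric]) auto
  finally show ?thesis using Gf by (rule le_less_trans)
 qed
 have slice: "\<exists>W. (\<forall>i. H1_approx \<Omega> (%x. w i (t, x)) (W i)) \<and> (\<forall>i j x. x \<notin> \<Omega> --> W i j x = 0) \<and>
   (\<forall>i j. (NNINT x. ennreal ((W i j x)\<^sup>2)) <= (NNINT x. ennreal ((Y i j (t, x))\<^sup>2))) \<and>
   (\<forall>i. integrable lborel (%x. (w i (t, x))\<^sup>2)) \<and> (\<forall>i j. integrable lborel (%x. (W i j x)\<^sup>2)) \<and>
   (AE x in lborel. (\<Sum>j\<in>UNIV. W j j x) = 0)" for t
 proof (cases "t \<in> E")
  case True
  then have g: "\<And>i. H10 \<Omega> (%x. v t x $ i)" "\<And>i j. weak_pderiv \<Omega> j (%x. v t x $ i) (%x. G t x $ i $ j)"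
   using ET(2)[OF True] unfolding good_def by blast+
  obtain d where d: "\<And>j. weak_pderiv \<Omega> j (%x. v t x $ j) (d j)" "AE x in lebesgue_on \<Omega>. (\<Sum>j\<in>UNIV. d j x) = 0"
   using ET(2)[OF True] unfolding good_def by blast
  from divergence_free_slice[OF \<Omega>(2) g(1) slice_m(1) w_ae(1)[OF True] w_off(1) g(2) slice_m(2) w_ae(2)[OF True] w_off(2) d]
  obtain W where "\<And>i. H1_approx \<Omega> (%x. w i (t, x)) (W i)" "\<And>i j x. x \<notin> \<Omega> ==> W i j x = 0"
   "\<And>i j. (NNINT x. ennreal ((W i j x)\<^sup>2)) <= (NNINT x. ennreal ((Y i j (t, x))\<^sup>2))"
   "\<And>i. integrable lborel (%x. (w i (t, x))\<^sup>2)" "\<And>i j. integrable lborel (%x. (W i j x)\<^sup>2)"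
   "AE x in lborel. (\<Sum>j\<in>UNIV. W j j x) = 0" by blast
  then show ?thesis by (intro exI[of _ W]) blast
 next
  case False
  have z: "(%x. 0) \<in> Cc_infty \<Omega>" by (simp add: Cc_infty_def smooth_on_def Ck_on_const supp_on_def)
  have "pderiv_at j (%x. 0) x = 0" for j x by (simp add: pderiv_at_def)
  then have "H1_approx \<Omega> (%x. 0) (%j x. 0)" using z unfolding H1_approx_def by (auto intro!: bexI[OF _ z])
  then show ?thesis by (intro exI[of _ "%i j x. 0"]) (simp add: w_bad[OF False])
 qed
 have ae: "AE z in lborel. fst z \<in> {0..T} --> (\<forall>j. w j z = ext0 \<Omega> (v (fst z)) (snd z) $ j)"
 proof -
  note [measurable] = fst_snd_borel_measurable
  have [measurable]: "N \<in> sets borel" using N(1) by auto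
  have "AE z in lborel. fst (z :: real \<times> R3) \<notin> N"
   by (rule AE_time_space[of "%t x. t \<notin> N"]) (measurable, rule AE_not_in[OF N(1)])
  moreover have "AE z in lborel. \<forall>j. z \<in> {0..T} \<times> \<Omega> --> v (fst z) (snd z) $ j = v1 j z"
   by (rule eventually_all_finite) (rule v1e)
  ultimately show ?thesis
  proof eventually_elim
   case (elim z)
   show ?case
   proof (intro impI allI)
    fix j assume "fst z \<in> {0..T}"
    with elim show "w j z = ext0 \<Omega> (v (fst z)) (snd z) $ j"
     by (cases z) (auto simp: w_def E_def ext0_def)
   qed
  qed
 qed
 note est = slices_imp_estimates[OF R(2,1) T wm Ym wsupp slice fin]
 show thesis
 proof (rule that[OF R(1) _ _ R(2) wm wsupp ae L1 _ est])
  show "0 <= V" using vol by (simp add: V_def)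
  show "0 <= 6 * (\<Sum>i\<in>UNIV. \<Sum>j\<in>UNIV. enn2real (NNINT z. ennreal ((Y i j z)\<^sup>2)))" by (intro mult_nonneg_nonneg sum_nonneg) auto
  show "(NNINT y. ennreal ((w j (t, y))\<^sup>2)) <= ennreal V" for j t
   by (rule order_trans[OF L2]) (use vol in \<open>auto simp: V_def intro!: ennreal_leI\<close>)
 qed
qed

section \<open>Weak solutions\<close>

text \<open>At t = 0 and t = T the time derivative is one-sided. Uniqueness within the strip
  survives because from each of its points one can move along every coordinate direction, with one
  of the two signs, and stay inside.\<close>

lemma frechet_derivative_strip:
 fixes \<phi> :: "real \<times> R3 => real"
 assumes T: "0 < T" and t: "t \<in> {0..T}" and D: "(\<phi> has_derivative D) (at (t, x) within {0..T} \<times> UNIV)"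
 shows "frechet_derivative \<phi> (at (t, x) within {0..T} \<times> UNIV) = D"
proof (rule frechet_derivative_unique_within[OF _ D])
 show "(\<phi> has_derivative frechet_derivative \<phi> (at (t, x) within {0..T} \<times> UNIV)) (at (t, x) within {0..T} \<times> UNIV)"
  using D unfolding frechet_derivative_works[symmetric] differentiable_def by blast
 fix i :: "real \<times> R3" and e :: real
 assume i: "i \<in> Basis" and e: "0 < e"
 then have i1: "fst i = 0 \<or> fst i = 1" by (auto simp: Basis_prod_def)
 \<comment> \<open>Forwards from the first half of the interval and backwards from the second, by at
   most T/2, so that t + d remains in [0,T].\<close>
 define d where "d = (if t <= T / 2 then min (e / 2) (T / 2) else - min (e / 2) (T / 2))"
 have m: "0 < min (e / 2) (T / 2)" "min (e / 2) (T / 2) < e" "min (e / 2) (T / 2) <= T / 2" using e T by simp_all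
 have "0 < \<bar>d\<bar>" "\<bar>d\<bar> < e" using m(1,2) unfolding d_def by (simp_all only: if_distrib abs_minus_cancel abs_of_pos if_cancel)
 moreover have "t + d \<in> {0..T}"
 proof (cases "t <= T / 2")
  case True
  then have "d = min (e / 2) (T / 2)" by (simp add: d_def)
  then show ?thesis using m True t by simp
 next
  case False
  then have "d = - min (e / 2) (T / 2)" by (simp add: d_def)
  then show ?thesis using m False t by simp
 qed
 moreover have "(t, x) + d *\<^sub>R i \<in> {0..T} \<times> UNIV"
 proof -
  have "t + d * fst i \<in> {0..T}" using i1 t \<open>t + d \<in> {0..T}\<close> by (elim disjE) simp_all
  then show ?thesis by (simp only: mem_Times_iff fst_add fst_scaleR fst_conv real_scaleR_def UNIV_I simp_thms)
 qed
 ultimately show "\<exists>d. 0 < \<bar>d\<bar> \<and> \<bar>d\<bar> < e \<and> (t, x) + d *\<^sub>R i \<in> {0..T} \<times> UNIV" by (intro exI[of _ d] conjI)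
qed

text \<open>The time factor vanishes from s on, and s < T puts the support into the half-open strip.
  Its value at t = 0 is free, so the initial data are seen.\<close>

lemma product_test_function:
 fixes n :: nat
 assumes T: "0 < T" and s: "0 < s" "s < T" and \<psi>: "\<psi> \<in> Cc_infty UNIV"
 defines "\<phi> \<equiv> %z. cutoff s n (fst z) * \<psi> (snd z)"
 shows "\<phi> \<in> test_functions T"
  and "t \<in> {0..T} ==> time_deriv T \<phi> t x = cutoff_deriv s n t * \<psi> x"
  and "t \<in> {0..T} ==> space_grad T \<phi> t x $ j = cutoff s n t * pderiv_at j \<psi> x"
proof -
 have d1: "(fst has_derivative fst) (at z within X)" and d2: "(snd has_derivative snd) (at z within X)" for z :: "real \<times> R3" and X
  by (auto intro: bounded_linear_imp_has_derivative bounded_linear_fst bounded_linear_snd)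
 have sm: "Ck_on k UNIV \<psi>" for k using \<psi> by (auto simp: Cc_infty_def smooth_on_def)
 have "Ck_on k ({0..T} \<times> UNIV) \<phi>" for k unfolding \<phi>_def
  by (intro Ck_on_mult Ck_on_compose_affine[OF Ck_on_cutoff d1] Ck_on_compose_affine[OF sm d2])
 then have smooth: "smooth_on ({0..T} \<times> UNIV) \<phi>" by (simp add: smooth_on_def)
 let ?K = "{0..s} \<times> supp_on UNIV \<psi>"
 have K: "compact ?K" using \<psi> by (intro compact_Times) (auto simp: Cc_infty_def)
 have sub: "supp_on ({0..T} \<times> UNIV) \<phi> \<subseteq> ?K" unfolding supp_on_def[of "{0..T} \<times> UNIV"]
 proof (rule closure_minimal)
  show "{z \<in> {0..T} \<times> UNIV. \<phi> z \<noteq> 0} \<subseteq> ?K"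
   using cutoff_eq_0(1)[of s] closure_subset[of "{x. \<psi> x \<noteq> 0}"]
   by (fastforce simp: \<phi>_def supp_on_def not_le[symmetric] intro: less_imp_le)
  show "closed ?K" using K by (rule compact_imp_closed)
 qed
 have "compact (?K \<inter> supp_on ({0..T} \<times> UNIV) \<phi>)" using K by (rule compact_Int_closed) (simp add: supp_on_def)
 then have "compact (supp_on ({0..T} \<times> UNIV) \<phi>)" using sub by (simp add: Int_absorb1)
 moreover have "supp_on ({0..T} \<times> UNIV) \<phi> \<subseteq> {0..<T} \<times> UNIV" using sub s by fastforce
 ultimately show "\<phi> \<in> test_functions T" using smooth by (simp add: test_functions_def)
 assume t: "t \<in> {0..T}"
 have "(\<phi> has_derivative (%h. cutoff s n (fst (t, x)) * (\<Sum>j\<in>UNIV. snd h $ j * pderiv_at j \<psi> (snd (t, x)))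
   + (cutoff_deriv s n (fst (t, x)) * fst h) * \<psi> (snd (t, x)))) (at (t, x) within {0..T} \<times> UNIV)"
  unfolding \<phi>_def
  using cutoff_has_derivative[of s n] Cc_infty_has_derivative(1)[OF \<psi>]
  by (intro has_derivative_mult has_derivative_compose[OF d1] has_derivative_compose[OF d2]) (auto simp: has_field_derivative_def)
 note D = frechet_derivative_strip[OF T t this]
 show "time_deriv T \<phi> t x = cutoff_deriv s n t * \<psi> x" unfolding time_deriv_def D by simp
 show "space_grad T \<phi> t x $ j = cutoff s n t * pderiv_at j \<psi> x"
  unfolding space_grad_def D by (simp add: axis_def if_distrib[of "%a. a * _"] cong: if_cong)
qed

section \<open>Representatives of weak solutions\<close>

lemma AE_slices_imp_AE:
 assumes "Measurable.pred borel (P :: real \<times> R3 => bool)" "AE t in lborel. AE x in lborel. P (t, x)"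
 shows "AE z in lborel. P z"
proof -
 have m: "Measurable.pred (lborel \<Otimes>\<^sub>M lborel) P" using assms(1) by (simp add: lborel_prod)
 have "AE z in lborel \<Otimes>\<^sub>M lborel. P z"
  using m assms(2) by (intro lborel_pair.AE_pair_measure) (auto simp: pred_def)
 then show ?thesis unfolding lborel_prod .
qed

lemma AE_imp_AE_slices:
 assumes "AE z in lborel. P (fst z) (snd z)"
 shows "AE t in lborel :: real measure. AE x in lborel :: R3 measure. P t x"
proof -
 have "AE z in lborel \<Otimes>\<^sub>M lborel. P (fst z) (snd z)" using assms unfolding lborel_prod .
 from lborel_pair.AE_pair[OF this] show ?thesis by simp
qed

text \<open>Tensor test functions reduce the weak formulation to \<open>weak_time_identity\<close>
  for each spatial \<psi>, applied to a Borel version clamped to a bound. The identity then shows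
  that the solution vanishes outside the ball, which permits the final cut-off. The parameter
  \<open>M0\<close> is a lower limit for the bound, so that one constant can serve both the solution
  and its initial data.\<close>

lemma weak_solution_representative:
 fixes w :: "3 => real \<times> R3 => real" and f :: "real => R3 => real"
 assumes T: "0 < T" and V: "0 <= V" and wm[measurable]: "\<And>j. w j \<in> borel_fn"
  and w_supp: "\<And>j z. w j z \<noteq> 0 ==> norm (snd z) <= R \<and> fst z \<in> {0..T}"
  and w_ae: "AE z in lborel. fst z \<in> {0..T} --> (\<forall>j. w j z = vv (fst z) (snd z) $ j)"
  and w_L1: "\<And>j t. (NNINT y. ennreal \<bar>w j (t, y)\<bar>) <= ennreal V"
  and f0m[measurable]: "f0' \<in> borel_fn" and f0_ae: "AE x in lborel. f0 x = f0' x"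
  and f0_supp: "\<And>x. f0' x \<noteq> 0 ==> norm x <= R"
  and sol: "weak_solution T UNIV vv f0 f"
 obtains f' M where "f' \<in> borel_fn" "M0 <= M" "0 <= M" "\<And>z. \<bar>f' z\<bar> <= M"
  "\<And>z. f' z \<noteq> 0 ==> norm (snd z) <= R \<and> fst z \<in> {0..T}"
  "AE z in lborel. fst z \<in> {0..T} --> f (fst z) (snd z) = f' z"
  "\<And>\<psi>. \<psi> \<in> Cc_infty UNIV ==> AE t in lborel. t \<in> {0..T} -->
   (RINT y. f' (t, y) * \<psi> y) = weak_rhs f' w f0' t \<psi> (%j. pderiv_at j \<psi>)"
proof -
 note [measurable] = fst_snd_borel_measurable
 have TS: "({0..T} \<times> UNIV :: (real \<times> R3) set) \<in> sets borel" by (intro borel_Times) auto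
 have "(%(t, x). f t x) \<in> borel_measurable (lebesgue_on ({0..T} \<times> UNIV))"
  using sol by (simp add: weak_solution_def Linf_Linf_def joint_measurable_def)
 from borel_representative[OF TS this] obtain f1 where f1[measurable]: "f1 \<in> borel_fn"
  and f1_ae: "AE z in lborel. z \<in> {0..T} \<times> UNIV --> (case z of (t, x) => f t x) = f1 z" by blast
 obtain M1 where M1: "AE t in lebesgue_on {0..T}. AE x in lebesgue_on UNIV. \<bar>f t x\<bar> <= M1"
  using sol by (auto simp: weak_solution_def Linf_Linf_def)
 \<comment> \<open>Clamping at M does not change f up to null sets because M dominates M1, and makes
   the bound valid at every point.\<close>
 define M where "M = max (max M0 M1) 0"
 define fb where "fb z = indicator {0..T} (fst z) * max (- M) (min M (f1 z))" for z
 have M: "M0 <= M" "M1 <= M" "0 <= M" by (auto simp: M_def)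
 have [measurable]: "(%z :: real \<times> R3. indicator {0..T} (fst z) :: real) \<in> borel_fn"
  by (rule measurable_compose[OF fst_snd_borel_measurable(1) borel_measurable_indicator[OF borel_closed[OF closed_atLeastAtMost]]])
 have fbm[measurable]: "fb \<in> borel_fn" unfolding fb_def by measurable
 have fbb: "\<bar>fb z\<bar> <= M" for z using M(3) by (auto simp: fb_def indicator_def)
 have fbt: "fst z \<in> {0..T}" if "fb z \<noteq> 0" for z using that by (auto simp: fb_def indicator_def split: if_splits)
 have f1s: "AE t in lborel. AE x in lborel. t \<in> {0..T} --> f t x = f1 (t, x)"
  by (rule AE_imp_AE_slices) (use f1_ae in \<open>eventually_elim, auto\<close>)
 have "AE t in lborel. t \<in> {0..T} --> (AE x in lborel. \<bar>f t x\<bar> <= M1)"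
  using M1 by (subst (asm) AE_lebesgue_on_iff) (auto simp: AE_lebesgue_on_iff)
 with f1s have "AE t in lborel. AE x in lborel. t \<in> {0..T} --> \<bar>f1 (t, x)\<bar> <= M"
 proof eventually_elim
  case (elim t)
  show ?case
  proof (cases "t \<in> {0..T}")
   case True
   from elim(2)[rule_format, OF True] elim(1) show ?thesis by eventually_elim (use M(2) in auto)
  next
   case False
   show ?thesis by (rule AE_I2) (use False in blast)
  qed
 qed
 then have "AE z in lborel. fst z \<in> {0..T} --> \<bar>f1 z\<bar> <= M"
 proof (intro AE_slices_imp_AE)
  show "Measurable.pred borel (%z. fst z \<in> {0..T} --> \<bar>f1 z\<bar> <= M)" unfolding atLeastAtMost_iff by measurable
 qed simp
 with f1_ae have f_ae: "AE z in lborel. fst z \<in> {0..T} --> f (fst z) (snd z) = fb z"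
  by eventually_elim (auto simp: fb_def split_beta mem_Times_iff)
 have slices: "AE t in lborel. AE x in lborel. t \<in> {0..T} --> f t x = fb (t, x) \<and> (\<forall>j. w j (t, x) = vv t x $ j)"
  by (rule AE_imp_AE_slices) (use f_ae w_ae in \<open>eventually_elim, auto\<close>)
 have [measurable]: "fb \<in> borel_measurable (borel \<Otimes>\<^sub>M borel)" "w j \<in> borel_measurable (borel \<Otimes>\<^sub>M borel)" for j
  using fbm wm by (simp_all only: borel_prod)
 have weak: "AE t in lborel. t \<in> {0..T} --> (RINT y. fb (t, y) * \<psi> y) = weak_rhs fb w f0' t \<psi> (%j. pderiv_at j \<psi>)"
  if \<psi>: "\<psi> \<in> Cc_infty UNIV" for \<psi>
 proof -
  note [measurable] = Cc_infty_integrable(2)[OF \<psi>] Cc_infty_integrable(2)[OF Cc_infty_has_derivative(3)[OF \<psi>]]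
  let ?g = "%z. fb z * (\<Sum>j\<in>UNIV. w j z * pderiv_at j \<psi> (snd z))"
  define a b where "a t = (RINT y. fb (t, y) * \<psi> y)" and "b t = (RINT y. ?g (t, y))" for t
  define c where "c = (RINT y. f0' y * \<psi> y)"
  have [measurable]: "a \<in> borel_fn" "b \<in> borel_fn" unfolding a_def b_def by measurable
  have "\<forall>j. \<exists>B. \<forall>x. \<bar>pderiv_at j \<psi> x\<bar> <= B" using Cc_infty_bounded[OF Cc_infty_has_derivative(3)[OF \<psi>]] by blast
  from choice[OF this] obtain B0 where B0: "\<And>j x. \<bar>pderiv_at j \<psi> x\<bar> <= B0 j" by blast
  define B where "B = (\<Sum>j\<in>UNIV. \<bar>B0 j\<bar>)"
  have B: "\<bar>pderiv_at j \<psi> x\<bar> <= B" for j x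
   unfolding B_def using B0[of j x] member_le_sum[of j UNIV "%j. \<bar>B0 j\<bar>"] by auto
  have B_nn: "0 <= B" using B[of undefined undefined] by linarith
  have g_le: "ennreal \<bar>?g z\<bar> <= ennreal (M * B) * (\<Sum>j\<in>UNIV. ennreal \<bar>w j z\<bar>)" for z
  proof -
   have "\<bar>?g z\<bar> <= M * (\<Sum>j\<in>UNIV. \<bar>w j z\<bar> * B)"
    unfolding abs_mult using fbb B M(3)
    by (intro mult_mono order_trans[OF sum_abs] sum_mono) (auto simp: abs_mult intro!: mult_left_mono)
   then have "ennreal \<bar>?g z\<bar> <= ennreal (M * B * (\<Sum>j\<in>UNIV. \<bar>w j z\<bar>))"
    by (intro ennreal_leI) (simp add: sum_distrib_left[symmetric] sum_distrib_right[symmetric] mult_ac)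
   also have "\<dots> = ennreal (M * B) * (\<Sum>j\<in>UNIV. ennreal \<bar>w j z\<bar>)" using M(3) B_nn by (simp add: ennreal_mult sum_nonneg)
   finally show ?thesis .
  qed
  have g_slice: "(NNINT y. ennreal \<bar>?g (t, y)\<bar>) <= ennreal (M * B * (3 * V))" for t
  proof -
   have "(NNINT y. ennreal \<bar>?g (t, y)\<bar>) <= (NNINT y. ennreal (M * B) * (\<Sum>j\<in>UNIV. ennreal \<bar>w j (t, y)\<bar>))"
    by (intro nn_integral_mono g_le)
   also have "\<dots> = ennreal (M * B) * (\<Sum>j\<in>UNIV. NNINT y. ennreal \<bar>w j (t, y)\<bar>)"
    by (simp add: nn_integral_cmult nn_integral_sum del: sum_ennreal)
   also have "\<dots> <= ennreal (M * B) * (\<Sum>j\<in>(UNIV :: 3 set). ennreal V)" by (intro mult_left_mono sum_mono w_L1) simp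
   also have "\<dots> = ennreal (M * B * (3 * V))" using M(3) B_nn V by (simp add: ennreal_mult del: sum_constant) (simp add: ennreal_mult sum_constant)
   finally show ?thesis .
  qed
  have gi: "integrable lborel (%y. ?g (t, y))" for t
  proof (rule integrableI_bounded)
   show "(%y. ?g (t, y)) \<in> borel_measurable lborel" by measurable
   show "(NNINT y. ennreal (norm (?g (t, y)))) < \<infinity>"
    unfolding real_norm_def by (rule le_less_trans[OF g_slice]) simp
  qed
  have pi: "integrable lborel (%y. fb (t, y) * \<psi> y)" for t
   by (rule integrable_mult_bounded(2)[OF Cc_infty_integrable(1)[OF \<psi>] _ fbb]) measurable
  have ab: "\<bar>a t\<bar> <= M * (RINT y. \<bar>\<psi> y\<bar>)" for t
  proof -
   have "\<bar>a t\<bar> <= (RINT y. \<bar>fb (t, y) * \<psi> y\<bar>)" unfolding a_def by (rule integral_abs_bound)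
   also have "\<dots> <= (RINT y. M * \<bar>\<psi> y\<bar>)"
   proof (rule integral_mono)
    show "integrable lborel (%y. \<bar>fb (t, y) * \<psi> y\<bar>)" by (intro integrable_abs pi)
    show "integrable lborel (%y. M * \<bar>\<psi> y\<bar>)" using Cc_infty_integrable(1)[OF \<psi>] by simp
    show "\<bar>fb (t, y) * \<psi> y\<bar> <= M * \<bar>\<psi> y\<bar>" for y unfolding abs_mult using fbb by (intro mult_right_mono) auto
   qed
   finally show ?thesis by simp
  qed
  have bb: "\<bar>b t\<bar> <= M * B * (3 * V)" for t
  proof -
   have "ennreal \<bar>b t\<bar> <= ennreal (M * B * (3 * V))"
    unfolding b_def by (rule order_trans[OF abs_integral_le_nn_integral g_slice])
   then show ?thesis using M(3) B_nn V by (subst (asm) ennreal_le_iff) auto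
  qed
  have id: "AE t in lborel. t \<in> {0..T} --> a t = c + (RINT u. indicator {0..t} u * b u)"
  proof (rule weak_time_identity[OF T _ _ ab bb])
   fix s and n :: nat assume s: "0 < s" "s < T"
   define \<phi> where "\<phi> = (%z. cutoff s n (fst z) * \<psi> (snd z))"
   note \<phi> = product_test_function[OF T s \<psi>, where n=n, folded \<phi>_def]
   have "(LINT t|lebesgue_on {0..T}. LINT x|lebesgue_on UNIV. f t x * time_deriv T \<phi> t x + f t x * (vv t x \<bullet> space_grad T \<phi> t x))
    = (RINT t. indicator {0..T} t * (cutoff_deriv s n t * a t + cutoff s n t * b t))"
   proof (rule integral_lebesgue_on_eq)
    note [measurable] = cutoff_measurable
    show "(%t. cutoff_deriv s n t * a t + cutoff s n t * b t) \<in> borel_fn" by measurable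
    show "AE t in lborel. t \<in> {0..T} --> (LINT x|lebesgue_on UNIV. f t x * time_deriv T \<phi> t x + f t x * (vv t x \<bullet> space_grad T \<phi> t x))
     = cutoff_deriv s n t * a t + cutoff s n t * b t"
     using slices
    proof eventually_elim
     case (elim t)
     show ?case
     proof
      assume t: "t \<in> {0..T}"
      have "(LINT x|lebesgue_on UNIV. f t x * time_deriv T \<phi> t x + f t x * (vv t x \<bullet> space_grad T \<phi> t x))
       = (RINT x. indicator UNIV x * (cutoff_deriv s n t * (fb (t, x) * \<psi> x) + cutoff s n t * ?g (t, x)))"
      proof (rule integral_lebesgue_on_eq)
       show "AE x in lborel. x \<in> UNIV --> f t x * time_deriv T \<phi> t x + f t x * (vv t x \<bullet> space_grad T \<phi> t x)
        = cutoff_deriv s n t * (fb (t, x) * \<psi> x) + cutoff s n t * ?g (t, x)"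
        using elim
       proof eventually_elim
        case (elim x)
        then have e: "f t x = fb (t, x)" "\<And>j. vv t x $ j = w j (t, x)" using t by auto
        show ?case by (simp add: inner_vec_def \<phi>(2,3)[OF t] e sum_distrib_left mult_ac)
       qed
      qed measurable
      also have "\<dots> = cutoff_deriv s n t * a t + cutoff s n t * b t"
       unfolding a_def b_def using gi[of t] pi[of t] by (simp only: indicator_UNIV mult_1_left) (simp del: mult_eq_0_iff)
      finally show "(LINT x|lebesgue_on UNIV. f t x * time_deriv T \<phi> t x + f t x * (vv t x \<bullet> space_grad T \<phi> t x))
       = cutoff_deriv s n t * a t + cutoff s n t * b t" .
     qed
    qed
   qed simp
   moreover have "(LINT x|lebesgue_on UNIV. f0 x * \<phi> (0, x)) = (RINT x. indicator UNIV x * (cutoff s n 0 * (f0' x * \<psi> x)))"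
   proof (rule integral_lebesgue_on_eq)
    show "AE x in lborel. x \<in> UNIV --> f0 x * \<phi> (0, x) = cutoff s n 0 * (f0' x * \<psi> x)"
     using f0_ae by eventually_elim (simp add: \<phi>_def)
   qed measurable
   moreover have "\<dots> = c * cutoff s n 0" unfolding c_def by simp
   ultimately show "(RINT t. indicator {0..T} t * (cutoff_deriv s n t * a t + cutoff s n t * b t)) + c * cutoff s n 0 = 0"
    using sol[unfolded weak_solution_def, THEN conjunct2, rule_format, OF \<phi>(1)] by (simp only:)
  qed measurable
  have "weak_rhs fb w f0' t \<psi> (%j. pderiv_at j \<psi>) = c + (RINT u. indicator {0..t} u * b u)" for t
  proof -
   have ind[measurable]: "(%z :: real \<times> R3. indicator {0..t} (fst z) :: real) \<in> borel_fn"
    by (rule measurable_compose[OF fst_snd_borel_measurable(1) borel_measurable_indicator[OF borel_closed[OF closed_atLeastAtMost]]])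
   have "integrable lborel (%z. indicator {0..t} (fst z) * ?g z)"
   proof (rule integrableI_bounded)
    show "(%z. indicator {0..t} (fst z) * ?g z) \<in> borel_measurable lborel" by measurable
    have "(NNINT z. ennreal (norm (indicator {0..t} (fst z) * ?g z))) <= (NNINT z. ennreal \<bar>?g z\<bar>)"
     by (intro nn_integral_mono ennreal_leI) (auto simp: indicator_def)
    also have "\<dots> = (NNINT t. NNINT y. ennreal \<bar>?g (t, y)\<bar>)"
     by (rule nn_integral_lborel_time_space) measurable
    also have "\<dots> <= (NNINT t. ennreal (M * B * (3 * V)) * indicator {0..T} t)"
    proof (rule nn_integral_mono)
     fix t
     show "(NNINT y. ennreal \<bar>?g (t, y)\<bar>) <= ennreal (M * B * (3 * V)) * indicator {0..T} t"
     proof (cases "t \<in> {0..T}")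
      case False
      then have "fb (t, y) = 0" for y using fbt[of "(t, y)"] by auto
      then show ?thesis by simp
     qed (use g_slice in simp)
    qed
    also have "\<dots> < \<infinity>" using T by (simp add: nn_integral_cmult ennreal_mult_less_top)
    finally show "(NNINT z. ennreal (norm (indicator {0..t} (fst z) * ?g z))) < \<infinity>" .
   qed
   then have "integrable (lborel \<Otimes>\<^sub>M lborel) (%z. indicator {0..t} (fst z) * ?g z)" unfolding lborel_prod .
   from lborel_pair.integral_fst'[OF this]
   have "(RINT u. (RINT y. indicator {0..t} u * ?g (u, y))) = (RINT z. indicator {0..t} (fst z) * ?g z)"
    unfolding lborel_prod by simp
   then show ?thesis unfolding weak_rhs_def c_def b_def integral_mult_right_zero by simp
  qed
  with id show ?thesis unfolding a_def by simp
 qed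
 \<comment> \<open>The cut-off changes fb on a null set only, and does not touch the flux at all, as
   w vanishes outside the ball.\<close>
 define f' where "f' z = indicator (cball (0::R3) R) (snd z) * fb z" for z
 have "AE z in lborel. R < norm (snd z) --> fb z = 0"
 proof (rule weak_identity_support[OF fbm fbb fbt f0_supp _ weak])
  show "norm (snd z) <= R" if "w j z \<noteq> 0" for j z using w_supp that by blast
 qed
 then have f'_ae: "AE z in lborel. fb z = f' z"
  by eventually_elim (auto simp: f'_def indicator_def)
 have f'_slices: "AE t in lborel. AE x in lborel. fb (t, x) = f' (t, x)"
  by (rule AE_imp_AE_slices) (use f'_ae in simp)
 have [measurable]: "(%z :: real \<times> R3. indicator (cball (0::R3) R) (snd z) :: real) \<in> borel_fn"
  by (rule measurable_compose[OF fst_snd_borel_measurable(2) borel_measurable_indicator[OF borel_closed[OF closed_cball]]])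
 have f'm[measurable]: "f' \<in> borel_fn" unfolding f'_def by measurable
 have [measurable]: "f' \<in> borel_measurable (borel \<Otimes>\<^sub>M borel)" using f'm by (simp only: borel_prod)
 show thesis
 proof (rule that[OF f'm M(1,3)])
  show "\<bar>f' z\<bar> <= M" for z using fbb[of z] M(3) by (auto simp: f'_def indicator_def)
  show "norm (snd z) <= R \<and> fst z \<in> {0..T}" if "f' z \<noteq> 0" for z
   using that fbt[of z] by (auto simp: f'_def indicator_def split: if_splits)
  show "AE z in lborel. fst z \<in> {0..T} --> f (fst z) (snd z) = f' z" using f_ae f'_ae by eventually_elim auto
  fix \<psi> assume \<psi>: "\<psi> \<in> Cc_infty UNIV"
  note [measurable] = Cc_infty_integrable(2)[OF \<psi>]
  have same: "f' z * (\<Sum>j\<in>UNIV. w j z * P j (snd z)) = fb z * (\<Sum>j\<in>UNIV. w j z * P j (snd z))" for z P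
  proof (cases "norm (snd z) <= R")
   case False
   then have "w j z = 0" for j using w_supp by blast
   then show ?thesis by simp
  qed (simp add: f'_def)
  have rhs: "weak_rhs f' w f0' t \<psi> P = weak_rhs fb w f0' t \<psi> P" for t P unfolding weak_rhs_def same ..
  show "AE t in lborel. t \<in> {0..T} --> (RINT y. f' (t, y) * \<psi> y) = weak_rhs f' w f0' t \<psi> (%j. pderiv_at j \<psi>)"
   using weak[OF \<psi>] f'_slices
  proof eventually_elim
   case (elim t)
   have "(RINT y. f' (t, y) * \<psi> y) = (RINT y. fb (t, y) * \<psi> y)"
   proof (rule integral_cong_AE)
    show "AE y in lborel. f' (t, y) * \<psi> y = fb (t, y) * \<psi> y" using elim(2) by eventually_elim simp
   qed measurable
   then show ?case using elim(1) unfolding rhs by simp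
  qed
 qed
qed

section \<open>The scheme and the step functions\<close>

lemma step_function_eq:
 assumes "0 < h" "0 < \<tau>" "0 <= s"
 shows "step_function h \<tau> g s y = g (nat \<lfloor>s / \<tau>\<rfloor>) (rd h y)"
proof -
 have "0 <= \<lfloor>s / \<tau>\<rfloor>" using assms by simp
 then have n: "s \<in> {\<tau> * real n..<\<tau> * real (n + 1)} \<longleftrightarrow> n = nat \<lfloor>s / \<tau>\<rfloor>" for n
  using floor_cell[OF assms(2), of s "int n"] by (auto simp: add.commute)
 show ?thesis unfolding step_function_def n
  by (rule the_equality) (auto simp: mem_cell_iff_rd[OF assms(1)] rd_in_grid)
qed

lemma cell_average_eq:
 assumes h: "0 < h" and u': "u' \<in> borel_fn" and ae: "AE x in lborel. u x = u' x"
 shows "cell_average h u (rd h y) = cell_average_setting.avg (rd h) (h ^ 3) u' y"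
proof -
 note defs = cell_average_setting.avg_def[OF space_cell_average_setting[OF h]] cell_average_setting.cell_kernel_def[OF space_cell_average_setting[OF h]]
 have "(LINT z|lebesgue_on (cell h (rd h y)). u z) = (RINT z. indicator (cell h (rd h y)) z * u' z)"
  by (rule integral_lebesgue_on_eq) (use u' ae in \<open>auto elim!: eventually_mono\<close>)
 then show ?thesis unfolding cell_average_def defs cell_rd[OF h]
  by (simp add: integral_mult_right_zero[symmetric] del: integral_mult_right_zero)
qed

text \<open>The scheme averages over a closed time interval and the fibres of \<open>td\<close> are
  half-open; the endpoint is a null set. The bound on n keeps the interval within [0,T], the only
  times at which u represents the velocity.\<close>

lemma discrete_velocity_eq:
 fixes u :: "real \<times> R3 => real"
 assumes h: "0 < h" and \<tau>: "0 < \<tau>" and u: "integrable lborel u"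
  and ae: "AE z in lborel. fst z \<in> {0..T} --> vv (fst z) (snd z) $ j = u z" and n: "\<tau> * real (n + 1) <= T"
 shows "discrete_velocity h \<tau> vv n j (rd h y) = cell_average_setting.avg (td h \<tau>) (\<tau> * h ^ 3) u (\<tau> * real n, y)"
proof -
 note defs = cell_average_setting.avg_def[OF spacetime_cell_average_setting[OF h \<tau>]] cell_average_setting.cell_kernel_def[OF spacetime_cell_average_setting[OF h \<tau>]]
 let ?C = "cell h (rd h y)" and ?I = "{\<tau> * real n..\<tau> * real (n + 1)}" and ?J = "{\<tau> * real n..<\<tau> * real (n + 1)}"
 have um: "u \<in> borel_fn" using u by simp
 have [measurable]: "u \<in> borel_measurable (borel \<Otimes>\<^sub>M borel)" using um by (simp only: borel_prod)
 have fl: "\<lfloor>\<tau> * real n / \<tau>\<rfloor> = int n" using \<tau> by simp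
 have A: "{z. td h \<tau> z = td h \<tau> (\<tau> * real n, y)} = ?J \<times> ?C"
  unfolding td_cell[OF h \<tau>] fl by (simp add: add.commute)
 have JC: "?J \<times> ?C \<in> sets borel" by (intro borel_Times) auto
 define k where "k s = (RINT x. indicator ?C x * u (s, x))" for s
 have km: "k \<in> borel_fn" unfolding k_def by measurable
 have slices: "AE s in lborel. AE x in lborel. s \<in> {0..T} --> vv s x $ j = u (s, x)"
  by (rule AE_imp_AE_slices) (use ae in simp)
 have "(LINT s|lebesgue_on ?I. LINT x|lebesgue_on ?C. vv s x $ j) = (RINT s. indicator ?I s * k s)"
 proof (rule integral_lebesgue_on_eq[OF _ km])
  show "AE s in lborel. s \<in> ?I --> (LINT x|lebesgue_on ?C. vv s x $ j) = k s"
   using slices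
  proof eventually_elim
   case (elim s)
   show ?case
   proof
    assume s: "s \<in> ?I"
    have "0 <= \<tau> * real n" using \<tau> by simp
    then have sT: "s \<in> {0..T}" using s n by simp
    show "(LINT x|lebesgue_on ?C. vv s x $ j) = k s" unfolding k_def
    proof (rule integral_lebesgue_on_eq)
     show "AE x in lborel. x \<in> ?C --> vv s x $ j = u (s, x)" using elim by eventually_elim (use sT in blast)
    qed measurable
   qed
  qed
 qed simp
 also have "\<dots> = (RINT s. indicator ?J s * k s)"
 proof (rule integral_cong_AE)
  show "AE s in lborel. indicator ?I s * k s = indicator ?J s * k s"
   using AE_lborel_singleton[of "\<tau> * real (n + 1)"] 
  proof eventually_elim
   case (elim s)
   then have "s <= \<tau> * real (n + 1) \<longleftrightarrow> s < \<tau> * real (n + 1)" by linarith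
   then show ?case by (simp only: indicator_def atLeastAtMost_iff atLeastLessThan_iff)
  qed
 qed (use km in measurable)
 also have "\<dots> = (RINT z. indicator (?J \<times> ?C) z * u z)"
 proof -
  have "integrable lborel (%z. indicator (?J \<times> ?C) z * u z)"
   by (rule integrable_mult_bounded(2)[OF u, where c=1]) (use JC in \<open>auto simp: indicator_def\<close>)
  then have "integrable (lborel \<Otimes>\<^sub>M lborel) (%z. indicator (?J \<times> ?C) z * u z)" unfolding lborel_prod .
  from lborel_pair.integral_fst'[OF this]
  have "(RINT s. (RINT x. indicator ?J s * (indicator ?C x * u (s, x)))) = (RINT z. indicator (?J \<times> ?C) z * u z)"
   unfolding lborel_prod by (simp only: indicator_times fst_conv snd_conv mult.assoc)
  then show ?thesis unfolding k_def integral_mult_right_zero .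
 qed
 finally show ?thesis unfolding discrete_velocity_def defs A
  by (simp add: integral_mult_right_zero[symmetric] del: integral_mult_right_zero)
qed

text \<open>The grid function is composed with \<open>rd h\<close>. As stencil shifts are grid
  vectors, the recursion on the grid becomes \<open>scheme_step\<close> at every point of space, so
  values off the grid, about which the scheme says nothing, are never read.\<close>

lemma scheme_L1_convergence:
 fixes g :: "real \<times> real => nat => R3 => real"
 assumes tr: "transport T M R V \<Gamma> f w f0" and \<alpha>\<beta>: "0 < \<alpha>" "0 < \<beta>" "\<alpha> + \<beta> < 1"
  and w_ae: "AE z in lborel. fst z \<in> {0..T} --> (\<forall>j. w j z = vv (fst z) (snd z) $ j)"
  and f0_ae: "AE x in lborel. F0 x = f0 x"
  and scheme: "\<And>h \<tau>. (h, \<tau>) \<in> admissible \<alpha> \<beta> ==> truncated_explicit_scheme T \<beta> vv F0 h \<tau> (g (h, \<tau>))"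
  and e: "0 < e"
 shows "\<exists>d>0. \<forall>h \<tau>. (h, \<tau>) \<in> admissible \<alpha> \<beta> \<and> h < d -->
  (\<forall>n\<le>num_steps T \<tau>. (%y. g (h, \<tau>) n (rd h y)) \<in> borel_fn \<and> (\<forall>y. \<bar>g (h, \<tau>) n (rd h y)\<bar> <= M)) \<and>
  (NNINT s. indicator {0..T} s * (NNINT y. ennreal \<bar>g (h, \<tau>) (nat \<lfloor>s / \<tau>\<rfloor>) (rd h y) - f (s, y)\<bar>)) <= ennreal e"
proof -
 interpret transport T M R V \<Gamma> f w f0 by (rule tr)
 obtain d where d: "0 < d" and D: "\<forall>h \<tau> G. (h, \<tau>) \<in> admissible \<alpha> \<beta> \<and> h < d
  \<and> (\<forall>y. G 0 y = cell_average_setting.avg (rd h) (h ^ 3) f0 y)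
  \<and> (\<forall>n<num_steps T \<tau>. \<forall>y. G (Suc n) y = scheme_step h \<tau> (%j y. ut h \<tau> \<beta> j (\<tau> * real n, y)) (G n) y)
  --> (\<forall>n\<le>num_steps T \<tau>. G n \<in> borel_fn \<and> (\<forall>y. \<bar>G n y\<bar> <= M))
   \<and> (NNINT s. indicator {0..T} s * (NNINT y. ennreal \<bar>G (nat \<lfloor>s / \<tau>\<rfloor>) y - f (s, y)\<bar>)) <= ennreal e"
  using core_convergence[OF \<alpha>\<beta> e] by (elim exE conjE) (rule that)
 have wi: "integrable lborel (w j)" for j
 proof (rule integrableI_bounded)
  have "(NNINT z. ennreal (norm (w j z))) = (NNINT t. NNINT y. ennreal \<bar>w j (t, y)\<bar>)"
   unfolding real_norm_def by (rule nn_integral_lborel_time_space) measurable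
  also have "\<dots> <= (NNINT t. ennreal V * indicator {0..T} t)"
  proof (rule nn_integral_mono)
   fix t
   show "(NNINT y. ennreal \<bar>w j (t, y)\<bar>) <= ennreal V * indicator {0..T} t"
   proof (cases "t \<in> {0..T}")
    case False
    then have "w j (t, y) = 0" for y using w_supp[of j "(t, y)"] by auto
    then show ?thesis by simp
   qed (use w_L1 in simp)
  qed
  also have "\<dots> < \<infinity>" using params by (simp add: nn_integral_cmult ennreal_mult_less_top)
  finally show "(NNINT z. ennreal (norm (w j z))) < \<infinity>" .
 qed simp
 show ?thesis
 proof (intro exI[of _ d] conjI[OF d] allI impI)
  fix h \<tau> assume a: "(h, \<tau>) \<in> admissible \<alpha> \<beta> \<and> h < d"
  then have h: "0 < h" and \<tau>: "0 < \<tau>" by (auto simp: admissible_def)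
  note sc = scheme[OF conjunct1[OF a], unfolded truncated_explicit_scheme_def]
  show "(\<forall>n\<le>num_steps T \<tau>. (%y. g (h, \<tau>) n (rd h y)) \<in> borel_fn \<and> (\<forall>y. \<bar>g (h, \<tau>) n (rd h y)\<bar> <= M)) \<and>
   (NNINT s. indicator {0..T} s * (NNINT y. ennreal \<bar>g (h, \<tau>) (nat \<lfloor>s / \<tau>\<rfloor>) (rd h y) - f (s, y)\<bar>)) <= ennreal e"
  proof (rule D[THEN spec[of _ h], THEN spec[of _ \<tau>], THEN spec[of _ "%n y. g (h, \<tau>) n (rd h y)"], THEN mp],
    intro conjI allI impI)
   show "(h, \<tau>) \<in> admissible \<alpha> \<beta>" "h < d" using a by simp_all
   show "g (h, \<tau>) 0 (rd h y) = cell_average_setting.avg (rd h) (h ^ 3) f0 y" for y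
    using sc rd_in_grid[of h y] cell_average_eq[OF h f0_meas f0_ae] by simp
   fix n y assume n: "n < num_steps T \<tau>"
   let ?G = "g (h, \<tau>) n" and ?x = "rd h y"
   have "\<tau> * real (n + 1) <= \<tau> * real (num_steps T \<tau>)" using n \<tau> by (intro mult_left_mono) auto
   then have nT: "\<tau> * real (n + 1) <= T" using num_steps_bounds(1)[OF \<tau>, of T] params by simp
   have dv: "truncate h \<beta> (discrete_velocity h \<tau> vv n j ?x) = ut h \<tau> \<beta> j (\<tau> * real n, y)" for j
   proof -
    have "AE z in lborel. fst z \<in> {0..T} --> vv (fst z) (snd z) $ j = w j z" using w_ae by eventually_elim simp
    from discrete_velocity_eq[OF h \<tau> wi this nT] show ?thesis unfolding ut_def by (simp only:)
   qed
   have "(g (h, \<tau>) (Suc n) ?x - 1 / 7 * (\<Sum>\<omega>\<in>stencil. ?G (?x + h *\<^sub>R \<omega>))) * (1 / \<tau>)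
    + (\<Sum>j\<in>UNIV. truncate h \<beta> (discrete_velocity h \<tau> vv n j ?x) * central_diff h j ?G ?x) = 0"
    using sc n rd_in_grid[of h y] by blast
   then have eq: "g (h, \<tau>) (Suc n) ?x = 1 / 7 * (\<Sum>\<omega>\<in>stencil. ?G (?x + h *\<^sub>R \<omega>))
    - \<tau> * (\<Sum>j\<in>UNIV. ut h \<tau> \<beta> j (\<tau> * real n, y) * central_diff h j ?G ?x)"
    unfolding dv using \<tau> by (simp add: field_simps)
   have sh: "rd h (y + h *\<^sub>R axis j 1) = ?x + h *\<^sub>R axis j 1" "rd h (y - h *\<^sub>R axis j 1) = ?x - h *\<^sub>R axis j 1" for j
    using rd_add_grid[OF h axis_in_grid(1), of y j] rd_add_grid[OF h axis_in_grid(2), of y j] by simp_all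
   show "g (h, \<tau>) (Suc n) (rd h y) = scheme_step h \<tau> (%j y. ut h \<tau> \<beta> j (\<tau> * real n, y)) (%y. ?G (rd h y)) y"
    unfolding eq scheme_step_def sh central_diff_def sum_stencil[of "%\<omega>. ?G (?x + h *\<^sub>R \<omega>)"] by simp
  qed
 qed
qed

text \<open>For |U| <= K one has |U|^p <= K^(p-1) |U|, so under a uniform bound L1 convergence
  implies convergence for every finite p. The integrals are the iterated ones over restricted
  Lebesgue measure, hence the passage to the representative on almost every slice.\<close>

lemma Lp_le_L1:
 fixes U :: "real \<times> R3 => real"
 assumes S: "S \<in> sets borel" and p: "1 <= p" and U[measurable]: "U \<in> borel_fn" and K: "\<And>z. \<bar>U z\<bar> <= K"
  and ae: "AE t in lborel. AE x in lborel. t \<in> {0..T} --> x \<in> S --> u t x = U (t, x)"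
 shows "(\<integral>\<^sup>+t. (\<integral>\<^sup>+x. ennreal (\<bar>u t x\<bar> powr p) \<partial>lebesgue_on S) \<partial>lebesgue_on {0..T})
  <= ennreal (K powr (p - 1)) * (NNINT t. indicator {0..T} t * (NNINT x. ennreal \<bar>U (t, x)\<bar>))"
proof -
 have [measurable]: "U \<in> borel_measurable (borel \<Otimes>\<^sub>M borel)" using U by (simp only: borel_prod)
 have pw: "\<bar>a\<bar> powr p <= K powr (p - 1) * \<bar>a\<bar>" if "\<bar>a\<bar> <= K" for a :: real
 proof (cases "a = 0")
  case False
  then have "\<bar>a\<bar> powr p = \<bar>a\<bar> powr (p - 1) * \<bar>a\<bar>" using powr_add[of "\<bar>a\<bar>" "p - 1" 1] by simp
  also have "\<dots> <= K powr (p - 1) * \<bar>a\<bar>" using that p by (intro mult_right_mono powr_mono2) auto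
  finally show ?thesis .
 qed simp
 have "(\<integral>\<^sup>+t. (\<integral>\<^sup>+x. ennreal (\<bar>u t x\<bar> powr p) \<partial>lebesgue_on S) \<partial>lebesgue_on {0..T})
  = (NNINT t. (NNINT x. ennreal (\<bar>U (t, x)\<bar> powr p) * indicator S x) * indicator {0..T} t)"
 proof (rule nn_integral_lebesgue_on_eq)
  show "AE t in lborel. t \<in> {0..T} --> (\<integral>\<^sup>+x. ennreal (\<bar>u t x\<bar> powr p) \<partial>lebesgue_on S)
   = (NNINT x. ennreal (\<bar>U (t, x)\<bar> powr p) * indicator S x)"
   using ae
  proof eventually_elim
   case (elim t)
   show ?case
   proof
    assume t: "t \<in> {0..T}"
    show "(\<integral>\<^sup>+x. ennreal (\<bar>u t x\<bar> powr p) \<partial>lebesgue_on S) = (NNINT x. ennreal (\<bar>U (t, x)\<bar> powr p) * indicator S x)"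
    proof (rule nn_integral_lebesgue_on_eq[OF S])
     show "AE x in lborel. x \<in> S --> ennreal (\<bar>u t x\<bar> powr p) = ennreal (\<bar>U (t, x)\<bar> powr p)"
      using elim by eventually_elim (use t in auto)
    qed
   qed
  qed
 qed simp
 also have "\<dots> <= (NNINT t. ennreal (K powr (p - 1)) * (indicator {0..T} t * (NNINT x. ennreal \<bar>U (t, x)\<bar>)))"
 proof (rule nn_integral_mono)
  fix t
  have "(NNINT x. ennreal (\<bar>U (t, x)\<bar> powr p) * indicator S x) <= (NNINT x. ennreal (K powr (p - 1)) * ennreal \<bar>U (t, x)\<bar>)"
  proof (rule nn_integral_mono)
   fix x
   have "ennreal (\<bar>U (t, x)\<bar> powr p) <= ennreal (K powr (p - 1)) * ennreal \<bar>U (t, x)\<bar>"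
    using pw[OF K] by (subst ennreal_mult[symmetric]) (auto intro: ennreal_leI)
   then show "ennreal (\<bar>U (t, x)\<bar> powr p) * indicator S x <= ennreal (K powr (p - 1)) * ennreal \<bar>U (t, x)\<bar>"
    by (cases "x \<in> S") auto
  qed
  also have "\<dots> = ennreal (K powr (p - 1)) * (NNINT x. ennreal \<bar>U (t, x)\<bar>)" by (rule nn_integral_cmult) measurable
  finally show "(NNINT x. ennreal (\<bar>U (t, x)\<bar> powr p) * indicator S x) * indicator {0..T} t
   <= ennreal (K powr (p - 1)) * (indicator {0..T} t * (NNINT x. ennreal \<bar>U (t, x)\<bar>))"
   by (cases "t \<in> {0..T}") auto
 qed
 also have "\<dots> = ennreal (K powr (p - 1)) * (NNINT t. indicator {0..T} t * (NNINT x. ennreal \<bar>U (t, x)\<bar>))"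
  by (rule nn_integral_cmult) measurable
 finally show ?thesis .
qed

lemma L1_convergence_imp_converges_Lp_Lp:
 fixes g :: "real \<times> real => nat => R3 => real" and f' :: "real \<times> R3 => real"
 assumes S: "S \<in> sets borel" and p: "1 <= p" and T: "0 < T" and M: "0 <= M"
  and f'm[measurable]: "f' \<in> borel_fn" and f'b: "\<And>z. \<bar>f' z\<bar> <= M"
  and f's: "\<And>z. f' z \<noteq> 0 ==> norm (snd z) <= R \<and> fst z \<in> {0..T}"
  and fj: "joint_measurable T S f" and f_ae: "AE z in lborel. fst z \<in> {0..T} --> snd z \<in> S --> f (fst z) (snd z) = f' z"
  and conv: "\<And>e. 0 < e ==> \<exists>d>0. \<forall>h \<tau>. (h, \<tau>) \<in> admissible \<alpha> \<beta> \<and> h < d -->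
   (\<forall>n\<le>num_steps T \<tau>. (%y. g (h, \<tau>) n (rd h y)) \<in> borel_fn \<and> (\<forall>y. \<bar>g (h, \<tau>) n (rd h y)\<bar> <= M)) \<and>
   (NNINT s. indicator {0..T} s * (NNINT y. ennreal \<bar>g (h, \<tau>) (nat \<lfloor>s / \<tau>\<rfloor>) (rd h y) - f' (s, y)\<bar>)) <= ennreal e"
 shows "converges_Lp_Lp p T S (%(h, \<tau>). step_function h \<tau> (g (h, \<tau>))) f (at (0, 0) within admissible \<alpha> \<beta>)"
proof -
 let ?N = "%u. \<integral>\<^sup>+t. (\<integral>\<^sup>+x. ennreal (\<bar>u t x\<bar> powr p) \<partial>lebesgue_on S) \<partial>lebesgue_on {0..T}"
 let ?L = "%U. NNINT t. indicator {0..T} t * (NNINT x. ennreal \<bar>U (t, x)\<bar>)"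
 note [measurable] = fst_snd_borel_measurable
 have TS: "{0..T} \<times> S \<in> sets borel" using S by (intro borel_Times) auto
 have slices: "AE t in lborel. AE x in lborel. t \<in> {0..T} --> x \<in> S --> f t x = f' (t, x)"
  by (rule AE_imp_AE_slices) (use f_ae in simp)
 have f'm2[measurable]: "f' \<in> borel_measurable (borel \<Otimes>\<^sub>M borel)" using f'm by (simp only: borel_prod)
 have Lf: "?L f' < \<infinity>"
 proof -
  let ?v = "ennreal M * emeasure lborel (cball (0::R3) R)"
  have v: "?v < \<infinity>" using emeasure_bounded_finite[OF bounded_cball, of "0::R3" R] by (simp add: ennreal_mult_less_top)
  have "?L f' <= (NNINT t. ?v * indicator {0..T} t)"
  proof (rule nn_integral_mono)
   fix t
   have "(NNINT x. ennreal \<bar>f' (t, x)\<bar>) <= (NNINT x. ennreal M * indicator (cball (0::R3) R) x)"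
   proof (rule nn_integral_mono)
    fix x
    show "ennreal \<bar>f' (t, x)\<bar> <= ennreal M * indicator (cball (0::R3) R) x"
     using f'b[of "(t, x)"] f's[of "(t, x)"] by (cases "f' (t, x) = 0") (auto intro: ennreal_leI)
   qed
   also have "\<dots> = ?v" by (subst nn_integral_cmult) (simp_all add: borel_measurable_indicator[OF borel_closed[OF closed_cball]] borel_closed[OF closed_cball])
   finally show "indicator {0..T} t * (NNINT x. ennreal \<bar>f' (t, x)\<bar>) <= ?v * indicator {0..T} t"
    by (cases "t \<in> {0..T}") auto
  qed
  also have "\<dots> = ?v * ennreal T" using T by (subst nn_integral_cmult) auto
  also have "\<dots> < \<infinity>" using v by (simp add: ennreal_mult_less_top)
  finally show ?thesis .
 qed
 have "?N f <= ennreal (M powr (p - 1)) * ?L f'" by (rule Lp_le_L1[OF S p f'm f'b slices])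
 also have "\<dots> < \<infinity>" using Lf by (simp add: ennreal_mult_less_top)
 finally have Lpf: "Lp_Lp p T S f" using fj by (simp add: Lp_Lp_def)
 \<comment> \<open>The difference is bounded by 2M; the additional 1 keeps c positive when M = 0,
   since c is divided by below.\<close>
 define c where "c = (2 * M + 1) powr (p - 1)"
 have c: "0 < c" using M by (simp add: c_def)
 have main: "\<forall>\<^sub>F d in at (0, 0) within admissible \<alpha> \<beta>. Lp_Lp p T S ((%(h, \<tau>). step_function h \<tau> (g (h, \<tau>))) d) \<and>
   ?N (%t x. (%(h, \<tau>). step_function h \<tau> (g (h, \<tau>))) d t x - f t x) <= ennreal (c * e)" if e: "0 < e" for e
 proof -
  obtain d where d: "0 < d" and D: "\<forall>h \<tau>. (h, \<tau>) \<in> admissible \<alpha> \<beta> \<and> h < d -->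
   (\<forall>n\<le>num_steps T \<tau>. (%y. g (h, \<tau>) n (rd h y)) \<in> borel_fn \<and> (\<forall>y. \<bar>g (h, \<tau>) n (rd h y)\<bar> <= M)) \<and>
   (NNINT s. indicator {0..T} s * (NNINT y. ennreal \<bar>g (h, \<tau>) (nat \<lfloor>s / \<tau>\<rfloor>) (rd h y) - f' (s, y)\<bar>)) <= ennreal e"
   using conv[OF e] by (elim exE conjE) (rule that)
  show ?thesis
   unfolding eventually_at
  proof (intro exI[of _ d] conjI[OF d] ballI impI)
   fix hd :: "real \<times> real" assume hd: "hd \<in> admissible \<alpha> \<beta>" and dist: "hd \<noteq> (0, 0) \<and> dist hd (0, 0) < d"
   obtain h \<tau> where hd': "hd = (h, \<tau>)" by (cases hd)
   have h: "0 < h" and \<tau>: "0 < \<tau>" using hd by (auto simp: admissible_def hd')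
   have "h < d" using dist dist_fst_le[of hd "(0, 0)"] h by (simp add: hd' dist_real_def)
   note D' = D[THEN spec[of _ h], THEN spec[of _ \<tau>], THEN mp, OF conjI[OF hd[unfolded hd'] this]]
   \<comment> \<open>Beyond the last step g is unconstrained and might not even be measurable; the
     value 0 there does not affect times in [0,T].\<close>
   define G where "G n y = (if n <= num_steps T \<tau> then g (h, \<tau>) n (rd h y) else 0)" for n y
   have Gm: "G n \<in> borel_fn" for n
    using D' unfolding G_def by (cases "n <= num_steps T \<tau>") auto
   have Gb: "\<bar>G n y\<bar> <= M" for n y using D' M by (auto simp: G_def)
   define H where "H z = G (nat \<lfloor>fst z / \<tau>\<rfloor>) (snd z)" for z :: "real \<times> R3"
   have Hm[measurable]: "H \<in> borel_fn"
    unfolding H_def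
   proof (rule measurable_compose_countable[where g="%z. nat \<lfloor>fst z / \<tau>\<rfloor>"])
    show "(%z :: real \<times> R3. G n (snd z)) \<in> borel_fn" for n
     by (rule measurable_compose[OF fst_snd_borel_measurable(2) Gm])
    show "(%z :: real \<times> R3. nat \<lfloor>fst z / \<tau>\<rfloor>) \<in> measurable borel (count_space UNIV)" by measurable
   qed
   have Hs: "step_function h \<tau> (g (h, \<tau>)) t x = H (t, x)" "H (t, x) = g (h, \<tau>) (nat \<lfloor>t / \<tau>\<rfloor>) (rd h x)" if "t \<in> {0..T}" for t x
    using that num_steps_bounds(2)[OF \<tau>, of T t] T step_function_eq[OF h \<tau>, of t "g (h, \<tau>)" x] by (auto simp: H_def G_def)
   have Hb: "\<bar>H z\<bar> <= M" for z by (simp add: H_def Gb)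
   have Hm2[measurable]: "H \<in> borel_measurable (borel \<Otimes>\<^sub>M borel)" using Hm by (simp only: borel_prod)
   have L1: "?L (%z. H z - f' z) <= ennreal e"
   proof -
    have "?L (%z. H z - f' z) = (NNINT s. indicator {0..T} s * (NNINT y. ennreal \<bar>g (h, \<tau>) (nat \<lfloor>s / \<tau>\<rfloor>) (rd h y) - f' (s, y)\<bar>))"
    proof (rule nn_integral_cong)
     fix s
     show "indicator {0..T} s * (NNINT x. ennreal \<bar>H (s, x) - f' (s, x)\<bar>)
      = indicator {0..T} s * (NNINT y. ennreal \<bar>g (h, \<tau>) (nat \<lfloor>s / \<tau>\<rfloor>) (rd h y) - f' (s, y)\<bar>)"
      by (cases "s \<in> {0..T}") (simp_all add: Hs(2))
    qed
    then show ?thesis using D' by simp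
   qed
   have LH: "?L H < \<infinity>"
   proof -
    have "?L H <= (NNINT t. indicator {0..T} t * (NNINT x. ennreal \<bar>H (t, x) - f' (t, x)\<bar>) + indicator {0..T} t * (NNINT x. ennreal \<bar>f' (t, x)\<bar>))"
    proof (rule nn_integral_mono)
     fix t
     have "(NNINT x. ennreal \<bar>H (t, x)\<bar>) <= (NNINT x. ennreal \<bar>H (t, x) - f' (t, x)\<bar> + ennreal \<bar>f' (t, x)\<bar>)"
      by (intro nn_integral_mono) (simp add: ennreal_plus[symmetric] ennreal_leI del: ennreal_plus)
     also have "\<dots> = (NNINT x. ennreal \<bar>H (t, x) - f' (t, x)\<bar>) + (NNINT x. ennreal \<bar>f' (t, x)\<bar>)"
      by (rule nn_integral_add) measurable
     finally show "indicator {0..T} t * (NNINT x. ennreal \<bar>H (t, x)\<bar>)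
      <= indicator {0..T} t * (NNINT x. ennreal \<bar>H (t, x) - f' (t, x)\<bar>) + indicator {0..T} t * (NNINT x. ennreal \<bar>f' (t, x)\<bar>)"
      by (cases "t \<in> {0..T}") auto
    qed
    also have "\<dots> = ?L (%z. H z - f' z) + ?L f'" by (rule nn_integral_add) measurable
    also have "\<dots> < \<infinity>" using le_less_trans[OF L1 ennreal_less_top] Lf by simp
    finally show ?thesis .
   qed
   have "?N (step_function h \<tau> (g (h, \<tau>))) <= ennreal (M powr (p - 1)) * ?L H"
    by (rule Lp_le_L1[OF S p Hm Hb]) (auto simp: Hs(1))
   also have "\<dots> < \<infinity>" using LH by (simp add: ennreal_mult_less_top)
   finally have fin: "?N (step_function h \<tau> (g (h, \<tau>))) < \<infinity>" .
   have "(%(t, x). step_function h \<tau> (g (h, \<tau>)) t x) \<in> borel_measurable (lebesgue_on ({0..T} \<times> S))"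
   proof (subst measurable_cong)
    show "(case z of (t, x) => step_function h \<tau> (g (h, \<tau>)) t x) = H z" if "z \<in> space (lebesgue_on ({0..T} \<times> S))" for z
     using that by (cases z) (auto simp: Hs(1))
    show "H \<in> borel_measurable (lebesgue_on ({0..T} \<times> S))"
     by (intro measurable_restrict_space1 measurable_completion) simp
   qed
   then have Lp: "Lp_Lp p T S (step_function h \<tau> (g (h, \<tau>)))" using fin by (simp add: Lp_Lp_def joint_measurable_def)
   have diff_ae: "AE t in lborel. AE x in lborel. t \<in> {0..T} --> x \<in> S --> step_function h \<tau> (g (h, \<tau>)) t x - f t x = H (t, x) - f' (t, x)"
    using slices
   proof eventually_elim
    case (elim t)
    then show ?case by eventually_elim (auto simp: Hs(1))
   qed
   have "?N (%t x. step_function h \<tau> (g (h, \<tau>)) t x - f t x) <= ennreal c * ?L (%z. H z - f' z)"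
    unfolding c_def
   proof (rule Lp_le_L1[OF S p _ _ diff_ae])
    show "\<bar>H z - f' z\<bar> <= 2 * M + 1" for z using Hb[of z] f'b[of z] by linarith
   qed measurable
   also have "\<dots> <= ennreal c * ennreal e" by (intro mult_left_mono L1) simp
   also have "\<dots> = ennreal (c * e)" using c e by (simp add: ennreal_mult)
   finally show "Lp_Lp p T S ((%(h, \<tau>). step_function h \<tau> (g (h, \<tau>))) hd) \<and>
    ?N (%t x. (%(h, \<tau>). step_function h \<tau> (g (h, \<tau>))) hd t x - f t x) <= ennreal (c * e)"
    using Lp by (simp add: hd')
  qed
 qed
 have "((%d. Lp_Lp_norm p T S (%t x. (%(h, \<tau>). step_function h \<tau> (g (h, \<tau>))) d t x - f t x)) \<longlongrightarrow> 0) (at (0, 0) within admissible \<alpha> \<beta>)"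
 proof (rule tendstoI)
  fix \<epsilon> :: real assume \<epsilon>: "0 < \<epsilon>"
  \<comment> \<open>Chosen so that c e is the p-th power of \<epsilon>/2; halving \<epsilon> gives
    the strict inequality required by convergence.\<close>
  define e where "e = (\<epsilon> / 2) powr p / c"
  have e: "0 < e" using \<epsilon> c by (simp add: e_def)
  have ce: "c * e = (\<epsilon> / 2) powr p" using c by (simp add: e_def)
  show "\<forall>\<^sub>F d in at (0, 0) within admissible \<alpha> \<beta>. dist (Lp_Lp_norm p T S (%t x. (%(h, \<tau>). step_function h \<tau> (g (h, \<tau>))) d t x - f t x)) 0 < \<epsilon>"
   using main[OF e]
  proof eventually_elim
   case (elim d)
   let ?n = "?N (%t x. (%(h, \<tau>). step_function h \<tau> (g (h, \<tau>))) d t x - f t x)"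
   have "enn2real ?n <= (\<epsilon> / 2) powr p"
    using enn2real_mono[OF conjunct2[OF elim] ennreal_less_top] by (simp add: ce)
   then have "enn2real ?n powr (1 / p) <= ((\<epsilon> / 2) powr p) powr (1 / p)" using p by (intro powr_mono2) auto
   also have "\<dots> = \<epsilon> / 2" using p \<epsilon> by (simp add: powr_powr)
   finally have "Lp_Lp_norm p T S (%t x. (%(h, \<tau>). step_function h \<tau> (g (h, \<tau>))) d t x - f t x) <= \<epsilon> / 2"
    unfolding Lp_Lp_norm_def .
   moreover have "0 <= Lp_Lp_norm p T S (%t x. (%(h, \<tau>). step_function h \<tau> (g (h, \<tau>))) d t x - f t x)"
    unfolding Lp_Lp_norm_def by (rule powr_ge_zero)
   ultimately show ?case using \<epsilon> by (simp add: dist_real_def)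
  qed
 qed
 moreover have "\<forall>\<^sub>F d in at (0, 0) within admissible \<alpha> \<beta>. Lp_Lp p T S ((%(h, \<tau>). step_function h \<tau> (g (h, \<tau>))) d)"
  using main[of 1] by (auto elim: eventually_mono)
 ultimately show ?thesis using Lpf unfolding converges_Lp_Lp_def by blast
qed

text \<open>The test functions of both problems are the same: they live on the whole space and need
  not vanish on the boundary of \<Omega>. All integrands extend by 0, so the weak formulation
  carries over unchanged. The problem on \<Omega> thereby becomes an instance of the whole-space
  problem.\<close>

lemma weak_solution_ext0:
 fixes v :: "real => R3 => R3"
 assumes \<Omega>: "open \<Omega>" and sol: "weak_solution T \<Omega> v f0 f"
 shows "weak_solution T UNIV (%t. ext0 \<Omega> (v t)) (ext0 \<Omega> f0) (%t. ext0 \<Omega> (f t))"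
proof -
 have S: "\<Omega> \<in> sets lebesgue" using \<Omega> by simp
 have TS: "{0..T} \<times> \<Omega> \<in> sets borel" "({0..T} \<times> UNIV :: (real \<times> R3) set) \<in> sets borel" using \<Omega> by (auto intro!: borel_Times)
 have int: "(LINT x|lebesgue_on UNIV. a x) = (LINT x|lebesgue_on \<Omega>. b x)" if "\<And>x. a x = indicator \<Omega> x * b x" for a b :: "R3 => real"
 proof -
  have a: "a = (%x. indicator \<Omega> x * b x)" using that by auto
  show ?thesis unfolding a using S by (subst integral_restrict_space[of \<Omega>]) (simp_all add: lebesgue_on_UNIV_eq)
 qed
 have "joint_measurable T UNIV (%t. ext0 \<Omega> (f t))"
 proof -
  have "(%(t, x). f t x) \<in> borel_measurable (lebesgue_on ({0..T} \<times> \<Omega>))"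
   using sol by (simp add: weak_solution_def Linf_Linf_def joint_measurable_def)
  then have "(%z. indicator ({0..T} \<times> \<Omega>) z *\<^sub>R (case z of (t, x) => f t x)) \<in> borel_measurable lebesgue"
   using TS(1) by (subst (asm) borel_measurable_restrict_space_iff) auto
  then have "(%z. indicator ({0..T} \<times> \<Omega>) z *\<^sub>R (case z of (t, x) => f t x)) \<in> borel_measurable (lebesgue_on ({0..T} \<times> UNIV))"
   by (rule measurable_restrict_space1)
  then show ?thesis unfolding joint_measurable_def
   by (rule measurable_cong[THEN iffD1, rotated]) (auto simp: ext0_def indicator_def split: if_splits)
 qed
 moreover have "\<exists>M. AE t in lebesgue_on {0..T}. AE x in lebesgue_on UNIV. \<bar>ext0 \<Omega> (f t) x\<bar> <= M"
 proof -
  obtain M where M: "AE t in lebesgue_on {0..T}. AE x in lebesgue_on \<Omega>. \<bar>f t x\<bar> <= M"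
   using sol by (auto simp: weak_solution_def Linf_Linf_def)
  have "AE t in lebesgue_on {0..T}. AE x in lebesgue_on UNIV. \<bar>ext0 \<Omega> (f t) x\<bar> <= max M 0"
   using M
  proof eventually_elim
   case (elim t)
   then have "AE x in lborel. x \<in> \<Omega> --> \<bar>f t x\<bar> <= M" using \<Omega> by (subst (asm) AE_lebesgue_on_iff) auto
   then have "AE x in lborel. \<bar>ext0 \<Omega> (f t) x\<bar> <= max M 0" by eventually_elim (auto simp: ext0_def)
   then show ?case by (subst AE_lebesgue_on_iff) auto
  qed
  then show ?thesis by blast
 qed
 moreover have "(LINT t|lebesgue_on {0..T}. LINT x|lebesgue_on UNIV. ext0 \<Omega> (f t) x * time_deriv T \<phi> t x
   + ext0 \<Omega> (f t) x * (ext0 \<Omega> (v t) x \<bullet> space_grad T \<phi> t x)) + (LINT x|lebesgue_on UNIV. ext0 \<Omega> f0 x * \<phi> (0, x)) = 0"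
  if \<phi>: "\<phi> \<in> test_functions T" for \<phi>
 proof -
  have a: "(LINT x|lebesgue_on UNIV. ext0 \<Omega> (f t) x * time_deriv T \<phi> t x + ext0 \<Omega> (f t) x * (ext0 \<Omega> (v t) x \<bullet> space_grad T \<phi> t x))
   = (LINT x|lebesgue_on \<Omega>. f t x * time_deriv T \<phi> t x + f t x * (v t x \<bullet> space_grad T \<phi> t x))" for t
   by (rule int) (simp add: ext0_def)
  have b: "(LINT x|lebesgue_on UNIV. ext0 \<Omega> f0 x * \<phi> (0, x)) = (LINT x|lebesgue_on \<Omega>. f0 x * \<phi> (0, x))"
   by (rule int) (simp add: ext0_def)
  show ?thesis unfolding a b using sol \<phi> unfolding weak_solution_def by blast
 qed
 ultimately show ?thesis unfolding weak_solution_def Linf_Linf_def by blast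
qed

theorem theorem3p4:
  fixes T \<alpha> \<beta> :: real
    and \<Omega> :: "(real^3) set"
    and v :: "real \<Rightarrow> real^3 \<Rightarrow> real^3"
    and f0 :: "real^3 \<Rightarrow> real"
    and f f_ext :: "real \<Rightarrow> real^3 \<Rightarrow> real"
    and g :: "real \<times> real \<Rightarrow> nat \<Rightarrow> real^3 \<Rightarrow> real"
  assumes "0 < T"
    and "bounded \<Omega>" and "connected \<Omega>" and "open \<Omega>"
    and "L2_H10 T \<Omega> v" and "Linf_L2 T \<Omega> v"
    and "divergence_free T \<Omega> v"
    and "ess_supp T (\<lambda>t. ext0 \<Omega> (v t)) \<subseteq> {0..T} \<times> \<Omega>"
    and "Linf \<Omega> f0" and "vanishes_near_frontier \<Omega> f0"
    and "weak_solution T \<Omega> v f0 f"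
    and "weak_solution T UNIV (\<lambda>t. ext0 \<Omega> (v t)) (ext0 \<Omega> f0) f_ext"
    and "0 < \<alpha>" and "1 / 2 < \<beta>" and "\<alpha> + \<beta> < 1"
    and "\<forall>(h, \<tau>) \<in> admissible \<alpha> \<beta>.
           truncated_explicit_scheme T \<beta> (\<lambda>t. ext0 \<Omega> (v t)) (ext0 \<Omega> f0) h \<tau> (g (h, \<tau>))"
  shows "converges_Lp_Lp 2 T UNIV (\<lambda>(h, \<tau>). step_function h \<tau> (g (h, \<tau>))) f_ext
           (at (0, 0) within admissible \<alpha> \<beta>)
       \<and> (\<forall>p\<ge>1. converges_Lp_Lp p T \<Omega> (\<lambda>(h, \<tau>). step_function h \<tau> (g (h, \<tau>))) f
           (at (0, 0) within admissible \<alpha> \<beta>))"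
proof -
 let ?vv = "%t. ext0 \<Omega> (v t)"
 have S: "\<Omega> \<in> sets borel" using assms(4) by simp
 show ?thesis
 proof (rule velocity_representative[OF assms(1,2,4,5,6,7)])
 fix R V \<Gamma> w assume w: "0 <= R" "0 <= V" "0 <= \<Gamma>" "\<Omega> \<subseteq> cball 0 R" "\<And>j. w j \<in> borel_fn"
  "\<And>j z. w j z \<noteq> 0 ==> snd z \<in> \<Omega> \<and> fst z \<in> {0..T}"
  "AE z in lborel. fst z \<in> {0..T} --> (\<forall>j. w j z = ?vv (fst z) (snd z) $ j)"
  "\<And>j t. (NNINT y. ennreal \<bar>w j (t, y)\<bar>) <= ennreal V"
  "\<And>j t. (NNINT y. ennreal ((w j (t, y))\<^sup>2)) <= ennreal V"
  "\<And>\<psi> t. \<psi> \<in> Cc_infty UNIV ==> (RINT y. (\<Sum>j\<in>UNIV. w j (t, y) * pderiv_at j \<psi> y)) = 0"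
  "\<And>j k. (NNINT z. ennreal ((w j (z + (0, k)) - w j z)\<^sup>2)) <= ennreal ((norm k)\<^sup>2 * \<Gamma>)"
  "\<And>e. 0 < e ==> \<exists>d>0. \<forall>h. 0 < h \<and> h < d -->
   (NNINT z. ennreal \<bar>\<Sum>j\<in>UNIV. (w j (z + (0, h *\<^sub>R axis j 1)) - w j (z - (0, h *\<^sub>R axis j 1))) / (2 * h)\<bar>) <= ennreal e"
 have w_supp: "norm (snd z) <= R \<and> fst z \<in> {0..T}" if "w j z \<noteq> 0" for j z using w(6)[OF that] w(4) by auto
 obtain f1 where f1[measurable]: "f1 \<in> borel_fn" and f1_ae: "AE x in lborel. x \<in> \<Omega> --> f0 x = f1 x"
  using borel_representative[OF S] assms(9) unfolding Linf_def by blast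
 obtain M0 where M0: "AE x in lebesgue_on \<Omega>. \<bar>f0 x\<bar> <= M0" using assms(9) unfolding Linf_def by blast
 define M1 where "M1 = max M0 0"
 \<comment> \<open>A Borel version of the extended initial data, clamped so that the essential bound
   holds everywhere; M1 is then passed on as lower limit for the bound of the solution.\<close>
 define f0' where "f0' x = indicator \<Omega> x * max (- M1) (min M1 (f1 x))" for x
 have f0m: "f0' \<in> borel_fn" unfolding f0'_def using S by measurable
 have f0b: "\<bar>f0' x\<bar> <= M1" for x by (auto simp: f0'_def M1_def indicator_def)
 have f0s: "norm x <= R" if "f0' x \<noteq> 0" for x using that w(4) by (auto simp: f0'_def indicator_def split: if_splits)
 have "AE x in lborel. x \<in> \<Omega> --> \<bar>f0 x\<bar> <= M0" using M0 by (simp only: AE_lebesgue_on_iff[OF S])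
 with f1_ae have f0_ae: "AE x in lborel. ext0 \<Omega> f0 x = f0' x"
  by eventually_elim (auto simp: f0'_def ext0_def M1_def)
 \<comment> \<open>One statement for both claims: F' solves the whole-space problem and F agrees
   with it on S'. The first claim takes S' to be the whole space; the second takes S' = \<Omega> and
   for F' the extension of f by 0.\<close>
 have conv: "converges_Lp_Lp p T S' (%(h, \<tau>). step_function h \<tau> (g (h, \<tau>))) F (at (0, 0) within admissible \<alpha> \<beta>)"
  if sol: "weak_solution T UNIV ?vv (ext0 \<Omega> f0) F'" and S': "S' \<in> sets borel" and p: "1 <= p" and Fj: "joint_measurable T S' F"
   and eq: "\<And>t x. x \<in> S' ==> F t x = F' t x" for p S' F F'
 proof -
  show ?thesis
  proof (rule weak_solution_representative[where ?M0.0=M1, OF assms(1) w(2) w(5) w_supp w(7,8) f0m f0_ae f0s sol])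
  fix f' M assume f': "f' \<in> borel_fn" "M1 <= M" "0 <= M" "\<And>z. \<bar>f' z\<bar> <= M"
   "\<And>z. f' z \<noteq> 0 ==> norm (snd z) <= R \<and> fst z \<in> {0..T}"
   "AE z in lborel. fst z \<in> {0..T} --> F' (fst z) (snd z) = f' z"
   "\<And>\<psi>. \<psi> \<in> Cc_infty UNIV ==> AE t in lborel. t \<in> {0..T} -->
    (RINT y. f' (t, y) * \<psi> y) = weak_rhs f' w f0' t \<psi> (%j. pderiv_at j \<psi>)"
  have tr: "transport T M R V \<Gamma> f' w f0'"
  proof
   show "\<bar>f0' x\<bar> <= M" for x using f0b[of x] f'(2) by linarith
   show "norm (snd z) <= R \<and> fst z \<in> {0..T}" if "w j z \<noteq> 0" for j z by (rule w_supp[OF that])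
   show "norm x <= R" if "f0' x \<noteq> 0" for x by (rule f0s[OF that])
  qed (fact | rule f' w assms(1); assumption?)+
  have "0 < \<beta>" using assms(14) by simp
  have sch: "truncated_explicit_scheme T \<beta> ?vv (ext0 \<Omega> f0) h \<tau> (g (h, \<tau>))" if "(h, \<tau>) \<in> admissible \<alpha> \<beta>" for h \<tau>
   using assms(16) that by blast
  show ?thesis
  proof (rule L1_convergence_imp_converges_Lp_Lp[OF S' p assms(1) f'(3,1,4,5) Fj])
   show "AE z in lborel. fst z \<in> {0..T} --> snd z \<in> S' --> F (fst z) (snd z) = f' z"
    using f'(6) by eventually_elim (simp add: eq)
  qed (assumption | rule scheme_L1_convergence[OF tr assms(13) \<open>0 < \<beta>\<close> assms(15) w(7) f0_ae sch])+
  qed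
 qed
 show ?thesis
 proof (intro conjI allI impI)
  show "converges_Lp_Lp 2 T UNIV (%(h, \<tau>). step_function h \<tau> (g (h, \<tau>))) f_ext (at (0, 0) within admissible \<alpha> \<beta>)"
   by (rule conv[OF assms(12)]) (use assms(12) in \<open>auto simp: weak_solution_def Linf_Linf_def\<close>)
  show "converges_Lp_Lp p T \<Omega> (%(h, \<tau>). step_function h \<tau> (g (h, \<tau>))) f (at (0, 0) within admissible \<alpha> \<beta>)" if "1 <= p" for p
   by (rule conv[OF weak_solution_ext0[OF assms(4,11)] S that])
     (use assms(11) in \<open>auto simp: weak_solution_def Linf_Linf_def ext0_def\<close>)
 qed
qed
qed

end
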